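(* Let $S$ be a Prüfer scheme, i.e. a scheme all of whose local rings $\mathcal{O}_{S,s}$ ($s\in S$) are valuation domains. Then every smooth morphism of schemes $f:T\to S$ is convex.
   Context: For a scheme $S$ and an open $U\subset S$, $\mathcal{O}_S^{reg}(U)$ is the set of $x\in\mathcal{O}_S(U)$ whose germ $x_s$ is a nonzerodivisor in $\mathcal{O}_{S,s}$ for every $s\in U$. This defines a sheaf of multiplicative monoids $\mathcal{O}_S^{reg}$, with stalks $\mathcal{O}_{S,s}^{reg}$. Let $\mathcal{M}_S$ be the sheaf of $\mathcal{O}_S$-algebras associated with the presheaf $U\mapsto \mathcal{O}_S(U)[\mathcal{O}_S^{reg}(U)^{-1}]$; its stalk at $s$ is $\mathcal{M}_{S,s}=\mathcal{O}_{S,s}[(\mathcal{O}_{S,s}^{reg})^{-1}]$. The Zariski sheaf of Cartier divisors is $\mathcal{D}_S=\mathcal{M}_S^\times/\mathcal{O}_S^\times$, with stalks $\mathcal{D}_{S,s}=\mathcal{M}_{S,s}^\times/\mathcal{O}_{S,s}^\times$. It is a sheaf of partially ordered commutative groups: the submonoid of non-negative elements $\mathcal{D}_{S,s}^+$ is the image of $\mathcal{O}_{S,s}^{reg}$ in $\mathcal{D}_{S,s}$. If $f:T\to S$ is flat and $t\in T$ lies above $s\in S$, then $\mathcal{O}_{S,s}\to\mathcal{O}_{T,t}$ extends to an injection $\mathcal{M}_{S,s}\hookrightarrow\mathcal{M}_{T,t}$, inducing an injective morphism of partially ordered groups $\mathcal{D}_{S,s}\hookrightarrow\mathcal{D}_{T,t}$.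 A subgroup $H$ of a partially ordered commutative group $D$ is convex if $\alpha\le\beta\le\gamma$ in $D$ with $\alpha,\gamma\in H$ implies $\beta\in H$. A flat morphism $f:T\to S$ is called convex if for every $t\in T$ with image $s\in S$, the image of $\mathcal{D}_{S,s}\hookrightarrow\mathcal{D}_{T,t}$ is a convex subgroup of $\mathcal{D}_{T,t}$. *)

theory Defs
  imports
    "HOL-Analysis.Abstract_Topology"
    "HOL-Analysis.Function_Topology"
    "HOL-Algebra.Algebra"
    "HOL-Algebra.Free_Abelian_Groups"
    "HOL-Algebra.Indexed_Polynomials"
    "HOL-Combinatorics.Permutations"
begin

section \<open>Commutative algebra\<close>

definition local_ring :: "'a ring \<Rightarrow> bool" where
  "local_ring R \<longleftrightarrow> cring R \<and> (\<exists>!I. maximalideal I R)"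

definition local_ring_hom :: "'a ring \<Rightarrow> 'b ring \<Rightarrow> ('a \<Rightarrow> 'b) \<Rightarrow> bool" where
  "local_ring_hom A B \<phi> \<longleftrightarrow> \<phi> \<in> ring_hom A B \<and>
     (\<forall>I J. maximalideal I A \<longrightarrow> maximalideal J B \<longrightarrow> \<phi> ` I \<subseteq> J)"

text \<open>Fields are included: they are the trivial valuation domains.\<close>

definition valuation_domain :: "'a ring \<Rightarrow> bool" where
  "valuation_domain R \<longleftrightarrow> domain R \<and>
     (\<forall>a\<in>carrier R. \<forall>b\<in>carrier R. a divides\<^bsub>R\<^esub> b \<or> b divides\<^bsub>R\<^esub> a)"

definition nonzerodivisor :: "'a ring \<Rightarrow> 'a \<Rightarrow> bool" where
  "nonzerodivisor R x \<longleftrightarrow> x \<in> carrier R \<and> (\<forall>y\<in>carrier R. x \<otimes>\<^bsub>R\<^esub> y = \<zero>\<^bsub>R\<^esub> \<longrightarrow> y = \<zero>\<^bsub>R\<^esub>)"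


subsection \<open>Localization\<close>

text \<open>\<open>fraction R S a b\<close> is the fraction \<open>a / b\<close> in \<open>S\<inverse>R\<close>, as an equivalence class of pairs.
  Operations on classes (here, and for germs and tensors below) are written as unions over
  representatives; all members of the union coincide.\<close>

definition fraction :: "'a ring \<Rightarrow> 'a set \<Rightarrow> 'a \<Rightarrow> 'a \<Rightarrow> ('a \<times> 'a) set" where
  "fraction R S a b = {(c, d). c \<in> carrier R \<and> d \<in> S \<and>
     (\<exists>u\<in>S. u \<otimes>\<^bsub>R\<^esub> (a \<otimes>\<^bsub>R\<^esub> d) = u \<otimes>\<^bsub>R\<^esub> (c \<otimes>\<^bsub>R\<^esub> b))}"

definition localization :: "'a ring \<Rightarrow> 'a set \<Rightarrow> ('a \<times> 'a) set ring" where
  "localization R S =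
    \<lparr> carrier = {fraction R S a b | a b. a \<in> carrier R \<and> b \<in> S},
      monoid.mult = (\<lambda>x y. \<Union>(a, b)\<in>x. \<Union>(c, d)\<in>y. fraction R S (a \<otimes>\<^bsub>R\<^esub> c) (b \<otimes>\<^bsub>R\<^esub> d)),
      monoid.one = fraction R S \<one>\<^bsub>R\<^esub> \<one>\<^bsub>R\<^esub>,
      ring.zero = fraction R S \<zero>\<^bsub>R\<^esub> \<one>\<^bsub>R\<^esub>,
      ring.add = (\<lambda>x y. \<Union>(a, b)\<in>x. \<Union>(c, d)\<in>y.
               fraction R S ((a \<otimes>\<^bsub>R\<^esub> d) \<oplus>\<^bsub>R\<^esub> (c \<otimes>\<^bsub>R\<^esub> b)) (b \<otimes>\<^bsub>R\<^esub> d)) \<rparr>"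

definition localization_map ::
  "'b ring \<Rightarrow> 'b set \<Rightarrow> ('a \<Rightarrow> 'b) \<Rightarrow> ('a \<times> 'a) set \<Rightarrow> ('b \<times> 'b) set" where
  "localization_map R' S' \<phi> x = (\<Union>(a, b)\<in>x. fraction R' S' (\<phi> a) (\<phi> b))"


subsection \<open>Tensor products and flatness\<close>

definition tensor_free ::
  "('r, 'm) module \<Rightarrow> ('r, 'n) module \<Rightarrow> ('m \<times> 'n \<Rightarrow>\<^sub>0 int) monoid" where
  "tensor_free M N = free_Abelian_group (carrier M \<times> carrier N)"

definition tensor_relations ::
  "'r ring \<Rightarrow> ('r, 'm) module \<Rightarrow> ('r, 'n) module \<Rightarrow> ('m \<times> 'n \<Rightarrow>\<^sub>0 int) set" where
  "tensor_relations R M N = generate (tensor_free M N)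
     ({frag_of (x \<oplus>\<^bsub>M\<^esub> x', y) - frag_of (x, y) - frag_of (x', y) | x x' y.
         x \<in> carrier M \<and> x' \<in> carrier M \<and> y \<in> carrier N} \<union>
      {frag_of (x, y \<oplus>\<^bsub>N\<^esub> y') - frag_of (x, y) - frag_of (x, y') | x y y'.
         x \<in> carrier M \<and> y \<in> carrier N \<and> y' \<in> carrier N} \<union>
      {frag_of (r \<odot>\<^bsub>M\<^esub> x, y) - frag_of (x, r \<odot>\<^bsub>N\<^esub> y) | r x y.
         r \<in> carrier R \<and> x \<in> carrier M \<and> y \<in> carrier N})"

definition tensor_product ::
  "'r ring \<Rightarrow> ('r, 'm) module \<Rightarrow> ('r, 'n) module \<Rightarrow> ('m \<times> 'n \<Rightarrow>\<^sub>0 int) set monoid" where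
  "tensor_product R M N = tensor_free M N Mod tensor_relations R M N"

text \<open>The map \<open>u \<otimes> id : M \<otimes> N \<rightarrow> M' \<otimes> N\<close>.\<close>

definition tensor_map ::
  "'r ring \<Rightarrow> ('r, 'l) module \<Rightarrow> ('r, 'n) module \<Rightarrow> ('m \<Rightarrow> 'l) \<Rightarrow>
     ('m \<times> 'n \<Rightarrow>\<^sub>0 int) set \<Rightarrow> ('l \<times> 'n \<Rightarrow>\<^sub>0 int) set" where
  "tensor_map R M' N u Y =
     (\<Union>c\<in>Y. tensor_relations R M' N #>\<^bsub>tensor_free M' N\<^esub>
        frag_extend (\<lambda>(x, y). frag_of (u x, y)) c)"

definition linear_maps :: "'r ring \<Rightarrow> ('r, 'm) module \<Rightarrow> ('r, 'l) module \<Rightarrow> ('m \<Rightarrow> 'l) set" where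
  "linear_maps R M M' = {u \<in> hom (add_monoid M) (add_monoid M').
     \<forall>r\<in>carrier R. \<forall>x\<in>carrier M. u (r \<odot>\<^bsub>M\<^esub> x) = r \<odot>\<^bsub>M'\<^esub> u x}"

text \<open>HOL cannot quantify over types inside a formula, so the type of the test modules is a
  parameter; flatness is \<open>flat_module TYPE('m) R N\<close> for all \<open>'m\<close>. Using one type for
  \<open>M\<close> and \<open>M'\<close> is no restriction, as both embed into a sum type.\<close>

definition flat_module :: "'m itself \<Rightarrow> 'r ring \<Rightarrow> ('r, 'n) module \<Rightarrow> bool" where
  "flat_module (ty :: 'm itself) R N \<longleftrightarrow> Module.module R N \<and>
     (\<forall>(M :: ('r, 'm) module) (M' :: ('r, 'm) module) u.
        Module.module R M \<longrightarrow> Module.module R M' \<longrightarrow> u \<in> linear_maps R M M' \<longrightarrow> inj_on u (carrier M) \<longrightarrow>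
        inj_on (tensor_map R M' N u) (carrier (tensor_product R M N)))"

definition restrict_scalars :: "('a \<Rightarrow> 'b) \<Rightarrow> 'b ring \<Rightarrow> ('a, 'b) module" where
  "restrict_scalars \<phi> B = ring.extend B \<lparr> smult = (\<lambda>a b. \<phi> a \<otimes>\<^bsub>B\<^esub> b) \<rparr>"

definition flat_ring_hom :: "'m itself \<Rightarrow> 'a ring \<Rightarrow> 'b ring \<Rightarrow> ('a \<Rightarrow> 'b) \<Rightarrow> bool" where
  "flat_ring_hom ty A B \<phi> \<longleftrightarrow> \<phi> \<in> ring_hom A B \<and> flat_module ty A (restrict_scalars \<phi> B)"


subsection \<open>Polynomials and standard smooth algebras\<close>

text \<open>Polynomials in the variables \<open>X\<^sub>0, \<dots>, X\<^bsub>n-1\<^esub>\<close>, as coefficient functions on monomials;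
  a monomial is the multiset of its variables.\<close>

definition mpoly_ring :: "nat \<Rightarrow> 'a ring \<Rightarrow> (nat multiset \<Rightarrow> 'a) ring" where
  "mpoly_ring n R =
    \<lparr> carrier = ring.indexed_pset R {..<n} (carrier R),
      monoid.mult = (\<lambda>P Q m. \<Oplus>\<^bsub>R\<^esub>k\<in>{k. k \<subseteq># m}. P k \<otimes>\<^bsub>R\<^esub> Q (m - k)),
      monoid.one = ring.indexed_const R \<one>\<^bsub>R\<^esub>,
      ring.zero = ring.indexed_const R \<zero>\<^bsub>R\<^esub>,
      ring.add = ring.indexed_padd R \<rparr>"

definition mpoly_eval ::
  "nat \<Rightarrow> 'a ring \<Rightarrow> 'b ring \<Rightarrow> ('a \<Rightarrow> 'b) \<Rightarrow> (nat \<Rightarrow> 'b) \<Rightarrow> (nat multiset \<Rightarrow> 'a) \<Rightarrow> 'b" where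
  "mpoly_eval n R A \<phi> x P =
     (\<Oplus>\<^bsub>A\<^esub>m\<in>{m. P m \<noteq> \<zero>\<^bsub>R\<^esub>}. \<phi> (P m) \<otimes>\<^bsub>A\<^esub> (\<Otimes>\<^bsub>A\<^esub>i\<in>{..<n}. x i [^]\<^bsub>A\<^esub> count m i))"

definition mpoly_deriv ::
  "'a ring \<Rightarrow> nat \<Rightarrow> (nat multiset \<Rightarrow> 'a) \<Rightarrow> (nat multiset \<Rightarrow> 'a)" where
  "mpoly_deriv R i P = (\<lambda>m. [Suc (count m i)] \<cdot>\<^bsub>R\<^esub> P (add_mset i m))"

definition ring_det :: "'a ring \<Rightarrow> nat \<Rightarrow> (nat \<Rightarrow> nat \<Rightarrow> 'a) \<Rightarrow> 'a" where
  "ring_det R c M = (\<Oplus>\<^bsub>R\<^esub>\<sigma>\<in>{\<sigma>. \<sigma> permutes {..<c}}.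
     (if evenperm \<sigma> then \<one>\<^bsub>R\<^esub> else \<ominus>\<^bsub>R\<^esub> \<one>\<^bsub>R\<^esub>) \<otimes>\<^bsub>R\<^esub> (\<Otimes>\<^bsub>R\<^esub>i\<in>{..<c}. M i (\<sigma> i)))"

text \<open>\<open>A \<cong> R[X\<^sub>0, \<dots>, X\<^bsub>n-1\<^esub>] / (F\<^sub>0, \<dots>, F\<^bsub>c-1\<^esub>)\<close> as an \<open>R\<close>-algebra, where \<open>x i\<close> is the image of
  \<open>X\<^sub>i\<close>, with \<open>det (\<partial>F\<^sub>j/\<partial>X\<^sub>i)\<close> for \<open>i, j < c\<close> invertible in \<open>A\<close>.\<close>

definition standard_smooth :: "'a ring \<Rightarrow> 'b ring \<Rightarrow> ('a \<Rightarrow> 'b) \<Rightarrow> bool" where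
  "standard_smooth R A \<phi> \<longleftrightarrow> \<phi> \<in> ring_hom R A \<and>
     (\<exists>n c F x. c \<le> n \<and>
        (\<forall>j<c. F j \<in> carrier (mpoly_ring n R)) \<and>
        (\<forall>i<n. x i \<in> carrier A) \<and>
        mpoly_eval n R A \<phi> x ` carrier (mpoly_ring n R) = carrier A \<and>
        a_kernel (mpoly_ring n R) A (mpoly_eval n R A \<phi> x) =
          Idl\<^bsub>mpoly_ring n R\<^esub> (F ` {..<c}) \<and>
        ring_det A c (\<lambda>j i. mpoly_eval n R A \<phi> x (mpoly_deriv R i (F j))) \<in> Units A)"


section \<open>Ringed spaces\<close>

record ('p, 'a) ringed_space =
  space_of :: "'p topology"
  sections :: "'p set \<Rightarrow> 'a ring"
  res :: "'p set \<Rightarrow> 'p set \<Rightarrow> 'a \<Rightarrow> 'a"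

definition presheaf_of_rings :: "('p, 'a) ringed_space \<Rightarrow> bool" where
  "presheaf_of_rings Y \<longleftrightarrow>
     (\<forall>U. openin (space_of Y) U \<longrightarrow> cring (sections Y U)) \<and>
     (\<forall>U V. openin (space_of Y) U \<longrightarrow> openin (space_of Y) V \<longrightarrow> V \<subseteq> U \<longrightarrow>
        res Y U V \<in> ring_hom (sections Y U) (sections Y V)) \<and>
     (\<forall>U s. openin (space_of Y) U \<longrightarrow> s \<in> carrier (sections Y U) \<longrightarrow> res Y U U s = s) \<and>
     (\<forall>U V W s. openin (space_of Y) U \<longrightarrow> openin (space_of Y) V \<longrightarrow> openin (space_of Y) W \<longrightarrow>
        V \<subseteq> U \<longrightarrow> W \<subseteq> V \<longrightarrow> s \<in> carrier (sections Y U) \<longrightarrow>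
        res Y V W (res Y U V s) = res Y U W s)"

text \<open>The cover \<open>\<C>\<close> may be empty, which forces the sections over \<open>{}\<close> to be the zero ring.\<close>

definition ringed_space :: "('p, 'a) ringed_space \<Rightarrow> bool" where
  "ringed_space Y \<longleftrightarrow> presheaf_of_rings Y \<and>
     (\<forall>\<C>. (\<forall>U\<in>\<C>. openin (space_of Y) U) \<longrightarrow>
        (\<forall>s\<in>carrier (sections Y (\<Union>\<C>)). \<forall>s'\<in>carrier (sections Y (\<Union>\<C>)).
           (\<forall>U\<in>\<C>. res Y (\<Union>\<C>) U s = res Y (\<Union>\<C>) U s') \<longrightarrow> s = s') \<and>
        (\<forall>g. (\<forall>U\<in>\<C>. g U \<in> carrier (sections Y U)) \<longrightarrow>
           (\<forall>U\<in>\<C>. \<forall>V\<in>\<C>. res Y U (U \<inter> V) (g U) = res Y V (U \<inter> V) (g V)) \<longrightarrow>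
           (\<exists>s\<in>carrier (sections Y (\<Union>\<C>)). \<forall>U\<in>\<C>. res Y (\<Union>\<C>) U s = g U)))"

definition germ :: "('p, 'a) ringed_space \<Rightarrow> 'p \<Rightarrow> 'p set \<Rightarrow> 'a \<Rightarrow> ('p set \<times> 'a) set" where
  "germ Y x U s = {(V, t). openin (space_of Y) V \<and> x \<in> V \<and> t \<in> carrier (sections Y V) \<and>
     (\<exists>W. openin (space_of Y) W \<and> x \<in> W \<and> W \<subseteq> U \<inter> V \<and> res Y U W s = res Y V W t)}"

definition stalk :: "('p, 'a) ringed_space \<Rightarrow> 'p \<Rightarrow> ('p set \<times> 'a) set ring" where
  "stalk Y x =
    \<lparr> carrier = {germ Y x U s | U s.
                   openin (space_of Y) U \<and> x \<in> U \<and> s \<in> carrier (sections Y U)},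
      monoid.mult = (\<lambda>\<alpha> \<beta>. \<Union>(U, s)\<in>\<alpha>. \<Union>(V, t)\<in>\<beta>.
                germ Y x (U \<inter> V) (res Y U (U \<inter> V) s \<otimes>\<^bsub>sections Y (U \<inter> V)\<^esub> res Y V (U \<inter> V) t)),
      monoid.one = germ Y x (topspace (space_of Y)) \<one>\<^bsub>sections Y (topspace (space_of Y))\<^esub>,
      ring.zero = germ Y x (topspace (space_of Y)) \<zero>\<^bsub>sections Y (topspace (space_of Y))\<^esub>,
      ring.add = (\<lambda>\<alpha> \<beta>. \<Union>(U, s)\<in>\<alpha>. \<Union>(V, t)\<in>\<beta>.
               germ Y x (U \<inter> V) (res Y U (U \<inter> V) s \<oplus>\<^bsub>sections Y (U \<inter> V)\<^esub> res Y V (U \<inter> V) t)) \<rparr>"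

definition locally_ringed_space :: "('p, 'a) ringed_space \<Rightarrow> bool" where
  "locally_ringed_space Y \<longleftrightarrow> ringed_space Y \<and>
     (\<forall>x\<in>topspace (space_of Y). local_ring (stalk Y x))"

definition preimage :: "('q, 'b) ringed_space \<Rightarrow> ('q \<Rightarrow> 'p) \<Rightarrow> 'p set \<Rightarrow> 'q set" where
  "preimage T f V = {t \<in> topspace (space_of T). f t \<in> V}"

text \<open>A morphism \<open>T \<rightarrow> S\<close> is given by the map of points \<open>f\<close> and the comorphisms
  \<open>h V : \<O>\<^sub>S(V) \<rightarrow> \<O>\<^sub>T(f\<inverse>V)\<close>.\<close>

definition ringed_space_morphism ::
  "('q, 'b) ringed_space \<Rightarrow> ('p, 'a) ringed_space \<Rightarrow> ('q \<Rightarrow> 'p) \<Rightarrow> ('p set \<Rightarrow> 'a \<Rightarrow> 'b) \<Rightarrow> bool" where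
  "ringed_space_morphism T S f h \<longleftrightarrow>
     continuous_map (space_of T) (space_of S) f \<and>
     (\<forall>V. openin (space_of S) V \<longrightarrow>
        h V \<in> ring_hom (sections S V) (sections T (preimage T f V))) \<and>
     (\<forall>V W s. openin (space_of S) V \<longrightarrow> openin (space_of S) W \<longrightarrow> W \<subseteq> V \<longrightarrow>
        s \<in> carrier (sections S V) \<longrightarrow>
        h W (res S V W s) = res T (preimage T f V) (preimage T f W) (h V s))"

definition ringed_space_iso ::
  "('q, 'b) ringed_space \<Rightarrow> ('p, 'a) ringed_space \<Rightarrow> ('q \<Rightarrow> 'p) \<Rightarrow> ('p set \<Rightarrow> 'a \<Rightarrow> 'b) \<Rightarrow> bool" where
  "ringed_space_iso T S f h \<longleftrightarrow> ringed_space_morphism T S f h \<and>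
     homeomorphic_map (space_of T) (space_of S) f \<and>
     (\<forall>V. openin (space_of S) V \<longrightarrow>
        h V \<in> ring_iso (sections S V) (sections T (preimage T f V)))"

definition stalk_map ::
  "('q, 'b) ringed_space \<Rightarrow> ('q \<Rightarrow> 'p) \<Rightarrow> ('p set \<Rightarrow> 'a \<Rightarrow> 'b) \<Rightarrow> 'q \<Rightarrow>
     ('p set \<times> 'a) set \<Rightarrow> ('q set \<times> 'b) set" where
  "stalk_map T f h t \<alpha> = (\<Union>(V, s)\<in>\<alpha>. germ T t (preimage T f V) (h V s))"

definition locally_ringed_space_morphism ::
  "('q, 'b) ringed_space \<Rightarrow> ('p, 'a) ringed_space \<Rightarrow> ('q \<Rightarrow> 'p) \<Rightarrow> ('p set \<Rightarrow> 'a \<Rightarrow> 'b) \<Rightarrow> bool" where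
  "locally_ringed_space_morphism T S f h \<longleftrightarrow>
     locally_ringed_space T \<and> locally_ringed_space S \<and> ringed_space_morphism T S f h \<and>
     (\<forall>t\<in>topspace (space_of T).
        local_ring_hom (stalk S (f t)) (stalk T t) (stalk_map T f h t))"

definition open_subspace :: "('p, 'a) ringed_space \<Rightarrow> 'p set \<Rightarrow> ('p, 'a) ringed_space" where
  "open_subspace Y U = Y\<lparr> space_of := subtopology (space_of Y) U \<rparr>"


section \<open>Schemes\<close>

definition zariski_topology :: "'a ring \<Rightarrow> 'a set topology" where
  "zariski_topology R =
     topology_generated_by ((\<lambda>a. {P. primeideal P R \<and> a \<notin> P}) ` carrier R)"

abbreviation localization_at :: "'a ring \<Rightarrow> 'a set \<Rightarrow> ('a \<times> 'a) set ring" where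
  "localization_at R P \<equiv> localization R (carrier R - P)"

definition spec_sections :: "'a ring \<Rightarrow> 'a set set \<Rightarrow> ('a set \<Rightarrow> ('a \<times> 'a) set) ring" where
  "spec_sections R U =
    \<lparr> carrier = {s \<in> \<Pi>\<^sub>E P\<in>U. carrier (localization_at R P).
        \<forall>P\<in>U. \<exists>V a b. openin (zariski_topology R) V \<and> P \<in> V \<and> V \<subseteq> U \<and>
          a \<in> carrier R \<and> b \<in> carrier R \<and>
          (\<forall>Q\<in>V. b \<notin> Q \<and> s Q = fraction R (carrier R - Q) a b)},
      monoid.mult = (\<lambda>s t. \<lambda>P\<in>U. s P \<otimes>\<^bsub>localization_at R P\<^esub> t P),
      monoid.one = (\<lambda>P\<in>U. \<one>\<^bsub>localization_at R P\<^esub>),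
      ring.zero = (\<lambda>P\<in>U. \<zero>\<^bsub>localization_at R P\<^esub>),
      ring.add = (\<lambda>s t. \<lambda>P\<in>U. s P \<oplus>\<^bsub>localization_at R P\<^esub> t P) \<rparr>"

definition Spec :: "'a ring \<Rightarrow> ('a set, 'a set \<Rightarrow> ('a \<times> 'a) set) ringed_space" where
  "Spec R = \<lparr> space_of = zariski_topology R, sections = spec_sections R,
              res = (\<lambda>U V s. restrict s V) \<rparr>"

text \<open>Taking \<open>R\<close> over the type of sections of \<open>Y\<close> is no restriction: such an \<open>R\<close> is isomorphic
  to \<open>sections Y U\<close>.\<close>

definition affine_open :: "('p, 'a) ringed_space \<Rightarrow> 'p set \<Rightarrow> bool" where
  "affine_open Y U \<longleftrightarrow> openin (space_of Y) U \<and>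
     (\<exists>(R :: 'a ring) f h. cring R \<and> ringed_space_iso (open_subspace Y U) (Spec R) f h)"

definition scheme :: "('p, 'a) ringed_space \<Rightarrow> bool" where
  "scheme Y \<longleftrightarrow> locally_ringed_space Y \<and>
     (\<forall>x\<in>topspace (space_of Y). \<exists>U. affine_open Y U \<and> x \<in> U)"

definition scheme_morphism ::
  "('q, 'b) ringed_space \<Rightarrow> ('p, 'a) ringed_space \<Rightarrow> ('q \<Rightarrow> 'p) \<Rightarrow> ('p set \<Rightarrow> 'a \<Rightarrow> 'b) \<Rightarrow> bool" where
  "scheme_morphism T S f h \<longleftrightarrow>
     scheme T \<and> scheme S \<and> locally_ringed_space_morphism T S f h"

definition prufer_scheme :: "('p, 'a) ringed_space \<Rightarrow> bool" where
  "prufer_scheme S \<longleftrightarrow> scheme S \<and>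
     (\<forall>s\<in>topspace (space_of S). valuation_domain (stalk S s))"

definition flat_morphism ::
  "'m itself \<Rightarrow> ('q, 'b) ringed_space \<Rightarrow> ('p, 'a) ringed_space \<Rightarrow>
     ('q \<Rightarrow> 'p) \<Rightarrow> ('p set \<Rightarrow> 'a \<Rightarrow> 'b) \<Rightarrow> bool" where
  "flat_morphism ty T S f h \<longleftrightarrow> scheme_morphism T S f h \<and>
     (\<forall>t\<in>topspace (space_of T).
        flat_ring_hom ty (stalk S (f t)) (stalk T t) (stalk_map T f h t))"

text \<open>The Jacobian definition: locally on source and target, \<open>f\<close> is given by a standard smooth
  algebra.\<close>

definition smooth_morphism ::
  "('q, 'b) ringed_space \<Rightarrow> ('p, 'a) ringed_space \<Rightarrow> ('q \<Rightarrow> 'p) \<Rightarrow> ('p set \<Rightarrow> 'a \<Rightarrow> 'b) \<Rightarrow> bool" where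
  "smooth_morphism T S f h \<longleftrightarrow> scheme_morphism T S f h \<and>
     (\<forall>t\<in>topspace (space_of T). \<exists>U V. affine_open T U \<and> t \<in> U \<and> affine_open S V \<and> f ` U \<subseteq> V \<and>
        standard_smooth (sections S V) (sections T U) (\<lambda>s. res T (preimage T f V) U (h V s)))"


section \<open>Cartier divisors and convexity\<close>

definition regular_sections :: "('p, 'a) ringed_space \<Rightarrow> 'p set \<Rightarrow> 'a set" where
  "regular_sections Y U =
     {x \<in> carrier (sections Y U). \<forall>s\<in>U. nonzerodivisor (stalk Y s) (germ Y s U x)}"

text \<open>The stalk of the sheaf of regular sections. It consists of nonzerodivisors of the local
  ring, but a nonzerodivisor of the local ring need not extend to a regular section on a
  neighbourhood, so in general it is smaller than the set of all of them.\<close>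

definition regular_stalk :: "('p, 'a) ringed_space \<Rightarrow> 'p \<Rightarrow> ('p set \<times> 'a) set set" where
  "regular_stalk Y s = {germ Y s U x | U x.
     openin (space_of Y) U \<and> s \<in> U \<and> x \<in> regular_sections Y U}"

type_synonym ('p, 'a) mero = "(('p set \<times> 'a) set \<times> ('p set \<times> 'a) set) set"

definition mero_stalk :: "('p, 'a) ringed_space \<Rightarrow> 'p \<Rightarrow> ('p, 'a) mero ring" where
  "mero_stalk Y s = localization (stalk Y s) (regular_stalk Y s)"

definition to_mero ::
  "('p, 'a) ringed_space \<Rightarrow> 'p \<Rightarrow> ('p set \<times> 'a) set \<Rightarrow> ('p, 'a) mero" where
  "to_mero Y s x = fraction (stalk Y s) (regular_stalk Y s) x \<one>\<^bsub>stalk Y s\<^esub>"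

definition unit_divisors :: "('p, 'a) ringed_space \<Rightarrow> 'p \<Rightarrow> ('p, 'a) mero set" where
  "unit_divisors Y s = to_mero Y s ` Units (stalk Y s)"

definition divisor_class ::
  "('p, 'a) ringed_space \<Rightarrow> 'p \<Rightarrow> ('p, 'a) mero \<Rightarrow> ('p, 'a) mero set" where
  "divisor_class Y s m = unit_divisors Y s #>\<^bsub>units_of (mero_stalk Y s)\<^esub> m"

definition cartier_stalk :: "('p, 'a) ringed_space \<Rightarrow> 'p \<Rightarrow> ('p, 'a) mero set monoid" where
  "cartier_stalk Y s = units_of (mero_stalk Y s) Mod unit_divisors Y s"

definition cartier_nonneg :: "('p, 'a) ringed_space \<Rightarrow> 'p \<Rightarrow> ('p, 'a) mero set set" where
  "cartier_nonneg Y s = (\<lambda>x. divisor_class Y s (to_mero Y s x)) ` regular_stalk Y s"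

text \<open>A partial order on a commutative group is given by its submonoid \<open>P\<close> of non-negative
  elements.\<close>

definition group_le :: "'d monoid \<Rightarrow> 'd set \<Rightarrow> 'd \<Rightarrow> 'd \<Rightarrow> bool" where
  "group_le D P \<alpha> \<beta> \<longleftrightarrow> \<beta> \<otimes>\<^bsub>D\<^esub> inv\<^bsub>D\<^esub> \<alpha> \<in> P"

definition convex_subgroup :: "'d monoid \<Rightarrow> 'd set \<Rightarrow> 'd set \<Rightarrow> bool" where
  "convex_subgroup D P H \<longleftrightarrow> subgroup H D \<and>
     (\<forall>\<alpha>\<in>carrier D. \<forall>\<beta>\<in>carrier D. \<forall>\<gamma>\<in>carrier D.
        group_le D P \<alpha> \<beta> \<longrightarrow> group_le D P \<beta> \<gamma> \<longrightarrow> \<alpha> \<in> H \<longrightarrow> \<gamma> \<in> H \<longrightarrow> \<beta> \<in> H)"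

definition cartier_map ::
  "('q, 'b) ringed_space \<Rightarrow> ('q \<Rightarrow> 'p) \<Rightarrow> ('p set \<Rightarrow> 'a \<Rightarrow> 'b) \<Rightarrow> 'q \<Rightarrow>
     ('p, 'a) mero set \<Rightarrow> ('q, 'b) mero set" where
  "cartier_map T f h t \<delta> = (\<Union>m\<in>\<delta>. divisor_class T t
     (localization_map (stalk T t) (regular_stalk T t) (stalk_map T f h t) m))"

definition convex_morphism ::
  "'m itself \<Rightarrow> ('q, 'b) ringed_space \<Rightarrow> ('p, 'a) ringed_space \<Rightarrow>
     ('q \<Rightarrow> 'p) \<Rightarrow> ('p set \<Rightarrow> 'a \<Rightarrow> 'b) \<Rightarrow> bool" where
  "convex_morphism ty T S f h \<longleftrightarrow> flat_morphism ty T S f h \<and>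
     (\<forall>t\<in>topspace (space_of T).
        convex_subgroup (cartier_stalk T t) (cartier_nonneg T t)
          (cartier_map T f h t ` carrier (cartier_stalk S (f t))))"

end

theory Submission
  imports Defs "HOL-Library.Multiset_Order" "Jordan_Normal_Form.Determinant"
begin

text \<open>Let \<open>B\<close> be the local ring of \<open>T\<close> at a point above \<open>s\<close> and \<open>A\<close> the valuation ring of \<open>S\<close> at \<open>s\<close>. Then \<open>B\<close> is a
localization of \<open>A[X] / (F)\<close> with invertible Jacobian. The quasi-regularity of \<open>F\<close> and Krull's intersection theorem show
that \<open>B\<close> is torsion-free over \<open>A\<close>, hence flat, since over a valuation ring finitely generated torsion-free modules are
free. Taylor expansion at a prime of \<open>B\<close> above \<open>p\<close> shows that \<open>p B\<close> is prime for every prime \<open>p\<close> of \<open>A\<close>. Every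
nonzero \<open>b\<close> can be written as \<open>r b'\<close> with \<open>r\<close> in \<open>A\<close>, \<open>b'\<close> outside of \<open>p B\<close> and \<open>b'\<close> divisible by every element of
\<open>A - p\<close>, for some prime \<open>p\<close>. If \<open>b c\<close> is a nonzero element of \<open>A\<close>, comparing these expressions for \<open>b\<close> and \<open>c\<close> gives
\<open>b = r u\<close> with a unit \<open>u\<close>: effective divisors below a divisor from \<open>A\<close> come from \<open>A\<close>, which is convexity.\<close>

section \<open>Ideals of subrings, Hilbert's basis theorem and Krull's intersection theorem\<close>

text \<open>A valuation ring and its smooth algebras are rarely noetherian, while Hilbert's basis
  theorem and Krull's theorem drive the argument. Each use of Krull's theorem therefore descends to
  a ring generated by the finitely many coefficients in sight; when the resulting relation has
  coefficients in a ring that is too large, \<open>specialize_relation\<close> replaces them.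
  Quotients are avoided: a ring is a type with a kernel, and equations are memberships in
  \<open>K\<close> or \<open>KA\<close>. Power series are avoided as well: a Taylor expansion is a
  sequence of polynomials whose coefficients below degree \<open>N\<close> are final from stage
  \<open>N\<close> on. The primality of p B is needed because the primes attached to b and to c may
  differ: both are ideals of A, so they are comparable, and a scalar in both would force b or c into
  the wrong extension. These primes need not be maximal: the scalars dividing b may form a cut of A
  without greatest element, and p then measures the cut.\<close>

definition sring :: "'r::comm_ring_1 set => bool" where
 "sring Q \<longleftrightarrow> 1 \<in> Q \<and> (\<forall>x\<in>Q. \<forall>y\<in>Q. x - y \<in> Q \<and> x * y \<in> Q)"

text \<open>\<open>I\<close> need not lie in \<open>Q\<close>: the notion is that of a
  \<open>Q\<close>-submodule of the ambient ring. An ideal of a larger ring is thus also one over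
  every subring (\<open>qideal_mono\<close>), which the descent to rings of coefficients
  uses.\<close>

definition qideal :: "'r::comm_ring_1 set => 'r set => bool" where
 "qideal Q I \<longleftrightarrow> 0 \<in> I \<and> (\<forall>x\<in>I. \<forall>y\<in>I. x + y \<in> I) \<and> (\<forall>q\<in>Q. \<forall>x\<in>I. q * x \<in> I)"

definition qspan :: "'r::comm_ring_1 set => 'r set => 'r set" where
 "qspan Q G = \<Inter>{I. qideal Q I \<and> G \<subseteq> I}"

abbreviation rideal :: "'r::comm_ring_1 set => bool" where
 "rideal \<equiv> qideal UNIV"

definition rprime :: "'r::comm_ring_1 set => bool" where
 "rprime P \<longleftrightarrow> rideal P \<and> 1 \<notin> P \<and> (\<forall>a b. a * b \<in> P \<longrightarrow> a \<in> P \<or> b \<in> P)"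

lemma qidealI: "0 \<in> I ==> (\<And>x y. x \<in> I ==> y \<in> I ==> x + y \<in> I) ==> (\<And>q x. q \<in> Q ==> x \<in> I ==> q * x \<in> I) ==> qideal Q I"
 by (simp add: qideal_def)

lemma sring_UNIV [simp]: "sring UNIV"
 by (simp add: sring_def)

lemma sringD:
 assumes "sring Q"
 shows sring_1: "1 \<in> Q" and sring_0: "0 \<in> Q"
  and sring_diff: "x \<in> Q ==> y \<in> Q ==> x - y \<in> Q"
  and sring_mult: "x \<in> Q ==> y \<in> Q ==> x * y \<in> Q"
  and sring_minus: "x \<in> Q ==> - x \<in> Q"
  and sring_add: "x \<in> Q ==> y \<in> Q ==> x + y \<in> Q"
proof -
 show 1: "1 \<in> Q" and d: "x \<in> Q ==> y \<in> Q ==> x - y \<in> Q" for x y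
  using assms by (auto simp: sring_def)
 show "x \<in> Q ==> y \<in> Q ==> x * y \<in> Q" using assms by (auto simp: sring_def)
 show 0: "0 \<in> Q" using d[OF 1 1] by simp
 have m: "- y \<in> Q" if "y \<in> Q" for y using d[OF 0 that] by simp
 show "x \<in> Q ==> - x \<in> Q" by (rule m)
 show "x \<in> Q ==> y \<in> Q ==> x + y \<in> Q" using d[of x "- y"] m by auto
qed

lemma sring_sum: "sring Q ==> (\<And>i. i \<in> A ==> f i \<in> Q) ==> sum f A \<in> Q"
 by (induction A rule: infinite_finite_induct) (auto simp: sring_0 sring_add)

lemma sring_power: "sring Q ==> x \<in> Q ==> x ^ n \<in> Q"
 by (induction n) (auto simp: sring_1 sring_mult)

lemma sring_prod_mset: "sring Q ==> (\<And>i. i \<in># M ==> f i \<in> Q) ==> prod_mset (image_mset f M) \<in> Q"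
 by (induction M) (auto simp: sring_1 sring_mult)

lemma sring_of_int: "sring Q ==> of_int k \<in> Q"
proof -
 assume Q: "sring Q"
 have n: "of_nat m \<in> Q" for m by (induction m) (auto simp: sring_0[OF Q] sring_1[OF Q] sring_add[OF Q])
 show ?thesis by (cases k rule: int_cases2) (auto simp: n sring_minus[OF Q])
qed

lemma qidealD:
 assumes "qideal Q I"
 shows qideal_0: "0 \<in> I" and qideal_add: "x \<in> I ==> y \<in> I ==> x + y \<in> I"
  and qideal_mult: "q \<in> Q ==> x \<in> I ==> q * x \<in> I"
  and qideal_multr: "q \<in> Q ==> x \<in> I ==> x * q \<in> I"
 using assms by (auto simp: qideal_def mult.commute)

lemma qideal_minus: "qideal Q I ==> sring Q ==> x \<in> I ==> - x \<in> I"
 using qideal_mult[of Q I "-1" x] by (simp add: sring_minus sring_1)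

lemma qideal_diff: "qideal Q I ==> sring Q ==> x \<in> I ==> y \<in> I ==> x - y \<in> I"
 using qideal_add[of Q I x "- y"] qideal_minus[of Q I y] by simp

lemma qideal_sum: "qideal Q I ==> (\<And>i. i \<in> A ==> f i \<in> I) ==> sum f A \<in> I"
 by (induction A rule: infinite_finite_induct) (auto simp: qideal_0 qideal_add)

lemma qideal_sring: "sring Q ==> qideal Q Q"
 by (auto simp: qideal_def sring_0 sring_add sring_mult)

lemma qideal_mono: "qideal Q I ==> Q' \<subseteq> Q ==> qideal Q' I"
 by (auto simp: qideal_def)

lemma qideal_Int: "qideal Q I ==> qideal Q J ==> qideal Q (I \<inter> J)"
 by (auto simp: qideal_def)

lemma qideal_cong: "qideal Q I ==> x - y \<in> I ==> y \<in> I ==> x \<in> I"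
 using qideal_add[of Q I "x - y" y] by simp

lemma qspan_qideal: "qideal Q (qspan Q G)"
 by (auto simp: qspan_def qideal_def)

lemma qspan_base: "G \<subseteq> qspan Q G"
 by (auto simp: qspan_def)

lemma qspan_basic: "g \<in> G ==> g \<in> qspan Q G"
 using qspan_base by blast

lemma qspan_least: "qideal Q I ==> G \<subseteq> I ==> qspan Q G \<subseteq> I"
 by (auto simp: qspan_def)

lemma qspan_mono: "G \<subseteq> H ==> qspan Q G \<subseteq> qspan Q H"
 by (rule qspan_least[OF qspan_qideal]) (use qspan_base in blast)

lemma qspan_mono2: "Q \<subseteq> Q' ==> G \<subseteq> H ==> qspan Q G \<subseteq> qspan Q' H"
 by (rule qspan_least[OF qideal_mono[OF qspan_qideal]]) (use qspan_base in blast)+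

lemma qspan_insert:
 assumes Q: "sring Q" and x: "x \<in> qspan Q (insert g G)"
 shows "\<exists>q\<in>Q. x - q * g \<in> qspan Q G"
proof -
 let ?I = "{x. \<exists>q\<in>Q. x - q * g \<in> qspan Q G}"
 have "qideal Q ?I"
 proof (rule qidealI)
  show "0 \<in> ?I" using sring_0[OF Q] qideal_0[OF qspan_qideal] by force
  fix x y assume "x \<in> ?I" "y \<in> ?I"
  then obtain p q where pq: "p \<in> Q" "q \<in> Q" "x - p * g \<in> qspan Q G" "y - q * g \<in> qspan Q G" by blast
  have "(x + y) - (p + q) * g \<in> qspan Q G"
   using qideal_add[OF qspan_qideal pq(3,4)] by (simp add: algebra_simps)
  thus "x + y \<in> ?I" using sring_add[OF Q pq(1,2)] by blast
 next
  fix r x assume r: "r \<in> Q" and "x \<in> ?I"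
  then obtain p where p: "p \<in> Q" "x - p * g \<in> qspan Q G" by blast
  show "r * x \<in> ?I" using qideal_mult[OF qspan_qideal r p(2)] sring_mult[OF Q r p(1)] by (auto simp: algebra_simps)
 qed
 moreover have "insert g G \<subseteq> ?I"
 proof
  fix h assume "h \<in> insert g G"
  thus "h \<in> ?I"
  proof
   assume "h = g" thus ?thesis
    using sring_1[OF Q] qideal_0[OF qspan_qideal] by force
  next
   assume "h \<in> G" thus ?thesis
    using sring_0[OF Q] qspan_basic by force
  qed
 qed
 ultimately show ?thesis using qspan_least x by blast
qed

text \<open>Coefficients are recorded for the finite family only; what comes from \<open>J\<close>,
  typically the infinite set of polynomials with coefficients in a prime, stays inside a span. A
  relation is thereby reduced to finitely many coefficients.\<close>

lemma qspan_finite: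
 assumes Q: "sring Q" and "finite A" and "x \<in> qspan Q (f ` A \<union> J)"
 shows "\<exists>q. (\<forall>i\<in>A. q i \<in> Q) \<and> x - (\<Sum>i\<in>A. q i * f i) \<in> qspan Q J"
 using assms(2,3)
proof (induction A arbitrary: x rule: finite_induct)
 case empty
 thus ?case by simp
next
 case (insert a A)
 then obtain p where p: "p \<in> Q" "x - p * f a \<in> qspan Q (f ` A \<union> J)"
  using qspan_insert[OF Q, of x "f a" "f ` A \<union> J"] by auto
 from insert.IH[OF this(2)] obtain q where q: "\<forall>i\<in>A. q i \<in> Q"
  "x - p * f a - (\<Sum>i\<in>A. q i * f i) \<in> qspan Q J" by blast
 have "(\<Sum>i\<in>insert a A. (q(a := p)) i * f i) = p * f a + (\<Sum>i\<in>A. q i * f i)"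
  using insert.hyps by simp (intro sum.cong, auto)
 thus ?case using q p by (intro exI[of _ "q(a := p)"]) (auto simp: algebra_simps)
qed

lemma qspan_empty [simp]: "qspan Q {} = {0}"
proof
 have "qideal Q {0}" by (auto simp: qideal_def)
 thus "qspan Q {} \<subseteq> {0}" by (rule qspan_least) simp
 show "{0} \<subseteq> qspan Q {}" using qideal_0[OF qspan_qideal] by blast
qed

lemma qspan_sumI:
 "(\<And>i. i \<in> A ==> q i \<in> Q \<and> f i \<in> G) ==> (\<Sum>i\<in>A. q i * f i) \<in> qspan Q G"
 by (intro qideal_sum[OF qspan_qideal] qideal_mult[OF qspan_qideal] qspan_basic) auto

lemma rprimeD:
 assumes "rprime P"
 shows rprime_ideal: "rideal P" and rprime_1: "1 \<notin> P"
  and rprime_mult: "a * b \<in> P ==> a \<in> P \<or> b \<in> P"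
 using assms by (auto simp: rprime_def)

lemma rprime_mult_iff: "rprime P ==> a * b \<in> P \<longleftrightarrow> a \<in> P \<or> b \<in> P"
 using qideal_mult[OF rprime_ideal, of P a b] qideal_multr[OF rprime_ideal, of P b a] rprime_mult by auto

lemma rprime_prod:
 assumes "rprime P" "finite A" "\<And>i. i \<in> A ==> f i \<notin> P"
 shows "prod f A \<notin> P"
 using assms(2,3) by induction (auto simp: rprime_mult_iff[OF assms(1)] rprime_1[OF assms(1)])

lemma qideal_chain_Union:
 assumes "C \<noteq> {}" "\<And>I. I \<in> C ==> qideal Q I" "\<And>I J. I \<in> C ==> J \<in> C ==> I \<subseteq> J \<or> J \<subseteq> I"
 shows "qideal Q (\<Union>C)"
 proof (rule qidealI)
 show "0 \<in> \<Union>C" using assms(1) qideal_0[OF assms(2)] by blast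
 fix x y assume "x \<in> \<Union>C" "y \<in> \<Union>C"
 then obtain I J where IJ: "I \<in> C" "J \<in> C" "x \<in> I" "y \<in> J" by blast
 then obtain K where K: "K \<in> C" "x \<in> K" "y \<in> K" using assms(3) by blast
 thus "x + y \<in> \<Union>C" using qideal_add[OF assms(2)[OF K(1)] K(2,3)] by blast
next
 fix q x assume q: "q \<in> Q" "x \<in> \<Union>C"
 then obtain I where "I \<in> C" "x \<in> I" by blast
 thus "q * x \<in> \<Union>C" using qideal_mult[OF assms(2) q(1)] by blast
qed

text \<open>Zorn's lemma yields \<open>P\<close>; if \<open>a\<close> and \<open>b\<close> are
  outside, then P + (a) and P + (b) meet \<open>S\<close>, and the product of the two elements found
  lies in P + (a b). Maximality is kept in the conclusion because for \<open>S = {1}\<close> it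
  produces maximal ideals.\<close>

lemma exists_maximal_avoiding:
 fixes I S :: "'r::comm_ring_1 set"
 assumes I: "rideal I" and S1: "1 \<in> S" and Sm: "\<And>a b. a \<in> S ==> b \<in> S ==> a * b \<in> S"
  and dis: "I \<inter> S = {}"
 shows "\<exists>P. rprime P \<and> I \<subseteq> P \<and> P \<inter> S = {} \<and> (\<forall>N. rideal N \<longrightarrow> P \<subseteq> N \<longrightarrow> N \<inter> S = {} \<longrightarrow> N = P)"
proof -
 define \<A> where "\<A> = {P. rideal P \<and> I \<subseteq> P \<and> P \<inter> S = {}}"
 have "\<exists>M\<in>\<A>. \<forall>N\<in>\<A>. M \<subseteq> N \<longrightarrow> N = M"
 proof (rule subset_Zorn_nonempty)
  show "\<A> \<noteq> {}" using I dis by (auto simp: \<A>_def)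
  fix C assume C: "C \<noteq> {}" "subset.chain \<A> C"
  have CA: "C \<subseteq> \<A>" and ch: "\<And>M N. M \<in> C ==> N \<in> C ==> M \<subseteq> N \<or> N \<subseteq> M"
   using C(2) by (simp_all add: subset_chain_def)
  have "rideal (\<Union>C)" by (rule qideal_chain_Union[OF C(1) _ ch]) (use CA in \<open>auto simp: \<A>_def\<close>)
  moreover have "I \<subseteq> \<Union>C" "\<Union>C \<inter> S = {}" using C(1) CA by (auto simp: \<A>_def)
  ultimately show "\<Union>C \<in> \<A>" by (simp add: \<A>_def)
 qed
 then obtain P where PA: "P \<in> \<A>" and max: "\<And>N. N \<in> \<A> ==> P \<subseteq> N ==> N = P" by blast
 have P: "rideal P" "I \<subseteq> P" "P \<inter> S = {}" using PA by (auto simp: \<A>_def)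
 have ext: "\<exists>s\<in>S. \<exists>q. s - q * a \<in> P" if "a \<notin> P" for a
 proof (rule ccontr)
  assume no: "\<not> ?thesis"
  define N where "N = qspan UNIV (insert a P)"
  have aPN: "insert a P \<subseteq> N" unfolding N_def by (rule qspan_base)
  have "N \<inter> S = {}"
  proof (rule ccontr)
   assume "N \<inter> S \<noteq> {}"
   then obtain s where s: "s \<in> N" "s \<in> S" by blast
   then obtain q where "s - q * a \<in> qspan UNIV P" unfolding N_def using qspan_insert[OF sring_UNIV] by blast
   thus False using qspan_least[OF P(1), of P] no s(2) by blast
  qed
  moreover have "rideal N" unfolding N_def by (rule qspan_qideal)
  ultimately have "N \<in> \<A>" using aPN P(2) by (auto simp: \<A>_def)
  thus False using max that aPN by blast
 qed
 have "rprime P" unfolding rprime_def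
 proof (intro conjI allI impI)
  show "1 \<notin> P" using P(3) S1 by blast
  fix a b assume ab: "a * b \<in> P"
  show "a \<in> P \<or> b \<in> P"
  proof (rule ccontr)
   assume "\<not> ?thesis"
   then obtain s t q r where st: "s \<in> S" "t \<in> S" "s - q * a \<in> P" "t - r * b \<in> P"
    using ext ext[of b] by blast
   have "s * t = (s - q * a) * t + (q * a * (t - r * b) + q * r * (a * b))" by (simp add: algebra_simps)
   also have "\<dots> \<in> P"
    by (rule qideal_add[OF P(1) qideal_multr[OF P(1) UNIV_I st(3)]
       qideal_add[OF P(1) qideal_mult[OF P(1) UNIV_I st(4)] qideal_mult[OF P(1) UNIV_I ab]]])
   finally show False using Sm[OF st(1,2)] P(3) by blast
  qed
 qed (fact P(1))
 moreover have "\<forall>N. rideal N \<longrightarrow> P \<subseteq> N \<longrightarrow> N \<inter> S = {} \<longrightarrow> N = P"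
 proof (intro allI impI)
  fix N assume "rideal N" "P \<subseteq> N" "N \<inter> S = {}"
  thus "N = P" using max P(2) by (simp add: \<A>_def)
 qed
 ultimately show ?thesis using P by blast
qed

lemma exists_prime_avoiding:
 fixes I S :: "'r::comm_ring_1 set"
 assumes "rideal I" "1 \<in> S" "\<And>a b. a \<in> S ==> b \<in> S ==> a * b \<in> S" "I \<inter> S = {}"
 obtains P where "rprime P" "I \<subseteq> P" "P \<inter> S = {}"
 using exists_maximal_avoiding[OF assms] by blast

subsection \<open>Hilbert's basis theorem\<close>

text \<open>The set \<open>S\<close> of multipliers allows the same statement to cover polynomials over \<open>\<int>\<close>
 (\<open>S = {1}\<close>) and over the residue field of a prime of an arbitrary ring.\<close>

definition noeth :: "'r::comm_ring_1 set => 'r set => 'r set => bool" where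
 "noeth Q J S \<longleftrightarrow> (\<forall>I. qideal Q I \<and> I \<subseteq> Q \<and> J \<subseteq> I \<and> (\<forall>v\<in>S. \<forall>h\<in>Q. v * h \<in> I \<longrightarrow> h \<in> I) \<longrightarrow>
   (\<exists>G. finite G \<and> G \<subseteq> I \<and> (\<forall>h\<in>I. \<exists>v\<in>S. v * h \<in> qspan Q (G \<union> J))))"

lemma noethE:
 assumes "noeth Q J S" "qideal Q I" "I \<subseteq> Q" "J \<subseteq> I" "\<And>v h. v \<in> S ==> h \<in> Q ==> v * h \<in> I ==> h \<in> I"
 obtains G where "finite G" "G \<subseteq> I" "\<forall>h\<in>I. \<exists>v\<in>S. v * h \<in> qspan Q (G \<union> J)"
proof -
 have "qideal Q I \<and> I \<subseteq> Q \<and> J \<subseteq> I \<and> (\<forall>v\<in>S. \<forall>h\<in>Q. v * h \<in> I \<longrightarrow> h \<in> I)" using assms by simp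
 with assms(1)[unfolded noeth_def, rule_format, of I]
 show thesis using that by auto
qed

definition adjoin :: "'r::comm_ring_1 set => 'r => 'r set" where
 "adjoin Q t = {\<Sum>i<d. p i * t ^ i | p d. \<forall>i. p i \<in> Q}"

lemma adjoin_bound:
 assumes "sring Q" "\<forall>i. p i \<in> Q" "d \<le> e"
 shows "\<exists>p'. (\<forall>i. p' i \<in> Q) \<and> (\<Sum>i<d. p i * t ^ i) = (\<Sum>i<e. p' i * t ^ i)"
proof (intro exI conjI allI)
 let ?p = "\<lambda>i. if i < d then p i else 0"
 show "?p i \<in> Q" for i using assms sring_0 by auto
 show "(\<Sum>i<d. p i * t ^ i) = (\<Sum>i<e. ?p i * t ^ i)"
  by (rule sum.mono_neutral_cong_left) (use assms(3) in auto)
qed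

lemma adjoin_const: "sring Q ==> q \<in> Q ==> q \<in> adjoin Q t"
 unfolding adjoin_def by (rule, rule exI[of _ "\<lambda>_. q"], rule exI[of _ 1]) simp

lemma adjoin_add:
 assumes Q: "sring Q" and "x \<in> adjoin Q t" "y \<in> adjoin Q t" shows "x + y \<in> adjoin Q t"
proof -
 obtain p d p' d' where 1: "\<forall>i. p i \<in> Q" "x = (\<Sum>i<d. p i * t ^ i)"
  "\<forall>i. p' i \<in> Q" "y = (\<Sum>i<d'. p' i * t ^ i)" using assms by (auto simp: adjoin_def)
 obtain r where r: "\<forall>i. r i \<in> Q" "x = (\<Sum>i<max d d'. r i * t ^ i)" using adjoin_bound[OF Q 1(1), of d "max d d'" t] 1(2) by auto
 obtain s where s: "\<forall>i. s i \<in> Q" "y = (\<Sum>i<max d d'. s i * t ^ i)" using adjoin_bound[OF Q 1(3), of d' "max d d'" t] 1(4) by auto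
 show ?thesis unfolding adjoin_def using r s sring_add[OF Q]
  by (intro CollectI exI[of _ "\<lambda>i. r i + s i"]) (auto simp: sum.distrib algebra_simps)
qed

lemma adjoin_cmult:
 assumes Q: "sring Q" and "q \<in> Q" "x \<in> adjoin Q t" shows "q * x \<in> adjoin Q t"
proof -
 obtain p d where 1: "\<forall>i. p i \<in> Q" "x = (\<Sum>i<d. p i * t ^ i)" using assms by (auto simp: adjoin_def)
 have "\<forall>i. q * p i \<in> Q" using 1(1) sring_mult[OF Q assms(2)] by blast
 moreover have "q * x = (\<Sum>i<d. (q * p i) * t ^ i)" by (simp add: 1(2) sum_distrib_left mult.assoc)
 ultimately show ?thesis unfolding adjoin_def by (intro CollectI exI conjI)
qed

lemma sum_shift_power:
 fixes t :: "'r::comm_ring_1"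
 shows "t ^ k * (\<Sum>i<d. p i * t ^ i) = (\<Sum>i<d + k. (if i < k then 0 else p (i - k)) * t ^ i)"
proof -
 have "(\<Sum>i<d + k. (if i < k then 0 else p (i - k)) * t ^ i) = (\<Sum>i\<in>{k..<d + k}. p (i - k) * t ^ i)"
  by (rule sum.mono_neutral_cong_right) auto
 also have "\<dots> = (\<Sum>i<d. p i * t ^ (i + k))"
  by (rule sum.reindex_bij_witness[of _ "\<lambda>i. i + k" "\<lambda>i. i - k"]) auto
 finally show ?thesis by (simp add: sum_distrib_left power_add algebra_simps)
qed

lemma adjoin_powmult:
 assumes Q: "sring Q" and "x \<in> adjoin Q t" shows "t ^ k * x \<in> adjoin Q t"
proof -
 obtain p d where 1: "\<forall>i. p i \<in> Q" "x = (\<Sum>i<d. p i * t ^ i)" using assms by (auto simp: adjoin_def)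
 show ?thesis unfolding adjoin_def 1(2) sum_shift_power using 1 sring_0[OF Q] by auto
qed

lemma adjoin_mult:
 assumes Q: "sring Q" and "x \<in> adjoin Q t" "y \<in> adjoin Q t" shows "x * y \<in> adjoin Q t"
proof -
 obtain p d where 1: "\<forall>i. p i \<in> Q" "x = (\<Sum>i<d. p i * t ^ i)" using assms by (auto simp: adjoin_def)
 have "x * y = (\<Sum>i<d. p i * (t ^ i * y))" by (simp add: 1 sum_distrib_right mult.assoc)
 also have "\<dots> \<in> adjoin Q t"
 proof (induction d)
  case 0 show ?case using adjoin_const[OF Q sring_0[OF Q]] by simp
 next
  case (Suc d) thus ?case
   using adjoin_add[OF Q _ adjoin_cmult[OF Q _ adjoin_powmult[OF Q assms(3)]]] 1 by simp
 qed
 finally show ?thesis .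
qed

lemma sring_adjoin: assumes Q: "sring Q" shows "sring (adjoin Q t)"
 unfolding sring_def
proof (intro conjI ballI)
 show "1 \<in> adjoin Q t" using adjoin_const[OF Q sring_1[OF Q]] .
 fix x y assume xy: "x \<in> adjoin Q t" "y \<in> adjoin Q t"
 show "x * y \<in> adjoin Q t" using adjoin_mult[OF Q xy] .
 show "x - y \<in> adjoin Q t"
  using adjoin_add[OF Q xy(1) adjoin_cmult[OF Q sring_minus[OF Q sring_1[OF Q]] xy(2)]] by simp
qed

lemma adjoin_base: "sring Q ==> Q \<subseteq> adjoin Q t"
 using adjoin_const by blast

lemma adjoin_gen: "sring Q ==> t \<in> adjoin Q t"
 using adjoin_powmult[of Q 1 t 1] adjoin_const[of Q 1 t] sring_1[of Q] by simp

text \<open>\<open>lc d\<close> collects the leading coefficients of the elements of \<open>I\<close> of degree \<open>\<le> d\<close>. Saturation of \<open>I\<close> does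
 not pass to it, hence the detour through \<open>Ls d\<close>.\<close>

theorem noeth_adjoin:
 fixes Q :: "'r::comm_ring_1 set"
 assumes Q: "sring Q" and JQ: "J \<subseteq> Q" and SQ: "S \<subseteq> Q" and S1: "1 \<in> S"
  and Sm: "\<And>a b. a \<in> S ==> b \<in> S ==> a * b \<in> S" and noe: "noeth Q J S"
 shows "noeth (adjoin Q t) J S"
 unfolding noeth_def
proof (intro allI impI, elim conjE)
 let ?R = "adjoin Q t"
 have R: "sring ?R" by (rule sring_adjoin[OF Q])
 have QR: "Q \<subseteq> ?R" by (rule adjoin_base[OF Q])
 have tR: "t \<in> ?R" by (rule adjoin_gen[OF Q])
 fix I assume I: "qideal ?R I" "I \<subseteq> ?R" "J \<subseteq> I" "\<forall>v\<in>S. \<forall>h\<in>?R. v * h \<in> I \<longrightarrow> h \<in> I"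
 have IQ: "qideal Q I" by (rule qideal_mono[OF I(1) QR])
 \<comment> \<open>\<open>t\<close> may be algebraic over \<open>Q\<close>, so degrees belong to
   expressions and not to elements: \<open>low d w\<close> says that some expression of
   \<open>w\<close> has degree below \<open>d\<close>.\<close>
 define low where "low d w \<longleftrightarrow> (\<exists>p. (\<forall>i. p i \<in> Q) \<and> w = (\<Sum>i<d. p i * t ^ i))" for d :: nat and w
 have low_add: "low d (w + w')" if "low d w" "low d w'" for d w w'
 proof -
  obtain p p' where "\<forall>i. p i \<in> Q" "w = (\<Sum>i<d. p i * t ^ i)" "\<forall>i. p' i \<in> Q" "w' = (\<Sum>i<d. p' i * t ^ i)"
   using \<open>low d w\<close> \<open>low d w'\<close> by (auto simp: low_def)
  thus ?thesis unfolding low_def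
   by (intro exI[of _ "\<lambda>i. p i + p' i"]) (auto simp: sum.distrib algebra_simps sring_add[OF Q])
 qed
 have low_mult: "low d (q * w)" if "q \<in> Q" "low d w" for d q w
 proof -
  obtain p where "\<forall>i. p i \<in> Q" "w = (\<Sum>i<d. p i * t ^ i)" using \<open>low d w\<close> by (auto simp: low_def)
  thus ?thesis unfolding low_def
   by (intro exI[of _ "\<lambda>i. q * p i"]) (auto simp: sum_distrib_left algebra_simps sring_mult[OF Q that(1)])
 qed
 have low_0: "low d 0" for d unfolding low_def using sring_0[OF Q] by (intro exI) auto
 have low_t: "low (d + k) (t ^ k * w)" if "low d w" for d w k
 proof -
  obtain p where "\<forall>i. p i \<in> Q" "w = (\<Sum>i<d. p i * t ^ i)" using \<open>low d w\<close> by (auto simp: low_def)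
  thus ?thesis unfolding low_def
   by (intro exI[of _ "\<lambda>i. if i < k then 0 else p (i - k)"]) (auto simp: sum_shift_power sring_0[OF Q])
 qed
 have top: "qideal Q {y \<in> Q. \<exists>w\<in>Xs. low d (w - y * t ^ d)}" if Xs: "qideal Q Xs" for Xs d
 proof (rule qidealI)
  show "0 \<in> {y \<in> Q. \<exists>w\<in>Xs. low d (w - y * t ^ d)}"
   using sring_0[OF Q] qideal_0[OF Xs] low_0 by auto
  fix x y assume "x \<in> {y \<in> Q. \<exists>w\<in>Xs. low d (w - y * t ^ d)}" "y \<in> {y \<in> Q. \<exists>w\<in>Xs. low d (w - y * t ^ d)}"
  then obtain w w' where w: "x \<in> Q" "y \<in> Q" "w \<in> Xs" "w' \<in> Xs" "low d (w - x * t ^ d)" "low d (w' - y * t ^ d)" by blast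
  show "x + y \<in> {y \<in> Q. \<exists>w\<in>Xs. low d (w - y * t ^ d)}" using low_add[OF w(5,6)] sring_add[OF Q w(1,2)] qideal_add[OF Xs w(3,4)] by (auto simp: algebra_simps)
 next
  fix q x assume q: "q \<in> Q" and "x \<in> {y \<in> Q. \<exists>w\<in>Xs. low d (w - y * t ^ d)}"
  then obtain w where w: "x \<in> Q" "w \<in> Xs" "low d (w - x * t ^ d)" by blast
  show "q * x \<in> {y \<in> Q. \<exists>w\<in>Xs. low d (w - y * t ^ d)}" using low_mult[OF q w(3)] sring_mult[OF Q q w(1)] qideal_mult[OF Xs q w(2)] by (auto simp: algebra_simps)
 qed
 define lc where "lc d = {y \<in> Q. \<exists>w\<in>I. low d (w - y * t ^ d)}" for d
 define Ls where "Ls d = {q \<in> Q. \<exists>v\<in>S. v * q \<in> lc d}" for d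
 have lcI: "qideal Q (lc d)" for d unfolding lc_def by (rule top[OF IQ])
 have lcsh: "lc d \<subseteq> lc (d + k)" for d k
 proof
  fix y assume "y \<in> lc d"
  then obtain w where w: "y \<in> Q" "w \<in> I" "low d (w - y * t ^ d)" by (auto simp: lc_def)
  show "y \<in> lc (d + k)" using low_t[OF w(3), of k] w qideal_mult[OF I(1) sring_power[OF R tR] w(2)] by (auto simp: algebra_simps power_add lc_def)
 qed
 have lcmono: "lc d \<subseteq> lc e" if "d \<le> e" for d e using lcsh[of d "e - d"] that by simp
 have Lsmono: "Ls d \<subseteq> Ls e" if "d \<le> e" for d e using lcmono[OF that] by (auto simp: Ls_def)
 have lcLs: "lc d \<subseteq> Ls d" for d
 proof
  fix y assume y: "y \<in> lc d"
  hence "y \<in> Q" "1 * y \<in> lc d" by (auto simp: lc_def)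
  thus "y \<in> Ls d" using S1 unfolding Ls_def by blast
 qed
 have LsI: "qideal Q (Ls d)" for d
 proof (rule qidealI)
  show "0 \<in> Ls d" using lcLs qideal_0[OF lcI] by blast
  fix x y assume "x \<in> Ls d" "y \<in> Ls d"
  then obtain v w where vw: "x \<in> Q" "y \<in> Q" "v \<in> S" "w \<in> S" "v * x \<in> lc d" "w * y \<in> lc d" by (auto simp: Ls_def)
  have vwQ: "v \<in> Q" "w \<in> Q" using vw SQ by auto
  have "(v * w) * (x + y) = w * (v * x) + v * (w * y)" by (simp add: algebra_simps)
  also have "\<dots> \<in> lc d" by (rule qideal_add[OF lcI qideal_mult[OF lcI vwQ(2) vw(5)] qideal_mult[OF lcI vwQ(1) vw(6)]])
  finally show "x + y \<in> Ls d" unfolding Ls_def using vw Sm sring_add[OF Q] by blast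
 next
  fix q x assume q: "q \<in> Q" and "x \<in> Ls d"
  then obtain v where v: "x \<in> Q" "v \<in> S" "v * x \<in> lc d" by (auto simp: Ls_def)
  have "v * (q * x) \<in> lc d" using qideal_mult[OF lcI q v(3)] by (simp add: algebra_simps)
  thus "q * x \<in> Ls d" using v sring_mult[OF Q q v(1)] by (auto simp: Ls_def)
 qed
 have Lssat: "h \<in> Ls d" if "v \<in> S" "h \<in> Q" "v * h \<in> Ls d" for v h d
  using that Sm by (auto simp: Ls_def mult.assoc[symmetric])
 have Jlc: "J \<subseteq> lc d" for d
 proof
  fix j assume j: "j \<in> J"
  hence "t ^ d * j \<in> I" using I(3) qideal_mult[OF I(1) sring_power[OF R tR]] by blast
  thus "j \<in> lc d" using j JQ low_0 unfolding lc_def by (auto intro!: bexI)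
 qed
 have JLs: "J \<subseteq> Ls d" for d using Jlc lcLs by blast
 have LsQ: "Ls d \<subseteq> Q" for d by (auto simp: Ls_def)
 \<comment> \<open>Generators of \<open>L\<close> up to \<open>S\<close> lie in \<open>Ls d\<close>
   only. Multiplying each by its own \<open>v g\<close> moves it into \<open>lc d\<close>, and the
   product \<open>?V\<close> of all these multipliers absorbs the change.\<close>
 have gens: "\<exists>G. finite G \<and> G \<subseteq> lc d \<and> (\<forall>h\<in>L. \<exists>v\<in>S. v * h \<in> qspan Q (G \<union> J))"
  if L: "qideal Q L" "L \<subseteq> Q" "J \<subseteq> L" "\<And>v h. v \<in> S ==> h \<in> Q ==> v * h \<in> L ==> h \<in> L"
   and fin: "\<And>G. finite G ==> G \<subseteq> L ==> G \<subseteq> Ls d" for L d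
 proof -
  obtain G where G: "finite G" "G \<subseteq> L" "\<forall>h\<in>L. \<exists>v\<in>S. v * h \<in> qspan Q (G \<union> J)"
   by (rule noethE[OF noe L])
  have "\<forall>g\<in>G. \<exists>v\<in>S. v * g \<in> lc d" using fin[OF G(1,2)] by (auto simp: Ls_def)
  then obtain v where v: "\<And>g. g \<in> G ==> v g \<in> S" "\<And>g. g \<in> G ==> v g * g \<in> lc d" by metis
  let ?G = "(\<lambda>g. v g * g) ` G" and ?V = "prod v G"
  have VS: "prod v A \<in> S" if "A \<subseteq> G" for A
   using finite_subset[OF that G(1)] that by induction (auto simp: S1 Sm v)
  have Vspan: "?V * y \<in> qspan Q (?G \<union> J)" if y: "y \<in> qspan Q (G \<union> J)" for y
  proof -
   have id: "qideal Q {y. ?V * y \<in> qspan Q (?G \<union> J)}"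
    using qspan_qideal unfolding qideal_def by (auto simp: distrib_left mult.left_commute)
   have "G \<union> J \<subseteq> {y. ?V * y \<in> qspan Q (?G \<union> J)}"
   proof
    fix g assume "g \<in> G \<union> J"
    thus "g \<in> {y. ?V * y \<in> qspan Q (?G \<union> J)}"
    proof
     assume g: "g \<in> G"
     hence "?V * g = prod v (G - {g}) * (v g * g)" by (simp add: prod.remove[OF G(1) g])
     moreover have "prod v (G - {g}) \<in> Q" using VS[of "G - {g}"] SQ by blast
     ultimately show ?thesis using g qspan_basic[of "v g * g" "?G \<union> J" Q] qideal_mult[OF qspan_qideal] by auto
    next
     assume "g \<in> J" thus ?thesis
      using qideal_mult[OF qspan_qideal, of ?V Q g] qspan_basic[of g "?G \<union> J" Q] VS SQ by auto
    qed
   qed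
   thus ?thesis using qspan_least[OF id] y by blast
  qed
  have "\<forall>h\<in>L. \<exists>w\<in>S. w * h \<in> qspan Q (?G \<union> J)"
  proof (intro ballI)
   fix h assume "h \<in> L"
   then obtain w where w: "w \<in> S" "w * h \<in> qspan Q (G \<union> J)" using G(3) by blast
   have "?V * (w * h) \<in> qspan Q (?G \<union> J)" by (rule Vspan[OF w(2)])
   thus "\<exists>w\<in>S. w * h \<in> qspan Q (?G \<union> J)"
    by (intro bexI[of _ "?V * w"] Sm[OF VS w(1)]) (simp_all add: mult.assoc)
  qed
  thus ?thesis using G(1) v(2) by (intro exI[of _ ?G]) auto
 qed
 define Linf where "Linf = (\<Union>d. Ls d)"
 have finL: "\<exists>d. G \<subseteq> Ls d" if "finite G" "G \<subseteq> Linf" for G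
  using that
 proof (induction G rule: finite_induct)
  case (insert g G)
  then obtain d e where "G \<subseteq> Ls d" "g \<in> Ls e" by (auto simp: Linf_def)
  thus ?case using Lsmono[of d "max d e"] Lsmono[of e "max d e"] by auto
 qed simp
 have Linf: "qideal Q Linf" "Linf \<subseteq> Q" "J \<subseteq> Linf" "\<And>v h. v \<in> S ==> h \<in> Q ==> v * h \<in> Linf ==> h \<in> Linf"
 proof -
  show "qideal Q Linf"
 proof (rule qidealI)
   show "0 \<in> Linf" using qideal_0[OF LsI] by (auto simp: Linf_def)
   fix x y assume "x \<in> Linf" "y \<in> Linf"
   then obtain d where "{x, y} \<subseteq> Ls d" using finL[of "{x, y}"] by auto
   thus "x + y \<in> Linf" using qideal_add[OF LsI] by (auto simp: Linf_def)
  next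
   fix q x assume "q \<in> Q" "x \<in> Linf" thus "q * x \<in> Linf" using qideal_mult[OF LsI] by (auto simp: Linf_def)
  qed
  show "Linf \<subseteq> Q" by (auto simp: Linf_def Ls_def)
  show "J \<subseteq> Linf" unfolding Linf_def using Jlc lcLs by blast
  show "h \<in> Linf" if "v \<in> S" "h \<in> Q" "v * h \<in> Linf" for v h using Lssat that by (auto simp: Linf_def)
 qed
 \<comment> \<open>Stabilization of the ascending chain \<open>Ls\<close>: finitely many generators
   of the union lie in one \<open>Ls d0\<close>, and saturation of \<open>Ls d0\<close> gives
   \<open>Linf \<subseteq> Ls d0\<close>. The generators are then replaced by ones in
   \<open>lc d0\<close>.\<close>
 have "\<exists>d0. \<exists>G. finite G \<and> G \<subseteq> lc d0 \<and> (\<forall>h\<in>Linf. \<exists>v\<in>S. v * h \<in> qspan Q (G \<union> J))"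
 proof -
  obtain G where G: "finite G" "G \<subseteq> Linf" "\<forall>h\<in>Linf. \<exists>v\<in>S. v * h \<in> qspan Q (G \<union> J)"
   by (rule noethE[OF noe Linf])
  obtain d0 where "G \<subseteq> Ls d0" using finL[OF G(1,2)] by blast
  have "\<exists>G'. finite G' \<and> G' \<subseteq> lc d0 \<and> (\<forall>h\<in>Ls d0. \<exists>v\<in>S. v * h \<in> qspan Q (G' \<union> J))"
   by (rule gens[OF LsI LsQ JLs Lssat])
  then obtain G' where G': "finite G'" "G' \<subseteq> lc d0" "\<forall>h\<in>Ls d0. \<exists>v\<in>S. v * h \<in> qspan Q (G' \<union> J)" by blast
  have "Linf \<subseteq> Ls d0"
  proof
   fix h assume h: "h \<in> Linf"
   then obtain v where v: "v \<in> S" "v * h \<in> qspan Q (G \<union> J)" using G(3) by blast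
   have "qspan Q (G \<union> J) \<subseteq> Ls d0" using \<open>G \<subseteq> Ls d0\<close> Jlc lcLs by (intro qspan_least[OF LsI]) blast
   thus "h \<in> Ls d0" using Lssat[OF v(1)] v(2) h Linf(2) by blast
  qed
  thus ?thesis using G' by blast
 qed
 then obtain d0 G0 where G0: "finite G0" "G0 \<subseteq> lc d0" "\<forall>h\<in>Linf. \<exists>v\<in>S. v * h \<in> qspan Q (G0 \<union> J)" by blast
 have "\<exists>G. finite G \<and> G \<subseteq> lc d \<and> (\<forall>h\<in>Ls d. \<exists>v\<in>S. v * h \<in> qspan Q (G \<union> J))" for d
  by (rule gens[OF LsI LsQ JLs Lssat])
 hence "\<exists>Gd. \<forall>d. finite (Gd d) \<and> Gd d \<subseteq> lc d \<and> (\<forall>h\<in>Ls d. \<exists>v\<in>S. v * h \<in> qspan Q (Gd d \<union> J))"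
  by (intro choice allI)
 then obtain Gd where "\<forall>d. finite (Gd d) \<and> Gd d \<subseteq> lc d \<and> (\<forall>h\<in>Ls d. \<exists>v\<in>S. v * h \<in> qspan Q (Gd d \<union> J))" ..
 hence Gd: "\<And>d. finite (Gd d)" "\<And>d. Gd d \<subseteq> lc d"
  "\<And>d h. h \<in> Ls d ==> \<exists>v\<in>S. v * h \<in> qspan Q (Gd d \<union> J)" by blast+
 define G' where "G' d = (if d < d0 then Gd d else G0)" for d
 have G'lc: "G' d \<subseteq> lc (min d d0)" for d using Gd(2) G0(2) by (auto simp: G'_def)
 have G'fin: "finite (G' d)" for d using Gd(1) G0(1) by (auto simp: G'_def)
 have G'gen: "\<exists>v\<in>S. v * h \<in> qspan Q (G' d \<union> J)" if "h \<in> Ls d" for d h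
  using that Gd(3) G0(3) by (auto simp: G'_def Linf_def)
 define f where "f d g = (SOME w. w \<in> I \<and> low d (w - g * t ^ d))" for d g
 have f: "f d g \<in> I \<and> low d (f d g - g * t ^ d)" if "g \<in> lc d" for d g
  unfolding f_def by (rule someI_ex) (use that in \<open>auto simp: lc_def\<close>)
 define Gt where "Gt = (\<Union>d\<le>d0. f d ` G' d)"
 have Gtfin: "finite Gt" unfolding Gt_def using G'fin by blast
 have GtI: "Gt \<subseteq> I" unfolding Gt_def using f G'lc by fastforce
 let ?Xs = "qspan ?R (Gt \<union> J)"
 have XI: "?Xs \<subseteq> I" using GtI I(3) by (intro qspan_least[OF I(1)]) blast
 have XQ: "qideal Q ?Xs" by (rule qideal_mono[OF qspan_qideal QR])
 have key: "\<exists>w\<in>?Xs. low d (w - y * t ^ d)" if y: "y \<in> qspan Q (G' d \<union> J)" for d y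
 proof -
  let ?Y = "{y \<in> Q. \<exists>w\<in>?Xs. low d (w - y * t ^ d)}"
  have "G' d \<union> J \<subseteq> ?Y"
  proof
   fix g assume "g \<in> G' d \<union> J"
   thus "g \<in> ?Y"
   proof
    assume g: "g \<in> G' d"
    \<comment> \<open>Beyond degree \<open>d0\<close> no new generators are chosen; those of degree
      \<open>d0\<close> are shifted by a power of \<open>t\<close>.\<close>
    let ?m = "min d d0"
    have gl: "g \<in> lc ?m" using G'lc g by blast
    have "G' ?m = G' d" by (auto simp: G'_def)
    hence fG: "f ?m g \<in> Gt" unfolding Gt_def using g by (intro UN_I[of ?m]) auto
    have "t ^ (d - ?m) * f ?m g \<in> ?Xs"
     using qideal_mult[OF qspan_qideal sring_power[OF R tR]] qspan_basic fG by blast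
    moreover have "low d (t ^ (d - ?m) * f ?m g - g * t ^ d)"
    proof -
     have e: "?m + (d - ?m) = d" by simp
     have "t ^ d = t ^ (d - ?m) * t ^ ?m" by (simp flip: power_add)
     thus ?thesis using low_t[of ?m "f ?m g - g * t ^ ?m" "d - ?m"] f[OF gl]
      by (simp add: algebra_simps)
    qed
    moreover have "g \<in> Q" using gl by (auto simp: lc_def)
    ultimately show ?thesis by blast
   next
    assume j: "g \<in> J"
    hence "t ^ d * g \<in> ?Xs" using qideal_mult[OF qspan_qideal sring_power[OF R tR]] qspan_basic by blast
    thus ?thesis using j JQ low_0 by (auto intro!: bexI)
   qed
  qed
  thus ?thesis using qspan_least[OF top[OF XQ]] y by blast
 qed
 \<comment> \<open>Division by leading coefficients: after multiplication by \<open>v\<close>, the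
   leading coefficient is matched by some \<open>w\<close> in the span, and the difference drops in
   degree. The multipliers from \<open>S\<close> accumulate to a product.\<close>
 have main: "\<exists>v\<in>S. v * h \<in> ?Xs" if "h \<in> I" "low d h" for h d
  using that
 proof (induction d arbitrary: h)
  case 0
  thus ?case using S1 qideal_0[OF qspan_qideal] by (auto simp: low_def)
 next
  case (Suc d)
  then obtain p where p: "\<forall>i. p i \<in> Q" "h = (\<Sum>i<Suc d. p i * t ^ i)" by (auto simp: low_def)
  hence hl: "low d (h - p d * t ^ d)" by (auto simp: low_def)
  hence "p d \<in> lc d" using Suc.prems(1) p(1) by (auto simp: lc_def)
  then obtain v where v: "v \<in> S" "v * p d \<in> qspan Q (G' d \<union> J)" using G'gen lcLs by blast
  obtain w where w: "w \<in> ?Xs" "low d (w - (v * p d) * t ^ d)" using key[OF v(2)] by blast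
  have vQ: "v \<in> Q" using v SQ by blast
  have "low d (v * h - w)"
  proof -
   have "v * h - w = v * (h - p d * t ^ d) + (-1) * (w - (v * p d) * t ^ d)" by (simp add: algebra_simps)
   moreover have "low d (v * (h - p d * t ^ d) + (-1) * (w - (v * p d) * t ^ d))"
    by (rule low_add[OF low_mult[OF vQ hl] low_mult[OF sring_minus[OF Q sring_1[OF Q]] w(2)]])
   ultimately show ?thesis by metis
  qed
  moreover have "v * h - w \<in> I" using XI w(1) Suc.prems(1) qideal_mult[OF IQ vQ] qideal_diff[OF IQ Q] by blast
  ultimately obtain v' where v': "v' \<in> S" "v' * (v * h - w) \<in> ?Xs" using Suc.IH by blast
  have "(v' * v) * h = v' * (v * h - w) + v' * w" by (simp add: algebra_simps)
  also have "\<dots> \<in> ?Xs" by (rule qideal_add[OF XQ v'(2) qideal_mult[OF XQ subsetD[OF SQ v'(1)] w(1)]])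
  finally show ?case using Sm[OF v'(1) v(1)] by blast
 qed
 have "\<exists>v\<in>S. v * h \<in> ?Xs" if "h \<in> I" for h
 proof -
  have "h \<in> ?R" using that I(2) by blast
  then obtain d where "low d h" unfolding adjoin_def low_def by blast
  thus ?thesis using main that by blast
 qed
 thus "\<exists>G. finite G \<and> G \<subseteq> I \<and> (\<forall>h\<in>I. \<exists>v\<in>S. v * h \<in> qspan ?R (G \<union> J))"
  using Gtfin GtI by blast
qed

section \<open>Rings generated by finitely many elements\<close>

fun adjoins :: "'r::comm_ring_1 set => 'r list => 'r set" where
 "adjoins Q [] = Q"
| "adjoins Q (t # ts) = adjoins (adjoin Q t) ts"

lemma sring_adjoins: "sring Q ==> sring (adjoins Q ts)"
 by (induction ts arbitrary: Q) (auto simp: sring_adjoin)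

lemma adjoins_base: "sring Q ==> Q \<subseteq> adjoins Q ts"
proof (induction ts arbitrary: Q)
 case (Cons t ts)
 show ?case using adjoin_base[OF Cons.prems, of t] Cons.IH[OF sring_adjoin[OF Cons.prems, of t]] by auto
qed simp

lemma adjoins_gen: "sring Q ==> t \<in> set ts ==> t \<in> adjoins Q ts"
proof (induction ts arbitrary: Q)
 case (Cons u ts)
 have Q: "sring (adjoin Q u)" by (rule sring_adjoin[OF Cons.prems(1)])
 show ?case using Cons.IH[OF Q] Cons.prems adjoins_base[OF Q, of ts] adjoin_gen by auto
qed simp

lemma noeth_adjoins:
 assumes "sring Q" "J \<subseteq> Q" "S \<subseteq> Q" "1 \<in> S" "\<And>a b. a \<in> S ==> b \<in> S ==> a * b \<in> S" "noeth Q J S"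
 shows "noeth (adjoins Q ts) J S"
 using assms
proof (induction ts arbitrary: Q)
 case (Cons t ts)
 show ?case unfolding adjoins.simps
  by (rule Cons.IH) (use Cons.prems adjoin_base[OF Cons.prems(1), of t] in \<open>auto intro!: sring_adjoin noeth_adjoin\<close>)
qed simp

lemma sring_ints: "sring (range (of_int :: int => 'r::comm_ring_1))"
 unfolding sring_def
proof (intro conjI ballI)
 show "1 \<in> range (of_int :: int => 'r)" by (rule range_eqI[of _ _ 1]) simp
 fix x y :: 'r assume "x \<in> range of_int" "y \<in> range of_int"
 then obtain i j where "x = of_int i" "y = of_int j" by auto
 thus "x - y \<in> range of_int" "x * y \<in> range of_int" by (metis of_int_diff rangeI, metis of_int_mult rangeI)
qed

text \<open>Euclidean division by the least positive integer whose image lies in \<open>I\<close>.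
  Minimizing over integers and not over elements includes positive characteristic, where that image
  may be zero.\<close>

lemma noeth_ints: "noeth (range (of_int :: int => 'r::comm_ring_1)) {} {1}"
 unfolding noeth_def
proof (intro allI impI, elim conjE)
 let ?Z = "range (of_int :: int => 'r)"
 fix I :: "'r set" assume I: "qideal ?Z I" "I \<subseteq> ?Z"
 show "\<exists>G. finite G \<and> G \<subseteq> I \<and> (\<forall>h\<in>I. \<exists>v\<in>{1}. v * h \<in> qspan ?Z (G \<union> {}))"
 proof (cases "\<exists>k::int. k > 0 \<and> of_int k \<in> I")
  case True
  hence ex: "\<exists>k::nat. k > 0 \<and> of_int (int k) \<in> I" by (metis zero_less_imp_eq_int)
  define k where "k = (LEAST k::nat. k > 0 \<and> of_int (int k) \<in> I)"
  have k: "k > 0" "of_int (int k) \<in> I" using LeastI_ex[OF ex] unfolding k_def by auto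
  have kmin: "k \<le> j" if "j > 0" "of_int (int j) \<in> I" for j using that unfolding k_def by (intro Least_le) auto
  have "h \<in> qspan ?Z {of_int (int k)}" if h: "h \<in> I" for h
  proof -
   obtain m where m: "h = of_int m" using h I(2) by auto
   have "of_int (m mod int k) = h - of_int (m div int k) * (of_int (int k) :: 'r)"
    unfolding m by (metis minus_mult_div_eq_mod mult.commute of_int_diff of_int_mult)
   also have "\<dots> \<in> I" using h k(2) by (intro qideal_diff[OF I(1) sring_ints] qideal_mult[OF I(1)]) auto
   finally have "of_int (int (nat (m mod int k))) \<in> I" using k(1) by simp
   hence "m mod int k = 0" using kmin[of "nat (m mod int k)"] k(1)
    using pos_mod_bound[of "int k" m] pos_mod_sign[of "int k" m] by linarith
   hence "h = of_int (m div int k) * of_int (int k)" unfolding m by auto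
   thus ?thesis using qideal_mult[OF qspan_qideal] qspan_basic by (metis insertI1 rangeI)
  qed
  thus ?thesis using k(2) by (intro exI[of _ "{of_int (int k)}"]) auto
 next
  case False
  have "I \<subseteq> {0}"
  proof
   fix h assume h: "h \<in> I"
   then obtain m where m: "h = of_int m" using I(2) by auto
   have "of_int (- m) \<in> I" using qideal_minus[OF I(1) sring_ints h] m by simp
   hence "\<not> 0 < m" "\<not> 0 < - m" using False h m by blast+
   thus "h \<in> {0}" by (simp add: m)
  qed
  thus ?thesis by (intro exI[of _ "{}"]) auto
 qed
qed

lemma noeth_finite_generation:
 "noeth (adjoins (range of_int) ts) {} {1 :: 'r::comm_ring_1}"
proof (rule noeth_adjoins[OF sring_ints])
 show "{1} \<subseteq> range (of_int :: int => 'r)" using sring_1[OF sring_ints] by simp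
qed (auto intro: noeth_ints)

lemma noeth_fg:
 assumes "noeth Q {} {1}" "qideal Q I" "I \<subseteq> Q"
 obtains G where "finite G" "G \<subseteq> I" "I = qspan Q G"
proof -
 obtain G where G: "finite G" "G \<subseteq> I" "\<forall>h\<in>I. \<exists>v\<in>{1}. v * h \<in> qspan Q (G \<union> {})"
  by (rule noethE[OF assms]) auto
 thus thesis using that[OF G(1,2)] qspan_least[OF assms(2) G(2)] by auto
qed

subsection \<open>Krull's intersection theorem\<close>

definition mon :: "('i => 'r::comm_ring_1) => 'i multiset => 'r" where
 "mon f \<nu> = prod_mset (image_mset f \<nu>)"

lemma mon_empty [simp]: "mon f {#} = 1" and mon_single [simp]: "mon f {#i#} = f i"
 and mon_add: "mon f (\<mu> + \<nu>) = mon f \<mu> * mon f \<nu>" and mon_add_mset: "mon f (add_mset i \<nu>) = f i * mon f \<nu>"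
 by (simp_all add: mon_def)

lemma mon_in_sring: "sring Q ==> (\<And>i. i \<in># \<nu> ==> f i \<in> Q) ==> mon f \<nu> \<in> Q"
 unfolding mon_def by (rule sring_prod_mset)

definition ipow :: "'r::comm_ring_1 set => nat => (nat => 'r) => nat => 'r set" where
 "ipow Q c f N = qspan Q {mon f \<nu> | \<nu>. set_mset \<nu> \<subseteq> {..<c} \<and> size \<nu> = N}"

text \<open>Pigeonhole principle on the \<open>c\<close> exponents. The summand \<open>1\<close>
  rules out \<open>c = 0\<close>, where there is no index to choose.\<close>

lemma mon_high_power:
 assumes "set_mset \<nu> \<subseteq> {..<c}" "size \<nu> \<ge> c * k + 1"
 shows "\<exists>j<c. \<exists>\<mu>. set_mset \<mu> \<subseteq> {..<c} \<and> \<nu> = replicate_mset k j + \<mu>"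
proof -
 have "\<exists>j<c. count \<nu> j \<ge> k"
 proof (rule ccontr)
  assume no: "\<not> ?thesis"
  have "size \<nu> = (\<Sum>j\<in>set_mset \<nu>. count \<nu> j)" by (simp add: size_multiset_overloaded_eq)
  also have "\<dots> \<le> (\<Sum>j<c. count \<nu> j)" by (rule sum_mono2) (use assms(1) in auto)
  also have "\<dots> \<le> (\<Sum>j<c. k)" by (rule sum_mono) (use no in \<open>auto simp: not_le less_imp_le\<close>)
  finally show False using assms(2) by simp
 qed
 then obtain j where j: "j < c" "k \<le> count \<nu> j" by blast
 hence "replicate_mset k j \<subseteq># \<nu>" by (simp add: count_le_replicate_mset_subset_eq)
 then obtain \<mu> where "\<nu> = replicate_mset k j + \<mu>" by (metis subset_mset.add_diff_inverse)
 thus ?thesis using j(1) assms(1) by auto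
qed

text \<open>The argument avoids the Artin--Rees lemma: among the ideals \<open>B\<close> with \<open>B \<inter> (z) = z n\<close> (modulo \<open>F\<close>) a
 maximal one contains a power of \<open>n\<close>, hence \<open>z\<close>.\<close>

theorem krull_intersection:
 fixes Q :: "'r::comm_ring_1 set" and f :: "nat => 'r"
 assumes Q: "sring Q" and noe: "noeth Q {} {1}" and F: "qideal Q F" "F \<subseteq> Q"
  and f: "\<And>j. j < c ==> f j \<in> Q" and z: "z \<in> Q"
  and app: "\<And>N. \<exists>y\<in>ipow Q c f N. z - y \<in> F"
 obtains e where "e \<in> Q" "e \<in> qspan Q (f ` {..<c})" "(1 - e) * z \<in> F"
proof -
 let ?n = "qspan Q (f ` {..<c})"
 have nQ: "?n \<subseteq> Q" using f by (intro qspan_least[OF qideal_sring[OF Q]]) auto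
 \<comment> \<open>Modulo \<open>F\<close>, a multiple of \<open>z\<close> that lies in
   \<open>B\<close> is already an \<open>?n\<close>-multiple of \<open>z\<close>. The condition
   concerns single elements, so it survives unions of chains; \<open>B0\<close> is \<open>?n\<close>
   z + F.\<close>
 define ok where "ok B \<longleftrightarrow> (\<forall>b\<in>B. \<forall>q\<in>Q. b - q * z \<in> F \<longrightarrow> (\<exists>e\<in>?n. b - e * z \<in> F))" for B
 define \<A> where "\<A> = {B. qideal Q B \<and> B \<subseteq> Q \<and> F \<subseteq> B \<and> (\<forall>e\<in>?n. e * z \<in> B) \<and> ok B}"
 define B0 where "B0 = {b\<in>Q. \<exists>e\<in>?n. b - e * z \<in> F}"
 have "qideal Q B0"
 proof (rule qidealI)
  show "0 \<in> B0" using sring_0[OF Q] qideal_0[OF F(1)] qideal_0[OF qspan_qideal]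
   by (auto simp: B0_def intro!: bexI)
  fix x y assume "x \<in> B0" "y \<in> B0"
  then obtain d e where de: "x \<in> Q" "y \<in> Q" "d \<in> ?n" "e \<in> ?n" "x - d * z \<in> F" "y - e * z \<in> F" by (auto simp: B0_def)
  have "x + y - (d + e) * z \<in> F" using qideal_add[OF F(1) de(5,6)] by (simp add: algebra_simps)
  thus "x + y \<in> B0" using sring_add[OF Q de(1,2)] qideal_add[OF qspan_qideal de(3,4)] by (auto simp: B0_def)
 next
  fix q x assume q: "q \<in> Q" and "x \<in> B0"
  then obtain d where d: "x \<in> Q" "d \<in> ?n" "x - d * z \<in> F" by (auto simp: B0_def)
  have "q * x - (q * d) * z \<in> F" using qideal_mult[OF F(1) q d(3)] by (simp add: algebra_simps)
  thus "q * x \<in> B0" using sring_mult[OF Q q d(1)] qideal_mult[OF qspan_qideal q d(2)] by (auto simp: B0_def)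
 qed
 moreover have "F \<subseteq> B0" using F(2) qideal_0[OF qspan_qideal] by (auto simp: B0_def intro!: bexI)
 moreover have "\<forall>e\<in>?n. e * z \<in> B0"
 proof
  fix e assume e: "e \<in> ?n"
  thus "e * z \<in> B0" using nQ sring_mult[OF Q _ z] qideal_0[OF F(1)] by (auto simp: B0_def bexI[of _ e])
 qed
 ultimately have B0: "B0 \<in> \<A>" by (auto simp: \<A>_def ok_def B0_def)
 have "\<exists>M\<in>\<A>. \<forall>N\<in>\<A>. M \<subseteq> N \<longrightarrow> N = M"
 proof (rule subset_Zorn_nonempty)
  show "\<A> \<noteq> {}" using B0 by blast
  fix C assume C: "C \<noteq> {}" "subset.chain \<A> C"
  have CA: "C \<subseteq> \<A>" and ch: "\<And>M N. M \<in> C ==> N \<in> C ==> M \<subseteq> N \<or> N \<subseteq> M"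
   using C(2) by (simp_all add: subset_chain_def)
  have "qideal Q (\<Union>C)" by (rule qideal_chain_Union[OF C(1) _ ch]) (use CA in \<open>auto simp: \<A>_def\<close>)
  moreover from C(1) obtain D where "D \<in> C" by blast
  hence "F \<subseteq> \<Union>C" "\<forall>e\<in>?n. e * z \<in> \<Union>C" using CA unfolding \<A>_def by blast+
  moreover have "\<Union>C \<subseteq> Q" using CA by (auto simp: \<A>_def)
  moreover have "ok (\<Union>C)" unfolding ok_def
  proof (intro ballI impI)
   fix b q assume b: "b \<in> \<Union>C" "q \<in> Q" "b - q * z \<in> F"
   then obtain B where "B \<in> C" "b \<in> B" by blast
   hence "ok B" using CA by (auto simp: \<A>_def)
   thus "\<exists>e\<in>?n. b - e * z \<in> F" using b \<open>b \<in> B\<close> by (auto simp: ok_def)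
  qed
  ultimately show "\<Union>C \<in> \<A>" by (simp add: \<A>_def)
 qed
 then obtain B where BA: "B \<in> \<A>" and max: "\<And>N. N \<in> \<A> ==> B \<subseteq> N ==> N = B" by blast
 have B: "qideal Q B" "B \<subseteq> Q" "F \<subseteq> B" "\<And>e. e \<in> ?n ==> e * z \<in> B" "ok B" using BA by (auto simp: \<A>_def)
 have pow: "\<exists>k. f j ^ k \<in> B" if j: "j < c" for j
 proof -
  let ?a = "f j"
  have a: "?a \<in> Q" "?a \<in> ?n" using f j qspan_basic[of ?a "f ` {..<c}" Q] by auto
  have ak: "?a ^ k \<in> Q" for k by (rule sring_power[OF Q a(1)])
  define col where "col k = {h\<in>Q. ?a ^ k * h \<in> B}" for k
  have colI: "qideal Q (col k)" for k
 proof (rule qidealI)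
   show "0 \<in> col k" using sring_0[OF Q] qideal_0[OF B(1)] by (auto simp: col_def)
   show "x + y \<in> col k" if "x \<in> col k" "y \<in> col k" for x y
    using that sring_add[OF Q] qideal_add[OF B(1)] by (auto simp: col_def distrib_left)
   show "q * x \<in> col k" if "q \<in> Q" "x \<in> col k" for q x
    using that sring_mult[OF Q] qideal_mult[OF B(1)] by (auto simp: col_def mult.left_commute)
  qed
  have colm: "col k \<subseteq> col l" if "k \<le> l" for k l
  proof -
   have "?a ^ l * h = ?a ^ (l - k) * (?a ^ k * h)" for h using that by (simp add: mult.assoc[symmetric] flip: power_add)
   thus ?thesis using qideal_mult[OF B(1) ak] by (auto simp: col_def)
  qed
  let ?U = "\<Union>(range col)"
  have "qideal Q ?U"
  proof (rule qideal_chain_Union)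
   fix I J assume "I \<in> range col" "J \<in> range col"
   then obtain k l where "I = col k" "J = col l" by auto
   thus "I \<subseteq> J \<or> J \<subseteq> I" using colm nat_le_linear by blast
  qed (use colI in auto)
  moreover have "?U \<subseteq> Q" by (auto simp: col_def)
  ultimately obtain G where G: "finite G" "G \<subseteq> ?U" "?U = qspan Q G" by (rule noeth_fg[OF noe])
  from G(1,2) have "\<exists>k. G \<subseteq> col k"
  proof (induction G rule: finite_induct)
   case (insert g G)
   then obtain k l where "G \<subseteq> col k" "g \<in> col l" by auto
   thus ?case using colm[of k "max k l"] colm[of l "max k l"] by auto
  qed simp
  then obtain k where k: "G \<subseteq> col k" by blast
  have Uk: "?U \<subseteq> col k" unfolding G(3) by (rule qspan_least[OF colI k])
  \<comment> \<open>\<open>N\<close> is \<open>B\<close> enlarged by the multiples of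
    \<open>?a ^ k\<close>, with \<open>k\<close> chosen so that the colon ideals \<open>col\<close>
    are constant from \<open>k\<close> on. If \<open>N\<close> still satisfies \<open>ok\<close>,
    maximality of \<open>B\<close> puts \<open>?a ^ k\<close> into \<open>B\<close>.\<close>
  define N where "N = {x\<in>Q. \<exists>t\<in>Q. x - ?a ^ k * t \<in> B}"
  have NI: "qideal Q N"
 proof (rule qidealI)
   show "0 \<in> N" using sring_0[OF Q] qideal_0[OF B(1)] by (auto simp: N_def bexI[of _ 0])
   fix x y assume "x \<in> N" "y \<in> N"
   then obtain s t where st: "x \<in> Q" "y \<in> Q" "s \<in> Q" "t \<in> Q" "x - ?a ^ k * s \<in> B" "y - ?a ^ k * t \<in> B" by (auto simp: N_def)
   have "x + y - ?a ^ k * (s + t) \<in> B" using qideal_add[OF B(1) st(5,6)] by (simp add: algebra_simps)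
   thus "x + y \<in> N" using sring_add[OF Q st(1,2)] sring_add[OF Q st(3,4)] by (auto simp: N_def)
  next
   fix q x assume q: "q \<in> Q" and "x \<in> N"
   then obtain t where t: "x \<in> Q" "t \<in> Q" "x - ?a ^ k * t \<in> B" by (auto simp: N_def)
   have "q * x - ?a ^ k * (q * t) \<in> B" using qideal_mult[OF B(1) q t(3)] by (simp add: algebra_simps)
   thus "q * x \<in> N" using sring_mult[OF Q q t(1)] sring_mult[OF Q q t(2)] by (auto simp: N_def)
  qed
  have BN: "B \<subseteq> N" using B(2) sring_0[OF Q] by (auto simp: N_def bexI[of _ 0])
  \<comment> \<open>Multiplying \<open>w\<close> = b + \<open>?a ^ k * t\<close> by
    \<open>?a\<close> lands in \<open>B\<close>, since \<open>?a * w\<close> is modulo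
    \<open>F\<close> an \<open>?n\<close>-multiple of \<open>z\<close>. Hence \<open>t\<close> lies
    in \<open>col (Suc k)\<close>, thus in \<open>col k\<close>, and \<open>w\<close> was in
    \<open>B\<close> from the start.\<close>
  have "ok N" unfolding ok_def
  proof (intro ballI impI)
   fix w q assume w: "w \<in> N" "q \<in> Q" "w - q * z \<in> F"
   then obtain t where t: "w \<in> Q" "t \<in> Q" "w - ?a ^ k * t \<in> B" by (auto simp: N_def)
   have "?a * (w - q * z) \<in> B" using qideal_mult[OF F(1) a(1) w(3)] B(3) by blast
   moreover have "q * ?a * z \<in> B" by (rule B(4)[OF qideal_mult[OF qspan_qideal w(2) a(2)]])
   ultimately have "?a * (w - q * z) + q * ?a * z \<in> B" by (rule qideal_add[OF B(1)])
   hence aw: "?a * w \<in> B" by (simp add: algebra_simps)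
   have "?a ^ Suc k * t = ?a * w - ?a * (w - ?a ^ k * t)" by (simp add: algebra_simps)
   also have "\<dots> \<in> B" by (rule qideal_diff[OF B(1) Q aw qideal_mult[OF B(1) a(1) t(3)]])
   finally have "t \<in> col (Suc k)" using t(2) by (simp add: col_def)
   hence "t \<in> col k" using Uk by blast
   thus "\<exists>e\<in>?n. w - e * z \<in> F" using qideal_cong[OF B(1) t(3)] B(5) w by (auto simp: col_def ok_def)
  qed
  moreover have "N \<subseteq> Q" by (auto simp: N_def)
  moreover have "\<forall>e\<in>?n. e * z \<in> N" using BN B(4) by blast
  ultimately have "N \<in> \<A>" using NI BN B(3) unfolding \<A>_def by blast
  hence "N = B" using max BN by blast
  moreover have "?a ^ k \<in> N" using ak sring_1[OF Q] qideal_0[OF B(1)] by (auto simp: N_def bexI[of _ 1])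
  ultimately show ?thesis by blast
 qed
 hence "\<exists>k0. \<forall>j<c. f j ^ k0 j \<in> B" by (intro choice) blast
 then obtain k0 where k0: "\<And>j. j < c ==> f j ^ k0 j \<in> B" by blast
 define k where "k = (\<Sum>j<c. k0 j)"
 have kB: "f j ^ k \<in> B" if j: "j < c" for j
 proof -
  have "k0 j \<le> k" unfolding k_def using j by (intro member_le_sum) auto
  hence "f j ^ k = f j ^ (k - k0 j) * f j ^ k0 j" by (simp flip: power_add)
  thus ?thesis using qideal_mult[OF B(1) sring_power[OF Q f[OF j]] k0[OF j]] by simp
 qed
 \<comment> \<open>A monomial of degree \<open>c * k + 1\<close> contains some
   \<open>f j ^ k\<close>, which lies in \<open>B\<close>; the approximation hypothesis then puts
   \<open>z\<close> itself into \<open>B\<close>.\<close>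
 have ipB: "ipow Q c f (c * k + 1) \<subseteq> B" unfolding ipow_def
 proof (rule qspan_least[OF B(1)], clarify)
  fix \<nu> assume \<nu>: "set_mset \<nu> \<subseteq> {..<c}" "size \<nu> = c * k + 1"
  then obtain j \<mu> where j: "j < c" "set_mset \<mu> \<subseteq> {..<c}" "\<nu> = replicate_mset k j + \<mu>"
   using mon_high_power[of \<nu> c k] by auto
  have "mon f \<nu> = mon f \<mu> * f j ^ k" by (simp add: j(3)) (simp add: mon_def)
  moreover have "mon f \<mu> \<in> Q" using j(2) f by (intro mon_in_sring[OF Q]) auto
  ultimately show "mon f \<nu> \<in> B" using qideal_mult[OF B(1) _ kB[OF j(1)]] by simp
 qed
 obtain y where y: "y \<in> ipow Q c f (c * k + 1)" "z - y \<in> F" using app by blast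
 hence zB: "z \<in> B" using ipB B(3) qideal_cong[OF B(1), of z y] by blast
 obtain e where e: "e \<in> ?n" "z - e * z \<in> F" using B(5)[unfolded ok_def, rule_format, OF zB sring_1[OF Q]] qideal_0[OF F(1)] by auto
 thus thesis using that nQ by (auto simp: algebra_simps)
qed

section \<open>Polynomials with multisets as monomials\<close>

type_synonym ('i, 'r) mp = "'i multiset \<Rightarrow>\<^sub>0 'r"

abbreviation "coef \<equiv> Poly_Mapping.lookup"
abbreviation "mons \<equiv> Poly_Mapping.keys"
abbreviation "term1 \<equiv> Poly_Mapping.single"

definition Cn :: "'r => ('i, 'r::comm_ring_1) mp" where "Cn c = term1 {#} c"
definition Vr :: "'i => ('i, 'r::comm_ring_1) mp" where "Vr i = term1 {#i#} 1"

definition rhm :: "('r::comm_ring_1 => 's::comm_ring_1) => bool" where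
 "rhm f \<longleftrightarrow> f 1 = 1 \<and> (\<forall>x y. f (x + y) = f x + f y) \<and> (\<forall>x y. f (x * y) = f x * f y)"

lemma rhmD:
 assumes "rhm f"
 shows rhm_1: "f 1 = 1" and rhm_add: "f (x + y) = f x + f y" and rhm_mult: "f (x * y) = f x * f y"
  and rhm_0: "f 0 = 0" and rhm_minus: "f (- x) = - f x" and rhm_diff: "f (x - y) = f x - f y"
proof -
 show "f 1 = 1" and a: "f (x + y) = f x + f y" and "f (x * y) = f x * f y" for x y
  using assms by (auto simp: rhm_def)
 show z: "f 0 = 0" using a[of 0 0] by simp
 show m: "f (- x) = - f x" for x using a[of x "- x"] z by (simp add: eq_neg_iff_add_eq_0 add.commute)
 show "f (x - y) = f x - f y" using a[of x "- y"] m by simp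
qed

lemma rhm_sum: "rhm f ==> f (sum g A) = (\<Sum>i\<in>A. f (g i))"
 by (induction rule: infinite_finite_induct) (auto simp: rhm_0 rhm_add)

lemma rhm_mon: "rhm f ==> f (mon x m) = mon (\<lambda>i. f (x i)) m"
 by (induction m) (auto simp: mon_add_mset rhm_1 rhm_mult)

lemma rhm_comp: "rhm f ==> rhm g ==> rhm (\<lambda>x. f (g x))"
 by (auto simp: rhm_def)

lemma rhm_id: "rhm (\<lambda>x. x)" by (simp add: rhm_def)

lemma rhm_of_int: "rhm f ==> f (of_int k) = of_int k"
proof -
 assume f: "rhm f"
 have n: "f (of_nat m) = of_nat m" for m by (induction m) (auto simp: rhm_0[OF f] rhm_1[OF f] rhm_add[OF f])
 show ?thesis by (cases k rule: int_cases2) (auto simp: n rhm_minus[OF f])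
qed

lemma rhm_Cn: "rhm (Cn :: 'r::comm_ring_1 => ('i, 'r) mp)"
 by (simp add: rhm_def Cn_def single_add mult_single)

lemmas Cn_simps = rhm_1[OF rhm_Cn] rhm_0[OF rhm_Cn] rhm_add[OF rhm_Cn] rhm_mult[OF rhm_Cn] rhm_minus[OF rhm_Cn] rhm_diff[OF rhm_Cn]

lemma coef_Cn: "coef (Cn c) m = (if m = {#} then c else 0)"
 by (simp add: Cn_def lookup_single)

lemma mon_Vr: "mon Vr m = term1 m 1"
 by (induction m) (auto simp: mon_add_mset Vr_def mult_single)

lemma term1_eq: "term1 m c = Cn c * mon Vr m"
 by (simp add: mon_Vr Cn_def mult_single)

lemma mp_expand: "(p :: ('i, 'r::comm_ring_1) mp) = (\<Sum>m\<in>mons p. term1 m (coef p m))"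
proof (rule poly_mapping_eqI)
 fix k
 have "coef (\<Sum>m\<in>mons p. term1 m (coef p m)) k = (\<Sum>m\<in>mons p. if m = k then coef p m else 0)"
  by (simp add: lookup_sum lookup_single when_def)
 also have "\<dots> = coef p k" by (simp add: in_keys_iff)
 finally show "coef p k = coef (\<Sum>m\<in>mons p. term1 m (coef p m)) k" by simp
qed

lemma mp_expand': "(p :: ('i, 'r::comm_ring_1) mp) = (\<Sum>m\<in>mons p. Cn (coef p m) * mon Vr m)"
 using mp_expand by (simp add: term1_eq)

lemma mp_induct [case_names add term1]:
 fixes p :: "('i, 'r::comm_ring_1) mp"
 assumes "\<And>p q. P p ==> P q ==> P (p + q)" "\<And>m c. P (term1 m c)"
 shows "P p"
proof -
 have "P (\<Sum>m\<in>A. term1 m (coef p m))" if "finite A" for A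
  using that by induction (use assms assms(2)[of "{#}" 0] in auto)
 thus ?thesis using mp_expand by (metis finite_keys)
qed

definition peval :: "('r::comm_ring_1 => 's::comm_ring_1) => ('i => 's) => ('i, 'r) mp => 's" where
 "peval f x p = (\<Sum>m\<in>mons p. f (coef p m) * mon x m)"

lemma peval_term1: "rhm f ==> peval f x (term1 m c) = f c * mon x m"
 by (auto simp: peval_def rhm_0)

lemma peval_add: "rhm f ==> peval f x (p + q) = peval f x p + peval f x q"
 unfolding peval_def by (rule setsum_keys_plus_distrib) (auto simp: rhm_0 rhm_add distrib_right)

lemma peval_mult: assumes f: "rhm f" shows "peval f x (p * q) = peval f x p * peval f x q"
proof (induction p rule: mp_induct)
 case (add p p') thus ?case by (simp add: distrib_right peval_add[OF f])
next
 case (term1 m c)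
 show ?case
 proof (induction q rule: mp_induct)
  case (add q q') thus ?case by (simp add: distrib_left peval_add[OF f])
 next
  case (term1 m' c')
  show ?case by (simp add: mult_single peval_term1[OF f] rhm_mult[OF f] mon_add)
 qed
qed

lemma rhm_peval: "rhm f ==> rhm (peval f x)"
proof -
 assume f: "rhm f"
 show ?thesis using peval_term1[OF f, of x "{#}" 1] by (simp add: rhm_1[OF f] rhm_def peval_add[OF f] peval_mult[OF f])
qed

lemma peval_Cn: "rhm f ==> peval f x (Cn c) = f c"
 by (simp add: Cn_def peval_term1)

lemma peval_Vr: "rhm f ==> peval f x (Vr i) = x i"
 by (simp add: Vr_def peval_term1 rhm_1)

lemma peval_rhm: "rhm g ==> g (peval f x p) = peval (\<lambda>c. g (f c)) (\<lambda>i. g (x i)) p"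
 by (simp add: peval_def rhm_sum rhm_mult rhm_mon)

lemma peval_peval:
 assumes "rhm f" "rhm g"
 shows "peval f x (peval g y p) = peval (\<lambda>c. peval f x (g c)) (\<lambda>i. peval f x (y i)) p"
 by (rule peval_rhm[OF rhm_peval[OF assms(1)]])

lemma peval_id: "peval Cn Vr p = p"
 unfolding peval_def by (rule mp_expand'[symmetric])

lemma coef_mult:
 fixes p q :: "('i, 'r::comm_ring_1) mp"
 shows "coef (p * q) m = (\<Sum>a\<in>mons p. \<Sum>b\<in>mons q. if a + b = m then coef p a * coef q b else 0)"
proof -
 have "p * q = (\<Sum>a\<in>mons p. term1 a (coef p a)) * (\<Sum>b\<in>mons q. term1 b (coef q b))"
  using mp_expand[of p] mp_expand[of q] by simp
 also have "\<dots> = (\<Sum>a\<in>mons p. \<Sum>b\<in>mons q. term1 (a + b) (coef p a * coef q b))"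
  by (simp add: sum_product mult_single)
 finally show ?thesis by (simp add: lookup_sum lookup_single when_def)
qed

lemma coef_mult_Cn: "coef (Cn c * p) m = c * coef (p :: ('i, 'r::comm_ring_1) mp) m"
proof (induction p rule: mp_induct)
 case (add p q) thus ?case by (simp add: distrib_left lookup_add)
next
 case (term1 k d) show ?case by (simp add: Cn_def mult_single lookup_single when_def)
qed

text \<open>\<open>R\<close> is sometimes a subring and sometimes an ideal; in the second case this
  is the extension of the ideal to the polynomial ring in the variables \<open>V\<close>.\<close>

definition pset :: "'r::comm_ring_1 set => 'i set => ('i, 'r) mp set" where
 "pset R V = {p. (\<forall>m. coef p m \<in> R) \<and> (\<forall>m\<in>mons p. set_mset m \<subseteq> V)}"

lemma psetI: "(\<And>m. coef p m \<in> R) ==> (\<And>m. m \<in> mons p ==> set_mset m \<subseteq> V) ==> p \<in> pset R V"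
 by (auto simp: pset_def)

lemma pset_coef: "p \<in> pset R V ==> coef p m \<in> R"
 by (auto simp: pset_def)

lemma pset_vars: "p \<in> pset R V ==> m \<in> mons p ==> set_mset m \<subseteq> V"
 by (auto simp: pset_def)

lemma pset_mult_ideal:
 assumes I: "qideal R I" and p: "p \<in> pset R V" and q: "q \<in> pset I V"
 shows "p * q \<in> pset I V"
proof (rule psetI)
 show "coef (p * q) m \<in> I" for m unfolding coef_mult
  by (intro qideal_sum[OF I]) (auto intro!: qideal_mult[OF I] qideal_0[OF I] pset_coef[OF p] pset_coef[OF q])
 fix m assume "m \<in> mons (p * q)"
 then obtain a b where "m = a + b" "a \<in> mons p" "b \<in> mons q" using keys_mult by blast
 thus "set_mset m \<subseteq> V" using pset_vars[OF p] pset_vars[OF q] by auto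
qed

lemma pset_add:
 assumes "\<And>x y. x \<in> I ==> y \<in> I ==> x + y \<in> I" "p \<in> pset I V" "q \<in> pset I V"
 shows "p + q \<in> pset I V"
proof (rule psetI)
 show "coef (p + q) m \<in> I" for m unfolding lookup_add by (intro assms(1) pset_coef[OF assms(2)] pset_coef[OF assms(3)])
 show "set_mset m \<subseteq> V" if "m \<in> mons (p + q)" for m
  using that Poly_Mapping.keys_add[of p q] assms(2,3)[THEN pset_vars] by blast
qed

lemma qideal_pset: "qideal R I ==> qideal (pset R V) (pset I V)"
 unfolding qideal_def[of "pset R V"]
proof (intro conjI ballI)
 assume I: "qideal R I"
 show "0 \<in> pset I V" using qideal_0[OF I] by (auto simp: pset_def)
 show "p + q \<in> pset I V" if "p \<in> pset I V" "q \<in> pset I V" for p q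
  by (rule pset_add[OF qideal_add[OF I] that])
 show "p * q \<in> pset I V" if "p \<in> pset R V" "q \<in> pset I V" for p q
  by (rule pset_mult_ideal[OF I that])
qed

lemma sring_pset: assumes R: "sring R" shows "sring (pset R V)"
 unfolding sring_def
proof (intro conjI ballI)
 have I: "qideal R R" by (rule qideal_sring[OF R])
 show "1 \<in> pset R V" using sring_0[OF R] sring_1[OF R] by (auto simp: pset_def lookup_one when_def)
 fix p q assume pq: "p \<in> pset R V" "q \<in> pset R V"
 show "p * q \<in> pset R V" by (rule pset_mult_ideal[OF I pq])
 have "- q \<in> pset R V" using pq(2) sring_minus[OF R] by (auto simp: pset_def)
 hence "p + (- q) \<in> pset R V" using pset_add[OF sring_add[OF R] pq(1)] by blast
 thus "p - q \<in> pset R V" by simp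
qed

lemma pset_mono: "R \<subseteq> R' ==> V \<subseteq> V' ==> pset R V \<subseteq> pset R' V'"
 unfolding pset_def by blast

lemma pset_Cn: "0 \<in> R ==> c \<in> R ==> Cn c \<in> pset R V"
 by (auto simp: pset_def Cn_def lookup_single when_def)

lemma pset_Vr: "sring R ==> i \<in> V ==> Vr i \<in> pset R V"
 by (auto simp: pset_def Vr_def lookup_single when_def sring_0 sring_1)

lemma pset_least:
 assumes Q: "sring Q" and "\<And>c. c \<in> R ==> Cn c \<in> Q" "\<And>i. i \<in> V ==> Vr i \<in> Q"
 shows "pset R V \<subseteq> Q"
proof
 fix p assume p: "p \<in> pset R V"
 have "(\<Sum>m\<in>mons p. Cn (coef p m) * mon Vr m) \<in> Q"
  by (intro sring_sum[OF Q] sring_mult[OF Q] mon_in_sring[OF Q] assms(2,3)) (use p in \<open>auto simp: pset_def\<close>)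
 thus "p \<in> Q" using mp_expand'[of p] by simp
qed

lemma peval_in_sring:
 assumes Q: "sring Q" and "\<And>m. m \<in> mons p ==> f (coef p m) \<in> Q" "\<And>m i. m \<in> mons p ==> i \<in># m ==> x i \<in> Q"
 shows "peval f x p \<in> Q"
 unfolding peval_def by (intro sring_sum[OF Q] sring_mult[OF Q] mon_in_sring[OF Q] assms(2,3))

lemma peval_in_ideal:
 assumes Q: "sring Q" and I: "qideal Q I" and "\<And>m. m \<in> mons p ==> f (coef p m) \<in> I"
  "\<And>m i. m \<in> mons p ==> i \<in># m ==> x i \<in> Q"
 shows "peval f x p \<in> I"
 unfolding peval_def
 by (intro qideal_sum[OF I] qideal_multr[OF I] mon_in_sring[OF Q] assms(3,4))

text \<open>Order at least \<open>N\<close> at the origin. Congruence modulo \<open>Dg N\<close>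
  replaces equality of power series below degree \<open>N\<close>.\<close>

definition Dg :: "nat => ('i, 'r::comm_ring_1) mp set" where
 "Dg N = {p. \<forall>m\<in>mons p. N \<le> size m}"

lemma Dg_0 [simp]: "p \<in> Dg 0" and Dg_zero [simp]: "0 \<in> Dg N"
 by (auto simp: Dg_def)

lemma Dg_add: "p \<in> Dg N ==> q \<in> Dg N ==> p + q \<in> Dg N"
 using Poly_Mapping.keys_add[of p q] by (auto simp: Dg_def)

lemma Dg_minus: "p \<in> Dg N ==> - p \<in> Dg N"
 by (auto simp: Dg_def)

lemma Dg_diff: "p \<in> Dg N ==> q \<in> Dg N ==> p - q \<in> Dg N"
 using Dg_add[of p N "- q"] Dg_minus[of q N] by simp

lemma Dg_mult: "p \<in> Dg M ==> q \<in> Dg N ==> p * q \<in> Dg (M + N)"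
proof -
 assume pq: "p \<in> Dg M" "q \<in> Dg N"
 have "M + N \<le> size m" if m: "m \<in> mons (p * q)" for m
 proof -
  obtain a b where "m = a + b" "a \<in> mons p" "b \<in> mons q" using keys_mult m by blast
  thus ?thesis using pq by (auto simp: Dg_def add_mono)
 qed
 thus ?thesis by (simp add: Dg_def)
qed

lemma Dg_mono: "M \<le> N ==> p \<in> Dg N ==> p \<in> Dg M"
 by (auto simp: Dg_def)

lemma Dg_ideal: "rideal (Dg N)"
 unfolding qideal_def using Dg_mult[of _ 0 _ N] by (auto simp: Dg_add)

lemma Dg_Vr: "Vr i \<in> Dg 1"
 by (auto simp: Dg_def Vr_def)

lemma Dg_mon: "(\<And>i. i \<in># m ==> x i \<in> Dg 1) ==> mon x m \<in> Dg (size m)"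
proof (induction m)
 case (add i m)
 thus ?case using Dg_mult[of "x i" 1 "mon x m" "size m"] by (simp add: mon_add_mset)
qed simp

lemma Dg_coef: "p \<in> Dg N ==> size m < N ==> coef p m = 0"
 unfolding Dg_def by (metis (mono_tags, lifting) in_keys_iff mem_Collect_eq not_less)

lemma DgI: assumes "\<And>m. size m < N ==> coef p m = 0" shows "p \<in> Dg N"
 unfolding Dg_def by (rule, rule, rule ccontr) (use assms in \<open>auto simp: in_keys_iff not_le\<close>)

subsection \<open>Partial derivatives and first-order expansion\<close>

definition mpd :: "'i => ('i, 'r::comm_ring_1) mp => ('i, 'r) mp" where
 "mpd i p = (\<Sum>m\<in>mons p. term1 (m - {#i#}) (of_nat (count m i) * coef p m))"

lemma mpd_add: "mpd i (p + q) = mpd i p + mpd i q"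
 unfolding mpd_def by (rule setsum_keys_plus_distrib) (auto simp: distrib_left single_add)

lemma mpd_term1: "mpd i (term1 m c) = term1 (m - {#i#}) (of_nat (count m i) * c)"
 by (auto simp: mpd_def)

lemma mpd_Cn_mult: "mpd i (Cn c * p) = Cn c * mpd i p"
proof (induction p rule: mp_induct)
 case (add p q) thus ?case by (simp add: distrib_left mpd_add)
next
 case (term1 m d) show ?case by (simp add: Cn_def mult_single mpd_term1 mult_ac)
qed

lemma mpd_Vr_mult: "mpd i (Vr j * p) = (if i = j then p else 0) + Vr j * mpd i p"
proof (induction p rule: mp_induct)
 case (add p q) thus ?case by (simp add: distrib_left mpd_add)
next
 case (term1 m d)
 have "add_mset j m - {#i#} = add_mset j (m - {#i#})" if "i \<noteq> j" using that by simp
 moreover have "of_nat (Suc (count m j)) * d = d + of_nat (count m j) * d" by (simp add: distrib_right)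
 moreover have "add_mset j (m - {#j#}) = m \<or> count m j = 0" by auto
 ultimately show ?case
  by (auto simp: Vr_def mult_single mpd_term1 simp flip: single_add)
qed

lemma mpd_one: "mpd i 1 = 0"
 using mpd_term1[of i "{#}" 1] by simp

lemma coef_mpd: "coef (mpd i p) m = of_nat (Suc (count m i)) * coef p (add_mset i m)"
proof (induction p rule: mp_induct)
 case (add p q) thus ?case by (simp add: mpd_add lookup_add distrib_left)
next
 case (term1 k c)
 show ?case
 proof (cases "i \<in># k")
  case True
  then obtain k' where "k = add_mset i k'" by (metis insert_DiffM)
  thus ?thesis by (simp add: mpd_term1 lookup_single when_def)
 next
  case False
  hence "k \<noteq> add_mset i m" by auto
  moreover have "count k i = 0" using False by (simp add: not_in_iff)
  ultimately show ?thesis by (simp add: mpd_term1 lookup_single)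
 qed
qed

lemma mpd_vars: "p \<in> pset UNIV V ==> mpd i p \<in> pset UNIV V"
proof (rule psetI)
 fix m assume p: "p \<in> pset UNIV V" and "m \<in> mons (mpd i p)"
 hence "add_mset i m \<in> mons p" by (auto simp: in_keys_iff coef_mpd)
 hence "set_mset (add_mset i m) \<subseteq> V" by (rule pset_vars[OF p])
 thus "set_mset m \<subseteq> V" by auto
qed simp

text \<open>The variables are mapped to \<open>y + L\<close> with \<open>L\<close> of order \<open>1\<close>.\<close>

lemma taylor1:
 fixes f :: "'r::comm_ring_1 => 's::comm_ring_1" and L :: "'i => ('j, 's) mp"
 assumes f: "rhm f" and fin: "finite V" and p: "p \<in> pset UNIV V" and L: "\<And>i. i \<in> V ==> L i \<in> Dg 1"
 shows "peval (\<lambda>c. Cn (f c)) (\<lambda>i. Cn (y i) + L i) p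
  - (Cn (peval f y p) + (\<Sum>i\<in>V. Cn (peval f y (mpd i p)) * L i)) \<in> Dg 2"
proof -
 let ?g = "\<lambda>c. Cn (f c) :: ('j, 's) mp" and ?z = "\<lambda>i. Cn (y i) + L i"
 have g: "rhm ?g" by (rule rhm_comp[OF rhm_Cn f])
 let ?T = "\<lambda>p. Cn (peval f y p) + (\<Sum>i\<in>V. Cn (peval f y (mpd i p)) * L i)"
 note fs = rhm_0[OF rhm_peval[OF f]] rhm_1[OF rhm_peval[OF f]] rhm_add[OF rhm_peval[OF f]] rhm_mult[OF rhm_peval[OF f]]
 note gs = rhm_0[OF rhm_peval[OF g]] rhm_1[OF rhm_peval[OF g]] rhm_add[OF rhm_peval[OF g]] rhm_mult[OF rhm_peval[OF g]]
 \<comment> \<open>For a product with \<open>Vr j\<close> the error is \<open>?z j\<close> times the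
   old error plus \<open>L j\<close> times a linear combination of the \<open>L i\<close>; both have
   order two. The general case follows because both sides are linear in \<open>p\<close>.\<close>
 have mono: "peval ?g ?z (mon Vr m) - ?T (mon Vr m) \<in> Dg 2" if "set_mset m \<subseteq> V" for m
  using that
 proof (induction m)
  case empty thus ?case by (simp add: fs gs Cn_simps mpd_one)
 next
  case (add j m)
  let ?q = "mon Vr m :: ('i, 'r) mp"
  let ?S = "\<Sum>i\<in>V. Cn (peval f y (mpd i ?q)) * L i" and ?c = "Cn (peval f y ?q) :: ('j, 's) mp"
  have j: "j \<in> V" and IH: "peval ?g ?z ?q - ?T ?q \<in> Dg 2" using add by auto
  have "?T (mon Vr (add_mset j m)) = Cn (y j) * ?c + (\<Sum>i\<in>V. (if i = j then ?c * L i else 0) + Cn (y j) * (Cn (peval f y (mpd i ?q)) * L i))"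
   unfolding mon_add_mset
   by (intro arg_cong2[of _ _ _ _ "(+)"] sum.cong)
    (auto simp: fs peval_Vr[OF f] Cn_simps mpd_Vr_mult algebra_simps)
  also have "\<dots> = Cn (y j) * ?c + ?c * L j + Cn (y j) * ?S"
   using fin j by (simp add: sum.distrib sum_distrib_left)
  finally have T: "?T (mon Vr (add_mset j m)) = Cn (y j) * ?c + ?c * L j + Cn (y j) * ?S" .
  have "peval ?g ?z (mon Vr (add_mset j m)) - ?T (mon Vr (add_mset j m))
   = ?z j * (peval ?g ?z ?q - ?T ?q) + L j * ?S"
   unfolding T by (simp add: mon_add_mset gs peval_Vr[OF g] algebra_simps)
  moreover have "L j * ?S \<in> Dg 2"
  proof -
   have "?S \<in> Dg 1" by (rule qideal_sum[OF Dg_ideal], rule qideal_mult[OF Dg_ideal UNIV_I], rule L)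
   hence "L j * ?S \<in> Dg (1 + 1)" by (rule Dg_mult[OF L[OF j]])
   thus ?thesis by (simp add: numeral_2_eq_2)
  qed
  ultimately show ?case using Dg_add[OF qideal_mult[OF Dg_ideal UNIV_I IH]] by simp
 qed
 have "peval ?g ?z p - ?T p = (\<Sum>m\<in>mons p. Cn (f (coef p m)) * (peval ?g ?z (mon Vr m) - ?T (mon Vr m)))"
 proof -
  have e: "peval f y (mpd i p) = (\<Sum>m\<in>mons p. f (coef p m) * peval f y (mpd i (mon Vr m)))" for i
  proof -
   have add0: "mpd i 0 = 0" using mpd_term1[of i "{#}" 0] by simp
   have ms: "mpd i (sum h A) = (\<Sum>m\<in>A. mpd i (h m))" for h :: "'i multiset => ('i, 'r) mp" and A
    by (induction rule: infinite_finite_induct) (auto simp: mpd_add add0)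
   have "mpd i p = (\<Sum>m\<in>mons p. Cn (coef p m) * mpd i (mon Vr m))"
    using arg_cong[OF mp_expand'[of p], of "mpd i"] by (simp only: ms mpd_Cn_mult)
   thus ?thesis by (simp only: rhm_sum[OF rhm_peval[OF f]] fs peval_Cn[OF f])
  qed
  have e0: "peval h z p = (\<Sum>m\<in>mons p. h (coef p m) * peval h z (mon Vr m))" if "rhm h" for h :: "'r => 't::comm_ring_1" and z
   by (simp add: peval_def mon_Vr rhm_1[OF that])
  have "(\<Sum>i\<in>V. Cn (peval f y (mpd i p)) * L i) = (\<Sum>m\<in>mons p. Cn (f (coef p m)) * (\<Sum>i\<in>V. Cn (peval f y (mpd i (mon Vr m))) * L i))"
   unfolding e rhm_sum[OF rhm_Cn] sum_distrib_right sum_distrib_left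
   by (subst sum.swap) (simp add: Cn_simps mult_ac)
  thus ?thesis unfolding e0[OF g, of ?z] e0[OF f, of y]
   by (simp add: rhm_sum[OF rhm_Cn] Cn_simps sum.distrib sum_subtractf distrib_left right_diff_distrib)
 qed
 also have "\<dots> \<in> Dg 2"
  by (rule qideal_sum[OF Dg_ideal], rule qideal_mult[OF Dg_ideal UNIV_I], rule mono, rule pset_vars[OF p])
 finally show ?thesis .
qed

section \<open>Noetherian rings of coefficients\<close>

lemma adjoin_least: "sring S ==> Q \<subseteq> S ==> t \<in> S ==> adjoin Q t \<subseteq> S"
 by (auto simp: adjoin_def intro!: sring_sum sring_mult sring_power)

lemma adjoins_least: "sring S ==> Q \<subseteq> S ==> set ts \<subseteq> S ==> adjoins Q ts \<subseteq> S"
proof (induction ts arbitrary: Q)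
 case (Cons t ts)
 thus ?case using adjoin_least[of S Q t] by simp
qed simp

lemma adjoins_eqI:
 assumes "sring Q" "sring S" "Q \<subseteq> S" "set ts \<subseteq> S" "\<And>T. sring T ==> Q \<subseteq> T ==> set ts \<subseteq> T ==> S \<subseteq> T"
 shows "adjoins Q ts = S"
proof
 show "adjoins Q ts \<subseteq> S" by (rule adjoins_least[OF assms(2-4)])
 show "S \<subseteq> adjoins Q ts"
  by (rule assms(5)[OF sring_adjoins[OF assms(1)] adjoins_base[OF assms(1)]]) (use adjoins_gen[OF assms(1)] in blast)
qed

lemma sring_vimage: "rhm f ==> sring T ==> sring (f -` T)"
 by (auto simp: sring_def rhm_1 rhm_diff rhm_mult)

lemma noeth_pset:
 assumes "R = adjoins (range of_int) cs"
 shows "noeth (pset R {..<n}) {} {1 :: (nat, 'r::comm_ring_1) mp}"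
proof -
 have R: "sring R" unfolding assms by (rule sring_adjoins[OF sring_ints])
 have "adjoins (range of_int) (map Cn cs @ map Vr [0..<n]) = pset R {..<n}"
 proof (rule adjoins_eqI[OF sring_ints sring_pset[OF R]])
  have ci: "of_int k = Cn (of_int k)" for k by (rule rhm_of_int[OF rhm_Cn, symmetric])
  show "range of_int \<subseteq> pset R {..<n}"
   using pset_Cn[OF sring_0[OF R] sring_of_int[OF R]] by (auto simp: ci)
  show "set (map Cn cs @ map Vr [0..<n]) \<subseteq> pset R {..<n}"
  proof
   fix p assume "p \<in> set (map Cn cs @ map Vr [0..<n])"
   then consider t where "t \<in> set cs" "p = Cn t" | i where "i < n" "p = Vr i" by auto
   thus "p \<in> pset R {..<n}"
   proof cases
    case (1 t)
    hence "t \<in> R" unfolding assms by (intro adjoins_gen[OF sring_ints])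
    thus ?thesis unfolding 1(2) by (rule pset_Cn[OF sring_0[OF R]])
   next
    case (2 i)
    thus ?thesis using pset_Vr[OF R, of i "{..<n}"] by simp
   qed
  qed
  fix T :: "(nat, 'r) mp set" assume T: "sring T" "range of_int \<subseteq> T" "set (map Cn cs @ map Vr [0..<n]) \<subseteq> T"
  have "R \<subseteq> Cn -` T" unfolding assms
   by (rule adjoins_least[OF sring_vimage[OF rhm_Cn T(1)]]) (use T in \<open>auto simp: ci[symmetric]\<close>)
  thus "pset R {..<n} \<subseteq> T" by (intro pset_least[OF T(1)]) (use T(3) in auto)
 qed
 thus ?thesis using noeth_finite_generation[of "map Cn cs @ map Vr [0..<n]"] by simp
qed

text \<open>Descent: the coefficients of finitely many polynomials generate a subring that is
  noetherian by Hilbert's theorem over the integers, whatever the ambient ring is. Krull's theorem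
  is applied over such subrings.\<close>

lemma fg_subring:
 fixes Ps :: "(nat, 'r::comm_ring_1) mp set"
 assumes "finite Ps" "Ps \<subseteq> pset UNIV {..<n}"
 obtains R where "sring R" "noeth R {} {1}" "noeth (pset R {..<n}) {} {1 :: (nat, 'r) mp}" "Ps \<subseteq> pset R {..<n}"
proof -
 let ?C = "\<Union>p\<in>Ps. coef p ` mons p"
 have "finite ?C" using assms(1) by auto
 from finite_list[OF this] obtain cs where cs: "set cs = ?C" ..
 define R where "R = adjoins (range of_int) cs"
 have R: "sring R" unfolding R_def by (rule sring_adjoins[OF sring_ints])
 have C: "?C \<subseteq> R" unfolding cs[symmetric] R_def by (rule, rule adjoins_gen[OF sring_ints])
 have "Ps \<subseteq> pset R {..<n}"
 proof
  fix p assume p: "p \<in> Ps"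
  show "p \<in> pset R {..<n}"
  proof (rule psetI)
   fix m show "coef p m \<in> R"
   proof (cases "m \<in> mons p")
    case True
    thus ?thesis using p C by blast
   qed (simp add: in_keys_iff sring_0[OF R])
  qed (use p assms(2) in \<open>auto simp: pset_def\<close>)
 qed
 thus thesis by (intro that[OF R _ noeth_pset[OF R_def]]) (simp_all add: R_def noeth_finite_generation)
qed

text \<open>The filtration by total degree, modulo coefficients in \<open>I\<close>.\<close>

definition Ef :: "'r::comm_ring_1 set => 'r set => nat => ('i, 'r) mp set" where
 "Ef Q I N = {p \<in> pset Q UNIV. \<forall>m. size m < N \<longrightarrow> coef p m \<in> I}"

lemma Ef_add:
 assumes "sring Q" "qideal Q I" "p \<in> Ef Q I N" "q \<in> Ef Q I N" shows "p + q \<in> Ef Q I N"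
 using assms(3,4) pset_add[OF sring_add[OF assms(1)], of p UNIV q]
 by (auto simp: Ef_def lookup_add qideal_add[OF assms(2)])

lemma Ef_sum:
 assumes "sring Q" "qideal Q I" "\<And>i. i \<in> A ==> f i \<in> Ef Q I N" shows "sum f A \<in> Ef Q I N"
proof -
 have "0 \<in> Ef Q I N" using sring_0[OF assms(1)] qideal_0[OF assms(2)] by (auto simp: Ef_def pset_def)
 thus ?thesis using assms(3) by (induction A rule: infinite_finite_induct) (auto intro: Ef_add[OF assms(1,2)])
qed

lemma Ef_mult:
 assumes Q: "sring Q" and I: "qideal Q I" and p: "p \<in> Ef Q I M" and q: "q \<in> Ef Q I N"
 shows "p * q \<in> Ef Q I (M + N)"
proof -
 have pq: "p \<in> pset Q UNIV" "q \<in> pset Q UNIV" using p q by (auto simp: Ef_def)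
 have "coef (p * q) m \<in> I" if "size m < M + N" for m unfolding coef_mult
 proof (intro qideal_sum[OF I])
  fix a b
  show "(if a + b = m then coef p a * coef q b else 0) \<in> I"
  proof (cases "a + b = m")
   case True
   hence "size a < M \<or> size b < N" using that by auto
   thus ?thesis using True p q pset_coef[OF pq(1), of a] pset_coef[OF pq(2), of b]
    by (auto simp: Ef_def qideal_mult[OF I] qideal_multr[OF I])
  qed (simp add: qideal_0[OF I])
 qed
 thus ?thesis using sring_mult[OF sring_pset[OF Q] pq] by (auto simp: Ef_def)
qed

lemma Ef_ideal: "p \<in> pset I UNIV ==> I \<subseteq> Q ==> p \<in> Ef Q I N"
 unfolding Ef_def using pset_mono[of I Q UNIV UNIV] pset_coef by auto

lemma Ef_Vr: "sring Q ==> qideal Q I ==> Vr i \<in> Ef Q I 1"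
 using pset_Vr[of Q i UNIV] qideal_0 by (simp add: Ef_def) (simp add: Vr_def lookup_single)

lemma Ef_Dg: "sring Q ==> qideal Q I ==> p \<in> pset Q UNIV ==> p \<in> Dg N ==> p \<in> Ef Q I N"
 by (auto simp: Ef_def Dg_coef qideal_0)

lemma Ef_0: "p \<in> pset Q UNIV ==> p \<in> Ef Q I 0"
 by (simp add: Ef_def)

text \<open>Factors are exchanged one at a time, by x a - y b = (x - y) a + y (a - b). Each summand
  contains one difference, which contributes an extra degree.\<close>

lemma Ef_mon:
 fixes x y :: "'j => ('i, 'r::comm_ring_1) mp"
 assumes Q: "sring Q" and I: "qideal Q I" and "\<And>i. i \<in># m ==> x i \<in> Ef Q I 1" "\<And>i. i \<in># m ==> y i \<in> Ef Q I 1"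
  "\<And>i. i \<in># m ==> x i - y i \<in> Ef Q I 2"
 shows "mon x m \<in> Ef Q I (size m) \<and> mon y m \<in> Ef Q I (size m) \<and> mon x m - mon y m \<in> Ef Q I (Suc (size m))"
 using assms(3-)
proof (induction m)
 case empty
 have "(1 :: ('i, 'r) mp) \<in> pset Q UNIV" "(0 :: ('i, 'r) mp) \<in> pset Q UNIV"
  using sring_1[OF sring_pset[OF Q]] sring_0[OF sring_pset[OF Q]] by auto
 thus ?case using qideal_0[OF I] by (auto simp: Ef_def)
next
 case (add i m)
 hence IH: "mon x m \<in> Ef Q I (size m)" "mon y m \<in> Ef Q I (size m)" "mon x m - mon y m \<in> Ef Q I (Suc (size m))" by auto
 have e: "x i * mon x m - y i * mon y m = (x i - y i) * mon x m + y i * (mon x m - mon y m)" by (simp add: algebra_simps)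
 have i: "x i \<in> Ef Q I 1" "y i \<in> Ef Q I 1" "x i - y i \<in> Ef Q I 2" using add.prems by auto
 show ?case unfolding mon_add_mset e
  using Ef_mult[OF Q I i(1) IH(1)] Ef_mult[OF Q I i(2) IH(2)]
   Ef_add[OF Q I Ef_mult[OF Q I i(3) IH(1)], of "y i * (mon x m - mon y m)"] Ef_mult[OF Q I i(2) IH(3)] by simp
qed

lemma finite_msets: "finite S ==> finite {\<nu>. set_mset \<nu> \<subseteq> S \<and> size \<nu> = N}"
proof (induction N)
 case 0
 show ?case by simp
next
 case (Suc N)
 have "{\<nu>. set_mset \<nu> \<subseteq> S \<and> size \<nu> = Suc N} \<subseteq> (\<Union>i\<in>S. add_mset i ` {\<nu>. set_mset \<nu> \<subseteq> S \<and> size \<nu> = N})"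
 proof
  fix \<nu> assume \<nu>: "\<nu> \<in> {\<nu>. set_mset \<nu> \<subseteq> S \<and> size \<nu> = Suc N}"
  then obtain i \<mu> where "\<nu> = add_mset i \<mu>" by (auto dest: size_eq_Suc_imp_eq_union)
  thus "\<nu> \<in> (\<Union>i\<in>S. add_mset i ` {\<nu>. set_mset \<nu> \<subseteq> S \<and> size \<nu> = N})" using \<nu> by auto
 qed
 thus ?case using Suc by (auto intro: finite_subset)
qed

section \<open>Standard smooth algebras over a domain are torsion-free\<close>

text \<open>Quasi-regularity: the substitution \<open>X \<mapsto> X + N U\<close>, with \<open>N\<close> a right inverse of the Jacobian matrix, turns
 \<open>F j\<close> into \<open>U j\<close> up to order two. Comparing coefficients of \<open>U\<close> shows that a relation \<open>\<Sum> h \<nu> F\<^sup>\<nu> \<in> I\<close> between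
 monomials of the same degree forces \<open>h \<nu> \<in> (F) + I\<close>.\<close>

lemma quasi_regular:
 fixes F :: "nat => (nat, 'v::comm_ring_1) mp"
 assumes R: "sring R" and F: "\<And>j. j < c ==> F j \<in> pset R {..<n}" and Nm: "\<And>i k. i < n ==> k < c ==> Nm i k \<in> pset R {..<n}"
  and d: "qideal (pset R {..<n}) d" "d \<subseteq> pset R {..<n}" and Fd: "\<And>j. j < c ==> F j \<in> d"
  and inv: "\<And>j k. j < c ==> k < c ==> (\<Sum>i<n. mpd i (F j) * Nm i k) - (if j = k then 1 else 0) \<in> d"
  and dh: "\<And>p \<theta>. \<theta> = peval (\<lambda>c. Cn (Cn c)) (\<lambda>i. Cn (Vr i) + (\<Sum>k<c. Cn (Nm i k) * Vr k)) ==> p \<in> I ==> \<theta> p \<in> pset d (UNIV :: nat set)"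
  and h: "\<And>\<nu>. \<nu> \<in> A ==> h \<nu> \<in> pset R {..<n}" and A: "A = {\<nu>. set_mset \<nu> \<subseteq> {..<c} \<and> size \<nu> = N}"
  and rel: "(\<Sum>\<nu>\<in>A. h \<nu> * mon F \<nu>) \<in> I" and mu: "\<mu> \<in> A"
 shows "h \<mu> \<in> d"
proof -
 let ?Q = "pset R {..<n}"
 have Q: "sring ?Q" by (rule sring_pset[OF R])
 have finA: "finite A" unfolding A by (rule finite_msets) simp
 \<comment> \<open>Two layers of polynomials: the coefficients are polynomials in X, and the outer
   variables are U. The map \<open>\<theta>\<close> below is the substitution of X + N U for
   X.\<close>
 define L where "L i = (\<Sum>k<c. Cn (Nm i k) * Vr k)" for i
 define \<theta> where "\<theta> = peval (\<lambda>c. Cn (Cn c)) (\<lambda>i. Cn (Vr i) + (L i :: (nat, (nat, 'v) mp) mp))"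
 have hh: "rhm (\<lambda>c. Cn (Cn c) :: (nat, (nat, 'v) mp) mp)" by (rule rhm_comp[OF rhm_Cn rhm_Cn])
 have th: "rhm \<theta>" unfolding \<theta>_def by (rule rhm_peval[OF hh])
 have LD: "L i \<in> Dg 1" for i unfolding L_def
  by (rule qideal_sum[OF Dg_ideal], rule qideal_mult[OF Dg_ideal UNIV_I Dg_Vr])
 have LQ: "L i \<in> pset ?Q UNIV" if "i < n" for i unfolding L_def
  by (rule sring_sum[OF sring_pset[OF Q]], rule sring_mult[OF sring_pset[OF Q] pset_Cn[OF sring_0[OF Q] Nm[OF that]] pset_Vr[OF Q]]) auto
 have thQ: "\<theta> p \<in> pset ?Q UNIV" if p: "p \<in> ?Q" for p unfolding \<theta>_def
 proof (rule peval_in_sring[OF sring_pset[OF Q]])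
  show "Cn (Cn (coef p m)) \<in> pset ?Q UNIV" for m
   using pset_coef[OF p] by (intro pset_Cn sring_0[OF Q] sring_0[OF R])
  fix m i assume "m \<in> mons p" "i \<in># m"
  hence i: "i < n" using pset_vars[OF p] by auto
  show "Cn (Vr i) + L i \<in> pset ?Q UNIV"
   by (rule sring_add[OF sring_pset[OF Q] pset_Cn[OF sring_0[OF Q] pset_Vr[OF R]] LQ]) (use i in auto)
 qed
 have tay: "\<theta> p - (Cn p + (\<Sum>i<n. Cn (mpd i p) * L i)) \<in> Dg 2" if p: "p \<in> ?Q" for p
 proof -
  have "p \<in> pset UNIV {..<n}" using p pset_mono[of R UNIV "{..<n}" "{..<n}"] by auto
  from taylor1[OF rhm_Cn _ this, of L Vr] LD show ?thesis by (simp add: \<theta>_def peval_id)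
 qed
 have mpdQ: "mpd i p \<in> ?Q" if p: "p \<in> ?Q" for i p
 proof (rule psetI)
  show "coef (mpd i p) m \<in> R" for m
   using sring_mult[OF R sring_of_int[OF R, of "int (Suc (count m i))"] pset_coef[OF p]] by (simp add: coef_mpd)
  show "set_mset m \<subseteq> {..<n}" if "m \<in> mons (mpd i p)" for m using p pset_mono[of R UNIV "{..<n}" "{..<n}"] using pset_vars[OF mpd_vars, of p "{..<n}" m i] that by auto
 qed
 have CnQ: "Cn p \<in> pset ?Q UNIV" if "p \<in> ?Q" for p by (rule pset_Cn[OF sring_0[OF Q] that])
 have th1: "\<theta> p - Cn p \<in> Ef ?Q d 1" if p: "p \<in> ?Q" for p
 proof -
  have "(\<Sum>i<n. Cn (mpd i p) * L i) \<in> Dg 1" by (rule qideal_sum[OF Dg_ideal], rule qideal_mult[OF Dg_ideal UNIV_I LD])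
  hence "(\<theta> p - (Cn p + (\<Sum>i<n. Cn (mpd i p) * L i))) + (\<Sum>i<n. Cn (mpd i p) * L i) \<in> Dg 1"
   by (intro Dg_add Dg_mono[OF _ tay[OF p]]) auto
  hence "\<theta> p - Cn p \<in> Dg 1" by simp
  thus ?thesis by (intro Ef_Dg[OF Q d(1)] sring_diff[OF sring_pset[OF Q]] thQ CnQ p)
 qed
 have V1: "Vr k \<in> Ef ?Q d 1" for k by (rule Ef_Vr[OF Q d(1)])
 \<comment> \<open>The constant term \<open>F j\<close> is in \<open>d\<close>, and the linear term
   is \<open>Vr j\<close> modulo \<open>d\<close> because \<open>Nm\<close> is a right inverse of
   the Jacobian matrix; the remainder has order two by Taylor's formula.\<close>
 have thF: "\<theta> (F j) - Vr j \<in> Ef ?Q d 2" if j: "j < c" for j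
 proof -
  let ?S = "\<Sum>k<c. Cn ((\<Sum>i<n. mpd i (F j) * Nm i k) - (if j = k then 1 else 0)) * Vr k"
  let ?D = "\<theta> (F j) - (Cn (F j) + (\<Sum>i<n. Cn (mpd i (F j)) * L i))"
  have "(\<Sum>i<n. Cn (mpd i (F j)) * L i) = (\<Sum>k<c. Cn (\<Sum>i<n. mpd i (F j) * Nm i k) * Vr k)"
   unfolding L_def sum_distrib_left rhm_sum[OF rhm_Cn] sum_distrib_right
   by (subst sum.swap) (simp add: Cn_simps mult.assoc)
  moreover have "Vr j = (\<Sum>k<c. Cn (if j = k then 1 else 0) * Vr k)"
   using j by (simp add: if_distrib[of Cn] if_distrib[of "\<lambda>x. x * _"] Cn_simps cong: if_cong)
  ultimately have e: "\<theta> (F j) - Vr j = Cn (F j) + ?S + ?D"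
   by (simp add: Cn_simps left_diff_distrib sum_subtractf)
  have dC: "Cn x \<in> pset d UNIV" if "x \<in> d" for x by (rule pset_Cn[OF qideal_0[OF d(1)] that])
  have pd: "qideal (pset ?Q UNIV) (pset d UNIV)" by (rule qideal_pset[OF d(1)])
  have Sd: "Cn (F j) + ?S \<in> pset d UNIV"
   by (rule qideal_add[OF pd dC[OF Fd[OF j]]], rule qideal_sum[OF pd], rule qideal_multr[OF pd pset_Vr[OF Q] dC[OF inv]])
    (use j in auto)
  have "Vr j \<in> pset ?Q UNIV" by (rule pset_Vr[OF Q]) simp
  hence "\<theta> (F j) - Vr j \<in> pset ?Q UNIV" by (rule sring_diff[OF sring_pset[OF Q] thQ[OF F[OF j]]])
  moreover have "Cn (F j) + ?S \<in> pset ?Q UNIV" by (rule subsetD[OF pset_mono[OF d(2) order_refl] Sd])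
  ultimately have "\<theta> (F j) - Vr j - (Cn (F j) + ?S) \<in> pset ?Q UNIV" by (rule sring_diff[OF sring_pset[OF Q]])
  hence "?D \<in> pset ?Q UNIV" unfolding e by (simp add: algebra_simps)
  hence "?D \<in> Ef ?Q d 2" using tay[OF F[OF j]] by (rule Ef_Dg[OF Q d(1)])
  thus ?thesis unfolding e by (intro Ef_add[OF Q d(1)] Ef_ideal[OF Sd d(2)])
 qed
 have thF1: "\<theta> (F j) \<in> Ef ?Q d 1" if j: "j < c" for j
 proof -
  have "\<theta> (F j) - Vr j \<in> Ef ?Q d 1" using thF[OF j] by (auto simp: Ef_def)
  hence "(\<theta> (F j) - Vr j) + Vr j \<in> Ef ?Q d 1" by (rule Ef_add[OF Q d(1) _ V1])
  thus ?thesis by simp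
 qed
 \<comment> \<open>The errors of replacing \<open>\<theta> (h \<nu>)\<close> by its constant term
   and the \<open>\<theta> (F j)\<close> by the variables U have one order more than the main term,
   so in degree \<open>N\<close> only \<open>h \<nu>\<close> times the monomial in U
   remains.\<close>
 have tm: "\<theta> (h \<nu> * mon F \<nu>) - Cn (h \<nu>) * mon Vr \<nu> \<in> Ef ?Q d (Suc N)" if \<nu>: "\<nu> \<in> A" for \<nu>
 proof -
  have s: "size \<nu> = N" and v: "\<And>j. j \<in># \<nu> ==> j < c" using \<nu> by (auto simp: A)
  let ?m = "mon (\<lambda>j. \<theta> (F j)) \<nu>"
  have m: "?m \<in> Ef ?Q d N \<and> mon Vr \<nu> \<in> Ef ?Q d N \<and> ?m - mon Vr \<nu> \<in> Ef ?Q d (Suc N)"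
   unfolding s[symmetric] by (rule Ef_mon[OF Q d(1) thF1[OF v] V1 thF[OF v]])
  have "\<theta> (h \<nu> * mon F \<nu>) - Cn (h \<nu>) * mon Vr \<nu> = (\<theta> (h \<nu>) - Cn (h \<nu>)) * ?m + Cn (h \<nu>) * (?m - mon Vr \<nu>)"
   by (simp add: rhm_mult[OF th] rhm_mon[OF th] algebra_simps)
  moreover have "(\<theta> (h \<nu>) - Cn (h \<nu>)) * ?m \<in> Ef ?Q d (1 + N)" using Ef_mult[OF Q d(1) th1[OF h[OF \<nu>]]] m by blast
  moreover have "Cn (h \<nu>) * (?m - mon Vr \<nu>) \<in> Ef ?Q d (0 + Suc N)"
   using Ef_mult[OF Q d(1) Ef_0[OF CnQ[OF h[OF \<nu>]]]] m by blast
  ultimately show ?thesis using Ef_add[OF Q d(1)] by simp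
 qed
 let ?y = "\<Sum>\<nu>\<in>A. h \<nu> * mon F \<nu>"
 have "(\<Sum>\<nu>\<in>A. \<theta> (h \<nu> * mon F \<nu>) - Cn (h \<nu>) * mon Vr \<nu>) \<in> Ef ?Q d (Suc N)" by (rule Ef_sum[OF Q d(1) tm])
 hence e1: "coef (\<Sum>\<nu>\<in>A. \<theta> (h \<nu> * mon F \<nu>) - Cn (h \<nu>) * mon Vr \<nu>) \<mu> \<in> d" using mu by (auto simp: Ef_def A)
 have e2: "coef (\<Sum>\<nu>\<in>A. \<theta> (h \<nu> * mon F \<nu>) - Cn (h \<nu>) * mon Vr \<nu>) \<mu> = coef (\<theta> ?y) \<mu> - h \<mu>"
 proof -
  have "coef (\<Sum>\<nu>\<in>A. Cn (h \<nu>) * mon Vr \<nu>) \<mu> = (\<Sum>\<nu>\<in>A. if \<nu> = \<mu> then h \<nu> else 0)"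
   by (simp add: lookup_sum term1_eq[symmetric] lookup_single when_def)
  also have "\<dots> = h \<mu>" using mu finA by simp
  finally show ?thesis by (simp add: sum_subtractf lookup_minus rhm_sum[OF th])
 qed
 have "\<theta> ?y \<in> pset d UNIV" by (rule dh[OF _ rel]) (simp add: \<theta>_def L_def)
 hence "coef (\<theta> ?y) \<mu> \<in> d" by (rule pset_coef)
 from qideal_diff[OF d(1) Q this e1] show ?thesis unfolding e2 by simp
qed

text \<open>The hypothesis is sharpened step by step to a z \<in> (F)^N + a (F) + K. The part of
  degree N in F is a multiple of a modulo K, so quasi-regularity puts its coefficients into (F) +
  (a) + K, which gives the step to N + 1. Krull's theorem yields (1 - e) a z \<in> a (F) + K, and a
  cancels coefficientwise since K is prime. Where F vanishes, the factor 1 - e is 1.\<close>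

theorem standard_smooth_torsion_free:
 fixes F :: "nat => (nat, 'v::comm_ring_1) mp" and K :: "'v set"
 assumes K: "rprime K" and F: "\<And>j. j < c ==> F j \<in> pset UNIV {..<n}"
  and Nm: "\<And>i k. i < n ==> k < c ==> Nm i k \<in> pset UNIV {..<n}"
  and inv: "\<And>j k. j < c ==> k < c ==> (\<Sum>i<n. mpd i (F j) * Nm i k) - (if j = k then 1 else 0)
    \<in> qspan (pset UNIV {..<n}) (F ` {..<c} \<union> pset K {..<n})"
  and a: "a \<notin> K" and z: "z \<in> pset UNIV {..<n}"
  and az: "Cn a * z \<in> qspan (pset UNIV {..<n}) (F ` {..<c} \<union> pset K {..<n})"
 obtains e where "e \<in> qspan (pset UNIV {..<n}) (F ` {..<c})"
  "(1 - e) * z \<in> qspan (pset UNIV {..<n}) (F ` {..<c} \<union> pset K {..<n})"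
proof -
 let ?P = "pset UNIV {..<n} :: (nat, 'v) mp set" and ?K = "pset K {..<n}"
 have P: "sring ?P" by (rule sring_pset) simp
 have KI: "qideal ?P ?K" by (rule qideal_pset[OF rprime_ideal[OF K]])
 have qK: "qspan ?P ?K \<subseteq> ?K" by (rule qspan_least[OF KI]) simp
 have wit: "\<exists>q. (\<forall>i<c. q i \<in> ?P) \<and> x - (\<Sum>i<c. q i * F i) \<in> ?K" if x: "x \<in> qspan ?P (F ` {..<c} \<union> ?K)" for x
 proof -
  obtain q where q: "\<forall>i\<in>{..<c}. q i \<in> ?P" "x - (\<Sum>i\<in>{..<c}. q i * F i) \<in> qspan ?P ?K"
   using qspan_finite[OF P _ x] by auto
  show ?thesis using q qK by (intro exI) auto
 qed
 obtain q0 where q0: "\<And>i. i < c ==> q0 i \<in> ?P" "Cn a * z - (\<Sum>i<c. q0 i * F i) \<in> ?K" using wit[OF az] by blast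
 define M where "M j k = (\<Sum>i<n. mpd i (F j) * Nm i k) - (if j = k then 1 else 0)" for j k
 have "\<exists>q. \<forall>j k. j < c \<longrightarrow> k < c \<longrightarrow> (\<forall>i<c. q j k i \<in> ?P) \<and> M j k - (\<Sum>i<c. q j k i * F i) \<in> ?K"
 proof (intro choice allI)
  fix j k show "\<exists>q. j < c \<longrightarrow> k < c \<longrightarrow> (\<forall>i<c. q i \<in> ?P) \<and> M j k - (\<Sum>i<c. q i * F i) \<in> ?K"
   using wit[OF inv[of j k]] unfolding M_def by blast
 qed
 then obtain q1 where q1: "\<And>j k i. j < c ==> k < c ==> i < c ==> q1 j k i \<in> ?P"
  "\<And>j k. j < c ==> k < c ==> M j k - (\<Sum>i<c. q1 j k i * F i) \<in> ?K" by blast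
 \<comment> \<open>Besides the data, the coefficients \<open>q0\<close> and \<open>q1\<close> of the
   given relations are included, so that these relations persist over the subring \<open>R\<close>,
   with \<open>KQ\<close> in place of \<open>?K\<close>.\<close>
 define Ps where "Ps = {Cn a, z} \<union> F ` {..<c} \<union> q0 ` {..<c} \<union> (\<Union>i<n. Nm i ` {..<c})
   \<union> (\<Union>j<c. \<Union>k<c. q1 j k ` {..<c})"
 have "finite Ps" by (simp add: Ps_def)
 moreover have "Ps \<subseteq> ?P" using z F q0(1) Nm q1(1) pset_Cn[of UNIV a] by (auto simp: Ps_def)
 ultimately obtain R where R: "sring R" and noe: "noeth (pset R {..<n}) {} {1 :: (nat, 'v) mp}" and PsR: "Ps \<subseteq> pset R {..<n}"
  by (rule fg_subring)
 let ?Q = "pset R {..<n}"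
 have Q: "sring ?Q" by (rule sring_pset[OF R])
 have QP: "?Q \<subseteq> ?P" by (rule pset_mono) auto
 have inQ: "Cn a \<in> ?Q" "z \<in> ?Q" "\<And>j. j < c ==> F j \<in> ?Q" "\<And>j. j < c ==> q0 j \<in> ?Q"
  "\<And>i k. i < n ==> k < c ==> Nm i k \<in> ?Q" "\<And>j k i. j < c ==> k < c ==> i < c ==> q1 j k i \<in> ?Q"
 proof -
  note P' = subsetD[OF PsR, unfolded Ps_def]
  show "Cn a \<in> ?Q" "z \<in> ?Q" by (rule P', simp)+
  show "F j \<in> ?Q" "q0 j \<in> ?Q" if "j < c" for j by (rule P', use that in simp)+
  show "Nm i k \<in> ?Q" if "i < n" "k < c" for i k by (rule P', use that in blast)
  show "q1 j k i \<in> ?Q" if "j < c" "k < c" "i < c" for j k i by (rule P', use that in blast)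
 qed
 define KQ where "KQ = ?K \<inter> ?Q"
 have KQ: "qideal ?Q KQ" "KQ \<subseteq> ?Q" unfolding KQ_def
  by (auto intro!: qideal_Int qideal_mono[OF KI QP] qideal_sring[OF Q])
 have mpdQ: "mpd i p \<in> ?Q" if p: "p \<in> ?Q" for i p
 proof (rule psetI)
  show "coef (mpd i p) m \<in> R" for m
   using sring_mult[OF R sring_of_int[OF R, of "int (Suc (count m i))"] pset_coef[OF p]] by (simp add: coef_mpd)
  show "set_mset m \<subseteq> {..<n}" if "m \<in> mons (mpd i p)" for m
   by (rule pset_vars[OF mpd_vars[OF subsetD[OF QP p]] that])
 qed
 define FQ where "FQ = qspan ?Q (F ` {..<c})"
 have FQ: "qideal ?Q FQ" unfolding FQ_def by (rule qspan_qideal)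
 have FQQ: "FQ \<subseteq> ?Q" unfolding FQ_def by (rule qspan_least[OF qideal_sring[OF Q]]) (use inQ(3) in auto)
 define d where "d = qspan ?Q (F ` {..<c} \<union> insert (Cn a) KQ)"
 have d: "qideal ?Q d" unfolding d_def by (rule qspan_qideal)
 have dQ: "d \<subseteq> ?Q" unfolding d_def by (rule qspan_least[OF qideal_sring[OF Q]]) (use inQ KQ(2) in auto)
 have dg: "F ` {..<c} \<union> insert (Cn a) KQ \<subseteq> d" unfolding d_def by (rule qspan_base)
 have mu_inv: "(\<Sum>i<n. mpd i (F j) * Nm i k) - (if j = k then 1 else 0) \<in> d" if jk: "j < c" "k < c" for j k
 proof -
  have MQ: "M j k \<in> ?Q" unfolding M_def
  proof (rule sring_diff[OF Q sring_sum[OF Q]])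
   show "mpd i (F j) * Nm i k \<in> ?Q" if "i \<in> {..<n}" for i
    by (rule sring_mult[OF Q mpdQ[OF inQ(3)[OF jk(1)]] inQ(5)]) (use that jk in auto)
  qed (simp add: sring_0[OF Q] sring_1[OF Q])
  have SQ: "(\<Sum>i<c. q1 j k i * F i) \<in> ?Q" by (rule sring_sum[OF Q], rule sring_mult[OF Q]) (use jk inQ in auto)
  have "M j k - (\<Sum>i<c. q1 j k i * F i) \<in> d" using q1(2)[OF jk] sring_diff[OF Q MQ SQ] dg by (auto simp: KQ_def)
  moreover have "(\<Sum>i<c. q1 j k i * F i) \<in> d"
   by (rule qideal_sum[OF d], rule qideal_mult[OF d]) (use jk inQ dg in auto)
  ultimately show ?thesis using qideal_cong[OF d] unfolding M_def by blast
 qed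
 \<comment> \<open>The product of \<open>a\<close> with \<open>FQ\<close> and not with all of
   \<open>?Q\<close>: cancelling \<open>a\<close> at the end must leave an element of
   \<open>FQ\<close>.\<close>
 define Fa where "Fa = {x. \<exists>f\<in>FQ. \<exists>k\<in>KQ. x = Cn a * f + k}"
 have idA: "qideal ?Q {x. \<exists>f\<in>A. \<exists>k\<in>B. x = Cn a * f + k}" if A: "qideal ?Q A" and B: "qideal ?Q B" for A B
  unfolding qideal_def
 proof (intro conjI ballI; clarify)
  show "\<exists>f\<in>A. \<exists>k\<in>B. 0 = Cn a * f + k" using qideal_0[OF A] qideal_0[OF B] by (auto intro!: bexI)
  fix f k f' k' assume "f \<in> A" "k \<in> B" "f' \<in> A" "k' \<in> B"
  thus "\<exists>f''\<in>A. \<exists>k''\<in>B. Cn a * f + k + (Cn a * f' + k') = Cn a * f'' + k''"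
   by (intro bexI[of _ "f + f'"] bexI[of _ "k + k'"]) (auto simp: algebra_simps qideal_add[OF A] qideal_add[OF B])
 next
  fix q f k assume q: "q \<in> ?Q" "f \<in> A" "k \<in> B"
  have "q * (Cn a * f + k) = Cn a * (q * f) + q * k" by (simp add: algebra_simps)
  thus "\<exists>f'\<in>A. \<exists>k'\<in>B. q * (Cn a * f + k) = Cn a * f' + k'"
   using qideal_mult[OF A q(1,2)] qideal_mult[OF B q(1,3)] by blast
 qed
 have Fa: "qideal ?Q Fa" unfolding Fa_def by (rule idA[OF FQ KQ(1)])
 have KFa: "x \<in> Fa" if "x \<in> KQ" for x
 proof -
  have "x = Cn a * 0 + x" by simp
  thus ?thesis unfolding Fa_def using that qideal_0[OF FQ] by blast
 qed
 have FFa: "Cn a * f \<in> Fa" if "f \<in> FQ" for f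
 proof -
  have "Cn a * f = Cn a * f + 0" by simp
  thus ?thesis unfolding Fa_def using that qideal_0[OF KQ(1)] by blast
 qed
 have FaQ: "Fa \<subseteq> ?Q" unfolding Fa_def using inQ(1) FQQ KQ(2) by (auto intro!: sring_add[OF Q] sring_mult[OF Q])
 have main: "\<exists>y\<in>ipow ?Q c F N. Cn a * z - y \<in> Fa" for N
 proof (induction N)
  case 0
  have "Cn a * z * mon F {#} \<in> ipow ?Q c F 0" unfolding ipow_def
   by (rule qideal_mult[OF qspan_qideal sring_mult[OF Q inQ(1,2)]], rule qspan_basic) (auto)
  thus ?case using qideal_0[OF Fa] by (auto intro!: bexI)
 next
  case (Suc N)
  let ?A = "{\<nu>. set_mset \<nu> \<subseteq> {..<c} \<and> size \<nu> = N}"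
  have ip: "qideal ?Q (ipow ?Q c F M)" for M unfolding ipow_def by (rule qspan_qideal)
  have ipmon: "mon F \<nu> \<in> ipow ?Q c F M" if "set_mset \<nu> \<subseteq> {..<c}" "size \<nu> = M" for \<nu> M
   unfolding ipow_def by (rule qspan_basic) (use that in blast)
  show ?case
  \<comment> \<open>The empty monomial 1 need not lie in \<open>FQ\<close>, so the passage from 0 to
    1 uses the given relation itself.\<close>
  proof (cases "N = 0")
   case True
   have "(\<Sum>i<c. q0 i * F i) \<in> ipow ?Q c F 1"
   proof (rule qideal_sum[OF ip], rule qideal_mult[OF ip])
    fix i assume "i \<in> {..<c}"
    thus "q0 i \<in> ?Q" "F i \<in> ipow ?Q c F 1" using inQ ipmon[of "{#i#}" 1] by auto
   qed
   moreover have "Cn a * z - (\<Sum>i<c. q0 i * F i) \<in> ?Q"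
    by (rule sring_diff[OF Q sring_mult[OF Q inQ(1,2)] sring_sum[OF Q sring_mult[OF Q inQ(4) inQ(3)]]]) auto
   hence "Cn a * z - (\<Sum>i<c. q0 i * F i) \<in> Fa" using q0(2) by (intro KFa) (simp add: KQ_def)
   ultimately show ?thesis using True by auto
  next
   case False
   obtain y f k where y: "y \<in> ipow ?Q c F N" "f \<in> FQ" "k \<in> KQ" "Cn a * z - y = Cn a * f + k"
    using Suc.IH by (auto simp: Fa_def)
   have fin: "finite ?A" by (rule finite_msets) simp
   have "{mon F \<nu> | \<nu>. set_mset \<nu> \<subseteq> {..<c} \<and> size \<nu> = N} = mon F ` ?A" by auto
   hence "y \<in> qspan ?Q (mon F ` ?A \<union> {})" using y(1) by (simp add: ipow_def)
   from qspan_finite[OF Q fin this] obtain h where h: "\<And>\<nu>. \<nu> \<in> ?A ==> h \<nu> \<in> ?Q" "y = (\<Sum>\<nu>\<in>?A. h \<nu> * mon F \<nu>)"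
    by auto
   have hd: "h \<nu> \<in> d" if \<nu>: "\<nu> \<in> ?A" for \<nu>
   proof (rule quasi_regular[OF R inQ(3) inQ(5) d dQ _ mu_inv])
    show "F j \<in> d" if "j < c" for j using dg that by auto
    show "\<nu>' \<in> ?A ==> h \<nu>' \<in> ?Q" for \<nu>' by (rule h(1))
    show "(\<Sum>\<nu>\<in>?A. h \<nu> * mon F \<nu>) \<in> {x. \<exists>f\<in>?Q. \<exists>k\<in>KQ. x = Cn a * f + k}"
    proof -
     have "y = Cn a * (z - f) + (- k)" using y(4) by (simp add: algebra_simps)
     moreover have "z - f \<in> ?Q" using y(2) FQQ sring_diff[OF Q inQ(2)] by blast
     ultimately show ?thesis unfolding h(2) using qideal_minus[OF KQ(1) Q y(3)] by blast
    qed
    fix p and \<theta> :: "(nat, 'v) mp => (nat, (nat, 'v) mp) mp"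
    assume \<theta>: "\<theta> = peval (\<lambda>c. Cn (Cn c)) (\<lambda>i. Cn (Vr i) + (\<Sum>k<c. Cn (Nm i k) * Vr k))"
     and p: "p \<in> {x. \<exists>f\<in>?Q. \<exists>k\<in>KQ. x = Cn a * f + k}"
    then obtain f k where fk: "f \<in> ?Q" "k \<in> KQ" "p = Cn a * f + k" by blast
    have hh: "rhm (\<lambda>c. Cn (Cn c) :: (nat, (nat, 'v) mp) mp)" by (rule rhm_comp[OF rhm_Cn rhm_Cn])
    have th: "rhm \<theta>" unfolding \<theta> by (rule rhm_peval[OF hh])
    have pQ: "sring (pset ?Q (UNIV :: nat set))" by (rule sring_pset[OF Q])
    have pd: "qideal (pset ?Q UNIV) (pset d (UNIV :: nat set))" by (rule qideal_pset[OF d])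
    have v: "Cn (Vr i) + (\<Sum>k<c. Cn (Nm i k) * Vr k) \<in> pset ?Q (UNIV :: nat set)" if "i < n" for i
     by (rule sring_add[OF pQ pset_Cn[OF sring_0[OF Q] pset_Vr[OF R]] sring_sum[OF pQ sring_mult[OF pQ pset_Cn[OF sring_0[OF Q] inQ(5)] pset_Vr[OF Q]]]])
      (use that in auto)
    have 1: "\<theta> f \<in> pset ?Q UNIV" unfolding \<theta>
    proof (rule peval_in_sring[OF pQ])
     show "Cn (Cn (coef f m)) \<in> pset ?Q UNIV" for m
      using pset_coef[OF fk(1)] by (intro pset_Cn sring_0[OF Q] sring_0[OF R])
    qed (use pset_vars[OF fk(1)] v in auto)
    have 2: "\<theta> k \<in> pset d UNIV" unfolding \<theta>
    proof (rule peval_in_ideal[OF pQ pd])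
     show "Cn (Cn (coef k m)) \<in> pset d UNIV" for m
     proof (rule pset_Cn[OF qideal_0[OF d]])
      have "coef k m \<in> K" "coef k m \<in> R" using fk(2) by (auto simp: KQ_def pset_def)
      thus "Cn (coef k m) \<in> d" using sring_0[OF R] qideal_0[OF rprime_ideal[OF K]] dg by (auto simp: KQ_def pset_Cn)
     qed
     fix m i assume "m \<in> mons k" "i \<in># m"
     hence "i < n" using fk(2) pset_vars[of k K "{..<n}" m] by (auto simp: KQ_def)
     thus "Cn (Vr i) + (\<Sum>k<c. Cn (Nm i k) * Vr k) \<in> pset ?Q (UNIV :: nat set)" by (rule v)
    qed
    have "\<theta> (Cn a) = Cn (Cn a)" unfolding \<theta> by (rule peval_Cn[OF hh])
    moreover have "Cn a \<in> d" using dg by blast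
    ultimately have "\<theta> (Cn a) * \<theta> f \<in> pset d UNIV"
     using qideal_multr[OF pd 1 pset_Cn[OF qideal_0[OF d]]] by simp
    thus "\<theta> p \<in> pset d UNIV" unfolding fk(3) rhm_add[OF th] rhm_mult[OF th]
     by (rule qideal_add[OF pd _ 2])
   qed (use \<nu> in auto)
   define W where "W = {x. \<exists>y'\<in>ipow ?Q c F (Suc N). x - y' \<in> Fa}"
   have W: "qideal ?Q W"
 proof (rule qidealI)
    show "0 \<in> W" using qideal_0[OF ip] qideal_0[OF Fa] by (auto simp: W_def bexI[of _ 0])
    fix x x' assume "x \<in> W" "x' \<in> W"
    then obtain w w' where w: "w \<in> ipow ?Q c F (Suc N)" "w' \<in> ipow ?Q c F (Suc N)" "x - w \<in> Fa" "x' - w' \<in> Fa" by (auto simp: W_def)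
    show "x + x' \<in> W" using qideal_add[OF Fa w(3,4)] qideal_add[OF ip w(1,2)] by (auto simp: algebra_simps W_def)
   next
    fix q x assume q: "q \<in> ?Q" and "x \<in> W"
    then obtain w where w: "w \<in> ipow ?Q c F (Suc N)" "x - w \<in> Fa" by (auto simp: W_def)
    show "q * x \<in> W" using qideal_mult[OF Fa q w(2)] qideal_mult[OF ip q w(1)] by (auto simp: algebra_simps W_def)
   qed
   have FaW: "Fa \<subseteq> W" using qideal_0[OF ip] by (auto simp: W_def bexI[of _ 0])
   have hW: "h \<nu> * mon F \<nu> \<in> W" if \<nu>: "\<nu> \<in> ?A" for \<nu>
   proof -
    have mQ: "mon F \<nu> \<in> ?Q" by (rule mon_in_sring[OF Q]) (use \<nu> inQ(3) in auto)
    have mFQ: "mon F \<nu> \<in> FQ"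
    proof -
     obtain i \<mu> where i: "\<nu> = add_mset i \<mu>" using \<nu> False by (cases \<nu>) auto
     have "mon F \<mu> \<in> ?Q" by (rule mon_in_sring[OF Q]) (use \<nu> i inQ(3) in auto)
     moreover have "F i \<in> FQ" unfolding FQ_def by (rule qspan_basic) (use \<nu> i in auto)
     ultimately show ?thesis using qideal_multr[OF FQ] by (simp add: i mon_add_mset)
    qed
    have "qideal ?Q {x. x * mon F \<nu> \<in> W}"
     using W unfolding qideal_def by (auto simp: distrib_right mult.assoc)
    moreover have "F ` {..<c} \<union> insert (Cn a) KQ \<subseteq> {x. x * mon F \<nu> \<in> W}"
    proof (intro Un_least insert_subsetI subsetI)
     fix x assume "x \<in> F ` {..<c}"
     then obtain j where j: "j < c" "x = F j" by auto
     show "x \<in> {x. x * mon F \<nu> \<in> W}" using ipmon[of "add_mset j \<nu>" "Suc N"] \<nu> j using qideal_0[OF Fa] by (simp add: mon_add_mset W_def bexI[of _ "x * mon F \<nu>"])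
    next
     have "Cn a * mon F \<nu> \<in> Fa" by (rule FFa[OF mFQ])
     thus "Cn a \<in> {x. x * mon F \<nu> \<in> W}" using FaW by auto
    next
     fix x assume "x \<in> KQ"
     hence "x * mon F \<nu> \<in> KQ" by (rule qideal_multr[OF KQ(1) mQ])
     hence "x * mon F \<nu> \<in> Fa" by (rule KFa)
     thus "x \<in> {x. x * mon F \<nu> \<in> W}" using FaW by auto
    qed
    ultimately have "d \<subseteq> {x. x * mon F \<nu> \<in> W}" unfolding d_def by (rule qspan_least)
    thus ?thesis using hd[OF \<nu>] by blast
   qed
   have "y \<in> W" unfolding h(2) by (rule qideal_sum[OF W hW])
   then obtain y' where y': "y' \<in> ipow ?Q c F (Suc N)" "y - y' \<in> Fa" by (auto simp: W_def)
   have "Cn a * z - y \<in> Fa" using y(2-4) unfolding Fa_def by blast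
   hence "(Cn a * z - y) + (y - y') \<in> Fa" using y'(2) by (rule qideal_add[OF Fa])
   thus ?thesis using y'(1) by auto
  qed
 qed
 obtain e where e: "e \<in> ?Q" "e \<in> qspan ?Q (F ` {..<c})" "(1 - e) * (Cn a * z) \<in> Fa"
  by (rule krull_intersection[OF Q noe Fa FaQ inQ(3) sring_mult[OF Q inQ(1,2)] main])
 then obtain f k where fk: "f \<in> FQ" "k \<in> KQ" "(1 - e) * (Cn a * z) = Cn a * f + k" by (auto simp: Fa_def)
 let ?w = "(1 - e) * z - f"
 have wP: "?w \<in> ?P"
  by (rule sring_diff[OF P sring_mult[OF P sring_diff[OF P sring_1[OF P]] z]]) (use e(1) QP fk(1) FQQ in auto)
 have "Cn a * ?w = k" using fk(3) by (simp add: algebra_simps)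
 hence "coef (Cn a * ?w) m \<in> K" for m using fk(2) by (auto simp: KQ_def pset_def)
 hence "?w \<in> ?K" using rprime_mult[OF K] a unfolding coef_mult_Cn using wP by (auto simp: pset_def)
 hence wS: "?w \<in> qspan ?P (F ` {..<c} \<union> ?K)" by (intro qspan_basic) blast
 have fS: "f \<in> qspan ?P (F ` {..<c} \<union> ?K)"
  using fk(1) qspan_mono2[OF QP, of "F ` {..<c}" "F ` {..<c} \<union> ?K"] unfolding FQ_def by blast
 have "(1 - e) * z \<in> qspan ?P (F ` {..<c} \<union> ?K)" using qideal_add[OF qspan_qideal wS fS] by simp
 moreover have "e \<in> qspan ?P (F ` {..<c})" using e(2) qspan_mono2[OF QP order_refl] by blast
 ultimately show thesis by (rule that[rotated])
qed

section \<open>Elimination of variables and specialization of linear relations\<close>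

text \<open>Measures how far the first \<open>c\<close> variables have been eliminated: they occur
  only in monomials of degree \<open>k\<close> and above.\<close>

definition Ez :: "nat => nat => (nat, 'r::comm_ring_1) mp set" where
 "Ez c k = {p. \<forall>m\<in>mons p. size m < k \<longrightarrow> set_mset m \<inter> {..<c} = {}}"

lemma Ez_add: "p \<in> Ez c k ==> q \<in> Ez c k ==> p + q \<in> Ez c k"
 using Poly_Mapping.keys_add by (fastforce simp: Ez_def)

lemma Ez_zero: "0 \<in> Ez c k"
 by (simp add: Ez_def)

lemma Ez_sum: "(\<And>i. i \<in> A ==> f i \<in> Ez c k) ==> sum f A \<in> Ez c k"
 by (induction A rule: infinite_finite_induct) (auto simp: Ez_zero Ez_add)

lemma DgEz_mult:
 assumes "p \<in> Dg s" "p \<in> Ez c (Suc s)" "q \<in> Dg t" "q \<in> Ez c (Suc t)"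
 shows "p * q \<in> Ez c (Suc (s + t))"
 unfolding Ez_def
proof (intro CollectI ballI impI)
 fix m assume m: "m \<in> mons (p * q)" "size m < Suc (s + t)"
 then obtain a b where ab: "m = a + b" "a \<in> mons p" "b \<in> mons q" using keys_mult by blast
 have "s \<le> size a" "t \<le> size b" using ab assms(1,3) by (auto simp: Dg_def)
 hence "size a = s" "size b = t" using m(2) ab(1) by auto
 hence "set_mset a \<inter> {..<c} = {}" "set_mset b \<inter> {..<c} = {}" using ab assms(2,4) by (auto simp: Ez_def)
 thus "set_mset m \<inter> {..<c} = {}" by (auto simp: ab(1))
qed

text \<open>The equations \<open>Vr j = G j\<close> define the first \<open>c\<close> variables
  implicitly as power series in the others, because the linear part of \<open>G j\<close> is free of
  them. Instead of solving by power series, the substitution \<open>g\<close> is iterated; its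
  \<open>N\<close>-th iterate is correct below degree \<open>N\<close>.\<close>

locale elimination =
 fixes c n :: nat and G :: "nat => (nat, 'r::comm_ring_1) mp"
 assumes G1: "j < c ==> G j \<in> Dg 1" and G2: "j < c ==> G j \<in> Ez c 2"
begin

definition sub :: "nat => (nat, 'r) mp" where "sub i = (if i < c then G i else Vr i)"
definition g :: "(nat, 'r) mp => (nat, 'r) mp" where "g = peval Cn sub"

lemma rhm_g: "rhm g"
 unfolding g_def by (rule rhm_peval[OF rhm_Cn])

lemma rhm_gn: "rhm (g ^^ N)"
 by (induction N) (auto simp: rhm_def rhm_1[OF rhm_g] rhm_add[OF rhm_g] rhm_mult[OF rhm_g])

lemma sub_Dg: "sub i \<in> Dg 1" and sub_Ez: "sub i \<in> Ez c 2"
proof -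
 show "sub i \<in> Dg 1" by (cases "i < c") (simp_all only: sub_def if_True if_False G1 Dg_Vr)
 show "sub i \<in> Ez c 2" unfolding sub_def using G2 by (auto simp: Ez_def Vr_def)
qed

lemma mon_sub: "mon sub m \<in> Dg (size m) \<and> mon sub m \<in> Ez c (Suc (size m))"
proof (induction m)
 case empty
 show ?case by (simp add: Ez_def)
next
 case (add i m)
 have "mon sub (add_mset i m) \<in> Dg (size (add_mset i m))" by (rule Dg_mon) (rule sub_Dg)
 moreover have "sub i * mon sub m \<in> Ez c (Suc (1 + size m))"
  by (rule DgEz_mult) (use add sub_Dg sub_Ez in \<open>auto simp: numeral_2_eq_2\<close>)
 ultimately show ?case by (simp add: mon_add_mset)
qed

lemma g_expand: "g p = (\<Sum>m\<in>mons p. Cn (coef p m) * mon sub m)"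
 by (simp add: g_def peval_def)

lemma Cn_mult_Ez: "p \<in> Ez c k ==> Cn a * p \<in> Ez c k"
 unfolding Ez_def by (auto simp: in_keys_iff coef_mult_Cn)

lemma mon_sub_fix: "set_mset m \<inter> {..<c} = {} ==> mon sub m = mon Vr m"
 unfolding mon_def by (rule arg_cong, rule image_mset_cong) (auto simp: sub_def)

text \<open>A substituted monomial keeps its degree only through the linear parts of the
  \<open>G j\<close>, which are free of the eliminated variables; so these variables move up by one
  degree.\<close>

lemma g_Ez: assumes "p \<in> Ez c k" shows "g p \<in> Ez c (Suc k)"
 unfolding g_expand
proof (rule Ez_sum, rule Cn_mult_Ez)
 fix m assume m: "m \<in> mons p"
 show "mon sub m \<in> Ez c (Suc k)"
 proof (cases "set_mset m \<inter> {..<c} = {}")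
  case True
  thus ?thesis by (simp add: mon_sub_fix mon_Vr Ez_def)
 next
  case False
  hence "k \<le> size m" using assms m by (auto simp: Ez_def)
  thus ?thesis using mon_sub by (auto simp: Ez_def)
 qed
qed

lemma gn_Ez: "(g ^^ N) p \<in> Ez c N"
proof (induction N)
 case 0 show ?case by (simp add: Ez_def)
next
 case (Suc N) thus ?case using g_Ez by simp
qed

lemma Ez_g: assumes "p \<in> Ez c k" shows "g p - p \<in> Dg k"
proof -
 have "g p - p = (\<Sum>m\<in>mons p. Cn (coef p m) * (mon sub m - mon Vr m))"
  unfolding g_expand by (subst (3) mp_expand') (simp add: sum_subtractf right_diff_distrib)
 also have "\<dots> \<in> Dg k"
 proof (rule qideal_sum[OF Dg_ideal], rule qideal_mult[OF Dg_ideal UNIV_I])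
  fix m assume m: "m \<in> mons p"
  show "mon sub m - mon Vr m \<in> Dg k"
  proof (cases "set_mset m \<inter> {..<c} = {}")
   case True thus ?thesis by (simp add: mon_sub_fix)
  next
   case False
   hence "k \<le> size m" using assms m by (auto simp: Ez_def)
   moreover have "mon sub m - mon Vr m \<in> Dg (size m)"
    by (rule Dg_diff[OF _ Dg_mon]) (auto simp: mon_sub Dg_Vr[simplified])
   ultimately show ?thesis by (rule Dg_mono)
  qed
 qed
 finally show ?thesis .
qed

text \<open>A further substitution only changes monomials with eliminated variables, and after
  \<open>N\<close> steps these have degree at least \<open>N\<close>.\<close>

lemma gn_stable: "(g ^^ (N + k)) p - (g ^^ N) p \<in> Dg N"
proof (induction k)
 case (Suc k)
 have "g ((g ^^ (N + k)) p) - (g ^^ (N + k)) p \<in> Dg N"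
  using Ez_g[OF gn_Ez, of "N + k" p] by (rule Dg_mono[rotated]) simp
 from Dg_add[OF this Suc] show ?case by simp
qed simp

lemma gn_coef_stable: "N \<le> M ==> size m < N ==> coef ((g ^^ M) p) m = coef ((g ^^ N) p) m"
 using Dg_coef[OF gn_stable[of N "M - N" p], of m] by (simp add: lookup_minus)

lemma gn_eliminated: assumes j: "j < c" shows "(g ^^ N) (Vr j - G j) \<in> Dg N"
proof -
 have "(g ^^ N) (G j) = (g ^^ (N + 1)) (Vr j)" using j by (simp add: g_def peval_Vr[OF rhm_Cn] sub_def funpow_swap1)
 thus ?thesis using Dg_minus[OF gn_stable[of N 1 "Vr j"]] by (simp add: rhm_diff[OF rhm_gn])
qed

text \<open>Modulo the equations \<open>Vr j = G j\<close> the substitution does nothing. The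
  congruence is kept over a subring of coefficients, since Krull's theorem is applied there.\<close>

lemma g_cong:
 assumes R: "sring R" and V: "{..<c} \<subseteq> V" and GR: "\<And>j. j < c ==> G j \<in> pset R V" and p: "p \<in> pset R V"
 shows "g p \<in> pset R V \<and> g p - p \<in> qspan (pset R V) ((\<lambda>j. Vr j - G j) ` {..<c})"
proof -
 let ?Q = "pset R V" and ?I = "qspan (pset R V) ((\<lambda>j. Vr j - G j) ` {..<c})"
 have Q: "sring ?Q" by (rule sring_pset[OF R])
 have I: "qideal ?Q ?I" by (rule qspan_qideal)
 let ?T = "{p\<in>?Q. g p \<in> ?Q \<and> g p - p \<in> ?I}"
 have "sring ?T" unfolding sring_def
 proof (intro conjI ballI)
  show "1 \<in> ?T" using sring_1[OF Q] qideal_0[OF I] by (simp add: rhm_1[OF rhm_g])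
  fix a b assume ab: "a \<in> ?T" "b \<in> ?T"
  have ab': "a \<in> ?Q" "b \<in> ?Q" "g b \<in> ?Q" "g a - a \<in> ?I" "g b - b \<in> ?I" using ab by auto
  have "(g a - a) - (g b - b) \<in> ?I" by (rule qideal_diff[OF I Q ab'(4,5)])
  moreover have "(g a - a) - (g b - b) = g (a - b) - (a - b)" by (simp add: rhm_diff[OF rhm_g])
  ultimately show "a - b \<in> ?T" using ab by (auto simp: rhm_diff[OF rhm_g] sring_diff[OF Q])
  have "(g a - a) * g b + a * (g b - b) \<in> ?I"
   by (rule qideal_add[OF I qideal_multr[OF I ab'(3,4)] qideal_mult[OF I ab'(1,5)]])
  moreover have "(g a - a) * g b + a * (g b - b) = g (a * b) - a * b" by (simp add: rhm_mult[OF rhm_g] algebra_simps)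
  ultimately show "a * b \<in> ?T" using ab by (auto simp: rhm_mult[OF rhm_g] sring_mult[OF Q])
 qed
 moreover have "Cn a \<in> ?T" if "a \<in> R" for a
  using pset_Cn[OF sring_0[OF R] that] qideal_0[OF I] by (auto simp: g_def peval_Cn[OF rhm_Cn])
 moreover have "Vr i \<in> ?T" if i: "i \<in> V" for i
 proof (cases "i < c")
  case True
  have "- (Vr i - G i) \<in> ?I" by (rule qideal_minus[OF I Q], rule qspan_basic) (use True in auto)
  thus ?thesis using GR pset_Vr[OF R i] True by (simp add: g_def peval_Vr[OF rhm_Cn] sub_def)
 next
  case False
  thus ?thesis using pset_Vr[OF R i] qideal_0[OF I] by (simp add: g_def peval_Vr[OF rhm_Cn] sub_def)
 qed
 ultimately have "?Q \<subseteq> ?T" by (rule pset_least)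
 thus ?thesis using p by blast
qed

lemma gn_cong:
 assumes R: "sring R" and V: "{..<c} \<subseteq> V" and GR: "\<And>j. j < c ==> G j \<in> pset R V" and p: "p \<in> pset R V"
 shows "(g ^^ N) p \<in> pset R V \<and> (g ^^ N) p - p \<in> qspan (pset R V) ((\<lambda>j. Vr j - G j) ` {..<c})"
proof (induction N)
 case 0
 thus ?case using p qideal_0[OF qspan_qideal] by simp
next
 case (Suc N)
 have 1: "g ((g ^^ N) p) \<in> pset R V \<and> g ((g ^^ N) p) - (g ^^ N) p \<in> qspan (pset R V) ((\<lambda>j. Vr j - G j) ` {..<c})"
  by (rule g_cong[OF R V GR conjunct1[OF Suc]])
 have "g ((g ^^ N) p) - (g ^^ N) p + ((g ^^ N) p - p) \<in> qspan (pset R V) ((\<lambda>j. Vr j - G j) ` {..<c})"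
  using 1 Suc by (intro qideal_add[OF qspan_qideal]) auto
 thus ?case using 1 by simp
qed

lemma gn_ideal:
 assumes I: "rideal I" and p: "p \<in> pset I UNIV" shows "(g ^^ N) p \<in> pset I UNIV"
proof (induction N)
 case (Suc N)
 have "g q \<in> pset I UNIV" if "q \<in> pset I UNIV" for q unfolding g_def
  by (rule peval_in_ideal[OF sring_pset[OF sring_UNIV] qideal_pset[OF I]])
   (rule pset_Cn[OF qideal_0[OF I] pset_coef[OF that]], simp add: pset_def)
 thus ?case using Suc by simp
qed (simp add: p)

end

lemma ipow_Vr:
 assumes R: "sring R" and w: "w \<in> pset R {..<n}"
 shows "(\<Sum>m\<in>{m\<in>mons w. N \<le> size m}. term1 m (coef w m)) \<in> ipow (pset R {..<n}) n Vr N"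
 unfolding ipow_def
proof (rule qideal_sum[OF qspan_qideal])
 let ?Q = "pset R {..<n}"
 have Q: "sring ?Q" by (rule sring_pset[OF R])
 fix m assume m: "m \<in> {m\<in>mons w. N \<le> size m}"
 have "\<exists>a b. m = a + b \<and> size a = N"
 proof -
  obtain xs where xs: "m = mset xs" using ex_mset[of m] by auto
  have "m = mset (take N xs) + mset (drop N xs)" by (simp add: xs flip: mset_append)
  moreover have "size (mset (take N xs)) = N" using m xs by simp
  ultimately show ?thesis by blast
 qed
 then obtain a b where ab: "m = a + b" "size a = N" by blast
 have v: "set_mset m \<subseteq> {..<n}" using m pset_vars[OF w] by blast
 have "term1 m (coef w m) = (Cn (coef w m) * mon Vr b) * mon Vr a" by (simp add: term1_eq ab(1) mon_add)
 moreover have "Cn (coef w m) * mon Vr b \<in> ?Q"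
  by (intro sring_mult[OF Q] pset_Cn[OF sring_0[OF R] pset_coef[OF w]] mon_in_sring[OF Q] pset_Vr[OF R]) (use v ab in auto)
 moreover have "mon Vr a \<in> qspan ?Q {mon Vr \<nu> | \<nu>. set_mset \<nu> \<subseteq> {..<n} \<and> size \<nu> = N}"
  by (rule qspan_basic) (use v ab in auto)
 ultimately show "term1 m (coef w m) \<in> qspan ?Q {mon Vr \<nu> | \<nu>. set_mset \<nu> \<subseteq> {..<n} \<and> size \<nu> = N}"
  using qideal_mult[OF qspan_qideal] by simp
qed

text \<open>A relation with coefficients \<open>\<beta> i\<close> in a larger ring specializes to one with coefficients in \<open>S\<close>, keeping a
 non-vanishing linear condition.\<close>

lemma specialize_relation:
 fixes phi :: "'v::comm_ring_1 => 'u::comm_ring_1" and p :: "'k => (nat, 'v) mp"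
 assumes phi: "rhm phi" and S: "sring S" and P: "rideal P" and q: "rprime q" and Pq: "P \<subseteq> q"
  and H: "\<And>(J :: 'k set) \<beta> \<rho>. finite J ==> (\<forall>i\<in>J. \<rho> i \<in> S) ==> (\<Sum>i\<in>J. phi (\<rho> i) * \<beta> i) \<in> P ==> \<exists>i\<in>J. phi (\<rho> i) \<notin> P ==>
   \<exists>\<rho>'. (\<forall>i\<in>J. \<rho>' i \<in> S) \<and> (\<Sum>i\<in>J. phi (\<rho>' i) * \<beta> i) \<in> P \<and> (\<exists>i\<in>J. phi (\<rho>' i) \<notin> q)"
  and fin: "finite I" and pS: "\<And>i m. i \<in> I ==> coef (p i) m \<in> S"
  and rel: "\<And>m. (\<Sum>i\<in>I. phi (coef (p i) m) * \<beta> i) \<in> P"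
  and y: "(\<Sum>i\<in>I. \<beta> i * y i) \<notin> q"
 shows "\<exists>\<kappa>. (\<forall>i\<in>I. \<kappa> i \<in> S) \<and> (\<forall>m. phi (\<Sum>i\<in>I. \<kappa> i * coef (p i) m) \<in> P) \<and> (\<Sum>i\<in>I. phi (\<kappa> i) * y i) \<notin> q"
 using fin pS rel y
proof (induction "card I" arbitrary: I p \<beta> y)
 case 0
 thus ?case using qideal_0[OF rprime_ideal[OF q]] by simp
next
 case (Suc k)
 have fin: "finite I" by fact
 have qi: "rideal q" by (rule rprime_ideal[OF q])
 show ?case
 proof (cases "\<exists>\<rho>. (\<forall>i\<in>I. \<rho> i \<in> S) \<and> (\<Sum>i\<in>I. phi (\<rho> i) * \<beta> i) \<in> P \<and> (\<exists>i\<in>I. phi (\<rho> i) \<notin> P)")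
  \<comment> \<open>No nontrivial relation over \<open>S\<close> holds between the
    \<open>\<beta> i\<close>, so all coefficients of all \<open>p i\<close> vanish modulo
    \<open>P\<close>, and a single index with \<open>y i0 \<notin> q\<close> will do.\<close>
  case False
  have pP: "phi (coef (p i) m) \<in> P" if "i \<in> I" for i m
  proof (rule ccontr)
   assume "phi (coef (p i) m) \<notin> P"
   hence "\<exists>\<rho>. (\<forall>i\<in>I. \<rho> i \<in> S) \<and> (\<Sum>i\<in>I. phi (\<rho> i) * \<beta> i) \<in> P \<and> (\<exists>i\<in>I. phi (\<rho> i) \<notin> P)"
    using Suc.prems(2) Suc.prems(3) that by (intro exI[of _ "\<lambda>i. coef (p i) m"]) auto
   thus False using False by blast
  qed
  obtain i0 where i0: "i0 \<in> I" "y i0 \<notin> q"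
  proof (rule ccontr)
   assume "\<not> thesis"
   hence "\<And>i. i \<in> I ==> y i \<in> q" using that by blast
   hence "(\<Sum>i\<in>I. \<beta> i * y i) \<in> q" by (intro qideal_sum[OF qi] qideal_mult[OF qi UNIV_I])
   thus False using Suc.prems(4) by blast
  qed
  let ?\<kappa> = "\<lambda>i. if i = i0 then 1 else 0 :: 'v"
  have "(\<Sum>i\<in>I. ?\<kappa> i * coef (p i) m) = coef (p i0) m" for m
   using fin i0(1) by (simp add: if_distrib[of "\<lambda>x. x * _"] cong: if_cong)
  moreover have "(\<Sum>i\<in>I. phi (?\<kappa> i) * y i) = y i0"
   using fin i0(1) by (simp add: if_distrib[of phi] rhm_1[OF phi] rhm_0[OF phi] if_distrib[of "\<lambda>x. x * _"] cong: if_cong)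
  ultimately show ?thesis using pP[OF i0(1)] i0(2) sring_0[OF S] sring_1[OF S]
   by (intro exI[of _ ?\<kappa>]) auto
 next
  case True
  then obtain \<rho>0 where "\<forall>i\<in>I. \<rho>0 i \<in> S" "(\<Sum>i\<in>I. phi (\<rho>0 i) * \<beta> i) \<in> P" "\<exists>i\<in>I. phi (\<rho>0 i) \<notin> P" by blast
  from H[OF fin this] obtain \<rho> j where \<rho>: "\<forall>i\<in>I. \<rho> i \<in> S" "(\<Sum>i\<in>I. phi (\<rho> i) * \<beta> i) \<in> P" and j: "j \<in> I" "phi (\<rho> j) \<notin> q" by blast
  define J where "J = I - {j}"
  have J: "finite J" "card J = k" "I = insert j J" "j \<notin> J" using fin j(1) Suc.hyps(2) by (auto simp: J_def)
  \<comment> \<open>Elimination of \<open>\<beta> j\<close> by cross-multiplication. Since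
    \<open>phi (\<rho> j)\<close> is outside \<open>q\<close>, the condition on the
    \<open>y i\<close> survives.\<close>
  define p' where "p' i = Cn (\<rho> j) * p i - Cn (\<rho> i) * p j" for i
  define y' where "y' i = phi (\<rho> j) * y i - phi (\<rho> i) * y j" for i
  have p': "coef (p' i) m = \<rho> j * coef (p i) m - \<rho> i * coef (p j) m" for i m
   by (simp add: p'_def lookup_minus coef_mult_Cn)
  have 1: "coef (p' i) m \<in> S" if "i \<in> J" for i m unfolding p'
   by (rule sring_diff[OF S sring_mult[OF S] sring_mult[OF S]]) (use Suc.prems(2) \<rho>(1) that J(3) in auto)
  let ?r = "\<Sum>i\<in>J. phi (\<rho> i) * \<beta> i"
  have r: "phi (\<rho> j) * \<beta> j + ?r \<in> P" using \<rho>(2) J by simp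
  have 2: "(\<Sum>i\<in>J. phi (coef (p' i) m) * \<beta> i) \<in> P" for m
  proof -
   let ?s = "\<Sum>i\<in>J. phi (coef (p i) m) * \<beta> i"
   have s: "phi (coef (p j) m) * \<beta> j + ?s \<in> P" using Suc.prems(3) J by simp
   have "(\<Sum>i\<in>J. phi (coef (p' i) m) * \<beta> i) = phi (\<rho> j) * ?s - phi (coef (p j) m) * ?r"
    by (simp add: p' rhm_diff[OF phi] rhm_mult[OF phi] sum_distrib_left sum_subtractf right_diff_distrib mult_ac)
   also have "\<dots> = phi (\<rho> j) * (phi (coef (p j) m) * \<beta> j + ?s) - phi (coef (p j) m) * (phi (\<rho> j) * \<beta> j + ?r)"
    by (simp add: algebra_simps)
   also have "\<dots> \<in> P" by (rule qideal_diff[OF P sring_UNIV qideal_mult[OF P UNIV_I s] qideal_mult[OF P UNIV_I r]])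
   finally show ?thesis .
  qed
  have 3: "(\<Sum>i\<in>J. \<beta> i * y' i) \<notin> q"
  proof
   let ?t = "\<Sum>i\<in>J. \<beta> i * y i"
   assume a: "(\<Sum>i\<in>J. \<beta> i * y' i) \<in> q"
   have "phi (\<rho> j) * (\<beta> j * y j + ?t) = (\<Sum>i\<in>J. \<beta> i * y' i) + y j * (phi (\<rho> j) * \<beta> j + ?r)" by (simp add: y'_def sum_subtractf sum_distrib_left algebra_simps)
   also have "\<dots> \<in> q" by (rule qideal_add[OF qi a qideal_mult[OF qi UNIV_I subsetD[OF Pq r]]])
   finally show False using rprime_mult[OF q] j(2) Suc.prems(4) J by auto
  qed
  from Suc.hyps(1)[OF J(2)[symmetric] J(1) 1 2 3] obtain \<kappa> where \<kappa>: "\<forall>i\<in>J. \<kappa> i \<in> S"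
   "\<forall>m. phi (\<Sum>i\<in>J. \<kappa> i * coef (p' i) m) \<in> P" "(\<Sum>i\<in>J. phi (\<kappa> i) * y' i) \<notin> q" by blast
  \<comment> \<open>Back substitution: the value at \<open>j\<close> collects the multiples of
    \<open>p j\<close> that were introduced with \<open>p'\<close>.\<close>
  define \<kappa>' where "\<kappa>' i = (if i = j then - (\<Sum>i\<in>J. \<kappa> i * \<rho> i) else \<rho> j * \<kappa> i)" for i
  have \<kappa>J: "\<kappa>' i = \<rho> j * \<kappa> i" if "i \<in> J" for i using that J(4) by (auto simp: \<kappa>'_def)
  have "(\<Sum>i\<in>I. \<kappa>' i * coef (p i) m) = (\<Sum>i\<in>J. \<kappa> i * coef (p' i) m)" for m
  proof -
   have "(\<Sum>i\<in>I. \<kappa>' i * coef (p i) m) = - (\<Sum>i\<in>J. \<kappa> i * \<rho> i) * coef (p j) m + (\<Sum>i\<in>J. \<rho> j * \<kappa> i * coef (p i) m)"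
    using J by (simp add: \<kappa>J) (simp add: \<kappa>'_def)
   also have "\<dots> = (\<Sum>i\<in>J. \<kappa> i * coef (p' i) m)"
    by (simp add: p' right_diff_distrib sum_subtractf sum_distrib_left mult_ac)
   finally show ?thesis .
  qed
  moreover have "(\<Sum>i\<in>I. phi (\<kappa>' i) * y i) = (\<Sum>i\<in>J. phi (\<kappa> i) * y' i)"
  proof -
   have "(\<Sum>i\<in>I. phi (\<kappa>' i) * y i) = - (\<Sum>i\<in>J. phi (\<kappa> i) * phi (\<rho> i)) * y j + (\<Sum>i\<in>J. phi (\<rho> j) * phi (\<kappa> i) * y i)"
    using J by (simp add: \<kappa>J) (simp add: \<kappa>'_def rhm_minus[OF phi] rhm_sum[OF phi] rhm_mult[OF phi])
   also have "\<dots> = (\<Sum>i\<in>J. phi (\<kappa> i) * y' i)"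
    by (simp add: y'_def right_diff_distrib sum_subtractf sum_distrib_left mult_ac)
   finally show ?thesis .
  qed
  moreover have "\<forall>i\<in>I. \<kappa>' i \<in> S"
  proof
   fix i assume i: "i \<in> I"
   have "(\<Sum>i\<in>J. \<kappa> i * \<rho> i) \<in> S" by (rule sring_sum[OF S sring_mult[OF S]]) (use \<kappa>(1) \<rho>(1) J(3) in auto)
   thus "\<kappa>' i \<in> S" unfolding \<kappa>'_def using sring_minus[OF S] sring_mult[OF S, of "\<rho> j" "\<kappa> i"] \<kappa>(1) \<rho>(1) J(3) i by auto
  qed
  ultimately show ?thesis using \<kappa>(2,3) by (intro exI[of _ \<kappa>']) simp
 qed
qed

section \<open>Local rings of smooth algebras over a valuation domain\<close>

text \<open>\<open>'v\<close> and \<open>'u\<close> stand for rings that surject onto the valuation domain \<open>A = 'v / KA\<close> and onto the local ring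
 \<open>B = 'u / K\<close> with maximal ideal \<open>q\<close>; \<open>B\<close> is the localization at \<open>q\<close> of \<open>A[X] / (F)\<close>, and \<open>Nm\<close> is
 inverse to the Jacobian matrix.\<close>

locale smooth_local =
 fixes phi :: "'v::comm_ring_1 => 'u::comm_ring_1" and KA :: "'v set" and K q :: "'u set"
  and n c :: nat and F :: "nat => (nat, 'v) mp" and x :: "nat => 'u" and Nm :: "nat => nat => (nat, 'v) mp"
 assumes phi: "rhm phi" and KA: "rprime KA"
  and chain: "(\<exists>d. a - b * d \<in> KA) \<or> (\<exists>d. b - a * d \<in> KA)"
  and K: "rideal K" and phiK: "a \<in> KA ==> phi a \<in> K"
  and qI: "rideal q" and Kq: "K \<subseteq> q" and q1: "1 \<notin> q" and unit: "s \<notin> q ==> \<exists>s'. s * s' - 1 \<in> K"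
  and loc: "phi a \<notin> q ==> \<exists>a'. a * a' - 1 \<in> KA"
  and cn: "c \<le> n"
  and F: "j < c ==> F j \<in> pset UNIV {..<n}" and Nm: "i < c ==> k < c ==> Nm i k \<in> pset UNIV {..<n}"
  and P0: "j < c ==> peval phi x (F j) \<in> K"
  and P1: "\<exists>s\<in>pset UNIV {..<n}. \<exists>g\<in>pset UNIV {..<n}. peval phi x s \<notin> q \<and> y * peval phi x s - peval phi x g \<in> K"
  and P2: "g \<in> pset UNIV {..<n} ==> peval phi x g \<in> K ==>
   \<exists>s\<in>pset UNIV {..<n}. peval phi x s \<notin> q \<and> s * g \<in> qspan (pset UNIV {..<n}) (F ` {..<c} \<union> pset KA {..<n})"
  and inv1: "j < c ==> k < c ==> (\<Sum>i<c. mpd i (F j) * Nm i k) - (if j = k then 1 else 0)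
   \<in> qspan (pset UNIV {..<n}) (F ` {..<c} \<union> pset KA {..<n})"
  and inv2: "i < c ==> l < c ==> (\<Sum>k<c. Nm i k * mpd l (F k)) - (if i = l then 1 else 0)
   \<in> qspan (pset UNIV {..<n}) (F ` {..<c} \<union> pset KA {..<n})"
begin

abbreviation "PA \<equiv> pset UNIV {..<n} :: (nat, 'v) mp set"
abbreviation "Rel \<equiv> qspan PA (F ` {..<c} \<union> pset KA {..<n})"

definition E :: "(nat, 'v) mp => 'u" where "E = peval phi x"

lemma rhm_E: "rhm E"
 unfolding E_def by (rule rhm_peval[OF phi])

lemmas E_simps = rhm_0[OF rhm_E] rhm_1[OF rhm_E] rhm_add[OF rhm_E] rhm_diff[OF rhm_E] rhm_mult[OF rhm_E]

lemma E_Cn: "E (Cn a) = phi a" and E_Vr: "E (Vr i) = x i"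
 by (simp_all add: E_def peval_Cn[OF phi] peval_Vr[OF phi])

lemma sring_PA: "sring PA"
 by (rule sring_pset) simp

lemma KAI: "rideal KA"
 by (rule rprime_ideal[OF KA])

lemmas K_0 = qideal_0[OF K] and K_add = qideal_add[OF K] and K_mult = qideal_mult[OF K UNIV_I]
 and K_multr = qideal_multr[OF K UNIV_I] and K_diff = qideal_diff[OF K sring_UNIV] and K_minus = qideal_minus[OF K sring_UNIV]
 and K_sum = qideal_sum[OF K]

lemma E_ideal:
 assumes "rideal I" "p \<in> pset J V" "\<And>a. a \<in> J ==> phi a \<in> I" shows "E p \<in> I"
proof -
 have "\<And>m. phi (coef p m) \<in> I" by (rule assms(3)[OF pset_coef[OF assms(2)]])
 thus ?thesis unfolding E_def by (intro peval_in_ideal[OF sring_UNIV assms(1)]) simp_all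
qed

lemma E_Rel: "p \<in> Rel ==> E p \<in> K"
proof -
 have "qideal PA {p. E p \<in> K}" unfolding qideal_def by (auto simp: E_simps K_0 K_add K_mult)
 moreover have "F ` {..<c} \<union> pset KA {..<n} \<subseteq> {p. E p \<in> K}"
  using P0 E_ideal[OF K _ phiK] by (auto simp: E_def)
 ultimately have "Rel \<subseteq> {p. E p \<in> K}" by (rule qspan_least)
 thus "p \<in> Rel ==> E p \<in> K" by blast
qed

lemma qprime: "rprime q"
 unfolding rprime_def
proof (intro conjI allI impI qI q1)
 fix a b assume ab: "a * b \<in> q"
 show "a \<in> q \<or> b \<in> q"
 proof (rule disjCI)
  assume "b \<notin> q"
  then obtain b' where "b * b' - 1 \<in> K" using unit by blast
  hence "a * (b * b' - 1) \<in> q" using Kq qideal_mult[OF qI] by blast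
  moreover have "b' * (a * b) \<in> q" using qideal_mult[OF qI] ab by blast
  ultimately have "b' * (a * b) - a * (b * b' - 1) \<in> q" using qideal_diff[OF qI sring_UNIV] by blast
  thus "a \<in> q" by (simp add: algebra_simps)
 qed
qed

lemma cancel_unit:
 assumes "rideal I" "K \<subseteq> I" "s \<notin> q" "s * b \<in> I" shows "b \<in> I"
proof -
 obtain s' where s': "s * s' - 1 \<in> K" using unit[OF assms(3)] by blast
 have "s' * (s * b) - b * (s * s' - 1) \<in> I"
  by (rule qideal_diff[OF assms(1) sring_UNIV qideal_mult[OF assms(1) UNIV_I assms(4)]
     qideal_mult[OF assms(1) UNIV_I subsetD[OF assms(2) s']]])
 thus ?thesis by (simp add: algebra_simps)
qed

lemma P1':
 obtains s g where "s \<in> PA" "g \<in> PA" "E s \<notin> q" "b * E s - E g \<in> K"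
 using P1 unfolding E_def by blast

lemma P2':
 assumes "g \<in> PA" "E g \<in> K" obtains s where "s \<in> PA" "E s \<notin> q" "s * g \<in> Rel"
 using P2 assms unfolding E_def by blast

lemma torsion_free:
 assumes ab: "phi a * b \<in> K" and a: "a \<notin> KA" shows "b \<in> K"
proof -
 obtain s g where sg: "s \<in> PA" "g \<in> PA" "E s \<notin> q" "b * E s - E g \<in> K" by (rule P1')
 have aP: "Cn a \<in> PA" by (rule pset_Cn) auto
 have "phi a * E g = phi a * b * E s - phi a * (b * E s - E g)" by (simp add: algebra_simps)
 also have "\<dots> \<in> K" by (rule K_diff[OF K_multr[OF ab] K_mult[OF sg(4)]])
 finally obtain s1 where s1: "s1 \<in> PA" "E s1 \<notin> q" "s1 * (Cn a * g) \<in> Rel" using P2'[OF sring_mult[OF sring_PA aP sg(2)]] by (auto simp: E_simps E_Cn)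
 \<comment> \<open>\<open>Nm\<close> inverts the square Jacobian matrix of the first
   \<open>c\<close> variables; zero rows extend it to a right inverse of the full \<open>c\<close>
   by \<open>n\<close> matrix.\<close>
 let ?N = "\<lambda>i k. if i < c then Nm i k else 0"
 have z: "s1 * g \<in> PA" by (rule sring_mult[OF sring_PA s1(1) sg(2)])
 obtain e where e: "e \<in> qspan PA (F ` {..<c})" "(1 - e) * (s1 * g) \<in> Rel"
 proof (rule standard_smooth_torsion_free[OF KA F _ _ a z, where Nm = ?N])
  show "?N i k \<in> PA" if "i < n" "k < c" for i k using Nm that sring_0[OF sring_PA] by auto
  show "(\<Sum>i<n. mpd i (F j) * ?N i k) - (if j = k then 1 else 0) \<in> Rel" if jk: "j < c" "k < c" for j k
  proof -
   have "(\<Sum>i<n. mpd i (F j) * ?N i k) = (\<Sum>i<c. mpd i (F j) * Nm i k)"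
    by (rule sum.mono_neutral_cong_right) (use cn in auto)
   thus ?thesis using inv1[OF jk] by simp
  qed
  show "Cn a * (s1 * g) \<in> Rel" using s1(3) by (simp add: mult_ac)
 qed
 have "E e \<in> K" using e(1) qspan_mono E_Rel by blast
 moreover have "(1 - E e) * (E s1 * E g) \<in> K" using E_Rel[OF e(2)] by (simp add: E_simps)
 ultimately have "(1 - E e) * (E s1 * E g) + E e * (E s1 * E g) \<in> K" using K_add K_multr by simp
 hence "E s1 * E g \<in> K" by (simp add: algebra_simps)
 hence "E g \<in> K" by (rule cancel_unit[OF K order_refl s1(2)])
 hence "E s * b \<in> K" using K_add[OF sg(4), of "E g"] by (simp add: mult.commute)
 thus ?thesis by (rule cancel_unit[OF K order_refl sg(3)])
qed

lemma phi_KA: "phi a \<in> K \<longleftrightarrow> a \<in> KA"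
 using phiK torsion_free[of a 1] Kq q1 by auto

text \<open>The extension \<open>p B\<close> of an ideal \<open>p\<close> of \<open>A\<close>.\<close>

definition ext :: "'v set => 'u set" where
 "ext p = {b. \<exists>a\<in>p. \<exists>w. b - phi a * w \<in> K}"

text \<open>One product \<open>phi a * w\<close> suffices for each element of p B, since of two
  scalars one divides the other and can be factored out of a sum.\<close>

lemma ext_ideal: assumes p: "rideal p" "KA \<subseteq> p" shows "rideal (ext p)" and "K \<subseteq> ext p"
proof -
 show Kp: "K \<subseteq> ext p"
 proof
  fix b assume "b \<in> K"
  hence "b - phi 0 * 0 \<in> K" by simp
  thus "b \<in> ext p" unfolding ext_def using qideal_0[OF p(1)] by blast
 qed
 show "rideal (ext p)"
 proof (rule qidealI)
  show "0 \<in> ext p" using Kp K_0 by blast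
  fix b b' assume "b \<in> ext p" "b' \<in> ext p"
  then obtain a w a' w' where *: "a \<in> p" "a' \<in> p" "b - phi a * w \<in> K" "b' - phi a' * w' \<in> K" by (auto simp: ext_def)
  have key: "b + b' \<in> ext p" if "a' - a * d \<in> KA" "a \<in> p" "b - phi a * w \<in> K" "b' - phi a' * w' \<in> K" for a a' d b b' w w'
  proof -
   have "b + b' - phi a * (w + phi d * w') = (b - phi a * w) + (b' - phi a' * w') + phi (a' - a * d) * w'"
    by (simp add: rhm_diff[OF phi] rhm_mult[OF phi] algebra_simps)
   also have "\<dots> \<in> K" by (rule K_add[OF K_add[OF that(3,4)] K_multr[OF phiK[OF that(1)]]])
   finally show ?thesis using that(2) by (auto simp: ext_def)
  qed
  from chain[of a a'] show "b + b' \<in> ext p"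
  proof (elim disjE exE)
   fix d assume "a - a' * d \<in> KA"
   from key[OF this *(2,4,3)] show ?thesis by (simp add: add.commute)
  next
   fix d assume "a' - a * d \<in> KA"
   from key[OF this *(1,3,4)] show ?thesis .
  qed
 next
  fix r b assume "b \<in> ext p"
  then obtain a w where *: "a \<in> p" "b - phi a * w \<in> K" by (auto simp: ext_def)
  have "r * b - phi a * (r * w) \<in> K" using K_mult[OF *(2), of r] by (simp add: algebra_simps)
  thus "r * b \<in> ext p" using *(1) by (auto simp: ext_def)
 qed
qed

lemma ext_phi: "a \<in> p ==> phi a \<in> ext p"
 unfolding ext_def using K_0 by (auto intro!: bexI exI[of _ 1])

subsection \<open>Taylor expansion at the generic section\<close>

definition Ts :: "(nat, 'v) mp => (nat, 'u) mp" where
 "Ts = peval (\<lambda>a. Cn (phi a)) (\<lambda>i. Cn (x i) + Vr i)"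

lemma rhm_Cphi: "rhm (\<lambda>a. Cn (phi a) :: (nat, 'u) mp)"
 by (rule rhm_comp[OF rhm_Cn phi])

lemma rhm_Ts: "rhm Ts"
 unfolding Ts_def by (rule rhm_peval[OF rhm_Cphi])

lemma Ts_vars: assumes p: "p \<in> PA" shows "Ts p \<in> pset UNIV {..<n}"
 unfolding Ts_def
proof (rule peval_in_sring[OF sring_pset[OF sring_UNIV]])
 fix m i assume "m \<in> mons p" "i \<in># m"
 thus "Cn (x i) + Vr i \<in> pset UNIV {..<n}" using pset_vars[OF p] by (intro sring_add[OF sring_pset[OF sring_UNIV]] pset_Cn pset_Vr) auto
qed (auto intro!: pset_Cn)

lemma Ts_taylor:
 assumes p: "p \<in> PA" shows "Ts p - (Cn (E p) + (\<Sum>i<n. Cn (E (mpd i p)) * Vr i)) \<in> Dg 2"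
 unfolding Ts_def E_def by (rule taylor1[OF phi _ p Dg_Vr]) simp

lemma coef_term1_sum: "coef (\<Sum>i<(k::nat). Cn (a i) * Vr i) m = (if \<exists>i<k. m = {#i#} then a (THE i. m = {#i#}) else (0 :: 'u))"
proof -
 have "coef (\<Sum>i<k. Cn (a i) * Vr i) m = (\<Sum>i<k. if m = {#i#} then a i else 0)"
  by (simp add: lookup_sum Vr_def Cn_def mult_single lookup_single when_def eq_commute)
 also have "\<dots> = (if \<exists>i<k. m = {#i#} then a (THE i. m = {#i#}) else 0)"
 by auto
 finally show ?thesis .
qed

lemma Ts_const: "p \<in> PA ==> coef (Ts p) {#} = E p"
 using Dg_coef[OF Ts_taylor, of p "{#}"] by (simp add: lookup_minus lookup_add coef_Cn coef_term1_sum)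

lemma Ts_linear: "p \<in> PA ==> i < n ==> coef (Ts p) {#i#} = E (mpd i p)"
 using Dg_coef[OF Ts_taylor, of p "{#i#}"] by (simp add: lookup_minus lookup_add coef_Cn coef_term1_sum)

text \<open>Newton's step: multiplying the expanded equations \<open>Ts (F k)\<close> by the inverse
  Jacobian matrix makes their linear part in the first \<open>c\<close> variables equal to these
  variables modulo \<open>K\<close>, so that the equations take the form
  \<open>Vr j = Gp j\<close>.\<close>

definition Gp :: "nat => (nat, 'u) mp" where
 "Gp j = Vr j - (\<Sum>k<c. Cn (E (Nm j k)) * Ts (F k))"

text \<open>The constant term and the linear terms in the first \<open>c\<close> variables of
  \<open>Gp j\<close> vanish only modulo \<open>K\<close>. Subtracting them makes the hypotheses of
  \<open>elimination\<close> hold exactly.\<close>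

definition Gk :: "nat => (nat, 'u) mp" where
 "Gk j = Cn (coef (Gp j) {#}) + (\<Sum>l<c. Cn (coef (Gp j) {#l#}) * Vr l)"

definition G :: "nat => (nat, 'u) mp" where "G j = Gp j - Gk j"

lemma coef_Gp0: assumes "j < c" shows "coef (Gp j) {#} \<in> K"
proof -
 have "coef (Gp j) {#} = - (\<Sum>k<c. E (Nm j k) * E (F k))"
  by (simp add: Gp_def lookup_minus lookup_sum coef_mult_Cn Ts_const[OF F]) (simp add: Vr_def lookup_single)
 thus ?thesis using P0 by (auto intro!: K_minus K_sum K_mult simp: E_def)
qed

lemma E_inv2: "i < c ==> l < c ==> (\<Sum>k<c. E (Nm i k) * E (mpd l (F k))) - (if i = l then 1 else 0) \<in> K"
 using E_Rel[OF inv2[of i l]] by (simp add: E_simps rhm_sum[OF rhm_E] if_distrib cong: if_cong)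

lemma E_inv1: "j < c ==> k < c ==> (\<Sum>i<c. E (mpd i (F j)) * E (Nm i k)) - (if j = k then 1 else 0) \<in> K"
 using E_Rel[OF inv1[of j k]] by (simp add: E_simps rhm_sum[OF rhm_E] if_distrib cong: if_cong)

lemma coef_Gp1: assumes "j < c" "l < c" shows "coef (Gp j) {#l#} \<in> K"
proof -
 have "coef (Gp j) {#l#} = - ((\<Sum>k<c. E (Nm j k) * E (mpd l (F k))) - (if j = l then 1 else 0))"
  using assms cn by (simp add: Gp_def lookup_minus lookup_sum coef_mult_Cn Ts_linear[OF F])
   (simp add: Vr_def lookup_single)
 thus ?thesis using K_minus[OF E_inv2[OF assms]] by simp
qed

lemma Gp_vars: "j < c ==> Gp j \<in> pset UNIV {..<n}"
 unfolding Gp_def using cn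
 by (intro sring_diff[OF sring_pset[OF sring_UNIV]] sring_sum[OF sring_pset[OF sring_UNIV]]
   sring_mult[OF sring_pset[OF sring_UNIV]] pset_Vr pset_Cn Ts_vars F) auto

lemma Gk_vars: assumes "j < c" shows "Gk j \<in> pset K {..<n}"
proof -
 have I: "qideal (pset UNIV {..<n}) (pset K {..<n})" by (rule qideal_pset[OF K])
 have "Cn (coef (Gp j) {#l#}) * Vr l \<in> pset K {..<n}" if "l < c" for l
  by (rule qideal_multr[OF I pset_Vr[OF sring_UNIV] pset_Cn[OF K_0 coef_Gp1]]) (use that assms cn in auto)
 thus ?thesis unfolding Gk_def
  by (intro qideal_add[OF I] qideal_sum[OF I] pset_Cn[OF K_0] coef_Gp0[OF assms]) auto
qed

lemma G_vars: "j < c ==> G j \<in> pset UNIV {..<n}"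
 unfolding G_def using Gp_vars Gk_vars pset_mono[of K UNIV "{..<n}" "{..<n}"]
 by (intro sring_diff[OF sring_pset[OF sring_UNIV]]) auto

lemma coef_G_small: "coef (G j) {#} = 0" "l < c ==> coef (G j) {#l#} = 0"
 by (auto simp: G_def Gk_def lookup_minus lookup_add coef_Cn coef_term1_sum)

sublocale el: elimination c n G
proof
 fix j assume "j < c"
 show "G j \<in> Dg 1" by (rule DgI) (auto simp: coef_G_small)
 show "G j \<in> Ez c 2" unfolding Ez_def
 proof (intro CollectI ballI impI)
  fix m assume m: "m \<in> mons (G j)" "size m < 2"
  then obtain l where l: "m = {#l#}" using coef_G_small(1) by (cases m) auto
  thus "set_mset m \<inter> {..<c} = {}" using m(1) coef_G_small(2) by auto
 qed
qed

text \<open>Stage \<open>N\<close> of the Taylor expansion in the free coordinates; its coefficients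
  below degree \<open>N\<close> are those of the power series.\<close>

definition tau :: "nat => (nat, 'v) mp => (nat, 'u) mp" where "tau N p = (el.g ^^ N) (Ts p)"

lemma rhm_tau: "rhm (tau N)"
 unfolding tau_def by (rule rhm_comp[OF el.rhm_gn rhm_Ts])

text \<open>Multiplying by the Jacobian matrix undoes the multiplication by \<open>Nm\<close> in
  \<open>Gp\<close>, up to \<open>K\<close>. Together with \<open>G_in_F\<close>, both systems of
  equations generate the same ideal modulo \<open>K\<close>.\<close>

lemma F_in_G: "j < c ==> Ts (F j) \<in> qspan (pset UNIV {..<n}) ((\<lambda>j. Vr j - G j) ` {..<c} \<union> pset K {..<n})"
proof -
 let ?U = "pset UNIV {..<n} :: (nat, 'u) mp set" and ?S = "qspan (pset UNIV {..<n}) ((\<lambda>j. Vr j - G j) ` {..<c} \<union> pset K {..<n})"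
 assume j: "j < c"
 have S: "qideal ?U ?S" by (rule qspan_qideal)
 have U: "sring ?U" by (rule sring_pset) simp
 have KI: "qideal ?U (pset K {..<n})" by (rule qideal_pset[OF K])
 have KS: "pset K {..<n} \<subseteq> ?S" using qspan_base by blast
 have 1: "Vr l - Gp l \<in> ?S" if l: "l < c" for l
 proof -
  have "Vr l - G l \<in> ?S" by (rule qspan_basic) (use l in auto)
  hence "(Vr l - G l) - Gk l \<in> ?S" by (rule qideal_diff[OF S U _ subsetD[OF KS Gk_vars[OF l]]])
  thus ?thesis by (simp add: G_def)
 qed
 have "(\<Sum>l<c. Cn (E (mpd l (F j))) * (Vr l - Gp l)) \<in> ?S"
  by (rule qideal_sum[OF S], rule qideal_mult[OF S]) (use 1 in \<open>auto intro: pset_Cn\<close>)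
 moreover have "(\<Sum>l<c. Cn (E (mpd l (F j))) * (Vr l - Gp l)) = (\<Sum>k<c. Cn (\<Sum>l<c. E (mpd l (F j)) * E (Nm l k)) * Ts (F k))"
  unfolding Gp_def rhm_sum[OF rhm_Cn] sum_distrib_right
  by (subst sum.swap) (simp add: sum_distrib_left Cn_simps mult.assoc)
 moreover have "(\<Sum>k<c. Cn ((\<Sum>l<c. E (mpd l (F j)) * E (Nm l k)) - (if j = k then 1 else 0)) * Ts (F k)) \<in> ?S"
 proof (rule qideal_sum[OF S])
  fix k assume k: "k \<in> {..<c}"
  have "Cn ((\<Sum>l<c. E (mpd l (F j)) * E (Nm l k)) - (if j = k then 1 else 0)) * Ts (F k) \<in> pset K {..<n}"
   by (rule qideal_multr[OF KI Ts_vars[OF F] pset_Cn[OF K_0 E_inv1[OF j]]]) (use k in auto)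
  thus "Cn ((\<Sum>l<c. E (mpd l (F j)) * E (Nm l k)) - (if j = k then 1 else 0)) * Ts (F k) \<in> ?S" using KS by blast
 qed
 moreover have "Ts (F j) = (\<Sum>k<c. Cn (if j = k then 1 else 0) * Ts (F k))"
  using j by (simp add: if_distrib[of Cn] if_distrib[of "\<lambda>x. x * _"] Cn_simps cong: if_cong)
 hence "Ts (F j) = (\<Sum>k<c. Cn (\<Sum>l<c. E (mpd l (F j)) * E (Nm l k)) * Ts (F k))
   - (\<Sum>k<c. Cn ((\<Sum>l<c. E (mpd l (F j)) * E (Nm l k)) - (if j = k then 1 else 0)) * Ts (F k))"
  by (simp add: Cn_simps left_diff_distrib sum_subtractf)
 ultimately show ?thesis using qideal_diff[OF S U] by simp
qed

lemma G_in_F: "j < c ==> Vr j - G j \<in> qspan (pset UNIV {..<n}) ((\<lambda>k. Ts (F k)) ` {..<c} \<union> pset K {..<n})"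
proof -
 assume j: "j < c"
 have "Vr j - G j = (\<Sum>k<c. Cn (E (Nm j k)) * Ts (F k)) + Gk j" by (simp add: G_def Gp_def)
 also have "\<dots> \<in> qspan (pset UNIV {..<n}) ((\<lambda>k. Ts (F k)) ` {..<c} \<union> pset K {..<n})"
  by (rule qideal_add[OF qspan_qideal qspan_sumI qspan_basic]) (use Gk_vars[OF j] in \<open>auto intro: pset_Cn\<close>)
 finally show ?thesis .
qed

end

section \<open>Products of polynomials modulo a prime\<close>

lemma pset_term1: "a \<in> I ==> 0 \<in> I ==> set_mset m \<subseteq> V ==> term1 m a \<in> pset I V"
 by (auto simp: pset_def lookup_single when_def)

lemma Ef_ideal_UNIV: assumes "rideal I" shows "rideal (Ef UNIV I N :: ('i, 'r::comm_ring_1) mp set)"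
 proof (rule qidealI)
 show "0 \<in> (Ef UNIV I N :: ('i, 'r) mp set)" using qideal_0[OF assms] by (simp add: Ef_def pset_def)
 fix p q :: "('i, 'r) mp"
 show "p + q \<in> Ef UNIV I N" if "p \<in> Ef UNIV I N" "q \<in> Ef UNIV I N" by (rule Ef_add[OF sring_UNIV assms that])
 show "p * q \<in> Ef UNIV I N" if "q \<in> Ef UNIV I N"
  using Ef_mult[OF sring_UNIV assms Ef_0 that, of p] by (simp add: pset_def)
qed

text \<open>Extremal monomials: smallest degree, ties broken by the multiset order, which is
  compatible with addition. All other contributions to the coefficient at \<open>m1 + m2\<close> lie
  in \<open>P\<close>, so the product of the two extremal coefficients survives.\<close>

lemma prime_product_coef:
 fixes p p' :: "(nat, 'r::comm_ring_1) mp"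
 assumes P: "rprime P" and 1: "coef p m \<notin> P" "size m < N" and 2: "coef p' m' \<notin> P" "size m' < N'"
 shows "p * p' \<notin> Ef UNIV P (N + N')"
proof -
 have PI: "rideal P" by (rule rprime_ideal[OF P])
 have ex: "\<exists>m1. coef p m1 \<notin> P \<and> size m1 < N \<and> (\<forall>m. coef p m \<notin> P \<longrightarrow> size m1 \<le> size m \<and> (size m = size m1 \<longrightarrow> m1 \<le> m))"
  if "coef p m \<notin> P" "size m < N" for p :: "(nat, 'r) mp" and m N
 proof -
  define A where "A = {m\<in>mons p. coef p m \<notin> P}"
  have A: "m \<in> A \<longleftrightarrow> coef p m \<notin> P" for m using qideal_0[OF PI] by (auto simp: A_def in_keys_iff)
  have finA: "finite A" by (simp add: A_def)
  define s where "s = Min (size ` A)"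
  have s: "s \<in> size ` A" "\<And>m. m \<in> A ==> s \<le> size m" using finA A that(1) by (auto simp: s_def intro!: Min_in)
  define m1 where "m1 = Min {m\<in>A. size m = s}"
  have "m1 \<in> {m\<in>A. size m = s}" unfolding m1_def by (rule Min_in) (use finA s(1) in auto)
  moreover have "m1 \<le> m" if "m \<in> A" "size m = s" for m unfolding m1_def by (rule Min_le) (use finA that in auto)
  moreover have "s < N" using s(2)[of m] that A by auto
  ultimately show ?thesis using s(2) A by (intro exI) auto
 qed
 obtain m1 where m1: "coef p m1 \<notin> P" "size m1 < N" "\<And>m. coef p m \<notin> P ==> size m1 \<le> size m"
  "\<And>m. coef p m \<notin> P ==> size m = size m1 ==> m1 \<le> m" using ex[OF 1] by blast
 obtain m2 where m2: "coef p' m2 \<notin> P" "size m2 < N'" "\<And>m. coef p' m \<notin> P ==> size m2 \<le> size m"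
  "\<And>m. coef p' m \<notin> P ==> size m = size m2 ==> m2 \<le> m" using ex[OF 2] by blast
 have in12: "m1 \<in> mons p" "m2 \<in> mons p'" using m1(1) m2(1) qideal_0[OF PI] by (auto simp: in_keys_iff)
 have other: "coef p a * coef p' b \<in> P" if ab: "a + b = m1 + m2" "(a, b) \<noteq> (m1, m2)" for a b
 proof (rule ccontr)
  assume "coef p a * coef p' b \<notin> P"
  hence nP: "coef p a \<notin> P" "coef p' b \<notin> P" by (auto simp: rprime_mult_iff[OF P])
  have sz: "size a = size m1" "size b = size m2" using arg_cong[OF ab(1), of size] m1(3)[OF nP(1)] m2(3)[OF nP(2)] by auto
  have le: "m1 \<le> a" "m2 \<le> b" using m1(4)[OF nP(1) sz(1)] m2(4)[OF nP(2) sz(2)] by auto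
  have "a \<le> m1"
  proof (rule ccontr)
   assume "\<not> a \<le> m1"
   hence "m1 < a" by simp
   hence "m1 + m2 < a + b" using le(2) by (rule add_less_le_mono)
   thus False using ab(1) by simp
  qed
  thus False using le(1) ab by simp
 qed
 have "coef (p * p') (m1 + m2) = (\<Sum>a\<in>mons p. \<Sum>b\<in>mons p'. if a + b = m1 + m2 then coef p a * coef p' b else 0)"
  by (rule coef_mult)
 also have "\<dots> = (\<Sum>(a, b)\<in>mons p \<times> mons p'. if a + b = m1 + m2 then coef p a * coef p' b else 0)"
  by (rule sum.cartesian_product)
 also have "\<dots> = coef p m1 * coef p' m2 + (\<Sum>(a, b)\<in>mons p \<times> mons p' - {(m1, m2)}. if a + b = m1 + m2 then coef p a * coef p' b else 0)"
  by (subst sum.remove) (use in12 in auto)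
 finally have e: "coef (p * p') (m1 + m2) = coef p m1 * coef p' m2 + (\<Sum>(a, b)\<in>mons p \<times> mons p' - {(m1, m2)}. if a + b = m1 + m2 then coef p a * coef p' b else 0)" .
 have "(\<Sum>(a, b)\<in>mons p \<times> mons p' - {(m1, m2)}. if a + b = m1 + m2 then coef p a * coef p' b else 0) \<in> P"
 proof (rule qideal_sum[OF PI])
  fix i assume "i \<in> mons p \<times> mons p' - {(m1, m2)}"
  then obtain a b where "i = (a, b)" "(a, b) \<noteq> (m1, m2)" by auto
  thus "(case i of (a, b) => if a + b = m1 + m2 then coef p a * coef p' b else 0) \<in> P"
   using other qideal_0[OF PI] by simp
 qed
 from qideal_diff[OF PI sring_UNIV _ this, of "coef (p * p') (m1 + m2)"] have "coef (p * p') (m1 + m2) \<notin> P"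
  using rprime_mult[OF P] m1(1) m2(1) unfolding e by auto
 moreover have "size (m1 + m2) < N + N'" using m1(2) m2(2) by simp
 ultimately show ?thesis unfolding Ef_def by blast
qed

context smooth_local
begin

lemma exists_common_divisor:
 assumes "finite J" "J \<noteq> {}" shows "\<exists>j\<in>J. \<forall>i\<in>J. \<exists>d. \<rho> i - \<rho> j * d \<in> KA"
 using assms
proof (induction J rule: finite_ne_induct)
 case (singleton j)
 have "\<rho> j - \<rho> j * 1 \<in> KA" using qideal_0[OF KAI] by simp
 thus ?case by blast
next
 case (insert i J)
 then obtain j where j: "j \<in> J" "\<forall>k\<in>J. \<exists>d. \<rho> k - \<rho> j * d \<in> KA" by blast
 have tr: "\<exists>d. \<rho> k - \<rho> i * d \<in> KA" if "\<rho> j - \<rho> i * d \<in> KA" "k \<in> J" for k d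
 proof -
  obtain d' where "\<rho> k - \<rho> j * d' \<in> KA" using j(2) \<open>k \<in> J\<close> by blast
  hence "(\<rho> k - \<rho> j * d') + (\<rho> j - \<rho> i * d) * d' \<in> KA"
   using qideal_add[OF KAI] qideal_multr[OF KAI UNIV_I that(1)] by blast
  hence "\<rho> k - \<rho> i * (d * d') \<in> KA" by (simp add: algebra_simps)
  thus ?thesis by blast
 qed
 have refl: "\<exists>d. \<rho> i - \<rho> i * d \<in> KA" using qideal_0[OF KAI] by (intro exI[of _ 1]) simp
 from chain[of "\<rho> i" "\<rho> j"] show ?case
 proof (elim disjE)
  assume "\<exists>d. \<rho> i - \<rho> j * d \<in> KA" thus ?thesis using j by blast
 next
  assume "\<exists>d. \<rho> j - \<rho> i * d \<in> KA" thus ?thesis using tr refl by blast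
 qed
qed

lemma Ts_ideal:
 assumes "rideal I" "\<And>a. a \<in> J ==> phi a \<in> I" "p \<in> pset J V" shows "Ts p \<in> pset I UNIV"
proof -
 have "\<And>m. Cn (phi (coef p m)) \<in> pset I UNIV" by (rule pset_Cn[OF qideal_0[OF assms(1)] assms(2)[OF pset_coef[OF assms(3)]]])
 thus ?thesis unfolding Ts_def
  by (intro peval_in_ideal[OF sring_pset[OF sring_UNIV] qideal_pset[OF assms(1)]]) (auto simp: pset_def)
qed

text \<open>It suffices to look at generators: \<open>Ts (F j)\<close> lies in the ideal of the
  eliminated equations, whose images have order \<open>N\<close>, and coefficients from
  \<open>J\<close> or \<open>K\<close> stay in \<open>I\<close>.\<close>

lemma tau_rel:
 assumes I: "rideal I" "K \<subseteq> I" and J: "\<And>a. a \<in> J ==> phi a \<in> I" and z: "z \<in> qspan PA (F ` {..<c} \<union> pset J {..<n})"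
 shows "tau N z \<in> Ef UNIV I N"
proof -
 have EI: "rideal (Ef UNIV I N :: (nat, 'u) mp set)" by (rule Ef_ideal_UNIV[OF I(1)])
 have pI: "Ef UNIV I N \<supseteq> (pset I UNIV :: (nat, 'u) mp set)" using Ef_ideal by blast
 have DI: "Ef UNIV I N \<supseteq> (Dg N :: (nat, 'u) mp set)" using Ef_Dg[OF sring_UNIV I(1)] by (auto simp: pset_def)
 have gI: "qideal Q {p. (el.g ^^ N) p \<in> Ef UNIV I N}" for Q
  using EI unfolding qideal_def by (auto simp: rhm_0[OF el.rhm_gn] rhm_add[OF el.rhm_gn] rhm_mult[OF el.rhm_gn])
 have "(\<lambda>j. Vr j - G j) ` {..<c} \<union> pset K {..<n} \<subseteq> {p. (el.g ^^ N) p \<in> Ef UNIV I N}"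
 proof (intro Un_least subsetI; clarify)
  fix j assume "j < c"
  thus "(el.g ^^ N) (Vr j - G j) \<in> Ef UNIV I N" using el.gn_eliminated DI by blast
 next
  fix p assume "p \<in> pset K {..<n}"
  thus "(el.g ^^ N) p \<in> Ef UNIV I N" using pset_mono[OF I(2), of "{..<n}" UNIV] using el.gn_ideal[OF I(1)] pI by blast
 qed
 hence FE: "(el.g ^^ N) (Ts (F j)) \<in> Ef UNIV I N" if "j < c" for j
  using F_in_G[OF that] qspan_least[OF gI] by blast
 have "qideal PA {p. tau N p \<in> Ef UNIV I N}"
  using EI unfolding qideal_def by (auto simp: rhm_0[OF rhm_tau] rhm_add[OF rhm_tau] rhm_mult[OF rhm_tau])
 moreover have "F ` {..<c} \<union> pset J {..<n} \<subseteq> {p. tau N p \<in> Ef UNIV I N}"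
 proof (intro Un_least subsetI; clarify)
  fix j assume "j < c" thus "tau N (F j) \<in> Ef UNIV I N" using FE by (simp add: tau_def)
 next
  fix p assume "p \<in> pset J {..<n}"
  thus "tau N p \<in> Ef UNIV I N" using Ts_ideal[OF I(1) J] unfolding tau_def using el.gn_ideal[OF I(1)] pI by blast
 qed
 ultimately show ?thesis using qspan_least z by blast
qed

text \<open>The Taylor expansion \<open>B / pB \<rightarrow> (B / P)[[Z]]\<close> is injective for every prime \<open>P\<close> of \<open>B\<close> above \<open>p\<close>.\<close>

lemma taylor_injective:
 assumes P: "rprime P" "K \<subseteq> P" "P \<subseteq> q" and z: "z \<in> PA" and hyp: "\<And>N. tau N z \<in> Ef UNIV P N"
 shows "E z \<in> ext {a. phi a \<in> P}"
proof -
 have PI: "rideal P" by (rule rprime_ideal[OF P(1)])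
 let ?p = "{a. phi a \<in> P}" and ?U = "pset UNIV {..<n} :: (nat, 'u) mp set"
 have U: "sring ?U" by (rule sring_pset) simp
 let ?D = "(\<lambda>j. Vr j - G j) ` {..<c}"
 have "finite (insert (Ts z) (G ` {..<c}))" "insert (Ts z) (G ` {..<c}) \<subseteq> ?U" using Ts_vars[OF z] G_vars by auto
 then obtain R where R: "sring R" and noe: "noeth (pset R {..<n}) {} {1 :: (nat, 'u) mp}" and sub: "insert (Ts z) (G ` {..<c}) \<subseteq> pset R {..<n}"
  by (rule fg_subring)
 let ?Q = "pset R {..<n}"
 have Q: "sring ?Q" by (rule sring_pset[OF R])
 have QU: "?Q \<subseteq> ?U" by (rule pset_mono) auto
 have zQ: "Ts z \<in> ?Q" and GQ: "\<And>j. j < c ==> G j \<in> ?Q" using sub by auto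
 have VQ: "Vr i \<in> ?Q" if "i < n" for i by (rule pset_Vr[OF R]) (use that in simp)
 define Fd where "Fd = qspan ?Q (?D \<union> pset P {..<n} \<inter> ?Q)"
 have Fd: "qideal ?Q Fd" unfolding Fd_def by (rule qspan_qideal)
 have FdQ: "Fd \<subseteq> ?Q" using GQ VQ cn sring_diff[OF Q] unfolding Fd_def by (intro qspan_least[OF qideal_sring[OF Q]]) auto
 \<comment> \<open>Stage \<open>N\<close> of the expansion is congruent to \<open>Ts z\<close>
   modulo the equations; its part below degree \<open>N\<close> has coefficients in \<open>P\<close>
   by hypothesis, and the rest is in the \<open>N\<close>-th power of the ideal of the
   variables.\<close>
 have app: "\<exists>y\<in>ipow ?Q n Vr N. Ts z - y \<in> Fd" for N
 proof -
  define w where "w = (el.g ^^ N) (Ts z)"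
  have w: "w \<in> ?Q" "w - Ts z \<in> qspan ?Q ?D"
   using el.gn_cong[OF R, of "{..<n}" "Ts z" N] cn GQ zQ by (auto simp: w_def)
  have wP: "coef w m \<in> P" if "size m < N" for m using hyp that by (auto simp: w_def tau_def Ef_def)
  let ?y = "\<Sum>m\<in>{m\<in>mons w. N \<le> size m}. term1 m (coef w m)" and ?l = "\<Sum>m\<in>{m\<in>mons w. size m < N}. term1 m (coef w m)"
  have wl: "w = ?l + ?y"
  proof -
   have "mons w = {m\<in>mons w. size m < N} \<union> {m\<in>mons w. N \<le> size m}" by auto
   thus ?thesis using mp_expand by (subst sum.union_disjoint[symmetric]) auto
  qed
  have lF: "?l \<in> Fd"
  proof (rule qideal_sum[OF Fd])
   fix m assume m: "m \<in> {m\<in>mons w. size m < N}"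
   have "term1 m (coef w m) \<in> pset P {..<n} \<inter> ?Q"
    using m wP pset_coef[OF w(1)] pset_vars[OF w(1)] sring_0[OF R] qideal_0[OF PI] by (auto intro!: pset_term1)
   thus "term1 m (coef w m) \<in> Fd" unfolding Fd_def by (intro qspan_basic) blast
  qed
  have "w - Ts z \<in> Fd" using w(2) qspan_mono unfolding Fd_def by blast
  hence "?l - (w - Ts z) \<in> Fd" by (rule qideal_diff[OF Fd Q lF])
  moreover have "Ts z - ?y = ?l - (w - Ts z)" using wl by (simp add: algebra_simps)
  ultimately have "Ts z - ?y \<in> Fd" by (simp only:)
  thus ?thesis using ipow_Vr[OF R w(1), of N] by blast
 qed
 obtain e where e: "e \<in> ?Q" "e \<in> qspan ?Q (Vr ` {..<n})" "(1 - e) * Ts z \<in> Fd"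
  by (rule krull_intersection[OF Q noe Fd FdQ VQ zQ app])
 define s where "s = 1 - e"
 have "qspan ?Q (Vr ` {..<n}) \<subseteq> Dg 1" by (rule qspan_least[OF qideal_mono[OF Dg_ideal] image_subsetI[OF Dg_Vr]]) simp
 hence e0: "coef e {#} = 0" using e(2) Dg_coef by auto
 have s0: "coef s {#} = 1" by (simp add: s_def lookup_minus e0)
 let ?H = "qspan ?U ((\<lambda>k. Ts (F k)) ` {..<c} \<union> pset P {..<n})"
 have H: "qideal ?U ?H" by (rule qspan_qideal)
 have "Fd \<subseteq> qspan ?U (?D \<union> pset P {..<n})" unfolding Fd_def by (rule qspan_mono2[OF QU]) blast
 also have "\<dots> \<subseteq> ?H"
 proof (rule qspan_least[OF H], intro Un_least subsetI)
  fix v assume "v \<in> ?D"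
  then obtain j where "j < c" "v = Vr j - G j" by auto
  thus "v \<in> ?H" using G_in_F qspan_mono[of "(\<lambda>k. Ts (F k)) ` {..<c} \<union> pset K {..<n}" "(\<lambda>k. Ts (F k)) ` {..<c} \<union> pset P {..<n}" ?U]
    pset_mono[OF P(2), of "{..<n}" "{..<n}"] by blast
 next
  fix v assume "v \<in> pset P {..<n}" thus "v \<in> ?H" by (intro qspan_basic) blast
 qed
 finally have "s * Ts z \<in> ?H" using e(3) by (auto simp: s_def)
 hence "\<exists>qq. (\<forall>k\<in>{..<c}. qq k \<in> ?U) \<and> s * Ts z - (\<Sum>k<c. qq k * Ts (F k)) \<in> qspan ?U (pset P {..<n})"
  by (intro qspan_finite[OF U]) auto
 then obtain qq where qq: "s * Ts z - (\<Sum>k<c. qq k * Ts (F k)) \<in> pset P {..<n}"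
  using qspan_least[OF qideal_pset[OF PI, of "{..<n}"] order_refl] by blast
 \<comment> \<open>Translation back from Z to X - x, which turns \<open>Ts p\<close> into
   \<open>p\<close> with its coefficients mapped by \<open>phi\<close>. What results is a relation
   between \<open>z\<close> and the \<open>F k\<close> with coefficients in B, modulo
   \<open>P\<close>, in which the multiplier of \<open>z\<close> has the value 1 at
   \<open>x\<close>.\<close>
 define Us where "Us = peval Cn (\<lambda>i. Vr i - Cn (x i) :: (nat, 'u) mp)"
 define ph where "ph = peval (\<lambda>a. Cn (phi a)) (Vr :: nat => (nat, 'u) mp)"
 have rU: "rhm Us" unfolding Us_def by (rule rhm_peval[OF rhm_Cn])
 have rp: "rhm ph" unfolding ph_def by (rule rhm_peval[OF rhm_Cphi])
 have UT: "Us (Ts p) = ph p" for p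
 proof -
  have "Us (Ts p) = peval (\<lambda>a. Us (Cn (phi a))) (\<lambda>i. Us (Cn (x i) + Vr i)) p"
   unfolding Ts_def by (rule peval_rhm[OF rU])
  also have "\<dots> = ph p"
  proof -
   have "Us (Cn b) = Cn b" for b unfolding Us_def by (rule peval_Cn[OF rhm_Cn])
   moreover have "Us (Vr i) = Vr i - Cn (x i)" for i unfolding Us_def by (rule peval_Vr[OF rhm_Cn])
   ultimately show ?thesis unfolding ph_def by (simp add: rhm_add[OF rU])
  qed
  finally show ?thesis .
 qed
 have phc: "coef (ph p) m = phi (coef p m)" for p m
 proof (induction p rule: mp_induct)
  case (add p p') thus ?case by (simp add: rhm_add[OF rp] lookup_add rhm_add[OF phi])
 next
  case (term1 k a)
  show ?case by (simp add: ph_def peval_term1[OF rhm_Cphi] term1_eq[symmetric] lookup_single when_def rhm_0[OF phi])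
 qed
 \<comment> \<open>Bookkeeping of this relation: \<open>None\<close> marks the multiples of
   \<open>z\<close> and \<open>Some k\<close> those of \<open>F k\<close>. An index carries a
   monomial of the multiplier; \<open>\<beta>\<close> is its coefficient in B, \<open>pp\<close> the
   polynomial over A that it multiplies, and \<open>y\<close> its value at \<open>x\<close>, set to
   0 for the multiples of \<open>F k\<close>, which vanish there.\<close>
 define poly where "poly o' = (case o' of None => Us s | Some k => - Us (qq k))" for o'
 define base where "base o' = (case o' of None => z | Some k => F k)" for o'
 let ?O = "insert None (Some ` {..<c})"
 define I where "I = (SIGMA o':?O. mons (poly o'))"
 define \<beta> where "\<beta> i = coef (poly (fst i)) (snd i)" for i
 define pp where "pp i = mon Vr (snd i) * base (fst i)" for i
 define y where "y i = (if fst i = None then mon x (snd i) else 0)" for i :: "nat option \<times> nat multiset"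
 have finI: "finite I" by (simp add: I_def)
 have sumI: "(\<Sum>i\<in>I. h i) = (\<Sum>o'\<in>?O. \<Sum>m\<in>mons (poly o'). h (o', m))" for h :: "nat option \<times> nat multiset => 't::comm_monoid_add"
  unfolding I_def by (subst sum.Sigma) auto
 have sumO: "(\<Sum>o'\<in>?O. h o') = h None + (\<Sum>k<c. h (Some k))" for h :: "nat option => 't::comm_monoid_add"
  by (subst sum.insert) (auto simp: sum.reindex)
 have rel: "(\<Sum>i\<in>I. phi (coef (pp i) m) * \<beta> i) \<in> P" for m
 proof -
  have "(\<Sum>i\<in>I. phi (coef (pp i) m) * \<beta> i) = coef (\<Sum>i\<in>I. Cn (\<beta> i) * ph (pp i)) m"
   by (simp add: lookup_sum coef_mult_Cn phc mult.commute)
  also have "(\<Sum>i\<in>I. Cn (\<beta> i) * ph (pp i)) = (\<Sum>o'\<in>?O. poly o' * ph (base o'))"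
  proof -
   have "ph (Vr i) = Vr i" for i unfolding ph_def by (rule peval_Vr[OF rhm_Cphi])
   hence "ph (mon Vr m) = mon Vr m" for m by (simp add: rhm_mon[OF rp])
   hence "(\<Sum>m\<in>mons (poly o'). Cn (\<beta> (o', m)) * ph (pp (o', m))) = poly o' * ph (base o')" for o'
    unfolding \<beta>_def pp_def using mp_expand'[of "poly o'"]
    by (simp add: rhm_mult[OF rp] mult.assoc[symmetric] flip: sum_distrib_right)
   thus ?thesis unfolding sumI by simp
  qed
  also have "\<dots> = Us (s * Ts z - (\<Sum>k<c. qq k * Ts (F k)))"
   unfolding sumO by (simp add: poly_def base_def rhm_diff[OF rU] rhm_mult[OF rU] rhm_sum[OF rU] UT sum_negf)
  also have "coef \<dots> m \<in> P"
  proof -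
   have "Us v \<in> pset P UNIV" if v: "v \<in> pset P {..<n}" for v
   proof -
    have "\<And>m. Cn (coef v m) \<in> pset P UNIV" by (rule pset_Cn[OF qideal_0[OF PI] pset_coef[OF v]])
    thus ?thesis unfolding Us_def
     by (intro peval_in_ideal[OF sring_pset[OF sring_UNIV] qideal_pset[OF PI]]) (auto simp: pset_def)
   qed
   thus ?thesis using qq pset_coef by blast
  qed
  finally show ?thesis .
 qed
 have y1: "(\<Sum>i\<in>I. \<beta> i * y i) \<notin> q"
 proof -
  have "(\<Sum>i\<in>I. \<beta> i * y i) = (\<Sum>m\<in>mons (Us s). coef (Us s) m * mon x m)"
   unfolding sumI sumO by (simp add: \<beta>_def y_def poly_def)
  also have "\<dots> = peval (\<lambda>a. a) x (Us s)" by (simp add: peval_def)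
  also have "\<dots> = peval (\<lambda>a. peval (\<lambda>a. a) x (Cn a)) (\<lambda>i. peval (\<lambda>a. a) x (Vr i - Cn (x i))) s"
   unfolding Us_def by (rule peval_peval[OF rhm_id rhm_Cn])
  also have "\<dots> = peval (\<lambda>a. a) (\<lambda>_. 0) s"
   by (simp add: peval_Cn[OF rhm_id] peval_Vr[OF rhm_id] rhm_diff[OF rhm_peval[OF rhm_id]])
  also have "\<dots> = coef s {#}"
  proof -
   have "mon (\<lambda>_. 0 :: 'u) m = 0" if "m \<noteq> {#}" for m :: "nat multiset" using that by (cases m) (auto simp: mon_add_mset)
   hence "peval (\<lambda>a. a) (\<lambda>_. 0) s = (\<Sum>m\<in>mons s. if m = {#} then coef s m else 0)"
    unfolding peval_def by (intro sum.cong) auto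
   thus ?thesis by (simp add: in_keys_iff)
  qed
  finally show ?thesis using q1 by (simp add: s0)
 qed
 \<comment> \<open>Over a valuation ring a relation is divided by a common divisor of its
   coefficients; the divisor is outside the prime \<open>P\<close>, and one quotient is 1.\<close>
 have Hyp: "\<exists>\<rho>'. (\<forall>i\<in>J. \<rho>' i \<in> UNIV) \<and> (\<Sum>i\<in>J. phi (\<rho>' i) * \<beta> i) \<in> P \<and> (\<exists>i\<in>J. phi (\<rho>' i) \<notin> q)"
  if J: "finite J" "(\<Sum>i\<in>J. phi (\<rho> i) * \<beta> i) \<in> P" "\<exists>i\<in>J. phi (\<rho> i) \<notin> P"
  for J :: "(nat option \<times> nat multiset) set" and \<beta> \<rho>
 proof -
  obtain j where j: "j \<in> J" "\<forall>i\<in>J. \<exists>d. \<rho> i - \<rho> j * d \<in> KA" using exists_common_divisor[OF J(1), of \<rho>] J(3) by blast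
  from bchoice[OF j(2)] obtain d0 where d0: "\<And>i. i \<in> J ==> \<rho> i - \<rho> j * d0 i \<in> KA" by blast
  define d where "d = d0(j := 1)"
  have d: "\<rho> i - \<rho> j * d i \<in> KA" if "i \<in> J" for i using d0[OF that] qideal_0[OF KAI] by (auto simp: d_def)
  have d': "phi (\<rho> i) - phi (\<rho> j) * phi (d i) \<in> P" if "i \<in> J" for i
   using phiK[OF d[OF that]] P(2) by (auto simp: rhm_diff[OF phi] rhm_mult[OF phi])
  have jP: "phi (\<rho> j) \<notin> P"
  proof
   assume "phi (\<rho> j) \<in> P"
   hence "phi (\<rho> i) \<in> P" if "i \<in> J" for i
    using qideal_cong[OF PI d'[OF that] qideal_multr[OF PI UNIV_I]] by blast
   thus False using J(3) by blast
  qed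
  have "phi (\<rho> j) * (\<Sum>i\<in>J. phi (d i) * \<beta> i) = (\<Sum>i\<in>J. phi (\<rho> i) * \<beta> i) - (\<Sum>i\<in>J. (phi (\<rho> i) - phi (\<rho> j) * phi (d i)) * \<beta> i)"
   by (simp add: left_diff_distrib sum_subtractf sum_distrib_left mult.assoc)
  also have "\<dots> \<in> P" by (rule qideal_diff[OF PI sring_UNIV J(2) qideal_sum[OF PI qideal_multr[OF PI UNIV_I d']]])
  finally have "(\<Sum>i\<in>J. phi (d i) * \<beta> i) \<in> P" using rprime_mult[OF P(1)] jP by blast
  moreover have "phi (d j) \<notin> q" using q1 by (simp add: d_def rhm_1[OF phi])
  ultimately show ?thesis using j(1) by (intro exI) auto
 qed
 have "\<exists>\<kappa>. (\<forall>i\<in>I. \<kappa> i \<in> UNIV) \<and> (\<forall>m. phi (\<Sum>i\<in>I. \<kappa> i * coef (pp i) m) \<in> P) \<and> (\<Sum>i\<in>I. phi (\<kappa> i) * y i) \<notin> q"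
  by (rule specialize_relation[OF phi sring_UNIV PI qprime P(3) Hyp finI UNIV_I rel y1])
 then obtain \<kappa> where \<kappa>: "\<And>m. phi (\<Sum>i\<in>I. \<kappa> i * coef (pp i) m) \<in> P" "(\<Sum>i\<in>I. phi (\<kappa> i) * y i) \<notin> q" by blast
 have pI: "rideal ?p" "KA \<subseteq> ?p" using PI P(2) phiK unfolding qideal_def
  by (auto simp: rhm_0[OF phi] rhm_add[OF phi] rhm_mult[OF phi])
 have xI: "rideal (ext ?p)" "K \<subseteq> ext ?p" by (rule ext_ideal[OF pI])+
 \<comment> \<open>The specialized relation has coefficients in the trace of \<open>P\<close> on A.
   Its value at \<open>x\<close> is \<open>E z\<close> times a unit, since the terms with
   \<open>F k\<close> vanish at \<open>x\<close>.\<close>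
 define w where "w = (\<Sum>i\<in>I. Cn (\<kappa> i) * pp i)"
 have "w \<in> pset ?p UNIV" using \<kappa>(1) by (auto simp: pset_def w_def lookup_sum coef_mult_Cn)
 hence "E w \<in> ext ?p" by (rule E_ideal[OF xI(1) _ ext_phi])
 moreover have "E w - (\<Sum>i\<in>I. phi (\<kappa> i) * y i) * E z \<in> K"
 proof -
  have "E w - (\<Sum>i\<in>I. phi (\<kappa> i) * y i) * E z = (\<Sum>i\<in>I. phi (\<kappa> i) * (E (pp i) - y i * E z))"
   by (simp add: w_def rhm_sum[OF rhm_E] E_simps E_Cn sum_distrib_right right_diff_distrib sum_subtractf mult.assoc)
  also have "\<dots> \<in> K"
  proof (rule K_sum, rule K_mult)
   fix i assume i: "i \<in> I"
   have m: "E (mon Vr (snd i)) = mon x (snd i)" by (simp add: rhm_mon[OF rhm_E] E_Vr)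
   show "E (pp i) - y i * E z \<in> K"
   proof (cases "fst i")
    case None thus ?thesis by (simp add: pp_def base_def y_def E_simps m K_0)
   next
    case (Some k)
    hence "k < c" using i by (auto simp: I_def)
    thus ?thesis using Some P0 K_mult by (simp add: pp_def base_def y_def E_simps) (simp add: E_def)
   qed
  qed
  finally show ?thesis .
 qed
 ultimately have "E w - (E w - (\<Sum>i\<in>I. phi (\<kappa> i) * y i) * E z) \<in> ext ?p"
  by (rule qideal_diff[OF xI(1) sring_UNIV _ subsetD[OF xI(2)]])
 thus ?thesis using cancel_unit[OF xI \<kappa>(2)] by simp
qed

lemma prime_le_max: "rprime p ==> KA \<subseteq> p ==> a \<in> p ==> phi a \<in> q"
proof (rule ccontr)
 assume p: "rprime p" "KA \<subseteq> p" "a \<in> p" and "phi a \<notin> q"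
 then obtain a' where "a * a' - 1 \<in> KA" using loc by blast
 hence "a * a' - (a * a' - 1) \<in> p"
  using p(2,3) qideal_diff[OF rprime_ideal[OF p(1)] sring_UNIV] qideal_multr[OF rprime_ideal[OF p(1)] UNIV_I p(3)] by blast
 thus False using rprime_1[OF p(1)] by simp
qed

text \<open>There is a prime \<open>P\<close> of B above p, possibly larger than p B. By
  \<open>taylor_injective\<close> the Taylor expansion embeds B / p B into power series over B / P,
  a domain; truncations and \<open>prime_product_coef\<close> replace the power series.\<close>

theorem ext_prime:
 assumes p: "rprime p" "KA \<subseteq> p" and yy: "y * y' \<in> ext p"
 shows "y \<in> ext p \<or> y' \<in> ext p"
proof -
 have pI: "rideal p" by (rule rprime_ideal[OF p(1)])
 have xI: "rideal (ext p)" "K \<subseteq> ext p" by (rule ext_ideal[OF pI p(2)])+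
 let ?S = "phi ` (- p)"
 \<comment> \<open>Otherwise w \<in> p B for a scalar w outside p. Then w divides some a of p in A,
   it cancels by torsion-freeness, and 1 becomes a multiple of an element of the maximal
   ideal.\<close>
 have dis: "ext p \<inter> ?S = {}"
 proof (rule ccontr)
  assume "ext p \<inter> ?S \<noteq> {}"
  then obtain w a b where w: "w \<notin> p" "a \<in> p" "phi w - phi a * b \<in> K" by (auto simp: ext_def)
  from chain[of w a] show False
  proof (elim disjE exE)
   fix d assume "w - a * d \<in> KA"
   thus False using p(2) w(2) qideal_cong[OF pI] qideal_multr[OF pI UNIV_I] w(1) by blast
  next
   fix d assume d: "a - w * d \<in> KA"
   have "a - (a - w * d) \<in> p" by (rule qideal_diff[OF pI sring_UNIV w(2) subsetD[OF p(2) d]])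
   hence dp: "d \<in> p" using rprime_mult[OF p(1)] w(1) by auto
   have "phi w * (1 - phi d * b) = (phi w - phi a * b) + phi (a - w * d) * b"
    by (simp add: rhm_diff[OF phi] rhm_mult[OF phi] algebra_simps)
   also have "\<dots> \<in> K" by (rule K_add[OF w(3) K_multr[OF phiK[OF d]]])
   finally have "1 - phi d * b \<in> K" by (rule torsion_free) (use w(1) p(2) in blast)
   hence "(1 - phi d * b) + phi d * b \<in> q" using Kq qideal_multr[OF qI UNIV_I prime_le_max[OF p dp]]
    by (intro qideal_add[OF qI]) auto
   thus False using q1 by simp
  qed
 qed
 have S1: "1 \<in> ?S" using rprime_1[OF p(1)] by (intro image_eqI) (auto simp: rhm_1[OF phi])
 have Sm: "a * b \<in> ?S" if ab: "a \<in> ?S" "b \<in> ?S" for a b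
 proof -
  obtain a' b' where "a' \<notin> p" "b' \<notin> p" "a = phi a'" "b = phi b'" using ab by blast
  hence "a * b = phi (a' * b')" "a' * b' \<notin> p" by (auto simp: rhm_mult[OF phi] rprime_mult_iff[OF p(1)])
  thus ?thesis by blast
 qed
 obtain P where P: "rprime P" "ext p \<subseteq> P" "P \<inter> ?S = {}" by (rule exists_prime_avoiding[OF xI(1) S1 Sm dis])
 have PI: "rideal P" by (rule rprime_ideal[OF P(1)])
 have KP: "K \<subseteq> P" using xI(2) P(2) by blast
 have Pq: "P \<subseteq> q"
 proof (rule subsetI, rule ccontr)
  fix s assume s: "s \<in> P" "s \<notin> q"
  thus False using cancel_unit[OF PI KP s(2), of 1] rprime_1[OF P(1)] by simp
 qed
 have pP: "{a. phi a \<in> P} = p" using P(2,3) ext_phi by blast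
 have inj: "E z \<in> ext p" if "z \<in> PA" "\<And>N. tau N z \<in> Ef UNIV P N" for z
  using taylor_injective[OF P(1) KP Pq that] unfolding pP .
 obtain s g where sg: "s \<in> PA" "g \<in> PA" "E s \<notin> q" "y * E s - E g \<in> K" by (rule P1')
 obtain s' g' where sg': "s' \<in> PA" "g' \<in> PA" "E s' \<notin> q" "y' * E s' - E g' \<in> K" by (rule P1')
 obtain a b where ab: "a \<in> p" "y * y' - phi a * b \<in> K" using yy by (auto simp: ext_def)
 obtain t h where th: "t \<in> PA" "h \<in> PA" "E t \<notin> q" "b * E t - E h \<in> K" by (rule P1')
 \<comment> \<open>The relation y y' = a b with all denominators cleared.\<close>
 let ?Z = "t * (g * g') - Cn a * (s * (s' * h))"
 have aP: "Cn a \<in> PA" by (rule pset_Cn) auto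
 have "E ?Z \<in> K"
 proof -
  have "E ?Z = E t * E s * E s' * (y * y' - phi a * b) + phi a * E s * E s' * (b * E t - E h)
    - E t * E s' * y' * (y * E s - E g) - E t * E g * (y' * E s' - E g')"
   by (simp add: E_simps E_Cn algebra_simps)
  also have "\<dots> \<in> K"
   by (rule K_diff[OF K_diff[OF K_add[OF K_mult[OF ab(2)] K_mult[OF th(4)]] K_mult[OF sg(4)]] K_mult[OF sg'(4)]])
  finally show ?thesis .
 qed
 moreover have "?Z \<in> PA"
  by (intro sring_diff[OF sring_PA] sring_mult[OF sring_PA] aP sg(1,2) sg'(1,2) th(1,2))
 ultimately obtain r where r: "r \<in> PA" "E r \<notin> q" "r * ?Z \<in> Rel" using P2' by blast
 define u where "u = r * t * g"
 have uP: "u \<in> PA" unfolding u_def by (intro sring_mult[OF sring_PA] r(1) th(1) sg(2))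
 have rel: "u * g' \<in> qspan PA (F ` {..<c} \<union> pset p {..<n})"
 proof -
  let ?J = "qspan PA (F ` {..<c} \<union> pset p {..<n})"
  have "Rel \<subseteq> ?J" using pset_mono[OF p(2), of "{..<n}" "{..<n}"] by (intro qspan_mono) blast
  hence 1: "r * ?Z \<in> ?J" using r(3) by blast
  have "r * (s * (s' * h)) \<in> PA" by (intro sring_mult[OF sring_PA] r(1) sg(1) sg'(1) th(2))
  hence "r * (s * (s' * h)) * Cn a \<in> pset p {..<n}"
   by (rule qideal_mult[OF qideal_pset[OF pI] _ pset_Cn[OF qideal_0[OF pI] ab(1)]])
  hence "r * (s * (s' * h)) * Cn a \<in> ?J" by (intro qspan_basic) blast
  from qideal_add[OF qspan_qideal 1 this] show ?thesis by (simp add: u_def algebra_simps)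
 qed
 have "E u \<in> ext p \<or> E g' \<in> ext p"
 proof (rule ccontr)
  assume no: "\<not> ?thesis"
  obtain N1 where "tau N1 u \<notin> Ef UNIV P N1" using no inj[OF uP] by blast
  then obtain m1 where m1: "size m1 < N1" "coef (tau N1 u) m1 \<notin> P" by (auto simp: Ef_def pset_def)
  obtain N2 where "tau N2 g' \<notin> Ef UNIV P N2" using no inj[OF sg'(2)] by blast
  then obtain m2 where m2: "size m2 < N2" "coef (tau N2 g') m2 \<notin> P" by (auto simp: Ef_def pset_def)
  \<comment> \<open>Both nonvanishing coefficients are read off at one common stage, which is
    possible because coefficients below degree \<open>N1\<close> and \<open>N2\<close>,
    respectively, no longer change.\<close>
  let ?N = "N1 + N2"
  have "coef (tau ?N u) m1 \<notin> P" "coef (tau ?N g') m2 \<notin> P"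
   using m1 m2 el.gn_coef_stable[of N1 ?N m1 "Ts u"] el.gn_coef_stable[of N2 ?N m2 "Ts g'"] by (auto simp: tau_def)
  hence "tau ?N u * tau ?N g' \<notin> Ef UNIV P ?N" using prime_product_coef[OF P(1)] m1(1) m2(1) by blast
  moreover have "tau ?N (u * g') \<in> Ef UNIV P ?N" by (rule tau_rel[OF PI KP _ rel]) (use P(2) ext_phi in blast)
  ultimately show False by (simp add: rhm_mult[OF rhm_tau])
 qed
 thus ?thesis
 proof
  assume "E u \<in> ext p"
  hence "E r * (E t * E g) \<in> ext p" by (simp add: u_def E_simps mult.assoc)
  hence "E t * E g \<in> ext p" by (rule cancel_unit[OF xI r(2)])
  hence "E g \<in> ext p" by (rule cancel_unit[OF xI th(3)])
  thus ?thesis using qideal_add[OF xI(1) subsetD[OF xI(2) sg(4)], of "E g"] using cancel_unit[OF xI sg(3)] by (simp add: mult.commute)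
 next
  assume "E g' \<in> ext p"
  thus ?thesis using qideal_add[OF xI(1) subsetD[OF xI(2) sg'(4)], of "E g'"] using cancel_unit[OF xI sg'(3)] by (simp add: mult.commute)
 qed
qed

end

text \<open>Containing p and being saturated by the scalars outside p amounts to being an ideal over
  the residue field of p. Constants are settled directly, as a field has only two ideals; the
  variables are adjoined by Hilbert's theorem.\<close>

lemma noeth_residue_field:
 fixes p :: "'r::comm_ring_1 set"
 assumes p: "rprime p"
 shows "noeth (pset UNIV {..<n}) (Cn ` p) (Cn ` (- p) :: (nat, 'r) mp set)"
proof -
 let ?C = "range (Cn :: 'r => (nat, 'r) mp)"
 have C: "sring ?C" unfolding sring_def
  by (auto simp: Cn_simps(1)[symmetric] simp flip: Cn_simps(4,6))
 have eq: "adjoins ?C (map Vr [0..<n]) = pset UNIV {..<n}"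
 proof (rule adjoins_eqI[OF C sring_pset[OF sring_UNIV]])
  show "?C \<subseteq> pset UNIV {..<n}" by (auto intro: pset_Cn)
  show "set (map Vr [0..<n]) \<subseteq> pset UNIV {..<n}" by (auto intro: pset_Vr)
  fix T :: "(nat, 'r) mp set" assume T: "sring T" "?C \<subseteq> T" "set (map Vr [0..<n]) \<subseteq> T"
  show "pset UNIV {..<n} \<subseteq> T" by (rule pset_least[OF T(1)]) (use T(2,3) in auto)
 qed
 have base: "noeth ?C (Cn ` p) (Cn ` (- p))"
  unfolding noeth_def
 proof (intro allI impI, elim conjE)
  fix I assume I: "qideal ?C I" "I \<subseteq> ?C" "Cn ` p \<subseteq> I"
  show "\<exists>G. finite G \<and> G \<subseteq> I \<and> (\<forall>h\<in>I. \<exists>v\<in>Cn ` (- p). v * h \<in> qspan ?C (G \<union> Cn ` p))"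
  proof (cases "\<exists>v. v \<notin> p \<and> Cn v \<in> I")
   case True
   then obtain v where v: "v \<notin> p" "Cn v \<in> I" by blast
   have "Cn v * h \<in> qspan ?C ({Cn v} \<union> Cn ` p)" if "h \<in> I" for h
    using qideal_multr[OF qspan_qideal subsetD[OF I(2) that] qspan_basic] by blast
   thus ?thesis using v by (intro exI[of _ "{Cn v}"]) auto
  next
   case False
   have "I \<subseteq> Cn ` p"
   proof
    fix h assume h: "h \<in> I"
    then obtain v where v: "h = Cn v" using I(2) by blast
    thus "h \<in> Cn ` p" using False h by blast
   qed
   hence "1 * h \<in> qspan ?C ({} \<union> Cn ` p)" if "h \<in> I" for h using subsetD[OF qspan_base subsetD[OF \<open>I \<subseteq> Cn ` p\<close> that], of ?C] by simp
   moreover have "1 \<in> Cn ` (- p)" using rprime_1[OF p] by (intro image_eqI) (auto simp: Cn_simps)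
   ultimately show ?thesis by blast
  qed
 qed
 show ?thesis unfolding eq[symmetric]
 proof (rule noeth_adjoins[OF C _ _ _ _ base])
  show "1 \<in> Cn ` (- p)" using rprime_1[OF p] by (intro image_eqI) (auto simp: Cn_simps)
  fix a b :: "(nat, 'r) mp" assume "a \<in> Cn ` (- p)" "b \<in> Cn ` (- p)"
  then obtain a' b' where "a' \<notin> p" "b' \<notin> p" "a = Cn a'" "b = Cn b'" by blast
  hence "a * b = Cn (a' * b')" "a' * b' \<notin> p" by (auto simp: Cn_simps rprime_mult_iff[OF p])
  thus "a * b \<in> Cn ` (- p)" by blast
 qed auto
qed

lemma ideal_add_cancel: "rideal I ==> x \<in> I ==> y \<in> I ==> x = z + y ==> z \<in> I"
 using qideal_diff[OF _ sring_UNIV, of I x y] by simp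

section \<open>Contents modulo a scalar\<close>

context smooth_local
begin

definition mult_of :: "'v => 'u set" where "mult_of a = {b. \<exists>w. b - phi a * w \<in> K}"

lemma mult_of_ideal: "rideal (mult_of a)" "K \<subseteq> mult_of a"
proof -
 show "K \<subseteq> mult_of a" unfolding mult_of_def by (auto intro!: exI[of _ 0])
 hence 0: "0 \<in> mult_of a" using K_0 by blast
 show "rideal (mult_of a)" unfolding qideal_def
 proof (intro conjI ballI 0)
  fix b b' assume "b \<in> mult_of a" "b' \<in> mult_of a"
  then obtain w w' where w: "b - phi a * w \<in> K" "b' - phi a * w' \<in> K" by (auto simp: mult_of_def)
  have "b + b' - phi a * (w + w') \<in> K" using K_add[OF w] by (simp add: algebra_simps)
  thus "b + b' \<in> mult_of a" by (auto simp: mult_of_def)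
 next
  fix r b assume "b \<in> mult_of a"
  then obtain w where w: "b - phi a * w \<in> K" by (auto simp: mult_of_def)
  have "r * b - phi a * (r * w) \<in> K" using K_mult[OF w, of r] by (simp add: algebra_simps)
  thus "r * b \<in> mult_of a" by (auto simp: mult_of_def)
 qed
qed

lemma mult_of_dvd: assumes "a - e * d \<in> KA" "b \<in> mult_of a" shows "b \<in> mult_of e"
proof -
 obtain w where w: "b - phi a * w \<in> K" using assms(2) by (auto simp: mult_of_def)
 have "b - phi e * (phi d * w) = (b - phi a * w) + phi (a - e * d) * w"
  by (simp add: rhm_diff[OF phi] rhm_mult[OF phi] algebra_simps)
 also have "\<dots> \<in> K" by (rule K_add[OF w K_multr[OF phiK[OF assms(1)]]])
 finally show ?thesis by (auto simp: mult_of_def)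
qed

lemma mult_of_phi: "phi a * w \<in> mult_of a"
 unfolding mult_of_def using K_0 by (auto intro!: exI[of _ w])

lemma mult_of_mult: "b \<in> mult_of a ==> phi r * b \<in> mult_of (r * a)"
proof -
 assume "b \<in> mult_of a"
 then obtain w where w: "b - phi a * w \<in> K" by (auto simp: mult_of_def)
 show ?thesis using K_mult[OF w, of "phi r"] by (auto simp: rhm_mult[OF phi] algebra_simps mult_of_def)
qed

lemma ext_mult_of: "ext p = (\<Union>a\<in>p. mult_of a)"
 by (auto simp: ext_def mult_of_def)

text \<open>The elements of B that lie in the extension of p after localization at
  \<open>M\<close>.\<close>

definition locid :: "'u set => 'v set => 'u set" where
 "locid M p = {b. \<exists>s. s \<notin> M \<and> s * b \<in> ext p}"

text \<open>Only finitely many coefficients occur in \<open>F\<close> and in a presentation of the fibre at \<open>M\<close>. The subring \<open>R\<close> they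
 generate becomes a field modulo a single element \<open>e\<close> of \<open>p\<close>, so modulo \<open>e\<close> the algebra is, locally at \<open>M\<close>,
 the base change of an algebra over that field. In particular it is free and its elements have contents.\<close>

lemma content_modulo:
 assumes M: "rprime M" "K \<subseteq> M"
 defines "p \<equiv> {a. phi a \<in> M}"
 obtains e where "e \<in> p" "\<And>b. \<exists>s. s \<notin> M \<and> (s * b \<in> mult_of e \<or> (\<exists>a c'. c' \<notin> locid M p \<and> s * b - phi a * c' \<in> mult_of e))"
proof -
 have MI: "rideal M" by (rule rprime_ideal[OF M(1)])
 have p: "rprime p" unfolding p_def
  using M(1) by (auto simp: rprime_def qideal_def rhm_0[OF phi] rhm_1[OF phi] rhm_add[OF phi] rhm_mult[OF phi])
 have pI: "rideal p" by (rule rprime_ideal[OF p])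
 have KAp: "KA \<subseteq> p" using phiK M(2) by (auto simp: p_def)
 have xI: "rideal (ext p)" "K \<subseteq> ext p" by (rule ext_ideal[OF pI KAp])+
 have Mmult: "s * t \<notin> M" if "s \<notin> M" "t \<notin> M" for s t using that by (simp add: rprime_mult_iff[OF M(1)])
 have M1: "1 \<notin> M" by (rule rprime_1[OF M(1)])
 let ?L = "locid M p"
 have xL: "ext p \<subseteq> ?L" unfolding locid_def using M1 by auto
 have LI: "rideal ?L"
 proof (rule qidealI)
  show "0 \<in> ?L" using xL qideal_0[OF xI(1)] by blast
  fix b b' assume "b \<in> ?L" "b' \<in> ?L"
  then obtain s s' where s: "s \<notin> M" "s' \<notin> M" "s * b \<in> ext p" "s' * b' \<in> ext p" by (auto simp: locid_def)
  have "s' * (s * b) + s * (s' * b') \<in> ext p" using s by (intro qideal_add[OF xI(1)] qideal_mult[OF xI(1) UNIV_I, of "s * b"] qideal_mult[OF xI(1) UNIV_I, of "s' * b'"])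
  thus "b + b' \<in> ?L" using Mmult[OF s(1,2)] by (auto simp: algebra_simps locid_def)
 next
  fix r b assume "b \<in> ?L"
  then obtain s where s: "s \<notin> M" "s * b \<in> ext p" by (auto simp: locid_def)
  show "r * b \<in> ?L" using qideal_mult[OF xI(1) UNIV_I s(2), of r] s(1) by (auto simp: algebra_simps locid_def)
 qed
 have Lsat: "b \<in> ?L" if s: "s \<notin> M" "s * b \<in> ?L" for s b
 proof -
  obtain t where "t \<notin> M" "t * (s * b) \<in> ext p" using s(2) by (auto simp: locid_def)
  thus ?thesis using Mmult[OF _ s(1)] by (auto simp: locid_def mult.assoc[symmetric])
 qed
 \<comment> \<open>The equations of the fibre over p, localized at \<open>M\<close>. Over the
   residue field they are finitely generated, even where p itself is not.\<close>
 define \<gg> where "\<gg> = {h\<in>PA. E h \<in> ?L}"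
 have gI: "qideal PA \<gg>"
 proof (rule qidealI)
  show "0 \<in> \<gg>" using sring_0[OF sring_PA] qideal_0[OF LI] by (simp add: \<gg>_def E_simps)
  show "h + h' \<in> \<gg>" if "h \<in> \<gg>" "h' \<in> \<gg>" for h h'
   using that sring_add[OF sring_PA] qideal_add[OF LI] by (auto simp: \<gg>_def E_simps)
  show "r * h \<in> \<gg>" if "r \<in> PA" "h \<in> \<gg>" for r h
   using that sring_mult[OF sring_PA] qideal_mult[OF LI UNIV_I] by (auto simp: \<gg>_def E_simps)
 qed
 have CnPA: "Cn a \<in> PA" for a by (rule pset_Cn) auto
 obtain Gs where Gs: "finite Gs" "Gs \<subseteq> \<gg>" "\<forall>h\<in>\<gg>. \<exists>v\<in>Cn ` (- p). v * h \<in> qspan PA (Gs \<union> Cn ` p)"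
 proof (rule noethE[OF noeth_residue_field[OF p, of n] gI])
  show "\<gg> \<subseteq> PA" by (auto simp: \<gg>_def)
  show "Cn ` p \<subseteq> \<gg>" using CnPA xL ext_phi by (auto simp: \<gg>_def E_Cn)
  fix v h assume "v \<in> Cn ` (- p)" "h \<in> PA" "v * h \<in> \<gg>"
  then obtain v' where v': "v' \<notin> p" "v = Cn v'" by blast
  hence "phi v' \<notin> M" "phi v' * E h \<in> ?L" using \<open>v * h \<in> \<gg>\<close> by (auto simp: p_def \<gg>_def E_simps E_Cn)
  thus "h \<in> \<gg>" using Lsat \<open>h \<in> PA\<close> by (auto simp: \<gg>_def)
 qed
 have "\<forall>g\<in>Gs. \<exists>s. s \<notin> M \<and> (\<exists>\<pi>\<in>p. s * E g \<in> mult_of \<pi>)" using Gs(2) by (auto simp: \<gg>_def locid_def ext_mult_of)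
 from bchoice[OF this] obtain sg where sg: "\<forall>g\<in>Gs. sg g \<notin> M \<and> (\<exists>\<pi>\<in>p. sg g * E g \<in> mult_of \<pi>)" ..
 hence "\<forall>g\<in>Gs. \<exists>\<pi>. \<pi> \<in> p \<and> sg g * E g \<in> mult_of \<pi>" by blast
 from bchoice[OF this] obtain \<pi>g where \<pi>g: "\<forall>g\<in>Gs. \<pi>g g \<in> p \<and> sg g * E g \<in> mult_of (\<pi>g g)" ..
 have "Gs \<subseteq> PA" using Gs(2) by (auto simp: \<gg>_def)
 obtain R where R: "sring R" "noeth R {} {1}" "Gs \<subseteq> pset R {..<n}" by (rule fg_subring[OF Gs(1) \<open>Gs \<subseteq> PA\<close>])
 have "qideal R (p \<inter> R)" by (rule qideal_Int[OF qideal_mono[OF pI] qideal_sring[OF R(1)]]) simp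
 then obtain Ps where Ps: "finite Ps" "Ps \<subseteq> p \<inter> R" "p \<inter> R = qspan R Ps" by (rule noeth_fg[OF R(2)]) auto
 \<comment> \<open>\<open>e\<close> will be a common divisor of generators of
   \<open>p \<inter> R\<close> and of the scalars \<open>\<pi>g g\<close>. Modulo \<open>e\<close>,
   the elements of \<open>p \<inter> R\<close> vanish, and so do the equations \<open>Gs\<close> up
   to the multiplier \<open>s0\<close>. The element 0 keeps \<open>T\<close> nonempty.\<close>
 define T where "T = insert 0 (Ps \<union> \<pi>g ` Gs)"
 have T: "finite T" "T \<noteq> {}" "T \<subseteq> p" using Ps Gs(1) \<pi>g qideal_0[OF pI] by (auto simp: T_def)
 obtain e where e: "e \<in> T" "\<forall>t\<in>T. \<exists>d. t - e * d \<in> KA" using exists_common_divisor[OF T(1,2), of "\<lambda>t. t"] by blast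
 have ep: "e \<in> p" using e(1) T(3) by blast
 let ?eA = "{r. \<exists>d. r - e * d \<in> KA}" and ?eB = "mult_of e"
 have eAI: "rideal ?eA"
 proof (rule qidealI)
  show "0 \<in> ?eA" using qideal_0[OF KAI] by (auto intro!: exI[of _ 0])
  fix r r' assume "r \<in> ?eA" "r' \<in> ?eA"
  then obtain d d' where "r - e * d \<in> KA" "r' - e * d' \<in> KA" by blast
  hence "r + r' - e * (d + d') \<in> KA" using qideal_add[OF KAI, of "r - e * d" "r' - e * d'"] by (simp add: algebra_simps)
  thus "r + r' \<in> ?eA" by blast
 next
  fix q r assume "r \<in> ?eA"
  then obtain d where "r - e * d \<in> KA" by blast
  hence "q * r - e * (q * d) \<in> KA" using qideal_mult[OF KAI UNIV_I, of "r - e * d" q] by (simp add: algebra_simps)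
  thus "q * r \<in> ?eA" by blast
 qed
 have "qspan R Ps \<subseteq> ?eA" by (rule qspan_least[OF qideal_mono[OF eAI]]) (use e(2) in \<open>auto simp: T_def\<close>)
 hence pR: "r \<in> ?eA" if "r \<in> p" "r \<in> R" for r using that Ps(3) by blast
 have eB: "rideal ?eB" "K \<subseteq> ?eB" by (rule mult_of_ideal)+
 have phieA: "phi r \<in> ?eB" if "r \<in> ?eA" for r using that mult_of_dvd mult_of_phi[of r 1] by auto
 have sgE: "sg g \<notin> M" "sg g * E g \<in> ?eB" if g: "g \<in> Gs" for g
 proof -
  show "sg g \<notin> M" using g sg by blast
  obtain d where "\<pi>g g - e * d \<in> KA" using g e(2) by (auto simp: T_def)
  thus "sg g * E g \<in> ?eB" by (rule mult_of_dvd) (use g \<pi>g in blast)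
 qed
 define s0 where "s0 = (\<Prod>g\<in>Gs. sg g)"
 have s0: "s0 \<notin> M" unfolding s0_def by (rule rprime_prod[OF M(1) Gs(1)]) (use sgE in blast)
 have s0E: "s0 * E g \<in> ?eB" if "g \<in> Gs" for g
 proof -
  have "s0 * E g = (\<Prod>g\<in>Gs - {g}. sg g) * (sg g * E g)" unfolding s0_def by (subst prod.remove[OF Gs(1) that]) (simp)
  thus ?thesis using qideal_mult[OF eB(1) UNIV_I sgE(2)[OF that]] by simp
 qed
 define good where "good b \<longleftrightarrow> b \<in> ?eB \<or> (\<exists>a c'. c' \<notin> ?L \<and> b - phi a * c' \<in> ?eB)" for b
 have good_add: "good (b + w)" if "good b" "w \<in> ?eB" for b w
 proof -
  have "b - phi a * c' + w = b + w - phi a * c'" for a c' by simp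
  thus ?thesis using that qideal_add[OF eB(1)] unfolding good_def by metis
 qed
 have good_mult: "good (s * b)" if g: "good b" and s: "s \<notin> M" for b s
  using g unfolding good_def
 proof (elim disjE exE conjE)
  assume "b \<in> ?eB" thus "s * b \<in> ?eB \<or> (\<exists>a c'. c' \<notin> ?L \<and> s * b - phi a * c' \<in> ?eB)" using qideal_mult[OF eB(1) UNIV_I] by blast
 next
  fix a c' assume ac: "c' \<notin> ?L" "b - phi a * c' \<in> ?eB"
  have "s * b - phi a * (s * c') \<in> ?eB" using qideal_mult[OF eB(1) UNIV_I ac(2), of s] by (simp add: algebra_simps)
  moreover have "s * c' \<notin> ?L" using Lsat[OF s] ac(1) by blast
  ultimately show "s * b \<in> ?eB \<or> (\<exists>a c'. c' \<notin> ?L \<and> s * b - phi a * c' \<in> ?eB)" by blast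
 qed
 \<comment> \<open>Induction on the number of terms. With a common divisor factored out, the
   remaining sum \<open>H\<close> has a coefficient 1. Either \<open>H\<close> is outside
   \<open>?L\<close> and is the required cofactor, or it gives a relation over the residue field;
   the specialization of that relation to \<open>R\<close> holds modulo \<open>e\<close> and
   eliminates one term.\<close>
 have main: "\<exists>s. s \<notin> M \<and> good (s * (\<Sum>i\<in>I. phi (a i) * E (h i)))"
  if "finite I" "\<And>i. i \<in> I ==> h i \<in> pset R {..<n}" for I :: "nat multiset set" and a :: "nat multiset => 'v" and h
  using that
 proof (induction "card I" arbitrary: I a)
  case 0
  thus ?case using M1 qideal_0[OF eB(1)] by (intro exI) (simp add: good_def)
 next
  case (Suc k)
  hence Ine: "I \<noteq> {}" by auto
  obtain j where j: "j \<in> I" "\<forall>i\<in>I. \<exists>d. a i - a j * d \<in> KA" using exists_common_divisor[OF Suc.prems(1) Ine, of a] by blast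
  from bchoice[OF j(2)] obtain d0 where d0: "\<forall>i\<in>I. a i - a j * d0 i \<in> KA" ..
  define d where "d = d0(j := 1)"
  have d: "a i - a j * d i \<in> KA" if "i \<in> I" for i using d0 that qideal_0[OF KAI] by (auto simp: d_def)
  define H where "H = (\<Sum>i\<in>I. Cn (d i) * h i)"
  let ?S = "\<Sum>i\<in>I. phi (a i) * E (h i)"
  have EH: "E H = (\<Sum>i\<in>I. phi (d i) * E (h i))" by (simp add: H_def rhm_sum[OF rhm_E] E_simps E_Cn)
  have SH: "?S - phi (a j) * E H \<in> K"
  proof -
   have "?S - phi (a j) * E H = (\<Sum>i\<in>I. phi (a i - a j * d i) * E (h i))"
    by (simp add: EH rhm_diff[OF phi] rhm_mult[OF phi] left_diff_distrib sum_subtractf sum_distrib_left mult.assoc)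
   also have "\<dots> \<in> K" by (rule K_sum[OF K_multr[OF phiK[OF d]]])
   finally show ?thesis .
  qed
  show ?case
  proof (cases "E H \<in> ?L")
   case False
   hence "good (1 * ?S)" unfolding good_def using SH eB(2) by auto
   thus ?thesis using M1 by blast
  next
   case True
   have hPA: "h i \<in> PA" if "i \<in> I" for i using Suc.prems(2)[OF that] pset_mono[of R UNIV "{..<n}" "{..<n}"] by auto
   have "H \<in> PA" unfolding H_def by (rule sring_sum[OF sring_PA sring_mult[OF sring_PA CnPA hPA]])
   then obtain v where v: "v \<notin> p" "Cn v * H \<in> qspan PA (Gs \<union> Cn ` p)" using True Gs(3) by (auto simp: \<gg>_def)
   have "Cn v * H \<in> qspan PA ((\<lambda>g. g) ` Gs \<union> Cn ` p)" using v(2) by simp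
   from qspan_finite[OF sring_PA Gs(1) this] obtain Q where Q: "Cn v * H - (\<Sum>g\<in>Gs. Q g * g) \<in> qspan PA (Cn ` p)" by blast
   have "qspan PA (Cn ` p) \<subseteq> pset p {..<n}"
    by (rule qspan_least[OF qideal_pset[OF pI]]) (auto intro: pset_Cn qideal_0[OF pI])
   hence Qp: "coef (Cn v * H - (\<Sum>g\<in>Gs. Q g * g)) m \<in> p" for m using Q pset_coef by blast
   \<comment> \<open>Index \<open>None\<close> carries the terms of \<open>H\<close>, index
     \<open>Some g\<close> the monomials of the multiplier of the fibre equation \<open>g\<close>;
     \<open>y\<close> singles out the term \<open>j\<close>, whose coefficient must stay outside
     p.\<close>
   define O' where "O' = insert None (Some ` Gs)"
   define JJ where "JJ = (SIGMA o':O'. case o' of None => I | Some g => mons (Q g))"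
   define \<beta> where "\<beta> i = (case fst i of None => v * d (snd i) | Some g => - coef (Q g) (snd i))" for i
   define pp where "pp i = (case fst i of None => h (snd i) | Some g => mon Vr (snd i) * g)" for i
   define y where "y i = (if i = (None, j) then 1 else 0 :: 'v)" for i :: "(nat, 'v) mp option \<times> nat multiset"
   have finO: "finite O'" by (simp add: O'_def Gs(1))
   have finJ: "finite JJ" unfolding JJ_def by (rule finite_SigmaI[OF finO]) (auto split: option.split simp: Suc.prems(1))
   have sumJ: "(\<Sum>i\<in>JJ. f i) = (\<Sum>i\<in>I. f (None, i)) + (\<Sum>g\<in>Gs. \<Sum>m\<in>mons (Q g). f (Some g, m))"
    for f :: "(nat, 'v) mp option \<times> nat multiset => 't::comm_monoid_add"
   proof -
    have "(\<Sum>i\<in>JJ. f i) = (\<Sum>o'\<in>O'. \<Sum>m\<in>(case o' of None => I | Some g => mons (Q g)). f (o', m))"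
     unfolding JJ_def by (subst sum.Sigma) (auto split: option.split simp: Suc.prems(1) finO)
    also have "\<dots> = (\<Sum>i\<in>I. f (None, i)) + (\<Sum>g\<in>Gs. \<Sum>m\<in>mons (Q g). f (Some g, m))"
     unfolding O'_def by (subst sum.insert) (auto simp: Gs(1) sum.reindex)
    finally show ?thesis .
   qed
   have gR: "mon Vr m * g \<in> pset R {..<n}" if "g \<in> Gs" "set_mset m \<subseteq> {..<n}" for g m
    by (intro sring_mult[OF sring_pset[OF R(1)]] mon_in_sring[OF sring_pset[OF R(1)]] pset_Vr[OF R(1)]) (use that R(3) in auto)
   have ppR: "coef (pp i) m \<in> R" if "i \<in> JJ" for i m
   proof -
    have "pp i \<in> pset R UNIV"
    proof (cases "fst i")
     case None
     hence "pp i = h (snd i)" "snd i \<in> I" using that by (auto simp: pp_def JJ_def)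
     thus ?thesis using Suc.prems(2) pset_mono[of R R "{..<n}" UNIV] by auto
    next
     case (Some g)
     hence g: "pp i = mon Vr (snd i) * g" "g \<in> Gs" using that by (auto simp: pp_def JJ_def O'_def)
     thus ?thesis using R(3) pset_mono[of R R "{..<n}" UNIV] unfolding g(1) by (intro sring_mult[OF sring_pset[OF R(1)]] mon_in_sring[OF sring_pset[OF R(1)]] pset_Vr[OF R(1)]) auto
    qed
    thus ?thesis by (rule pset_coef)
   qed
   have rel: "(\<Sum>i\<in>JJ. coef (pp i) m * \<beta> i) \<in> p" for m
   proof -
    have "(\<Sum>i\<in>JJ. coef (pp i) m * \<beta> i) = coef (\<Sum>i\<in>JJ. Cn (\<beta> i) * pp i) m"
     by (simp add: lookup_sum coef_mult_Cn mult.commute[of "\<beta> _"])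
    also have "(\<Sum>i\<in>JJ. Cn (\<beta> i) * pp i) = Cn v * H - (\<Sum>g\<in>Gs. Q g * g)"
    proof -
     have "(\<Sum>m\<in>mons (Q g). Cn (\<beta> (Some g, m)) * pp (Some g, m)) = - (Q g * g)" for g
      unfolding \<beta>_def pp_def using mp_expand'[of "Q g"]
      by (simp add: Cn_simps sum_negf mult.assoc[symmetric] flip: sum_distrib_right)
     thus ?thesis unfolding sumJ by (simp add: \<beta>_def pp_def H_def sum_distrib_left Cn_simps mult.assoc sum_negf)
    qed
    finally show ?thesis using Qp by simp
   qed
   have y1: "(\<Sum>i\<in>JJ. \<beta> i * y i) \<notin> p"
   proof -
    have "(None, j) \<in> JJ" using j(1) by (simp add: JJ_def O'_def)
    hence "(\<Sum>i\<in>JJ. \<beta> i * y i) = \<beta> (None, j)" using finJ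
     by (simp add: y_def if_distrib cong: if_cong)
    thus ?thesis using v(1) by (simp add: \<beta>_def d_def)
   qed
   have "\<exists>\<kappa>. (\<forall>i\<in>JJ. \<kappa> i \<in> R) \<and> (\<forall>m. (\<Sum>i\<in>JJ. \<kappa> i * coef (pp i) m) \<in> p) \<and> (\<Sum>i\<in>JJ. \<kappa> i * y i) \<notin> p"
    by (rule specialize_relation[OF rhm_id R(1) pI p order_refl _ finJ ppR rel y1]) blast
   then obtain \<kappa> where \<kappa>: "\<And>i. i \<in> JJ ==> \<kappa> i \<in> R" "\<And>m. (\<Sum>i\<in>JJ. \<kappa> i * coef (pp i) m) \<in> p" "(\<Sum>i\<in>JJ. \<kappa> i * y i) \<notin> p" by blast
   define \<mu> where "\<mu> i = \<kappa> (None, i)" for i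
   have \<mu>j: "\<mu> j \<notin> p"
   proof -
    have "(None, j) \<in> JJ" using j(1) by (simp add: JJ_def O'_def)
    thus ?thesis using finJ \<kappa>(3) by (simp add: y_def \<mu>_def if_distrib cong: if_cong)
   qed
   define W where "W = (\<Sum>i\<in>JJ. Cn (\<kappa> i) * pp i)"
   have "coef W m \<in> ?eA" for m
   proof -
    have "coef W m = (\<Sum>i\<in>JJ. \<kappa> i * coef (pp i) m)" by (simp add: W_def lookup_sum coef_mult_Cn)
    moreover have "(\<Sum>i\<in>JJ. \<kappa> i * coef (pp i) m) \<in> R" by (rule sring_sum[OF R(1) sring_mult[OF R(1) \<kappa>(1) ppR]])
    ultimately show ?thesis using pR \<kappa>(2) by simp
   qed
   hence "W \<in> pset ?eA UNIV" by (auto simp: pset_def)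
   hence "E W \<in> ?eB" by (rule E_ideal[OF eB(1) _ phieA])
   hence "s0 * E W \<in> ?eB" by (rule qideal_mult[OF eB(1) UNIV_I])
   moreover have "(\<Sum>g\<in>Gs. \<Sum>m\<in>mons (Q g). phi (\<kappa> (Some g, m)) * E (mon Vr m) * (s0 * E g)) \<in> ?eB"
    by (rule qideal_sum[OF eB(1)], rule qideal_sum[OF eB(1)], rule qideal_mult[OF eB(1) UNIV_I s0E])
   moreover have "s0 * E W = s0 * (\<Sum>i\<in>I. phi (\<mu> i) * E (h i)) + (\<Sum>g\<in>Gs. \<Sum>m\<in>mons (Q g). phi (\<kappa> (Some g, m)) * E (mon Vr m) * (s0 * E g))"
   proof -
    have "E W = (\<Sum>i\<in>JJ. phi (\<kappa> i) * E (pp i))" by (simp add: W_def rhm_sum[OF rhm_E] E_simps E_Cn)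
    also have "\<dots> = (\<Sum>i\<in>I. phi (\<mu> i) * E (h i)) + (\<Sum>g\<in>Gs. \<Sum>m\<in>mons (Q g). phi (\<kappa> (Some g, m)) * E (mon Vr m) * E g)"
     unfolding sumJ by (simp add: \<mu>_def pp_def E_simps mult.assoc)
    finally show ?thesis by (simp add: distrib_left sum_distrib_left mult.left_commute)
   qed
   ultimately have sE: "s0 * (\<Sum>i\<in>I. phi (\<mu> i) * E (h i)) \<in> ?eB"
    by (rule ideal_add_cancel[OF eB(1)])
   define I' where "I' = I - {j}"
   have I': "finite I'" "card I' = k" "I = insert j I'" "j \<notin> I'" using Suc.prems(1) Suc.hyps(2) j(1) by (auto simp: I'_def)
   \<comment> \<open>Coefficients after elimination of \<open>h j\<close>:
     \<open>phi (\<mu> j)\<close> times the old sum differs from the new one by a multiple of the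
     relation between the \<open>h i\<close>, which is zero modulo \<open>e\<close> after
     multiplication by \<open>s0\<close>.\<close>
   define a' where "a' i = \<mu> j * a i - a j * \<mu> i" for i
   have "\<exists>s. s \<notin> M \<and> good (s * (\<Sum>i\<in>I'. phi (a' i) * E (h i)))"
    by (rule Suc.hyps(1)[OF I'(2)[symmetric] I'(1)]) (use Suc.prems(2) I'(3) in auto)
   then obtain s where s: "s \<notin> M" "good (s * (\<Sum>i\<in>I'. phi (a' i) * E (h i)))" by blast
   have e1: "phi (\<mu> j) * ?S = (\<Sum>i\<in>I'. phi (a' i) * E (h i)) + phi (a j) * (\<Sum>i\<in>I. phi (\<mu> i) * E (h i))"
    using I' by (simp add: a'_def rhm_diff[OF phi] rhm_mult[OF phi] algebra_simps sum_subtractf sum_distrib_left)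
   have "good (s0 * (s * (\<Sum>i\<in>I'. phi (a' i) * E (h i))))" by (rule good_mult[OF s(2) s0])
   moreover have "s * phi (a j) * (s0 * (\<Sum>i\<in>I. phi (\<mu> i) * E (h i))) \<in> ?eB" by (rule qideal_mult[OF eB(1) UNIV_I sE])
   ultimately have "good (s0 * (s * (\<Sum>i\<in>I'. phi (a' i) * E (h i))) + s * phi (a j) * (s0 * (\<Sum>i\<in>I. phi (\<mu> i) * E (h i))))"
    by (rule good_add)
   moreover have "s0 * (s * (\<Sum>i\<in>I'. phi (a' i) * E (h i))) + s * phi (a j) * (s0 * (\<Sum>i\<in>I. phi (\<mu> i) * E (h i))) = (s0 * s * phi (\<mu> j)) * ?S"
   proof -
    have "(s0 * s * phi (\<mu> j)) * ?S = s0 * s * (phi (\<mu> j) * ?S)" by simp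
    thus ?thesis unfolding e1 by (simp add: algebra_simps)
   qed
   moreover have "phi (\<mu> j) \<notin> M" using \<mu>j by (simp add: p_def)
   ultimately show ?thesis using Mmult[OF Mmult[OF s0 s(1)]] by metis
  qed
 qed
 show thesis
 proof (rule that[OF ep])
  fix b
  obtain s g where sg': "s \<in> PA" "g \<in> PA" "E s \<notin> q" "b * E s - E g \<in> K" by (rule P1')
  have Mq: "M \<subseteq> q"
  proof (rule subsetI, rule ccontr)
   fix s assume s: "s \<in> M" "s \<notin> q"
   thus False using cancel_unit[OF MI M(2) s(2), of 1] M1 by simp
  qed
  have "E g = (\<Sum>m\<in>mons g. phi (coef g m) * E (mon Vr m))"
   using arg_cong[OF mp_expand'[of g], of E] by (simp add: rhm_sum[OF rhm_E] E_simps E_Cn)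
  moreover have "\<exists>s. s \<notin> M \<and> good (s * (\<Sum>m\<in>mons g. phi (coef g m) * E (mon Vr m)))"
  proof (rule main)
   fix m assume "m \<in> mons g"
   hence "set_mset m \<subseteq> {..<n}" by (rule pset_vars[OF sg'(2)])
   thus "mon Vr m \<in> pset R {..<n}" by (intro mon_in_sring[OF sring_pset[OF R(1)]] pset_Vr[OF R(1)]) auto
  qed simp
  ultimately obtain t where t: "t \<notin> M" "good (t * E g)" by auto
  have "t * (b * E s - E g) \<in> ?eB" using K_mult[OF sg'(4)] eB(2) by blast
  from good_add[OF t(2) this] have "good ((t * E s) * b)" by (simp add: algebra_simps)
  moreover have "t * E s \<notin> M" using Mmult[OF t(1)] sg'(3) Mq by blast
  ultimately show "\<exists>s. s \<notin> M \<and> (s * b \<in> mult_of e \<or> (\<exists>a c'. c' \<notin> locid M p \<and> s * b - phi a * c' \<in> mult_of e))"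
   unfolding good_def by blast
 qed
qed

end

section \<open>Contents in general and divisors of scalars\<close>

context smooth_local
begin

definition dv :: "'v => 'v => bool" where "dv a b \<longleftrightarrow> (\<exists>d. b - a * d \<in> KA)"

lemma dv_total: "dv a b \<or> dv b a"
 using chain by (auto simp: dv_def)

lemma dv_mult: "dv a b ==> dv (r * a) (r * b)"
proof -
 assume "dv a b"
 then obtain d where "b - a * d \<in> KA" by (auto simp: dv_def)
 hence "r * (b - a * d) \<in> KA" by (rule qideal_mult[OF KAI UNIV_I])
 hence "r * b - r * a * d \<in> KA" by (simp add: algebra_simps)
 thus ?thesis by (auto simp: dv_def)
qed

lemma dv_ideal:
 assumes p: "rideal p" "KA \<subseteq> p" and "dv a b" "a \<in> p" shows "b \<in> p"
proof -
 obtain d where d: "b - a * d \<in> KA" using assms(3) by (auto simp: dv_def)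
 have "(b - a * d) + a * d \<in> p" by (rule qideal_add[OF p(1) subsetD[OF p(2) d] qideal_multr[OF p(1) UNIV_I assms(4)]])
 thus ?thesis by simp
qed

lemma mult_of_dv: "dv e a ==> b \<in> mult_of a ==> b \<in> mult_of e"
 unfolding dv_def using mult_of_dvd by blast

lemma ideal_chain:
 assumes "rideal p" "KA \<subseteq> p" "rideal p'" "KA \<subseteq> p'" shows "p \<subseteq> p' \<or> p' \<subseteq> p"
proof (rule disjCI, rule subsetI)
 fix x assume n: "\<not> p' \<subseteq> p" "x \<in> p"
 then obtain y where y: "y \<in> p'" "y \<notin> p" by blast
 thus "x \<in> p'" using dv_ideal[OF assms(1,2)] n(2) dv_total dv_ideal[OF assms(3,4)] by blast
qed

lemma K_cong: "u - v \<in> K ==> v \<in> I ==> rideal I ==> K \<subseteq> I ==> u \<in> I"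
 using qideal_add[of UNIV I "u - v" v] by auto

lemma mult_of_mult_congD:
 assumes "phi r * y \<in> mult_of (r * w)" "r \<notin> KA" shows "y \<in> mult_of w"
proof -
 obtain v where "phi r * y - phi (r * w) * v \<in> K" using assms(1) by (auto simp: mult_of_def)
 hence "phi r * (y - phi w * v) \<in> K" by (simp add: rhm_mult[OF phi] algebra_simps)
 thus ?thesis using torsion_free assms(2) by (auto simp: mult_of_def)
qed

text \<open>The prime ideal \<open>p\<close> is the maximal ideal if \<open>b\<close> has a content \<open>r\<close>; in general \<open>b\<close> need not have a greatest
 divisor in the valuation ring.\<close>

lemma content:
 assumes b: "b \<notin> K"
 obtains r p b1 where "rprime p" "KA \<subseteq> p" "b - phi r * b1 \<in> K" "b1 \<notin> ext p" "\<And>w. w \<notin> p ==> b1 \<in> mult_of w"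
proof -
 define D where "D = {a. b \<in> mult_of a}"
 have K1: "mult_of a \<subseteq> K" if "a \<in> KA" for a
  using K_cong[OF _ K_multr[OF phiK[OF that]] K order_refl] by (auto simp: mult_of_def)
 have DKA: "a \<notin> KA" if "a \<in> D" for a using K1 that b by (auto simp: D_def)
 have D1: "1 \<in> D" using mult_of_phi[of 1 b] by (simp add: D_def rhm_1[OF phi])
 have Ddv: "e \<in> D" if "dv e a" "a \<in> D" for e a using mult_of_dv[OF that(1)] that(2) by (auto simp: D_def)
 have DI: "b1 \<in> mult_of w" if "b - phi r * b1 \<in> K" "r * w \<in> D" "r \<in> D" for r w b1
 proof -
  have "phi r * b1 - b \<in> K" using K_minus[OF that(1)] by simp
  moreover have "b \<in> mult_of (r * w)" using that(2) by (simp add: D_def)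
  ultimately have "phi r * b1 \<in> mult_of (r * w)" by (rule K_cong[OF _ _ mult_of_ideal])
  thus ?thesis by (rule mult_of_mult_congD[OF _ DKA[OF that(3)]])
 qed
 have DI2: "r * w \<in> D" if "b - phi r * b1 \<in> K" "b1 \<in> mult_of w" for r w b1
  unfolding D_def using K_cong[OF that(1) mult_of_mult[OF that(2)] mult_of_ideal] by simp
 show thesis
 proof (cases "\<exists>r\<in>D. \<forall>d\<in>D. dv d r")
  \<comment> \<open>With a greatest divisor \<open>r\<close> of \<open>b\<close>, no element of the
    maximal ideal divides the cofactor any further, and the scalars outside the maximal ideal are
    units.\<close>
  case True
  then obtain r where r: "r \<in> D" "\<And>d. d \<in> D ==> dv d r" by blast
  then obtain b1 where b1: "b - phi r * b1 \<in> K" by (auto simp: D_def mult_of_def)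
  define p where "p = {a. phi a \<in> q}"
  have p: "rprime p" unfolding p_def
   using qprime by (auto simp: rprime_def qideal_def rhm_0[OF phi] rhm_1[OF phi] rhm_add[OF phi] rhm_mult[OF phi])
  have pI: "rideal p" by (rule rprime_ideal[OF p])
  have KAp: "KA \<subseteq> p" using phiK Kq by (auto simp: p_def)
  have "b1 \<notin> ext p"
  proof
   assume "b1 \<in> ext p"
   then obtain \<pi> where \<pi>: "\<pi> \<in> p" "b1 \<in> mult_of \<pi>" by (auto simp: ext_mult_of)
   obtain t where "r - r * \<pi> * t \<in> KA" using r(2)[OF DI2[OF b1 \<pi>(2)]] by (auto simp: dv_def)
   hence "r * (1 - \<pi> * t) \<in> KA" by (simp add: algebra_simps)
   thus False using DKA[OF r(1)] qideal_add[OF pI, of "1 - \<pi> * t" "\<pi> * t"] KAp qideal_multr[OF pI UNIV_I \<pi>(1)] using rprime_1[OF p] by (auto simp: rprime_mult_iff[OF KA])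
  qed
  moreover have "b1 \<in> mult_of w" if "w \<notin> p" for w
  proof -
   obtain w' where "w * w' - 1 \<in> KA" using loc \<open>w \<notin> p\<close> by (auto simp: p_def)
   hence "- (w * w' - 1) \<in> KA" by (rule qideal_minus[OF KAI sring_UNIV])
   thus ?thesis using mult_of_dvd mult_of_phi[of 1 b1] by (simp add: rhm_1[OF phi])
  qed
  ultimately show thesis using that[OF p KAp b1] by blast
 next
  case False
  define J where "J = - D"
  \<comment> \<open>Without a greatest divisor, the scalars not dividing \<open>b\<close> are
    exactly the common multiples of all divisors, hence an ideal.\<close>
  have J_iff: "a \<in> J \<longleftrightarrow> (\<forall>d\<in>D. dv d a)" for a
   using False dv_total Ddv unfolding J_def by blast
  have JI: "rideal J"
 proof (rule qidealI)
   show "0 \<in> J" unfolding J_iff dv_def using qideal_0[OF KAI] by (auto intro!: exI[of _ 0])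
   fix a a' assume "a \<in> J" "a' \<in> J"
   show "a + a' \<in> J" unfolding J_iff
   proof
    fix d assume "d \<in> D"
    then obtain t t' where "a - d * t \<in> KA" "a' - d * t' \<in> KA" using \<open>a \<in> J\<close> \<open>a' \<in> J\<close> unfolding J_iff dv_def by blast
    hence "(a - d * t) + (a' - d * t') \<in> KA" by (rule qideal_add[OF KAI])
    thus "dv d (a + a')" by (auto simp: dv_def algebra_simps exI[of _ "t + t'"])
   qed
  next
   fix u a assume "a \<in> J"
   show "u * a \<in> J" unfolding J_iff
   proof
    fix d assume "d \<in> D"
    then obtain t where "a - d * t \<in> KA" using \<open>a \<in> J\<close> unfolding J_iff dv_def by blast
    hence "u * (a - d * t) \<in> KA" by (rule qideal_mult[OF KAI UNIV_I])
    thus "dv d (u * a)" by (auto simp: dv_def algebra_simps)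
   qed
  qed
  have KAJ: "KA \<subseteq> J" using DKA by (auto simp: J_def)
  \<comment> \<open>The prime of the cut between \<open>D\<close> and \<open>J\<close>:
    multiplication by an element outside p maps \<open>D\<close> to itself
    (\<open>Dp\<close>).\<close>
  define p where "p = {s. \<exists>r\<in>D. r * s \<in> J}"
  have Jp: "J \<subseteq> p" using D1 by (auto simp: p_def bexI[of _ 1])
  have KAp: "KA \<subseteq> p" using KAJ Jp by blast
  have Jdv: "r * s \<in> J" if "dv r' r" "r' * s \<in> J" for r r' s
   using dv_ideal[OF JI KAJ dv_mult[OF that(1), of s]] that(2) by (simp add: mult.commute)
  have pI: "rideal p"
 proof (rule qidealI)
   show "0 \<in> p" using Jp qideal_0[OF JI] by blast
   fix s s' assume "s \<in> p" "s' \<in> p"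
   then obtain r r' where r: "r \<in> D" "r * s \<in> J" "r' \<in> D" "r' * s' \<in> J" by (auto simp: p_def)
   have "\<exists>r''\<in>D. r'' * s \<in> J \<and> r'' * s' \<in> J" using dv_total Jdv r by blast
   then obtain r'' where "r'' \<in> D" "r'' * s \<in> J" "r'' * s' \<in> J" by blast
   thus "s + s' \<in> p" using qideal_add[OF JI, of "r'' * s" "r'' * s'"] by (auto simp: p_def distrib_left)
  next
   fix u s assume "s \<in> p"
   then obtain r where "r \<in> D" "r * s \<in> J" by (auto simp: p_def)
   thus "u * s \<in> p" using qideal_mult[OF JI UNIV_I, of "r * s" u] by (auto simp: p_def mult.left_commute)
  qed
  have Dp: "r * w \<in> D" if "r \<in> D" "w \<notin> p" for r w using that by (auto simp: p_def J_def)
  have p: "rprime p" unfolding rprime_def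
  proof (intro conjI allI impI pI)
   show "1 \<notin> p" by (auto simp: p_def J_def)
   fix s t assume "s * t \<in> p"
   then obtain r where r: "r \<in> D" "r * (s * t) \<in> J" by (auto simp: p_def)
   show "s \<in> p \<or> t \<in> p"
   proof (rule disjCI)
    assume "t \<notin> p"
    show "s \<in> p"
    proof (rule ccontr)
     assume "s \<notin> p"
     hence "r * s * t \<in> D" using Dp r(1) \<open>t \<notin> p\<close> by blast
     thus False using r(2) by (simp add: J_def mult.assoc)
    qed
   qed
  qed
  \<comment> \<open>For \<open>s\<close> outside \<open>C\<close>, the product \<open>s * b\<close>
    still avoids J B. A prime \<open>M\<close> containing \<open>C\<close> with trace p on A is a
    place where this persists under localization.\<close>
  define C where "C = {s. s * b \<in> ext J}"
  have xJ: "rideal (ext J)" "K \<subseteq> ext J" by (rule ext_ideal[OF JI KAJ])+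
  have CI: "rideal C" unfolding qideal_def C_def
   using qideal_0[OF xJ(1)] qideal_add[OF xJ(1)] qideal_mult[OF xJ(1) UNIV_I] by (auto simp: distrib_right mult.assoc)
  have KC: "K \<subseteq> C" using K_multr xJ(2) by (auto simp: C_def)
  have Cp: "a \<in> p" if aC: "phi a \<in> C" for a
  proof (rule ccontr)
   assume a: "a \<notin> p"
   obtain j where j: "j \<in> J" "phi a * b \<in> mult_of j" using aC by (auto simp: C_def ext_mult_of)
   obtain j' where j': "j - a * j' \<in> KA" using dv_ideal[OF pI KAp] a j(1) Jp dv_total[of a j] by (auto simp: dv_def)
   have "phi a * b \<in> mult_of (a * j')" by (rule mult_of_dvd[of j _ 1, OF _ j(2)]) (simp add: j')
   hence "j' \<in> D" using mult_of_mult_congD a KAp by (auto simp: D_def)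
   hence "a * j' \<in> D" using Dp[of j' a] a by (simp add: mult.commute)
   moreover have "dv j (a * j')"
    unfolding dv_def using qideal_minus[OF KAI sring_UNIV j'] by (auto intro!: exI[of _ 1])
   ultimately show False using Ddv j(1) by (auto simp: J_def)
  qed
  obtain M where M: "rprime M" "C \<subseteq> M" "M \<inter> phi ` (- p) = {}"
  proof (rule exists_prime_avoiding[OF CI])
   show "1 \<in> phi ` (- p)" using rprime_1[OF p] rhm_1[OF phi] by (intro image_eqI) auto
   show "a * b \<in> phi ` (- p)" if ab: "a \<in> phi ` (- p)" "b \<in> phi ` (- p)" for a b
   proof -
    obtain x y where "a = phi x" "b = phi y" "x \<notin> p" "y \<notin> p" using ab by blast
    thus ?thesis using rprime_mult_iff[OF p] by (intro image_eqI[of _ _ "x * y"]) (auto simp: rhm_mult[OF phi])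
   qed
   show "C \<inter> phi ` (- p) = {}" using Cp by auto
  qed
  have Mp: "{a. phi a \<in> M} = p"
  proof
   show "{a. phi a \<in> M} \<subseteq> p" using M(3) by auto
   show "p \<subseteq> {a. phi a \<in> M}"
   proof
    fix s assume "s \<in> p"
    then obtain r where r: "r \<in> D" "r * s \<in> J" by (auto simp: p_def)
    then obtain b1 where b1: "b - phi r * b1 \<in> K" by (auto simp: D_def mult_of_def)
    have "phi s * b - phi (r * s) * b1 \<in> K" using K_mult[OF b1, of "phi s"] by (simp add: rhm_mult[OF phi] algebra_simps)
    thus "s \<in> {a. phi a \<in> M}" using r(2) M(2) by (auto simp: ext_mult_of mult_of_def C_def)
   qed
  qed
  have KM: "K \<subseteq> M" using KC M(2) by blast
  obtain e where e: "e \<in> p" and cm: "\<And>b. \<exists>s. s \<notin> M \<and> (s * b \<in> mult_of e \<or> (\<exists>a c'. c' \<notin> locid M p \<and> s * b - phi a * c' \<in> mult_of e))"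
   by (rule content_modulo[OF M(1) KM]) ( simp only: Mp)
  \<comment> \<open>By definition of p, each of its elements is carried into \<open>J\<close> by
    some divisor of \<open>b\<close>; one divisor for all elements at once makes the cofactor avoid
    p B. This is where contents modulo \<open>e\<close> are used.\<close>
  have "\<exists>r0\<in>D. \<forall>\<pi>\<in>p. r0 * \<pi> \<in> J"
  proof (rule ccontr)
   assume neg: "\<not> (\<exists>r0\<in>D. \<forall>\<pi>\<in>p. r0 * \<pi> \<in> J)"
   obtain r where r: "r \<in> D" "r * e \<in> J" using e by (auto simp: p_def)
   then obtain b1 where b1: "b - phi r * b1 \<in> K" by (auto simp: D_def mult_of_def)
   have xM: "False" if s: "s \<notin> M" and a: "r * a \<in> J" "s * b1 \<in> mult_of a" for s a
   proof -
    have "s * b - phi r * (s * b1) \<in> K" using K_mult[OF b1, of s] by (simp add: algebra_simps)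
    from K_cong[OF this mult_of_mult[OF a(2)] mult_of_ideal] show False using a(1) s M(2) by (auto simp: ext_mult_of C_def)
   qed
   obtain s where s: "s \<notin> M" "s * b1 \<in> mult_of e \<or> (\<exists>a c'. c' \<notin> locid M p \<and> s * b1 - phi a * c' \<in> mult_of e)" using cm by blast
   then obtain a c' where ac: "c' \<notin> locid M p" "s * b1 - phi a * c' \<in> mult_of e" using xM[OF s(1) r(2)] by blast
   have "\<not> dv e a"
   proof
    assume "dv e a"
    hence "phi a * c' \<in> mult_of e" by (rule mult_of_dv[OF _ mult_of_phi])
    hence "s * b1 - phi a * c' + phi a * c' \<in> mult_of e" by (rule qideal_add[OF mult_of_ideal(1) ac(2)])
    thus False using xM[OF s(1) r(2)] by simp
   qed
   then obtain d where d: "e - a * d \<in> KA" using dv_total[of e a] by (auto simp: dv_def)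
   have "s * b1 - phi a * c' \<in> mult_of (a * d)" by (rule mult_of_dvd[of e _ 1, OF _ ac(2)]) (simp add: d)
   then obtain w where w: "s * b1 - phi a * c' - phi (a * d) * w \<in> K" by (auto simp: mult_of_def)
   define c'' where "c'' = c' + phi d * w"
   have sc: "s * b1 - phi a * c'' \<in> K" using w by (simp add: c''_def rhm_mult[OF phi] algebra_simps)
   hence ra: "r * a \<in> D" using xM[OF s(1)] by (auto simp: mult_of_def J_def)
   \<comment> \<open>Outside p, \<open>d\<close> would keep \<open>r * a * d\<close>, hence
     \<open>r * e\<close>, among the divisors of \<open>b\<close>.\<close>
   have dp: "d \<in> p"
   proof (rule ccontr)
    assume "d \<notin> p"
    hence "r * a * d \<in> D" by (rule Dp[OF ra])
    moreover have "dv e (a * d)" unfolding dv_def using qideal_minus[OF KAI sring_UNIV d] by (auto intro!: exI[of _ 1])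
    ultimately show False using Ddv[OF dv_mult] r(2) by (auto simp: J_def mult.assoc)
   qed
   \<comment> \<open>As \<open>r * a\<close> divides \<open>b\<close>, by assumption some
     \<open>\<pi>\<close> in p leaves \<open>r * a * \<pi>\<close> a divisor too. Cancelling
     \<open>r * a\<close> exhibits \<open>c''\<close>, and then \<open>c'\<close>, as an element of
     p B.\<close>
   obtain \<pi> where \<pi>: "\<pi> \<in> p" "r * a * \<pi> \<in> D" using neg ra by (auto simp: J_def)
   hence "b \<in> mult_of (r * a * \<pi>)" by (simp add: D_def)
   hence "s * b \<in> mult_of (r * a * \<pi>)" by (rule qideal_mult[OF mult_of_ideal(1) UNIV_I])
   moreover have "phi (r * a) * c'' - s * b \<in> K"
    using K_minus[OF K_add[OF K_mult[OF b1, of s] K_mult[OF sc, of "phi r"]]] by (simp add: rhm_mult[OF phi] algebra_simps)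
   ultimately have "phi (r * a) * c'' \<in> mult_of (r * a * \<pi>)" by - (rule K_cong[OF _ _ mult_of_ideal])
   hence "c'' \<in> mult_of \<pi>" by (rule mult_of_mult_congD[OF _ DKA[OF ra]])
   hence c2: "c'' \<in> ext p" using \<pi>(1) by (auto simp: ext_mult_of)
   have xp: "rideal (ext p)" by (rule ext_ideal[OF pI KAp])
   have "phi d * w \<in> ext p" using dp mult_of_phi by (auto simp: ext_mult_of)
   from qideal_diff[OF xp sring_UNIV c2 this] show False using ac(1) rprime_1[OF M(1)] unfolding locid_def by (auto simp: c''_def)
  qed
  then obtain r0 where r0: "r0 \<in> D" "\<And>\<pi>. \<pi> \<in> p ==> r0 * \<pi> \<in> J" by blast
  then obtain b1 where b1: "b - phi r0 * b1 \<in> K" by (auto simp: D_def mult_of_def)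
  have "b1 \<notin> ext p"
  proof
   assume "b1 \<in> ext p"
   then obtain \<pi> where \<pi>: "\<pi> \<in> p" "b1 \<in> mult_of \<pi>" by (auto simp: ext_mult_of)
   thus False using DI2[OF b1 \<pi>(2)] r0(2) by (simp add: J_def)
  qed
  moreover have "b1 \<in> mult_of w" if "w \<notin> p" for w
   by (rule DI[OF b1 Dp[OF r0(1) that] r0(1)])
  ultimately show thesis by (rule that[OF p KAp b1])
 qed
qed

text \<open>With b = r b1 and c0 = r' c1, either a divides r r' and b1 is a unit, or b1 c1 is a
  scalar t. If t lies in both primes, primality of the extensions puts c1 into p B and b1 into p' B,
  impossible as p and p' are comparable. If t is outside one of them, it divides b1 or c1, and
  cancelling it shows that the other factor is a unit.\<close>

theorem divisor_of_scalar:
 assumes bc: "b * c0 - phi a \<in> K" and a: "a \<notin> KA"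
 shows "\<exists>r b1. b1 \<notin> q \<and> b - phi r * b1 \<in> K"
proof -
 have phia: "phi a \<notin> K" using a phi_KA by blast
 have "b * c0 \<notin> K"
 proof
  assume "b * c0 \<in> K"
  from K_diff[OF this bc] show False using phia by simp
 qed
 hence "b \<notin> K" "c0 \<notin> K" using K_mult K_multr by blast+
 obtain r p b1 where b: "rprime p" "KA \<subseteq> p" "b - phi r * b1 \<in> K" "b1 \<notin> ext p" "\<And>w. w \<notin> p ==> b1 \<in> mult_of w"
  by (rule content[OF \<open>b \<notin> K\<close>], erule that)
 obtain r' p' c1 where c: "rprime p'" "KA \<subseteq> p'" "c0 - phi r' * c1 \<in> K" "c1 \<notin> ext p'" "\<And>w. w \<notin> p' ==> c1 \<in> mult_of w"
  by (rule content[OF \<open>c0 \<notin> K\<close>], erule that)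
 have unitI: "y \<notin> q" if "y * z - 1 \<in> K" for y z
 proof
  assume "y \<in> q"
  hence "y * z - (y * z - 1) \<in> q" using qideal_diff[OF qI sring_UNIV qideal_multr[OF qI UNIV_I]] that Kq by blast
  thus False using q1 by simp
 qed
 have e: "phi (r * r') * (b1 * c1) - phi a \<in> K"
 proof -
  have "(b * c0 - phi a) - ((b - phi r * b1) * c0 + phi r * b1 * (c0 - phi r' * c1)) \<in> K"
   by (rule K_diff[OF bc K_add[OF K_multr[OF b(3)] K_mult[OF c(3)]]])
  thus ?thesis by (simp add: rhm_mult[OF phi] algebra_simps)
 qed
 show ?thesis
 proof (cases "dv a (r * r')")
  case True
  then obtain t where t: "r * r' - a * t \<in> KA" by (auto simp: dv_def)
  have "phi (r * r') * (b1 * c1) - phi a - phi (r * r' - a * t) * (b1 * c1) \<in> K"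
   by (rule K_diff[OF e K_multr[OF phiK[OF t]]])
  hence "phi a * (b1 * (c1 * phi t) - 1) \<in> K" by (simp add: rhm_mult[OF phi] rhm_diff[OF phi] algebra_simps)
  hence "b1 * (c1 * phi t) - 1 \<in> K" by (rule torsion_free[OF _ a])
  hence "b1 \<notin> q" by (rule unitI)
  thus ?thesis using b(3) by blast
 next
  case False
  then obtain t where t: "a - r * r' * t \<in> KA" using dv_total[of a "r * r'"] by (auto simp: dv_def)
  have rr: "r * r' \<notin> KA"
  proof
   assume "r * r' \<in> KA"
   from qideal_add[OF KAI t qideal_multr[OF KAI UNIV_I this, of t]] show False using a by simp
  qed
  have "phi (r * r') * (b1 * c1) - phi a + phi (a - r * r' * t) \<in> K" by (rule K_add[OF e phiK[OF t]])
  hence "phi (r * r') * (b1 * c1 - phi t) \<in> K" by (simp add: rhm_mult[OF phi] rhm_diff[OF phi] algebra_simps)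
  hence bct: "b1 * c1 - phi t \<in> K" by (rule torsion_free[OF _ rr])
  show ?thesis
  proof (cases "t \<in> p \<and> t \<in> p'")
   case True
   note pI = rprime_ideal[OF b(1)] rprime_ideal[OF c(1)]
   have x: "rideal (ext p)" "K \<subseteq> ext p" "rideal (ext p')" "K \<subseteq> ext p'"
    using ext_ideal[OF pI(1) b(2)] ext_ideal[OF pI(2) c(2)] by simp_all
   have "phi t \<in> ext p" "phi t \<in> ext p'" using True ext_phi by simp_all
   hence bc: "b1 * c1 \<in> ext p" "b1 * c1 \<in> ext p'" by - (rule K_cong[OF bct _ x(1,2)], assumption, rule K_cong[OF bct _ x(3,4)], assumption)
   have "c1 \<in> ext p" using ext_prime[OF b(1,2) bc(1)] b(4) by simp
   moreover have "b1 \<in> ext p'" using ext_prime[OF c(1,2) bc(2)] c(4) by simp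
   moreover have "ext p \<subseteq> ext p' \<or> ext p' \<subseteq> ext p" using ideal_chain[OF pI(1) b(2) pI(2) c(2)] by (auto simp: ext_mult_of)
   ultimately show ?thesis using b(4) c(4) by blast
  next
   case False
   then consider "t \<notin> p" | "t \<notin> p'" by blast
   thus ?thesis
   proof cases
    case 1
    then obtain v where v: "b1 - phi t * v \<in> K" using b(5) by (auto simp: mult_of_def)
    have "b1 * c1 - phi t - (b1 - phi t * v) * c1 \<in> K" by (rule K_diff[OF bct K_multr[OF v]])
    hence "phi t * (v * c1 - 1) \<in> K" by (simp add: algebra_simps)
    moreover have "t \<notin> KA" using 1 b(2) by blast
    ultimately have "v * c1 - 1 \<in> K" by (rule torsion_free)
    hence "v \<notin> q" by (rule unitI)
    moreover have "(b - phi r * b1) + phi r * (b1 - phi t * v) \<in> K" by (rule K_add[OF b(3) K_mult[OF v]])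
    hence "b - phi (r * t) * v \<in> K" by (simp add: rhm_mult[OF phi] algebra_simps)
    ultimately show ?thesis by blast
   next
    case 2
    then obtain v where v: "c1 - phi t * v \<in> K" using c(5) by (auto simp: mult_of_def)
    have "b1 * c1 - phi t - b1 * (c1 - phi t * v) \<in> K" by (rule K_diff[OF bct K_mult[OF v]])
    hence "phi t * (b1 * v - 1) \<in> K" by (simp add: algebra_simps)
    moreover have "t \<notin> KA" using 2 c(2) by blast
    ultimately have "b1 * v - 1 \<in> K" by (rule torsion_free)
    hence "b1 \<notin> q" by (rule unitI)
    thus ?thesis using b(3) by blast
   qed
  qed
 qed
qed

end

section \<open>Rings of the algebra library as images of type class rings\<close>

text \<open>The algebra above concerns rings given by types, while the schemes carry rings given by
  records. \<open>e\<close> presents a record ring as a quotient of a typed one, and its kernel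
  takes the place of \<open>K\<close> or \<open>KA\<close>. The domain \<open>Q\<close> accommodates
  polynomials in \<open>n\<close> variables, which do not form a type.\<close>

definition rcover :: "('w::comm_ring_1 => 'a) => 'w set => 'a ring => bool" where
 "rcover e Q R \<longleftrightarrow> sring Q \<and> e ` Q = carrier R \<and> e 1 = \<one>\<^bsub>R\<^esub> \<and> e 0 = \<zero>\<^bsub>R\<^esub> \<and>
   (\<forall>a\<in>Q. \<forall>b\<in>Q. e (a + b) = e a \<oplus>\<^bsub>R\<^esub> e b \<and> e (a * b) = e a \<otimes>\<^bsub>R\<^esub> e b)"

lemma rcoverD:
 assumes "rcover e Q R"
 shows rcover_sring: "sring Q" and rcover_1: "e 1 = \<one>\<^bsub>R\<^esub>" and rcover_0: "e 0 = \<zero>\<^bsub>R\<^esub>"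
  and rcover_carrier: "a \<in> Q ==> e a \<in> carrier R" and rcover_image: "carrier R = e ` Q"
  and rcover_add: "a \<in> Q ==> b \<in> Q ==> e (a + b) = e a \<oplus>\<^bsub>R\<^esub> e b"
  and rcover_mult: "a \<in> Q ==> b \<in> Q ==> e (a * b) = e a \<otimes>\<^bsub>R\<^esub> e b"
 using assms by (auto simp: rcover_def)

lemma rcover_surj:
 assumes "rcover e Q R" "x \<in> carrier R" obtains a where "a \<in> Q" "x = e a"
proof -
 have "x \<in> e ` Q" using assms by (simp add: rcover_def)
 thus thesis using that by blast
qed

lemma rcover_cring: assumes c: "rcover e Q R" shows "cring R"
proof -
 have Q: "sring Q" by (rule rcover_sring[OF c])
 note im = rcover_image[OF c] and ad = rcover_add[OF c, symmetric] and mu = rcover_mult[OF c, symmetric]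
  and o = rcover_1[OF c, symmetric] and z = rcover_0[OF c, symmetric]
 note s = sring_0[OF Q] sring_1[OF Q] sring_add[OF Q] sring_mult[OF Q] sring_minus[OF Q]
 show ?thesis
 proof (rule cringI)
  show "abelian_group R"
  proof (rule abelian_groupI)
   fix x y assume "x \<in> carrier R" "y \<in> carrier R"
   then obtain a b where "x = e a" "y = e b" "a \<in> Q" "b \<in> Q" unfolding im by blast
   thus "x \<oplus>\<^bsub>R\<^esub> y \<in> carrier R" "x \<oplus>\<^bsub>R\<^esub> y = y \<oplus>\<^bsub>R\<^esub> x"
    unfolding im using s by (auto simp: ad add.commute)
   fix w assume "w \<in> carrier R"
   then obtain d where "w = e d" "d \<in> Q" unfolding im by blast
   thus "x \<oplus>\<^bsub>R\<^esub> y \<oplus>\<^bsub>R\<^esub> w = x \<oplus>\<^bsub>R\<^esub> (y \<oplus>\<^bsub>R\<^esub> w)"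
    using s \<open>x = e a\<close> \<open>y = e b\<close> \<open>a \<in> Q\<close> \<open>b \<in> Q\<close> by (simp add: ad add.assoc)
  next
   fix x assume "x \<in> carrier R"
   then obtain a where a: "x = e a" "a \<in> Q" unfolding im by blast
   thus "\<zero>\<^bsub>R\<^esub> \<oplus>\<^bsub>R\<^esub> x = x" using s by (simp add: z ad)
   have "e (- a) \<in> carrier R" unfolding im using s a by blast
   moreover have "e (- a) \<oplus>\<^bsub>R\<^esub> x = \<zero>\<^bsub>R\<^esub>" using s a by (simp add: z ad)
   ultimately show "\<exists>y\<in>carrier R. y \<oplus>\<^bsub>R\<^esub> x = \<zero>\<^bsub>R\<^esub>" by blast
  qed (use s in \<open>auto simp: im z\<close>)
  show "comm_monoid R"
  proof (rule comm_monoidI)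
   fix x y assume "x \<in> carrier R" "y \<in> carrier R"
   then obtain a b where "x = e a" "y = e b" "a \<in> Q" "b \<in> Q" unfolding im by blast
   thus "x \<otimes>\<^bsub>R\<^esub> y \<in> carrier R" "x \<otimes>\<^bsub>R\<^esub> y = y \<otimes>\<^bsub>R\<^esub> x"
    unfolding im using s by (auto simp: mu mult.commute)
   fix w assume "w \<in> carrier R"
   then obtain d where "w = e d" "d \<in> Q" unfolding im by blast
   thus "x \<otimes>\<^bsub>R\<^esub> y \<otimes>\<^bsub>R\<^esub> w = x \<otimes>\<^bsub>R\<^esub> (y \<otimes>\<^bsub>R\<^esub> w)"
    using s \<open>x = e a\<close> \<open>y = e b\<close> \<open>a \<in> Q\<close> \<open>b \<in> Q\<close> by (simp add: mu mult.assoc)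
  next
   fix x assume "x \<in> carrier R"
   then obtain a where a: "x = e a" "a \<in> Q" unfolding im by blast
   thus "\<one>\<^bsub>R\<^esub> \<otimes>\<^bsub>R\<^esub> x = x" using s by (simp add: o mu)
  qed (use s in \<open>auto simp: im o\<close>)
  fix x y w assume "x \<in> carrier R" "y \<in> carrier R" "w \<in> carrier R"
  then obtain a b d where "x = e a" "y = e b" "w = e d" "a \<in> Q" "b \<in> Q" "d \<in> Q" unfolding im by blast
  thus "(x \<oplus>\<^bsub>R\<^esub> y) \<otimes>\<^bsub>R\<^esub> w = x \<otimes>\<^bsub>R\<^esub> w \<oplus>\<^bsub>R\<^esub> y \<otimes>\<^bsub>R\<^esub> w"
   using s by (simp add: mu ad distrib_right)
 qed
qed

lemma rcover_minus: assumes c: "rcover e Q R" and a: "a \<in> Q" shows "e (- a) = \<ominus>\<^bsub>R\<^esub> e a"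
proof -
 interpret cring R by (rule rcover_cring[OF c])
 have m: "- a \<in> Q" by (rule sring_minus[OF rcover_sring[OF c] a])
 show ?thesis using rcover_add[OF c m a] rcover_0[OF c] minus_equality rcover_carrier[OF c] a m by simp
qed

lemma rcover_diff: assumes c: "rcover e Q R" and ab: "a \<in> Q" "b \<in> Q" shows "e (a - b) = e a \<ominus>\<^bsub>R\<^esub> e b"
 using rcover_add[OF c ab(1) sring_minus[OF rcover_sring[OF c] ab(2)]] rcover_minus[OF c ab(2)] by (simp add: a_minus_def)

lemma rcover_eq_iff:
 assumes c: "rcover e Q R" and ab: "a \<in> Q" "b \<in> Q" shows "e a = e b \<longleftrightarrow> e (a - b) = \<zero>\<^bsub>R\<^esub>"
proof -
 interpret cring R by (rule rcover_cring[OF c])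
 show ?thesis unfolding rcover_diff[OF c ab] using rcover_carrier[OF c] ab by simp
qed

lemma rcover_sum:
 assumes c: "rcover e Q R" and g: "\<And>i. i \<in> A ==> g i \<in> Q"
 shows "e (sum g A) = (\<Oplus>\<^bsub>R\<^esub>i\<in>A. e (g i))"
proof -
 interpret cring R by (rule rcover_cring[OF c])
 show ?thesis using g
 proof (induction A rule: infinite_finite_induct)
  case (insert i A)
  have "sum g A \<in> Q" by (rule sring_sum[OF rcover_sring[OF c]]) (use insert in auto)
  thus ?case using insert rcover_carrier[OF c] by (simp add: rcover_add[OF c])
 qed (simp_all add: rcover_0[OF c])
qed

lemma rcover_prod:
 assumes c: "rcover e Q R" and g: "\<And>i. i \<in> A ==> g i \<in> Q"
 shows "e (prod g A) = (\<Otimes>\<^bsub>R\<^esub>i\<in>A. e (g i)) \<and> prod g A \<in> Q"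
proof -
 interpret cring R by (rule rcover_cring[OF c])
 note Q = rcover_sring[OF c]
 show ?thesis using g
 proof (induction A rule: infinite_finite_induct)
  case (insert i A)
  thus ?case using rcover_carrier[OF c] sring_mult[OF Q] by (simp add: rcover_mult[OF c])
 qed (simp_all add: rcover_1[OF c] sring_1[OF Q])
qed

lemma rcover_power:
 assumes c: "rcover e Q R" and a: "a \<in> Q"
 shows "e (a ^ k) = e a [^]\<^bsub>R\<^esub> (k::nat) \<and> a ^ k \<in> Q"
proof -
 interpret cring R by (rule rcover_cring[OF c])
 note Q = rcover_sring[OF c]
 show ?thesis using a rcover_carrier[OF c a]
  by (induction k) (simp_all add: rcover_1[OF c] sring_1[OF Q] rcover_mult[OF c] sring_mult[OF Q] m_comm)
qed

lemma rcover_kernel: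
 assumes c: "rcover e UNIV R" shows "rideal {a. e a = \<zero>\<^bsub>R\<^esub>}"
proof -
 interpret cring R by (rule rcover_cring[OF c])
 show ?thesis unfolding qideal_def using rcover_carrier[OF c] by (auto simp: rcover_0[OF c] rcover_add[OF c] rcover_mult[OF c])
qed

lemma ex_free_cover:
 assumes R: "cring (R :: 'a ring)"
 shows "\<exists>e :: ('a, int) mp => 'a. rcover e UNIV R"
proof -
 interpret cring R by (rule R)
 \<comment> \<open>Variables are indexed by the whole type. Those outside the carrier act trivially,
   so that the folded operation commutes on all arguments and the product over a multiset is
   defined.\<close>
 define op where "op x y = (if x \<in> carrier R \<and> y \<in> carrier R then x \<otimes>\<^bsub>R\<^esub> y else y)" for x y
 interpret comp_fun_commute op
  by unfold_locales (auto simp: op_def m_lcomm)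
 define f where "f m = fold_mset op \<one>\<^bsub>R\<^esub> m" for m
 have f_add1: "f (add_mset x m) = op x (f m)" for x m by (simp add: f_def)
 have fc: "f m \<in> carrier R" for m by (induction m) (auto simp: f_add1, auto simp: f_def op_def)
 have fadd: "f (m + k) = f m \<otimes>\<^bsub>R\<^esub> f k" for m k
 proof (induction m)
  case empty
  show ?case using fc by (simp add: f_def)
 next
  case (add x m) thus ?case using fc by (simp add: f_add1 op_def m_assoc)
 qed
 obtain h where h: "h \<in> hom (free_Abelian_group UNIV) (add_monoid R)" "\<And>m. h (frag_of m) = f m"
  using comm_group.free_Abelian_group_universal[OF a_comm_group, of f UNIV] fc by auto
 have hc: "h a \<in> carrier R" for a using h(1) by (auto simp: hom_def)
 have hadd: "h (a + b) = h a \<oplus>\<^bsub>R\<^esub> h b" for a b using h(1) by (auto simp: hom_def)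
 have h0: "h 0 = \<zero>\<^bsub>R\<^esub>" using hadd[of 0 0] hc by simp
 have hdiff: "h (a - b) = h a \<ominus>\<^bsub>R\<^esub> h b" for a b
 proof -
  show ?thesis using hadd[of "a - b" b] using hc by (simp add: a_minus_def a_assoc r_neg)
 qed
 have hm1: "h (frag_of m * b) = f m \<otimes>\<^bsub>R\<^esub> h b" for m b
 proof (rule frag_induction[of b UNIV])
  fix k show "h (frag_of m * frag_of k) = f m \<otimes>\<^bsub>R\<^esub> h (frag_of k)"
   by (simp add: mult_single h(2) fadd)
 next
  fix a b assume "h (frag_of m * a) = f m \<otimes>\<^bsub>R\<^esub> h a" "h (frag_of m * b) = f m \<otimes>\<^bsub>R\<^esub> h b"
  thus "h (frag_of m * (a - b)) = f m \<otimes>\<^bsub>R\<^esub> h (a - b)" using fc hc by (simp add: right_diff_distrib hdiff a_minus_def r_distr r_minus)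
 qed (use fc in \<open>simp_all add: h0\<close>)
 have hm: "h (a * b) = h a \<otimes>\<^bsub>R\<^esub> h b" for a b
 proof (rule frag_induction[of a UNIV])
  fix k show "h (frag_of k * b) = h (frag_of k) \<otimes>\<^bsub>R\<^esub> h b" by (simp add: hm1 h(2))
 next
  fix a c assume "h (a * b) = h a \<otimes>\<^bsub>R\<^esub> h b" "h (c * b) = h c \<otimes>\<^bsub>R\<^esub> h b"
  thus "h ((a - c) * b) = h (a - c) \<otimes>\<^bsub>R\<^esub> h b" using hc by (simp add: left_diff_distrib hdiff a_minus_def l_distr l_minus)
 qed (use hc in \<open>simp_all add: h0\<close>)
 have hV: "h (Vr x) = (if x \<in> carrier R then x else \<one>\<^bsub>R\<^esub>)" for x
  using h(2) by (simp add: Vr_def f_def op_def)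
 have h1: "h 1 = \<one>\<^bsub>R\<^esub>" using h(2)[of "{#}"] by (simp add: f_def)
 have "x \<in> range h" if "x \<in> carrier R" for x using that by (intro image_eqI[of _ _ "Vr x"]) (simp_all add: hV)
 hence "rcover h UNIV R" using hc by (auto simp: rcover_def h0 h1 hm hadd)
 thus ?thesis by blast
qed

definition cov :: "'a ring => ('a, int) mp => 'a" where
 "cov R = (SOME e. rcover e UNIV R)"

lemma rcover_cov: "cring R ==> rcover (cov R) UNIV R"
 unfolding cov_def using someI_ex[OF ex_free_cover] .

lemma rhm_of_int_mp: "rhm (of_int :: int => 'r::comm_ring_1)"
 by (simp add: rhm_def)

text \<open>Freeness of \<open>cov R\<close>.\<close>

lemma cov_lift:
 assumes R: "cring R" and e': "rcover e' UNIV R'" and \<theta>: "\<theta> \<in> Ring.ring_hom R R'"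
 obtains \<theta>' where "rhm \<theta>'" "\<And>w. e' (\<theta>' w) = \<theta> (cov R w)"
proof -
 note c = rcover_cov[OF R]
 have c': "cov R w \<in> carrier R" for w by (rule rcover_carrier[OF c UNIV_I])
 interpret R: cring R by (rule R)
 interpret R': cring R' by (rule rcover_cring[OF e'])
 have "\<forall>x. \<exists>w. e' w = \<theta> (cov R (Vr x))"
 proof
  fix x
  have "\<theta> (cov R (Vr x)) \<in> carrier R'" by (rule ring_hom_closed[OF \<theta> c'])
  thus "\<exists>w. e' w = \<theta> (cov R (Vr x))" by (metis rcover_surj[OF e'])
 qed
 then obtain g where g: "\<And>x. e' (g x) = \<theta> (cov R (Vr x))" by metis
 define \<theta>' where "\<theta>' = peval of_int g"
 have r: "rhm \<theta>'" unfolding \<theta>'_def by (rule rhm_peval[OF rhm_of_int_mp])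
 have \<theta>0: "\<theta> \<zero>\<^bsub>R\<^esub> = \<zero>\<^bsub>R'\<^esub>" by (rule ring_hom_zero[OF \<theta> R.ring_axioms R'.ring_axioms])
 have \<theta>m: "\<theta> (\<ominus>\<^bsub>R\<^esub> x) = \<ominus>\<^bsub>R'\<^esub> \<theta> x" if "x \<in> carrier R" for x
 proof -
  show ?thesis using ring_hom_add[OF \<theta>, of "\<ominus>\<^bsub>R\<^esub> x" x] using R'.minus_equality ring_hom_closed[OF \<theta>] that by (simp add: R.l_neg \<theta>0)
 qed
 let ?T = "{w. e' (\<theta>' w) = \<theta> (cov R w)}"
 have T: "sring ?T" unfolding sring_def
  using c' by (auto simp: rhm_1[OF r] rhm_mult[OF r] rhm_diff[OF r] rcover_1[OF c] rcover_1[OF e'] ring_hom_one[OF \<theta>]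
    rcover_diff[OF c] rcover_diff[OF e'] rcover_mult[OF c] rcover_mult[OF e'] ring_hom_mult[OF \<theta>] a_minus_def ring_hom_add[OF \<theta>] \<theta>m)
 have "pset UNIV UNIV \<subseteq> ?T"
 proof (rule pset_least[OF T])
  fix k :: int
  have "Cn k = (of_int k :: ('a, int) mp)" using rhm_of_int[OF rhm_Cn[where 'r = int], of k] by simp
  thus "Cn k \<in> ?T" using sring_of_int[OF T] by simp
 next
  fix x show "Vr x \<in> ?T" by (simp add: \<theta>'_def peval_Vr[OF rhm_of_int_mp] g)
 qed
 thus thesis using that[OF r] by (auto simp: pset_def)
qed

subsection \<open>Polynomial rings and standard smooth algebras\<close>

definition cpoly :: "('w::comm_ring_1 => 'a) => (nat, 'w) mp => nat multiset => 'a" where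
 "cpoly e p = (\<lambda>m. e (coef p m))"

lemma finite_submultisets: "finite {k. k \<subseteq># m}"
proof (rule finite_subset)
 show "{k. k \<subseteq># m} \<subseteq> mset ` {xs. set xs \<subseteq> set_mset m \<and> length xs \<le> size m}"
 proof
  fix k assume "k \<in> {k. k \<subseteq># m}"
  moreover obtain xs where "k = mset xs" using ex_mset[of k] by auto
  ultimately show "k \<in> mset ` {xs. set xs \<subseteq> set_mset m \<and> length xs \<le> size m}"
   using set_mset_mono[of k m] size_mset_mono[of k m] by auto
 qed
qed (simp add: finite_lists_length_le)

lemma coef_mult_subsets:
 fixes p q :: "('i, 'r::comm_ring_1) mp"
 shows "coef (p * q) m = (\<Sum>k\<in>{k. k \<subseteq># m}. coef p k * coef q (m - k))"
proof (induction p rule: mp_induct)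
 case (add p p') thus ?case by (simp add: distrib_right lookup_add sum.distrib)
next
 case (term1 a c)
 note fin = finite_submultisets[of m]
 have "(\<Sum>k\<in>{k. k \<subseteq># m}. coef (term1 a c) k * coef q (m - k)) = (\<Sum>k\<in>{k. k \<subseteq># m}. if k = a then c * coef q (m - a) else 0)"
  by (rule sum.cong) (auto simp: lookup_single)
 also have "\<dots> = (if a \<subseteq># m then c * coef q (m - a) else 0)" by (simp add: fin)
 also have "\<dots> = coef (term1 a c * q) m"
 proof (induction q rule: mp_induct)
  case (add q q') thus ?case by (simp add: distrib_left lookup_add split: if_splits)
 next
  case (term1 b d)
  show ?case by (auto simp: mult_single lookup_single when_def) (metis mset_subset_eq_add_left)
 qed
 finally show ?case ..
qed

context
 fixes e :: "'w::comm_ring_1 => 'a" and R :: "'a ring" and n :: nat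
 assumes e: "rcover e UNIV R"
begin

interpretation R: cring R by (rule rcover_cring[OF e])

lemma cpoly_add: "cpoly e (p + q) = R.indexed_padd (cpoly e p) (cpoly e q)"
 by (simp add: cpoly_def R.indexed_padd_def lookup_add rcover_add[OF e])

lemma cpoly_Cn: "cpoly e (Cn a) = R.indexed_const (e a)"
 by (auto simp: cpoly_def R.indexed_const_def coef_Cn rcover_0[OF e])

lemma cpoly_Vr_mult: "cpoly e (p * Vr i) = R.indexed_pmult (cpoly e p) i"
proof -
 have "coef (p * Vr i) m = (if i \<in># m then coef p (m - {#i#}) else 0)" for m
 proof -
  have "coef (Vr i * p) m = (\<Sum>k\<in>{k. k \<subseteq># m}. if k = {#i#} then coef p (m - {#i#}) else 0)"
   unfolding coef_mult_subsets by (rule sum.cong) (auto simp: Vr_def lookup_single)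
  thus ?thesis by (simp add: mult.commute finite_submultisets)
 qed
 thus ?thesis by (auto simp: cpoly_def R.indexed_pmult_def rcover_0[OF e])
qed

lemma cpoly_in_indexed_pset: "p \<in> pset UNIV {..<n} ==> cpoly e p \<in> R.indexed_pset {..<n} (carrier R)"
proof -
 have t: "cpoly e (term1 m c) \<in> R.indexed_pset {..<n} (carrier R)" if "set_mset m \<subseteq> {..<n}" for m c using that
 proof (induction m)
  case empty
  show ?case using R.indexed_const[of "e c" "carrier R"] rcover_carrier[OF e] by (simp add: cpoly_Cn flip: Cn_def)
 next
  case (add i m)
  have "term1 (add_mset i m) c = term1 m c * Vr i" by (simp add: Vr_def mult_single)
  moreover have "R.indexed_pmult (cpoly e (term1 m c)) i \<in> R.indexed_pset {..<n} (carrier R)"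
   by rule (use add in auto)
  ultimately show ?case by (simp add: cpoly_Vr_mult)
 qed
 have "cpoly e (\<Sum>m\<in>A. term1 m (c m)) \<in> R.indexed_pset {..<n} (carrier R)"
  if "finite A" "\<And>m. m \<in> A ==> set_mset m \<subseteq> {..<n}" for A c using that
 proof (induction A)
  case empty
  show ?case using t[of "{#}" 0] by simp
 next
  case (insert m A)
  moreover have "R.indexed_padd (cpoly e (term1 m (c m))) (cpoly e (\<Sum>m\<in>A. term1 m (c m))) \<in> R.indexed_pset {..<n} (carrier R)"
   by rule (use insert t in auto)
  ultimately show ?case by (simp add: cpoly_add)
 qed
 from this[of "mons p" "coef p"] show "p \<in> pset UNIV {..<n} ==> ?thesis" using mp_expand[of p] by (simp add: pset_vars)
qed

lemma indexed_pset_cpoly: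
 assumes "P \<in> R.indexed_pset {..<n} (carrier R)" shows "\<exists>p\<in>pset UNIV {..<n}. P = cpoly e p"
 using assms
proof induction
 case (indexed_const k)
 then obtain a where "k = e a" by (rule rcover_surj[OF e])
 thus ?case using pset_Cn by (intro bexI) (auto simp: cpoly_Cn)
next
 case (indexed_padd P Q)
 then obtain p q where "p \<in> pset UNIV {..<n}" "q \<in> pset UNIV {..<n}" "P = cpoly e p" "Q = cpoly e q" by blast
 thus ?case using sring_add[OF sring_pset[OF sring_UNIV]] by (intro bexI[of _ "p + q"]) (auto simp: cpoly_add)
next
 case (indexed_pmult P i)
 then obtain p where "p \<in> pset UNIV {..<n}" "P = cpoly e p" by blast
 thus ?case using sring_mult[OF sring_pset[OF sring_UNIV]] pset_Vr[OF sring_UNIV indexed_pmult(2)]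
  by (intro bexI[of _ "p * Vr i"]) (auto simp: cpoly_Vr_mult)
qed

lemma rcover_mpoly: "rcover (cpoly e) (pset UNIV {..<n}) (mpoly_ring n R)"
 unfolding rcover_def
proof (intro conjI ballI)
 show "sring (pset UNIV {..<n} :: (nat, 'w) mp set)" by (rule sring_pset) simp
 show "cpoly e ` pset UNIV {..<n} = carrier (mpoly_ring n R)"
  using cpoly_in_indexed_pset indexed_pset_cpoly by (auto simp: mpoly_ring_def)
 show "cpoly e 1 = \<one>\<^bsub>mpoly_ring n R\<^esub>" "cpoly e 0 = \<zero>\<^bsub>mpoly_ring n R\<^esub>"
  using cpoly_Cn[of 1] cpoly_Cn[of 0] by (simp_all add: mpoly_ring_def Cn_simps rcover_1[OF e] rcover_0[OF e])
 fix p q :: "(nat, 'w) mp"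
 show "cpoly e (p + q) = cpoly e p \<oplus>\<^bsub>mpoly_ring n R\<^esub> cpoly e q" by (simp add: mpoly_ring_def cpoly_add)
 show "cpoly e (p * q) = cpoly e p \<otimes>\<^bsub>mpoly_ring n R\<^esub> cpoly e q"
  by (simp add: mpoly_ring_def cpoly_def coef_mult_subsets rcover_sum[OF e] rcover_mult[OF e])
qed

lemma cpoly_mpd: "mpoly_deriv R i (cpoly e p) = cpoly e (mpd i p)"
proof -
 have "[k] \<cdot>\<^bsub>R\<^esub> e a = e (of_nat k * a)" for k a
  by (induction k) (simp_all add: rcover_0[OF e] rcover_add[OF e] distrib_right R.add.m_comm rcover_carrier[OF e])
 thus ?thesis by (simp add: mpoly_deriv_def cpoly_def coef_mpd)
qed

lemma cpoly_eval:
 assumes e': "rcover e' UNIV C" and \<kappa>: "rhm \<kappa>" "\<And>w. e' (\<kappa> w) = \<phi> (e w)"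
  and x: "\<And>i. i < n ==> e' (x' i) = x i" and p: "p \<in> pset UNIV {..<n}"
 shows "mpoly_eval n R C \<phi> x (cpoly e p) = e' (peval \<kappa> x' p)"
proof -
 interpret C: cring C by (rule rcover_cring[OF e'])
 have mon: "mon x' m = (\<Prod>i<n. x' i ^ count m i)" if "set_mset m \<subseteq> {..<n}" for m using that
 proof (induction m)
  case (add i m)
  have "(\<Prod>j<n. x' j ^ count (add_mset i m) j) = (\<Prod>j<n. (if j = i then x' i else 1) * x' j ^ count m j)"
   by (rule prod.cong) auto
  also have "\<dots> = x' i * (\<Prod>j<n. x' j ^ count m j)" using add.prems by (simp add: prod.distrib)
  finally show ?case using add by (simp add: mon_add_mset)
 qed simp
 have ec: "e' w \<in> carrier C" for w by (rule rcover_carrier[OF e' UNIV_I])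
 have emon: "e' (mon x' m) = (\<Otimes>\<^bsub>C\<^esub>i\<in>{..<n}. x i [^]\<^bsub>C\<^esub> count m i)" if "set_mset m \<subseteq> {..<n}" for m
 proof -
  have "e' (mon x' m) = (\<Otimes>\<^bsub>C\<^esub>i\<in>{..<n}. e' (x' i ^ count m i))" unfolding mon[OF that]
   by (rule conjunct1[OF rcover_prod[OF e']]) simp
  also have "\<dots> = (\<Otimes>\<^bsub>C\<^esub>i\<in>{..<n}. x i [^]\<^bsub>C\<^esub> count m i)"
   by (rule C.finprod_cong') (auto simp: rcover_power[OF e'] ec simp flip: x)
  finally show ?thesis .
 qed
 have "e' (peval \<kappa> x' p) = (\<Oplus>\<^bsub>C\<^esub>m\<in>mons p. \<phi> (cpoly e p m) \<otimes>\<^bsub>C\<^esub> e' (mon x' m))"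
  unfolding peval_def by (subst rcover_sum[OF e']) (simp_all add: rcover_mult[OF e'] \<kappa>(2) cpoly_def)
 \<comment> \<open>A monomial may have a nonzero lifted coefficient that maps to zero in
   \<open>R\<close>; such terms contribute nothing to the sum.\<close>
 also have "\<dots> = (\<Oplus>\<^bsub>C\<^esub>m\<in>{m. cpoly e p m \<noteq> \<zero>\<^bsub>R\<^esub>}. \<phi> (cpoly e p m) \<otimes>\<^bsub>C\<^esub> (\<Otimes>\<^bsub>C\<^esub>i\<in>{..<n}. x i [^]\<^bsub>C\<^esub> count m i))"
 proof (rule C.add.finprod_mono_neutral_cong_left[symmetric, OF finite_keys])
  show "{m. cpoly e p m \<noteq> \<zero>\<^bsub>R\<^esub>} \<subseteq> mons p" by (auto simp: cpoly_def in_keys_iff rcover_0[OF e])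
  have \<phi>0: "\<phi> \<zero>\<^bsub>R\<^esub> = \<zero>\<^bsub>C\<^esub>" using \<kappa>(2)[of 0] by (simp add: rhm_0[OF \<kappa>(1)] rcover_0[OF e] rcover_0[OF e'])
  show "\<phi> (cpoly e p m) \<otimes>\<^bsub>C\<^esub> e' (mon x' m) = \<zero>\<^bsub>C\<^esub>" if "m \<in> mons p - {m. cpoly e p m \<noteq> \<zero>\<^bsub>R\<^esub>}" for m
   using that ec by (simp add: \<phi>0)
  show "\<phi> (cpoly e p m) \<otimes>\<^bsub>C\<^esub> (\<Otimes>\<^bsub>C\<^esub>i\<in>{..<n}. x i [^]\<^bsub>C\<^esub> count m i) = \<phi> (cpoly e p m) \<otimes>\<^bsub>C\<^esub> e' (mon x' m)"
   if "m \<in> {m. cpoly e p m \<noteq> \<zero>\<^bsub>R\<^esub>}" for m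
  proof -
   have "m \<in> mons p" using that by (auto simp: cpoly_def in_keys_iff rcover_0[OF e])
   thus ?thesis using emon[OF pset_vars[OF p]] by simp
  qed
  show "(\<lambda>m. \<phi> (cpoly e p m) \<otimes>\<^bsub>C\<^esub> e' (mon x' m)) \<in> mons p \<rightarrow> carrier C"
   using ec by (auto simp: cpoly_def simp flip: \<kappa>(2))
 qed
 finally show ?thesis by (simp add: mpoly_eval_def)
qed

end

text \<open>Transfers the Jacobian determinant to matrices over a typed ring, where the adjugate is
  at hand.\<close>

lemma rcover_det:
 assumes e: "rcover e UNIV R"
 shows "ring_det R c (\<lambda>i j. e (M i j)) = e (det (mat c c (\<lambda>(i, j). M i j)))"
proof -
 interpret R: cring R by (rule rcover_cring[OF e])
 have ec: "e w \<in> carrier R" for w by (rule rcover_carrier[OF e UNIV_I])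
 have "e (det (mat c c (\<lambda>(i, j). M i j))) = e (\<Sum>\<sigma>\<in>{\<sigma>. \<sigma> permutes {..<c}}. signof \<sigma> * (\<Prod>i<c. M i (\<sigma> i)))"
  by (rule arg_cong, subst det_def')
   (auto simp: lessThan_atLeast0)
 also have "\<dots> = (\<Oplus>\<^bsub>R\<^esub>\<sigma>\<in>{\<sigma>. \<sigma> permutes {..<c}}. e (signof \<sigma> * (\<Prod>i<c. M i (\<sigma> i))))"
  by (rule rcover_sum[OF e]) simp
 also have "\<dots> = ring_det R c (\<lambda>i j. e (M i j))" unfolding ring_det_def
  by (rule R.finsum_cong') (auto simp: rcover_mult[OF e] rcover_prod[OF e] sign_def rcover_1[OF e] rcover_minus[OF e] ec)
 finally show ?thesis ..
qed

text \<open>The witness is \<open>t\<close> times the adjugate matrix. The determinant is invertible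
  only modulo \<open>I\<close>, hence both products are identities only modulo
  \<open>I\<close>.\<close>

lemma adjugate_inverse:
 fixes M :: "nat => nat => 'z::comm_ring_1"
 assumes I: "rideal I" and t: "t * det (mat c c (\<lambda>(i, j). M i j)) - 1 \<in> I"
 shows "\<exists>N. (\<forall>j<c. \<forall>k<c. (\<Sum>i<c. M j i * N i k) - (if j = k then 1 else 0) \<in> I) \<and>
  (\<forall>i<c. \<forall>l<c. (\<Sum>k<c. N i k * M k l) - (if i = l then 1 else 0) \<in> I)"
proof -
 define A where "A = mat c c (\<lambda>(i, j). M i j)"
 have A: "A \<in> carrier_mat c c" by (simp add: A_def)
 define N where "N i k = t * adj_mat A $$ (i, k)" for i k
 have aM: "(A * adj_mat A) $$ (j, k) = (\<Sum>i<c. M j i * adj_mat A $$ (i, k))"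
  and Ma: "(adj_mat A * A) $$ (j, k) = (\<Sum>i<c. adj_mat A $$ (j, i) * M i k)" if "j < c" "k < c" for j k
  using that adj_mat(1)[OF A] by (auto simp: scalar_prod_def lessThan_atLeast0 A_def)
 have tI: "t * (if j = k then det A else 0) - (if j = k then 1 else 0) \<in> I" for j k :: nat
  using t qideal_0[OF I] by (simp add: A_def)
 show ?thesis
 proof (intro exI[of _ N] conjI allI impI)
  fix j k assume jk: "j < c" "k < c"
  have "(\<Sum>i<c. M j i * N i k) = t * (A * adj_mat A) $$ (j, k)"
   by (simp add: aM[OF jk] N_def sum_distrib_left mult_ac)
  thus "(\<Sum>i<c. M j i * N i k) - (if j = k then 1 else 0) \<in> I"
   using tI jk by (simp add: adj_mat(2)[OF A] if_distrib cong: if_cong)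
 next
  fix i l assume jk: "i < c" "l < c"
  have "(\<Sum>k<c. N i k * M k l) = t * (adj_mat A * A) $$ (i, l)"
   by (simp add: Ma[OF jk] N_def sum_distrib_left mult_ac)
  thus "(\<Sum>k<c. N i k * M k l) - (if i = l then 1 else 0) \<in> I"
   using tI jk by (simp add: adj_mat(3)[OF A] if_distrib cong: if_cong)
 qed
qed

lemma rcover_ideal_image:
 assumes e: "rcover e Q P" and I: "qideal Q I" and IQ: "I \<subseteq> Q"
 shows "ideal (e ` I) P"
proof -
 interpret P: cring P by (rule rcover_cring[OF e])
 note Q = rcover_sring[OF e]
 show ?thesis
 proof (rule idealI[OF P.ring_axioms])
  show "subgroup (e ` I) (add_monoid P)"
  proof (rule P.add.subgroupI)
   show "e ` I \<subseteq> carrier P" using IQ rcover_carrier[OF e] by auto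
   show "e ` I \<noteq> {}" using qideal_0[OF I] by blast
   fix a assume "a \<in> e ` I"
   then obtain u where u: "u \<in> I" "a = e u" by blast
   have "\<ominus>\<^bsub>P\<^esub> a = e (- u)" using rcover_minus[OF e] u IQ by auto
   thus "\<ominus>\<^bsub>P\<^esub> a \<in> e ` I" using qideal_minus[OF I Q u(1)] by simp
   fix b assume "b \<in> e ` I"
   then obtain v where v: "v \<in> I" "b = e v" by blast
   have "u \<in> Q" "v \<in> Q" using u v IQ by auto
   hence "a \<oplus>\<^bsub>P\<^esub> b = e (u + v)" using rcover_add[OF e, of u v] u v by simp
   thus "a \<oplus>\<^bsub>P\<^esub> b \<in> e ` I" using qideal_add[OF I u(1) v(1)] by simp
  qed
  fix a x assume a: "a \<in> e ` I" and x: "x \<in> carrier P"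
  obtain u where u: "u \<in> I" "a = e u" using a by blast
  obtain v where v: "v \<in> Q" "x = e v" using x by (rule rcover_surj[OF e])
  have "x \<otimes>\<^bsub>P\<^esub> a = e (v * u)" using IQ rcover_mult[OF e, of v u] u v by auto
  thus "x \<otimes>\<^bsub>P\<^esub> a \<in> e ` I" using qideal_mult[OF I v(1) u(1)] by simp
  moreover have "a \<in> carrier P" using u IQ rcover_carrier[OF e] by auto
  ultimately show "a \<otimes>\<^bsub>P\<^esub> x \<in> e ` I" using x by (simp add: P.m_comm)
 qed
qed

lemma rcover_Idl:
 assumes e: "rcover e Q P" and H: "H \<subseteq> Q" and y: "y \<in> Idl\<^bsub>P\<^esub> (e ` H)"
 obtains p where "p \<in> qspan Q H" "y = e p"
proof -
 interpret P: cring P by (rule rcover_cring[OF e])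
 have "ideal (e ` qspan Q H) P"
  by (rule rcover_ideal_image[OF e qspan_qideal qspan_least[OF qideal_sring[OF rcover_sring[OF e]] H]])
 hence "Idl\<^bsub>P\<^esub> (e ` H) \<subseteq> e ` qspan Q H"
  by (rule P.genideal_minimal) (use qspan_base in blast)
 thus thesis using that y by blast
qed

text \<open>Polynomials over \<open>R\<close> have many lifts, differing by coefficients in the
  kernel of \<open>cov R\<close>; therefore \<open>pset ker\<close> joins the equations. The entries
  of the inverse Jacobian matrix live in \<open>C\<close> and are lifted to polynomials by
  surjectivity.\<close>

lemma standard_smooth_presentation:
 fixes R :: "'a ring" and C :: "'b ring"
 assumes R: "cring R" and C: "cring C" and ss: "standard_smooth R C \<phi>"
  and \<kappa>: "rhm \<kappa>" "\<And>w. cov C (\<kappa> w) = \<phi> (cov R w)"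
 defines "ker \<equiv> {w. cov R w = \<zero>\<^bsub>R\<^esub>}"
 shows "\<exists>(n::nat) c G x Nm. c \<le> n \<and> (\<forall>j<c. G j \<in> pset UNIV {..<n}) \<and>
  (\<forall>z. \<exists>p\<in>pset UNIV {..<n}. cov C (peval \<kappa> x p) = cov C z) \<and>
  (\<forall>p\<in>pset UNIV {..<n}. cov C (peval \<kappa> x p) = \<zero>\<^bsub>C\<^esub> \<longrightarrow> p \<in> qspan (pset UNIV {..<n}) (G ` {..<c} \<union> pset ker {..<n})) \<and>
  (\<forall>j<c. cov C (peval \<kappa> x (G j)) = \<zero>\<^bsub>C\<^esub>) \<and>
  (\<forall>i k. Nm i k \<in> pset UNIV {..<n}) \<and>
  (\<forall>j<c. \<forall>k<c. (\<Sum>i<c. mpd i (G j) * Nm i k) - (if j = k then 1 else 0)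
   \<in> qspan (pset UNIV {..<n}) (G ` {..<c} \<union> pset ker {..<n})) \<and>
  (\<forall>i<c. \<forall>l<c. (\<Sum>k<c. Nm i k * mpd l (G k)) - (if i = l then 1 else 0)
   \<in> qspan (pset UNIV {..<n}) (G ` {..<c} \<union> pset ker {..<n}))"
proof -
 note cR = rcover_cov[OF R] and cC = rcover_cov[OF C]
 interpret C: cring C by (rule C)
 from ss obtain n c F x where ncFx: "c \<le> n" "\<And>j. j < c ==> F j \<in> carrier (mpoly_ring n R)" "\<And>i. i < n ==> x i \<in> carrier C"
  "mpoly_eval n R C \<phi> x ` carrier (mpoly_ring n R) = carrier C"
  "a_kernel (mpoly_ring n R) C (mpoly_eval n R C \<phi> x) = Idl\<^bsub>mpoly_ring n R\<^esub> (F ` {..<c})"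
  "ring_det C c (\<lambda>j i. mpoly_eval n R C \<phi> x (mpoly_deriv R i (F j))) \<in> Units C"
  unfolding standard_smooth_def by blast
 let ?P = "mpoly_ring n R" and ?PW = "pset UNIV {..<n} :: (nat, ('a, int) mp) mp set"
 have cP: "rcover (cpoly (cov R)) ?PW ?P" by (rule rcover_mpoly[OF cR])
 interpret P: cring ?P by (rule rcover_cring[OF cP])
 have PW: "sring ?PW" by (rule rcover_sring[OF cP])
 have "\<forall>j\<in>{..<c}. \<exists>G. G \<in> ?PW \<and> F j = cpoly (cov R) G" using ncFx(2) rcover_image[OF cP] by blast
 from bchoice[OF this] obtain G where G: "\<And>j. j < c ==> G j \<in> ?PW" "\<And>j. j < c ==> F j = cpoly (cov R) (G j)" by auto
 have "\<forall>i\<in>{..<n}. \<exists>z. x i = cov C z" using ncFx(3) rcover_image[OF cC] by auto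
 from bchoice[OF this] obtain x' where x': "\<And>i. i < n ==> cov C (x' i) = x i" by auto
 have ev: "mpoly_eval n R C \<phi> x (cpoly (cov R) p) = cov C (peval \<kappa> x' p)" if "p \<in> ?PW" for p
  by (rule cpoly_eval[OF cR cC \<kappa> x' that])
 let ?K = "{z. cov C z = \<zero>\<^bsub>C\<^esub>}"
 let ?Rel = "qspan ?PW (G ` {..<c} \<union> pset ker {..<n})"
 have K: "rideal ?K" by (rule rcover_kernel[OF cC])
 have FG: "F ` {..<c} = cpoly (cov R) ` (G ` {..<c})" using G(2) by force
 have surj: "\<exists>p\<in>?PW. cov C (peval \<kappa> x' p) = cov C z" for z
 proof -
  have "cov C z \<in> mpoly_eval n R C \<phi> x ` carrier ?P" unfolding ncFx(4) by (rule rcover_carrier[OF cC UNIV_I])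
  thus ?thesis using ev rcover_image[OF cP] by force
 qed
 have rel: "p \<in> ?Rel" if p: "p \<in> ?PW" "cov C (peval \<kappa> x' p) = \<zero>\<^bsub>C\<^esub>" for p
 proof -
  have "cpoly (cov R) p \<in> a_kernel ?P C (mpoly_eval n R C \<phi> x)"
   unfolding a_kernel_def' using p ev rcover_carrier[OF cP] by simp
  hence "cpoly (cov R) p \<in> Idl\<^bsub>?P\<^esub> (cpoly (cov R) ` (G ` {..<c}))" unfolding ncFx(5) FG .
  then obtain p' where p': "p' \<in> qspan ?PW (G ` {..<c})" "cpoly (cov R) p = cpoly (cov R) p'"
   by (rule rcover_Idl[OF cP, rotated]) (use G(1) in auto)
  have p'PW: "p' \<in> ?PW" using p'(1) qspan_least[OF qideal_sring[OF PW], of "G ` {..<c}"] G(1) by blast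
  have d: "p - p' \<in> ?PW" by (rule sring_diff[OF PW p(1) p'PW])
  have "coef (p - p') m \<in> ker" for m
   using fun_cong[OF p'(2), of m] rcover_eq_iff[OF cR, of "coef p m" "coef p' m"] by (simp add: cpoly_def ker_def lookup_minus)
  hence "p - p' \<in> pset ker {..<n}" by (rule psetI) (rule pset_vars[OF d])
  hence "p - p' \<in> ?Rel" by (intro qspan_basic) blast
  moreover have "p' \<in> ?Rel" using p'(1) qspan_mono by blast
  ultimately have "(p - p') + p' \<in> ?Rel" by (rule qideal_add[OF qspan_qideal])
  thus ?thesis by simp
 qed
 have zero: "cov C (peval \<kappa> x' (G j)) = \<zero>\<^bsub>C\<^esub>" if "j < c" for j
 proof -
  have "F j \<in> Idl\<^bsub>?P\<^esub> (F ` {..<c})" using subsetD[OF P.genideal_self[of "F ` {..<c}"], of "F j"] ncFx(2) that by auto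
  hence "F j \<in> a_kernel ?P C (mpoly_eval n R C \<phi> x)" unfolding ncFx(5) .
  thus ?thesis unfolding a_kernel_def' using ev[OF G(1)[OF that]] G(2)[OF that] by simp
 qed
 define M where "M j i = peval \<kappa> x' (mpd i (G j))" for j i
 have mpdPW: "mpd i (G j) \<in> ?PW" if "j < c" for i j by (rule mpd_vars[OF G(1)[OF that]])
 have "ring_det C c (\<lambda>j i. mpoly_eval n R C \<phi> x (mpoly_deriv R i (F j))) = ring_det C c (\<lambda>j i. cov C (M j i))"
  unfolding ring_det_def
 proof (rule C.finsum_cong')
  fix \<sigma> assume "\<sigma> \<in> {\<sigma>. \<sigma> permutes {..<c}}"
  have "(\<Otimes>\<^bsub>C\<^esub>j\<in>{..<c}. mpoly_eval n R C \<phi> x (mpoly_deriv R (\<sigma> j) (F j))) = (\<Otimes>\<^bsub>C\<^esub>j\<in>{..<c}. cov C (M j (\<sigma> j)))"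
   by (rule C.finprod_cong') (auto simp: G(2) cpoly_mpd[OF cR] ev[OF mpdPW] M_def rcover_carrier[OF cC])
  thus "(if evenperm \<sigma> then \<one>\<^bsub>C\<^esub> else \<ominus>\<^bsub>C\<^esub> \<one>\<^bsub>C\<^esub>) \<otimes>\<^bsub>C\<^esub> (\<Otimes>\<^bsub>C\<^esub>j\<in>{..<c}. mpoly_eval n R C \<phi> x (mpoly_deriv R (\<sigma> j) (F j)))
   = (if evenperm \<sigma> then \<one>\<^bsub>C\<^esub> else \<ominus>\<^bsub>C\<^esub> \<one>\<^bsub>C\<^esub>) \<otimes>\<^bsub>C\<^esub> (\<Otimes>\<^bsub>C\<^esub>j\<in>{..<c}. cov C (M j (\<sigma> j)))" by simp
 qed (auto simp: rcover_carrier[OF cC] intro!: C.finprod_closed)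
 hence u: "cov C (det (mat c c (\<lambda>(i, j). M i j))) \<in> Units C" using ncFx(6) rcover_det[OF cC] by simp
 then obtain y where y: "y \<in> carrier C" "y \<otimes>\<^bsub>C\<^esub> cov C (det (mat c c (\<lambda>(i, j). M i j))) = \<one>\<^bsub>C\<^esub>" unfolding Units_def by blast
 obtain t where "y = cov C t" using y(1) by (rule rcover_surj[OF cC])
 hence "t * det (mat c c (\<lambda>(i, j). M i j)) - 1 \<in> ?K"
  using y(2) by (simp add: rcover_diff[OF cC] rcover_mult[OF cC] rcover_1[OF cC])
 from adjugate_inverse[OF K this] obtain N where N: "\<And>j k. j < c ==> k < c ==> (\<Sum>i<c. M j i * N i k) - (if j = k then 1 else 0) \<in> ?K"
  "\<And>i l. i < c ==> l < c ==> (\<Sum>k<c. N i k * M k l) - (if i = l then 1 else 0) \<in> ?K"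
  by blast
 have "\<forall>i k. \<exists>p. p \<in> ?PW \<and> cov C (peval \<kappa> x' p) = cov C (N i k)" using surj by blast
 then obtain Nm where Nm: "\<And>i k. Nm i k \<in> ?PW" "\<And>i k. cov C (peval \<kappa> x' (Nm i k)) = cov C (N i k)" by metis
 have rp: "rhm (peval \<kappa> x')" by (rule rhm_peval[OF \<kappa>(1)])
 note rs = rhm_sum[OF rp] rhm_mult[OF rp] rhm_diff[OF rp]
 have d: "peval \<kappa> x' (if i = j then 1 else 0) = (if i = j then 1 else 0)" for i j :: nat by (simp add: rhm_0[OF rp] rhm_1[OF rp])
 have dP: "(if i = j then 1 else 0) \<in> ?PW" for i j :: nat using sring_0[OF PW] sring_1[OF PW] by simp
 have 1: "(\<Sum>i<c. mpd i (G j) * Nm i k) - (if j = k then 1 else 0) \<in> ?Rel" if jk: "j < c" "k < c" for j k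
 proof (rule rel)
  show "(\<Sum>i<c. mpd i (G j) * Nm i k) - (if j = k then 1 else 0) \<in> ?PW"
    by (intro sring_diff[OF PW sring_sum[OF PW sring_mult[OF PW mpdPW[OF jk(1)] Nm(1)]] dP])
   have "(\<Sum>i<c. M j i * (peval \<kappa> x' (Nm i k) - N i k)) \<in> ?K"
    by (rule qideal_sum[OF K], rule qideal_mult[OF K UNIV_I]) (simp add: rcover_eq_iff[OF cC, symmetric] Nm(2))
   from qideal_add[OF K this N(1)[OF jk]]
   show "cov C (peval \<kappa> x' ((\<Sum>i<c. mpd i (G j) * Nm i k) - (if j = k then 1 else 0))) = \<zero>\<^bsub>C\<^esub>"
    unfolding rs d by (simp add: M_def right_diff_distrib sum_subtractf)
 qed
 have 2: "(\<Sum>k<c. Nm i k * mpd l (G k)) - (if i = l then 1 else 0) \<in> ?Rel" if jk: "i < c" "l < c" for i l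
 proof (rule rel)
   show "(\<Sum>k<c. Nm i k * mpd l (G k)) - (if i = l then 1 else 0) \<in> ?PW"
    by (intro sring_diff[OF PW sring_sum[OF PW sring_mult[OF PW Nm(1) mpdPW]] dP]) simp
   have "(\<Sum>k<c. M k l * (peval \<kappa> x' (Nm i k) - N i k)) \<in> ?K"
    by (rule qideal_sum[OF K], rule qideal_mult[OF K UNIV_I]) (simp add: rcover_eq_iff[OF cC, symmetric] Nm(2))
   from qideal_add[OF K this N(2)[OF jk]]
   show "cov C (peval \<kappa> x' ((\<Sum>k<c. Nm i k * mpd l (G k)) - (if i = l then 1 else 0))) = \<zero>\<^bsub>C\<^esub>"
    unfolding rs d by (simp add: M_def right_diff_distrib sum_subtractf mult.commute)
 qed
 show ?thesis
  by (rule exI[of _ n], rule exI[of _ c], rule exI[of _ G], rule exI[of _ x'], rule exI[of _ Nm])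
   (use ncFx(1) G(1) surj rel zero Nm(1) 1 2 in simp)
qed

subsection \<open>Maximal and prime ideals\<close>

lemma rcover_ideal_vimage:
 assumes e: "rcover e UNIV R" and I: "ideal I R" shows "rideal {w. e w \<in> I}"
proof -
 interpret ideal I R by (rule I)
 show ?thesis unfolding qideal_def
  using rcover_carrier[OF e] I_l_closed by (auto simp: rcover_0[OF e] rcover_add[OF e] rcover_mult[OF e])
qed

lemma rcover_prime_image:
 assumes e: "rcover e UNIV R" and P: "rprime P" and k: "{w. e w = \<zero>\<^bsub>R\<^esub>} \<subseteq> P"
 shows "primeideal (e ` P) R" and rcover_mem_image: "e w \<in> e ` P \<longleftrightarrow> w \<in> P"
proof -
 have PI: "rideal P" by (rule rprime_ideal[OF P])
 have m: "e w \<in> e ` P \<longleftrightarrow> w \<in> P" for w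
 proof
  assume "e w \<in> e ` P"
  then obtain u where u: "u \<in> P" "e w = e u" by blast
  hence "w - u \<in> P" using rcover_eq_iff[OF e, of w u] k by auto
  from qideal_add[OF PI this u(1)] show "w \<in> P" by simp
 qed auto
 thus "e w \<in> e ` P \<longleftrightarrow> w \<in> P" .
 show "primeideal (e ` P) R"
 proof (rule primeidealI[OF rcover_ideal_image[OF e PI] rcover_cring[OF e]])
  have "e 1 \<in> carrier R" "e 1 \<notin> e ` P" using rcover_carrier[OF e] rprime_1[OF P] m by auto
  thus "carrier R \<noteq> e ` P" by blast
  fix a b assume ab: "a \<in> carrier R" "b \<in> carrier R" "a \<otimes>\<^bsub>R\<^esub> b \<in> e ` P"
  obtain u v where uv: "a = e u" "b = e v" using ab(1,2) rcover_image[OF e] by blast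
  hence "e (u * v) \<in> e ` P" using ab(3) by (simp add: rcover_mult[OF e])
  thus "a \<in> e ` P \<or> b \<in> e ` P" unfolding m uv by (simp add: rprime_mult_iff[OF P])
 qed simp
qed

lemma exists_primeideal_avoiding:
 fixes R :: "'a ring" (structure)
 assumes R: "cring R" and I: "ideal I R" and S: "\<one> \<in> S" "\<And>a b. a \<in> S ==> b \<in> S ==> a \<otimes> b \<in> S" and dis: "I \<inter> S = {}"
 shows "\<exists>P. primeideal P R \<and> I \<subseteq> P \<and> P \<inter> S = {} \<and> (S = {\<one>} \<longrightarrow> maximalideal P R)"
proof -
 interpret cring R by (rule R)
 note e = rcover_cov[OF is_cring]
 let ?e = "cov R"
 have IR: "I \<subseteq> carrier R" by (rule additive_subgroup.a_subset[OF ideal.axioms(1)[OF I]])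
 have "\<exists>P. rprime P \<and> {w. ?e w \<in> I} \<subseteq> P \<and> P \<inter> {w. ?e w \<in> S} = {} \<and>
  (\<forall>N. rideal N \<longrightarrow> P \<subseteq> N \<longrightarrow> N \<inter> {w. ?e w \<in> S} = {} \<longrightarrow> N = P)"
  by (rule exists_maximal_avoiding[OF rcover_ideal_vimage[OF e I]])
   (use S dis in \<open>auto simp: rcover_1[OF e] rcover_mult[OF e]\<close>)
 then obtain P where P: "rprime P" "{w. ?e w \<in> I} \<subseteq> P" "P \<inter> {w. ?e w \<in> S} = {}"
  "\<And>N. rideal N ==> P \<subseteq> N ==> N \<inter> {w. ?e w \<in> S} = {} ==> N = P" by blast
 have "\<zero> \<in> I" by (rule additive_subgroup.zero_closed[OF ideal.axioms(1)[OF I]])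
 hence k: "{w. ?e w = \<zero>} \<subseteq> P" using P(2) by auto
 note m = rcover_mem_image[OF e P(1) k]
 have 1: "primeideal (?e ` P) R" by (rule rcover_prime_image[OF e P(1) k])
 have 2: "I \<subseteq> ?e ` P"
 proof
  fix a assume a: "a \<in> I"
  then obtain w where "a = ?e w" using IR rcover_image[OF e] by blast
  thus "a \<in> ?e ` P" using a P(2) by auto
 qed
 have 3: "?e ` P \<inter> S = {}" using P(3) by auto
 have "maximalideal (?e ` P) R" if S1: "S = {\<one>}"
 proof (rule maximalidealI)
  show "ideal (?e ` P) R" "carrier R \<noteq> ?e ` P" using 1 by (simp_all add: primeideal.axioms(1) primeideal.I_notcarr)
  fix J assume J: "ideal J R" "?e ` P \<subseteq> J" "J \<subseteq> carrier R"
  show "J = ?e ` P \<or> J = carrier R"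
  proof (rule disjCI)
   assume nJ: "J \<noteq> carrier R"
   hence "\<one> \<notin> J" using ideal.one_imp_carrier[OF J(1)] by blast
   moreover have "P \<subseteq> {w. ?e w \<in> J}" using J(2) by blast
   ultimately have "{w. ?e w \<in> J} = P" using P(4)[OF rcover_ideal_vimage[OF e J(1)]] by (fastforce simp: S1)
   moreover have "J = ?e ` {w. ?e w \<in> J}"
   proof
    show "J \<subseteq> ?e ` {w. ?e w \<in> J}"
    proof
     fix a assume a: "a \<in> J"
     then obtain w where "a = ?e w" using J(3) rcover_image[OF e] by blast
     thus "a \<in> ?e ` {w. ?e w \<in> J}" using a by auto
    qed
   qed auto
   ultimately show "J = ?e ` P" by simp
  qed
 qed
 thus ?thesis using 1 2 3 by blast
qed

lemma nonunit_in_maximalideal: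
 fixes R :: "'a ring" (structure)
 assumes R: "cring R" and b: "b \<in> carrier R" "b \<notin> Units R" shows "\<exists>M. maximalideal M R \<and> b \<in> M"
proof -
 interpret cring R by (rule R)
 have I: "ideal (PIdl b) R" by (rule cgenideal_ideal[OF b(1)])
 have "\<one> \<notin> PIdl b"
 proof
  assume "\<one> \<in> PIdl b"
  then obtain a where "a \<in> carrier R" "\<one> = a \<otimes> b" unfolding cgenideal_def by blast
  thus False using b m_comm unfolding Units_def by auto
 qed
 thus ?thesis using exists_primeideal_avoiding[OF R I, of "{\<one>}"] cgenideal_self[OF b(1)] by auto
qed

lemma local_ring_maximalideal:
 fixes R :: "'a ring" (structure)
 assumes "local_ring R"
 obtains J where "maximalideal J R" "\<forall>b\<in>carrier R. b \<in> J \<longleftrightarrow> b \<notin> Units R"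
proof -
 interpret cring R using assms by (simp add: local_ring_def)
 obtain J where J: "maximalideal J R" "\<And>I. maximalideal I R ==> I = J" using assms unfolding local_ring_def by blast
 interpret J: maximalideal J R by (rule J(1))
 have "b \<notin> Units R" if "b \<in> J" for b
 proof
  assume "b \<in> Units R"
  have "inv b \<otimes> b \<in> J" by (rule J.I_l_closed[OF that Units_inv_closed[OF \<open>b \<in> Units R\<close>]])
  hence "\<one> \<in> J" unfolding Units_l_inv[OF \<open>b \<in> Units R\<close>] .
  thus False using J.one_imp_carrier J.I_notcarr by blast
 qed
 moreover have "b \<in> J" if "b \<in> carrier R" "b \<notin> Units R" for b
  using nonunit_in_maximalideal[OF is_cring that] J(2) by blast
 ultimately show thesis using that J(1) by blast
qed

subsection \<open>Smooth algebras over valuation rings\<close>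

lemma coef_peval_Cn:
 assumes f: "rhm f" shows "coef (peval (\<lambda>a. Cn (f a)) Vr p) m = f (coef p m)"
proof (induction p rule: mp_induct)
 case (add p q) thus ?case by (simp add: peval_add[OF rhm_comp[OF rhm_Cn f]] lookup_add rhm_add[OF f])
next
 case (term1 k a)
 have "peval (\<lambda>a. Cn (f a)) Vr (term1 k a) = term1 k (f a)"
  unfolding peval_term1[OF rhm_comp[OF rhm_Cn f]] by (rule term1_eq[symmetric])
 thus ?case by (simp add: lookup_single when_def rhm_0[OF f])
qed

lemma rhm_of_nat: "rhm f ==> f (of_nat k) = of_nat k"
 by (induction k) (simp_all add: rhm_0 rhm_1 rhm_add)

lemma rcover_peval_cong:
 assumes e: "rcover e UNIV R" and "\<And>w. e (f w) = e (f' w)" shows "e (peval f x p) = e (peval f' x p)"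
 unfolding peval_def by (simp add: rcover_sum[OF e] rcover_mult[OF e] assms(2))

text \<open>\<open>A\<close> and \<open>B\<close> stand for local rings of the spectra of
  \<open>R\<close> and \<open>C\<close>; this enters through \<open>fracA\<close>,
  \<open>fracB\<close> and \<open>kerB\<close>, which describe fractions without naming a prime. The
  presentation over \<open>R\<close> is base changed to \<open>A\<close> and then meets the
  assumptions of \<open>smooth_local\<close>.\<close>

theorem smooth_over_valuation_ring:
 fixes R :: "'a ring" and C :: "'b ring" and A :: "'c ring" and B :: "'d ring"
 assumes R: "cring R" and C: "cring C" and ss: "standard_smooth R C \<phi>"
  and A: "valuation_domain A" "local_ring A" and B: "local_ring B" and \<psi>: "local_ring_hom A B \<psi>"
  and gA: "gA \<in> Ring.ring_hom R A" and gB: "gB \<in> Ring.ring_hom C B"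
  and comm: "\<And>r. r \<in> carrier R ==> gB (\<phi> r) = \<psi> (gA r)"
  and fracA: "\<And>a. a \<in> carrier A ==> \<exists>r\<in>carrier R. \<exists>s\<in>carrier R. gA s \<in> Units A \<and> a \<otimes>\<^bsub>A\<^esub> gA s = gA r"
  and fracB: "\<And>b. b \<in> carrier B ==> \<exists>r\<in>carrier C. \<exists>s\<in>carrier C. gB s \<in> Units B \<and> b \<otimes>\<^bsub>B\<^esub> gB s = gB r"
  and kerB: "\<And>r. r \<in> carrier C ==> gB r = \<zero>\<^bsub>B\<^esub> ==> \<exists>s\<in>carrier C. gB s \<in> Units B \<and> s \<otimes>\<^bsub>C\<^esub> r = \<zero>\<^bsub>C\<^esub>"
 shows smooth_torsion_free: "\<And>a b. a \<in> carrier A ==> b \<in> carrier B ==> a \<noteq> \<zero>\<^bsub>A\<^esub> ==> \<psi> a \<otimes>\<^bsub>B\<^esub> b = \<zero>\<^bsub>B\<^esub> ==> b = \<zero>\<^bsub>B\<^esub>"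
  and smooth_divisor_of_scalar: "\<And>a b c. a \<in> carrier A ==> b \<in> carrier B ==> c \<in> carrier B ==> a \<noteq> \<zero>\<^bsub>A\<^esub> ==> b \<otimes>\<^bsub>B\<^esub> c = \<psi> a ==>
   \<exists>r\<in>carrier A. \<exists>u\<in>Units B. b = \<psi> r \<otimes>\<^bsub>B\<^esub> u"
proof -
 interpret A: domain A using A(1) by (simp add: valuation_domain_def)
 interpret B: cring B using B by (simp add: local_ring_def)
 interpret C: cring C by (rule C)
 have \<psi>h: "\<psi> \<in> Ring.ring_hom A B" using \<psi> by (simp add: local_ring_hom_def)
 have ss_h: "\<phi> \<in> Ring.ring_hom R C" using ss by (simp add: standard_smooth_def)
 note cR = rcover_cov[OF R] and cC = rcover_cov[OF C] and cA = rcover_cov[OF A.is_cring] and cB = rcover_cov[OF B.is_cring]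
 obtain \<kappa> where \<kappa>: "rhm \<kappa>" "\<And>w. cov C (\<kappa> w) = \<phi> (cov R w)" by (rule cov_lift[OF R cC ss_h]) blast
 obtain lam where lam: "rhm lam" "\<And>w. cov A (lam w) = gA (cov R w)" by (rule cov_lift[OF R cA gA]) blast
 obtain mu where mu: "rhm mu" "\<And>w. cov B (mu w) = gB (cov C w)" by (rule cov_lift[OF C cB gB]) blast
 obtain phi where phi: "rhm phi" "\<And>w. cov B (phi w) = \<psi> (cov A w)" by (rule cov_lift[OF A.is_cring cB \<psi>h]) blast
 define KW where "KW = {w. cov R w = \<zero>\<^bsub>R\<^esub>}"
 define KA where "KA = {w. cov A w = \<zero>\<^bsub>A\<^esub>}"
 define K where "K = {w. cov B w = \<zero>\<^bsub>B\<^esub>}"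
 obtain J where J: "maximalideal J B" "\<forall>b\<in>carrier B. b \<in> J \<longleftrightarrow> b \<notin> Units B" by (rule local_ring_maximalideal[OF B])
 obtain JA where JA: "maximalideal JA A" "\<forall>b\<in>carrier A. b \<in> JA \<longleftrightarrow> b \<notin> Units A" by (rule local_ring_maximalideal[OF A(2)])
 define q where "q = {w. cov B w \<in> J}"
 have cc: "cov R w \<in> carrier R" "cov C z \<in> carrier C" "cov A v \<in> carrier A" "cov B u \<in> carrier B" for w z v u
  by (rule rcover_carrier[OF cR UNIV_I] rcover_carrier[OF cC UNIV_I] rcover_carrier[OF cA UNIV_I] rcover_carrier[OF cB UNIV_I])+
 have nq: "u \<notin> q \<longleftrightarrow> cov B u \<in> Units B" for u using J(2) cc(4) by (simp add: q_def)
 from standard_smooth_presentation[OF R C ss \<kappa>]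
 obtain n c G x Nm where cn: "c \<le> (n::nat)" and G: "\<And>j. j < c ==> G j \<in> pset UNIV {..<n}"
  and surj: "\<And>z. \<exists>p\<in>pset UNIV {..<n}. cov C (peval \<kappa> x p) = cov C z"
  and rel: "\<And>p. p \<in> pset UNIV {..<n} ==> cov C (peval \<kappa> x p) = \<zero>\<^bsub>C\<^esub> ==> p \<in> qspan (pset UNIV {..<n}) (G ` {..<c} \<union> pset KW {..<n})"
  and zero: "\<And>j. j < c ==> cov C (peval \<kappa> x (G j)) = \<zero>\<^bsub>C\<^esub>"
  and Nm: "\<And>i k. Nm i k \<in> pset UNIV {..<n}"
  and inv1: "\<And>j k. j < c ==> k < c ==> (\<Sum>i<c. mpd i (G j) * Nm i k) - (if j = k then 1 else 0)
   \<in> qspan (pset UNIV {..<n}) (G ` {..<c} \<union> pset KW {..<n})"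
  and inv2: "\<And>i l. i < c ==> l < c ==> (\<Sum>k<c. Nm i k * mpd l (G k)) - (if i = l then 1 else 0)
   \<in> qspan (pset UNIV {..<n}) (G ` {..<c} \<union> pset KW {..<n})"
  unfolding KW_def by (elim exE conjE) blast
 let ?PW = "pset UNIV {..<n} :: (nat, ('a, int) mp) mp set" and ?PA = "pset UNIV {..<n} :: (nat, ('c, int) mp) mp set"
 have PW: "sring ?PW" and PA: "sring ?PA" by (rule sring_pset, simp)+
 define L where "L = peval (\<lambda>a. Cn (lam a)) (Vr :: nat => (nat, ('c, int) mp) mp)"
 have rCl: "rhm (\<lambda>a. Cn (lam a) :: (nat, ('c, int) mp) mp)" by (rule rhm_comp[OF rhm_Cn lam(1)])
 have rL: "rhm L" unfolding L_def by (rule rhm_peval[OF rCl])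
 note Ls = rhm_0[OF rL] rhm_1[OF rL] rhm_add[OF rL] rhm_diff[OF rL] rhm_mult[OF rL] rhm_sum[OF rL]
 have coefL: "coef (L p) m = lam (coef p m)" for p m unfolding L_def by (rule coef_peval_Cn[OF lam(1)])
 have LCn: "L (Cn a) = Cn (lam a)" and LVr: "L (Vr i) = Vr i" for a i
  unfolding L_def by (rule peval_Cn[OF rCl], rule peval_Vr[OF rCl])
 have Lpset: "L p \<in> pset I' {..<n}" if p: "p \<in> pset I {..<n}" and I: "\<And>a. a \<in> I ==> lam a \<in> I'" for p I I'
 proof (rule psetI)
  show "coef (L p) m \<in> I'" for m unfolding coefL by (rule I[OF pset_coef[OF p]])
  fix m assume "m \<in> mons (L p)"
  hence "m \<in> mons p" by (auto simp: in_keys_iff coefL rhm_0[OF lam(1)])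
  thus "set_mset m \<subseteq> {..<n}" by (rule pset_vars[OF p])
 qed
 have LPA: "L p \<in> ?PA" if "p \<in> ?PW" for p using Lpset[OF that, of UNIV] by simp
 have Lmpd: "L (mpd i p) = mpd i (L p)" for i p
  by (rule poly_mapping_eqI) (simp add: coefL coef_mpd rhm_mult[OF lam(1)] rhm_of_nat[OF lam(1)] del: of_nat_Suc)
 have KWA: "lam a \<in> KA" if "a \<in> KW" for a
  using that ring_hom_zero[OF gA] R A.ring_axioms by (simp add: KW_def KA_def lam(2) cring.axioms(1))
 define Rel where "Rel = qspan ?PA ((\<lambda>j. L (G j)) ` {..<c} \<union> pset KA {..<n})"
 have RelI: "qideal ?PA Rel" unfolding Rel_def by (rule qspan_qideal)
 have LRel: "L p \<in> Rel" if "p \<in> qspan ?PW (G ` {..<c} \<union> pset KW {..<n})" for p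
 proof -
  have "qideal ?PW {p. L p \<in> Rel}" unfolding qideal_def
   using qideal_0[OF RelI] qideal_add[OF RelI] qideal_mult[OF RelI LPA] by (auto simp: Ls)
  moreover have "G ` {..<c} \<union> pset KW {..<n} \<subseteq> {p. L p \<in> Rel}"
   using Lpset KWA unfolding Rel_def by (auto intro!: qspan_basic)
  ultimately have "qspan ?PW (G ` {..<c} \<union> pset KW {..<n}) \<subseteq> {p. L p \<in> Rel}" by (rule qspan_least)
  thus ?thesis using that by blast
 qed
 define x' where "x' i = mu (x i)" for i
 define E where "E = peval phi x'"
 have rE: "rhm E" unfolding E_def by (rule rhm_peval[OF phi(1)])
 note Es = rhm_0[OF rE] rhm_1[OF rE] rhm_add[OF rE] rhm_diff[OF rE] rhm_mult[OF rE]
 have ECn: "E (Cn a) = phi a" for a unfolding E_def by (rule peval_Cn[OF phi(1)])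
 have EL: "cov B (E (L p)) = gB (cov C (peval \<kappa> x p))" for p
 proof -
  have "cov B (E (L p)) = cov B (peval (\<lambda>a. phi (lam a)) x' p)"
   unfolding E_def L_def peval_peval[OF phi(1) rCl] by (simp add: peval_Cn[OF phi(1)] peval_Vr[OF phi(1)])
  also have "\<dots> = cov B (peval (\<lambda>a. mu (\<kappa> a)) x' p)"
   by (rule rcover_peval_cong[OF cB]) (simp add: phi(2) lam(2) mu(2) \<kappa>(2) comm cc)
  also have "\<dots> = cov B (mu (peval \<kappa> x p))" unfolding x'_def by (simp add: peval_rhm[OF mu(1)])
  finally show ?thesis by (simp add: mu(2))
 qed
 have KA_p: "rprime KA" unfolding rprime_def KA_def
 proof (intro conjI allI impI rcover_kernel[OF cA])
  show "1 \<notin> {w. cov A w = \<zero>\<^bsub>A\<^esub>}" by (simp add: rcover_1[OF cA])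
  show "a \<in> {w. cov A w = \<zero>\<^bsub>A\<^esub>} \<or> b \<in> {w. cov A w = \<zero>\<^bsub>A\<^esub>}" if "a * b \<in> {w. cov A w = \<zero>\<^bsub>A\<^esub>}" for a b
   using that A.integral cc(3) by (auto simp: rcover_mult[OF cA])
 qed
 have KAI: "rideal KA" by (rule rprime_ideal[OF KA_p])
 have KI: "rideal K" unfolding K_def by (rule rcover_kernel[OF cB])
 have diffA: "a - b \<in> KA \<longleftrightarrow> cov A a = cov A b" for a b unfolding KA_def using rcover_eq_iff[OF cA, of a b] by simp
 have diffB: "a - b \<in> K \<longleftrightarrow> cov B a = cov B b" for a b unfolding K_def using rcover_eq_iff[OF cB, of a b] by simp
 have phiK: "phi a \<in> K" if "a \<in> KA" for a
  using that ring_hom_zero[OF \<psi>h A.ring_axioms B.ring_axioms] by (simp add: KA_def K_def phi(2))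
 have EKA: "E p \<in> K" if "p \<in> pset KA {..<n}" for p
  unfolding E_def by (rule peval_in_ideal[OF sring_UNIV KI]) (use phiK pset_coef[OF that] in auto)
 have qideal: "rideal q" unfolding q_def by (rule rcover_ideal_vimage[OF cB]) (use J(1) in \<open>simp add: maximalideal.axioms(1)\<close>)
 have unitsB: "E (s * t) \<notin> q" if "E s \<notin> q" "E t \<notin> q" for s t
  using that unfolding nq by (simp add: Es rcover_mult[OF cB])
 have P1: "\<exists>s\<in>?PA. \<exists>g\<in>?PA. E s \<notin> q \<and> y * E s - E g \<in> K" for y
 proof -
  obtain r s where rs: "r \<in> carrier C" "s \<in> carrier C" "gB s \<in> Units B" "cov B y \<otimes>\<^bsub>B\<^esub> gB s = gB r" using fracB[OF cc(4)] by blast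
  obtain r' s' where "r = cov C r'" "s = cov C s'" using rs(1,2) rcover_image[OF cC] by blast
  then obtain g0 s0 where g0: "g0 \<in> ?PW" "s0 \<in> ?PW" "cov C (peval \<kappa> x g0) = r" "cov C (peval \<kappa> x s0) = s" using surj by metis
  have "E (L s0) \<notin> q" "y * E (L s0) - E (L g0) \<in> K" using rs g0 by (simp_all add: nq EL diffB rcover_mult[OF cB])
  thus ?thesis using LPA g0 by blast
 qed
 \<comment> \<open>Common denominators: up to a unit of \<open>A\<close>, a polynomial over
   \<open>A\<close> comes from one over \<open>R\<close>. The polynomials with this property form a
   subring containing the constants and the variables.\<close>
 have clear: "\<exists>a0. cov A (lam a0) \<in> Units A \<and> (\<exists>g0\<in>?PW. L g0 - Cn (lam a0) * g \<in> pset KA {..<n})" if "g \<in> ?PA" for g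
 proof -
  have KAP: "qideal ?PA (pset KA {..<n})" by (rule qideal_pset[OF KAI])
  have CnPA: "Cn a \<in> ?PA" for a by (rule pset_Cn) auto
  have CnPW: "Cn a \<in> ?PW" for a by (rule pset_Cn) auto
  let ?T = "{g\<in>?PA. \<exists>a0. cov A (lam a0) \<in> Units A \<and> (\<exists>g0\<in>?PW. L g0 - Cn (lam a0) * g \<in> pset KA {..<n})}"
  have I: "g \<in> ?T" if "g \<in> ?PA" "cov A (lam a0) \<in> Units A" "g0 \<in> ?PW" "L g0 - Cn (lam a0) * g \<in> pset KA {..<n}" for g a0 g0
   using that by blast
  have u1: "cov A (lam 1) \<in> Units A" by (simp add: rhm_1[OF lam(1)] rcover_1[OF cA])
  have "sring ?T" unfolding sring_def
  proof (intro conjI ballI)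
   show "1 \<in> ?T" by (rule I[OF sring_1[OF PA] u1 sring_1[OF PW]])
     (use qideal_0[OF KAP] in \<open>simp add: Ls rhm_1[OF lam(1)] Cn_simps\<close>)
   fix g h assume "g \<in> ?T" "h \<in> ?T"
   then obtain a0 g0 b0 h0 where g: "g \<in> ?PA" "cov A (lam a0) \<in> Units A" "g0 \<in> ?PW" "L g0 - Cn (lam a0) * g \<in> pset KA {..<n}"
    and h: "h \<in> ?PA" "cov A (lam b0) \<in> Units A" "h0 \<in> ?PW" "L h0 - Cn (lam b0) * h \<in> pset KA {..<n}" by blast
   have u: "cov A (lam (a0 * b0)) \<in> Units A" using g(2) h(2) by (simp add: rhm_mult[OF lam(1)] rcover_mult[OF cA])
   show "g - h \<in> ?T"
   proof (rule I[OF sring_diff[OF PA g(1) h(1)] u sring_diff[OF PW sring_mult[OF PW CnPW g(3)] sring_mult[OF PW CnPW h(3)]]])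
    have "Cn (lam b0) * (L g0 - Cn (lam a0) * g) - Cn (lam a0) * (L h0 - Cn (lam b0) * h) \<in> pset KA {..<n}"
     by (rule qideal_diff[OF KAP PA qideal_mult[OF KAP CnPA g(4)] qideal_mult[OF KAP CnPA h(4)]])
    thus "L (Cn b0 * g0 - Cn a0 * h0) - Cn (lam (a0 * b0)) * (g - h) \<in> pset KA {..<n}"
     by (simp add: Ls LCn rhm_mult[OF lam(1)] Cn_simps algebra_simps)
   qed
   show "g * h \<in> ?T"
   proof (rule I[OF sring_mult[OF PA g(1) h(1)] u sring_mult[OF PW g(3) h(3)]])
    have "(L g0 - Cn (lam a0) * g) * L h0 + (Cn (lam a0) * g) * (L h0 - Cn (lam b0) * h) \<in> pset KA {..<n}"
     by (rule qideal_add[OF KAP qideal_multr[OF KAP LPA[OF h(3)] g(4)] qideal_mult[OF KAP sring_mult[OF PA CnPA g(1)] h(4)]])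
    thus "L (g0 * h0) - Cn (lam (a0 * b0)) * (g * h) \<in> pset KA {..<n}"
     by (simp add: Ls rhm_mult[OF lam(1)] Cn_simps algebra_simps)
   qed
  qed
  moreover have "Cn a \<in> ?T" for a
  proof -
   obtain r s where rs: "r \<in> carrier R" "s \<in> carrier R" "gA s \<in> Units A" "cov A a \<otimes>\<^bsub>A\<^esub> gA s = gA r" using fracA[OF cc(3)] by blast
   obtain r' s' where e: "r = cov R r'" "s = cov R s'" using rs(1,2) rcover_image[OF cR] by blast
   show ?thesis
   proof (rule I[OF CnPA _ CnPW])
    show "cov A (lam s') \<in> Units A" using rs e by (simp add: lam(2))
    have "lam r' - lam s' * a \<in> KA" unfolding diffA using rs(4) e A.m_comm[OF cc(3) cc(3), of a "lam s'"] by (simp add: rcover_mult[OF cA] lam(2))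
    hence "Cn (lam r' - lam s' * a) \<in> pset KA {..<n}" by (intro pset_Cn qideal_0[OF KAI])
    thus "L (Cn r') - Cn (lam s') * Cn a \<in> pset KA {..<n}" by (simp add: LCn Cn_simps)
   qed
  qed
  moreover have "Vr i \<in> ?T" if "i \<in> {..<n}" for i
   by (rule I[OF pset_Vr[OF sring_UNIV that] u1 pset_Vr[OF sring_UNIV that]])
    (use qideal_0[OF KAP] in \<open>simp add: LVr rhm_1[OF lam(1)] Cn_simps\<close>)
  ultimately have "?PA \<subseteq> ?T" by (rule pset_least)
  thus ?thesis using that by blast
 qed
 have unit_hom: "\<psi> a \<in> Units B" if "a \<in> Units A" for a
 proof -
  obtain a' where a': "a' \<in> carrier A" "a' \<otimes>\<^bsub>A\<^esub> a = \<one>\<^bsub>A\<^esub>" "a \<in> carrier A" using \<open>a \<in> Units A\<close> unfolding Units_def by blast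
  show ?thesis using ring_hom_mult[OF \<psi>h a'(1,3)] ring_hom_one[OF \<psi>h] ring_hom_closed[OF \<psi>h] a' B.m_comm unfolding Units_def by auto
 qed
 have P2: "\<exists>s\<in>?PA. E s \<notin> q \<and> s * g \<in> Rel" if g: "g \<in> ?PA" "E g \<in> K" for g
 proof -
  obtain a0 g0 where g0: "cov A (lam a0) \<in> Units A" "g0 \<in> ?PW" "L g0 - Cn (lam a0) * g \<in> pset KA {..<n}" using clear[OF g(1)] by blast
  have CnPA: "Cn a \<in> ?PA" for a by (rule pset_Cn) auto
  have "E (L g0 - Cn (lam a0) * g) + phi (lam a0) * E g \<in> K" by (rule qideal_add[OF KI EKA[OF g0(3)] qideal_mult[OF KI UNIV_I g(2)]])
  hence "gB (cov C (peval \<kappa> x g0)) = \<zero>\<^bsub>B\<^esub>" by (simp add: Es ECn K_def EL)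
  \<comment> \<open>The cleared polynomial vanishes in \<open>B\<close>, so some element of
    \<open>C\<close> that is a unit in \<open>B\<close> kills it in \<open>C\<close>; lifted to
    polynomials, this becomes membership in the ideal of equations.\<close>
  from kerB[OF cc(2) this] obtain s where s: "s \<in> carrier C" "gB s \<in> Units B" "s \<otimes>\<^bsub>C\<^esub> cov C (peval \<kappa> x g0) = \<zero>\<^bsub>C\<^esub>" by blast
  obtain s' where "s = cov C s'" using s(1) by (rule rcover_surj[OF cC])
  then obtain s0 where s0: "s0 \<in> ?PW" "cov C (peval \<kappa> x s0) = s" using surj by metis
  have "cov C (peval \<kappa> x (s0 * g0)) = \<zero>\<^bsub>C\<^esub>" using s s0 by (simp add: peval_mult[OF \<kappa>(1)] rcover_mult[OF cC])
  hence 1: "L (s0 * g0) \<in> Rel" by (rule LRel[OF rel[OF sring_mult[OF PW s0(1) g0(2)]]])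
  have 2: "L s0 * (L g0 - Cn (lam a0) * g) \<in> Rel"
   by (rule qideal_mult[OF RelI LPA[OF s0(1)]]) (use g0(3) in \<open>simp add: Rel_def qspan_basic\<close>)
  have "L (s0 * g0) - L s0 * (L g0 - Cn (lam a0) * g) \<in> Rel" by (rule qideal_diff[OF RelI PA 1 2])
  hence "(L s0 * Cn (lam a0)) * g \<in> Rel" by (simp add: Ls algebra_simps)
  moreover have "E (L s0) \<notin> q" using s(2) s0(2) by (simp add: nq EL)
  moreover have "E (Cn (lam a0)) \<notin> q" using unit_hom[OF g0(1)] by (simp add: nq ECn phi(2))
  ultimately show ?thesis using unitsB sring_mult[OF PA LPA[OF s0(1)] CnPA] by blast
 qed
 have sl: "smooth_local phi KA K q n c (\<lambda>j. L (G j)) x' (\<lambda>i k. L (Nm i k))"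
 proof (unfold_locales)
  show "rhm phi" "rprime KA" "rideal K" "rideal q" "c \<le> n" by fact+
  show "phi a \<in> K" if "a \<in> KA" for a using that by (rule phiK)
  show "(\<exists>d. a - b * d \<in> KA) \<or> (\<exists>d. b - a * d \<in> KA)" for a b
  proof -
   have *: "\<exists>d. a - b * d \<in> KA" if dvd: "cov A b divides\<^bsub>A\<^esub> cov A a" for a b
   proof -
    obtain e where e: "e \<in> carrier A" "cov A a = cov A b \<otimes>\<^bsub>A\<^esub> e" using dvd by auto
    obtain d where "e = cov A d" using e(1) by (rule rcover_surj[OF cA])
    thus ?thesis using e(2) by (intro exI) (simp add: diffA rcover_mult[OF cA])
   qed
   show ?thesis using A(1) cc(3) unfolding valuation_domain_def using * by blast
  qed
  have J0: "\<zero>\<^bsub>B\<^esub> \<in> J" by (rule additive_subgroup.zero_closed[OF ideal.axioms(1)[OF maximalideal.axioms(1)[OF J(1)]]])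
  thus "K \<subseteq> q" by (auto simp: K_def q_def)
  show "1 \<notin> q" by (simp add: nq rcover_1[OF cB])
  show "\<exists>s'. s * s' - 1 \<in> K" if "s \<notin> q" for s
  proof -
   have "cov B s \<in> Units B" using that by (simp add: nq)
   then obtain b where b: "b \<in> carrier B" "cov B s \<otimes>\<^bsub>B\<^esub> b = \<one>\<^bsub>B\<^esub>" unfolding Units_def by blast
   obtain s' where "b = cov B s'" using b(1) by (rule rcover_surj[OF cB])
   thus ?thesis using b(2) by (intro exI) (simp add: diffB rcover_mult[OF cB] rcover_1[OF cB])
  qed
  show "\<exists>a'. a * a' - 1 \<in> KA" if "phi a \<notin> q" for a
  proof -
   have "cov A a \<notin> JA" using \<psi> JA(1) J(1) unfolding local_ring_hom_def using that by (auto simp: q_def phi(2))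
   then obtain b where b: "b \<in> carrier A" "cov A a \<otimes>\<^bsub>A\<^esub> b = \<one>\<^bsub>A\<^esub>" using JA(2) cc(3) unfolding Units_def by blast
   obtain s' where "b = cov A s'" using b(1) by (rule rcover_surj[OF cA])
   thus ?thesis using b(2) by (intro exI) (simp add: diffA rcover_mult[OF cA] rcover_1[OF cA])
  qed
  show "L (G j) \<in> ?PA" if "j < c" for j by (rule LPA[OF G[OF that]])
  show "L (Nm i k) \<in> ?PA" for i k by (rule LPA[OF Nm])
  have gB0: "gB \<zero>\<^bsub>C\<^esub> = \<zero>\<^bsub>B\<^esub>" by (rule ring_hom_zero[OF gB C.ring_axioms B.ring_axioms])
  show "peval phi x' (L (G j)) \<in> K" if "j < c" for j
   using EL zero[OF that] gB0 by (simp add: K_def E_def)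
  show "\<exists>s\<in>?PA. \<exists>g\<in>?PA. peval phi x' s \<notin> q \<and> y * peval phi x' s - peval phi x' g \<in> K" for y
   using P1 by (simp add: E_def)
  show "\<exists>s\<in>?PA. peval phi x' s \<notin> q \<and> s * g \<in> qspan ?PA ((\<lambda>j. L (G j)) ` {..<c} \<union> pset KA {..<n})"
   if "g \<in> ?PA" "peval phi x' g \<in> K" for g
   using P2[OF that(1)] that(2) by (simp add: E_def Rel_def)
  have LI: "L (if i = k then 1 else 0) = (if i = k then 1 else 0)" for i k :: nat by (simp add: Ls)
  show "(\<Sum>i<c. mpd i (L (G j)) * L (Nm i k)) - (if j = k then 1 else 0)
   \<in> qspan ?PA ((\<lambda>j. L (G j)) ` {..<c} \<union> pset KA {..<n})" if "j < c" "k < c" for j k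
   using LRel[OF inv1[OF that]] by (simp only: Ls LI Lmpd Rel_def)
  show "(\<Sum>k<c. L (Nm i k) * mpd l (L (G k))) - (if i = l then 1 else 0)
   \<in> qspan ?PA ((\<lambda>j. L (G j)) ` {..<c} \<union> pset KA {..<n})" if "i < c" "l < c" for i l
   using LRel[OF inv2[OF that]] by (simp only: Ls LI Lmpd Rel_def)
 qed
 {
  fix a b assume a: "a \<in> carrier A" "a \<noteq> \<zero>\<^bsub>A\<^esub>" and b: "b \<in> carrier B" and 0: "\<psi> a \<otimes>\<^bsub>B\<^esub> b = \<zero>\<^bsub>B\<^esub>"
  obtain a' where a': "a = cov A a'" using a(1) by (rule rcover_surj[OF cA])
  obtain b' where b': "b = cov B b'" using b by (rule rcover_surj[OF cB])
  have "phi a' * b' \<in> K" "a' \<notin> KA" using a a' b' 0 by (simp_all add: K_def KA_def rcover_mult[OF cB] phi(2))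
  hence "b' \<in> K" by (rule smooth_local.torsion_free[OF sl])
  thus "b = \<zero>\<^bsub>B\<^esub>" by (simp add: b' K_def)
 }
 {
  fix a b d assume a: "a \<in> carrier A" "a \<noteq> \<zero>\<^bsub>A\<^esub>" and b: "b \<in> carrier B" and d: "d \<in> carrier B" and 0: "b \<otimes>\<^bsub>B\<^esub> d = \<psi> a"
  obtain a' where a': "a = cov A a'" using a(1) by (rule rcover_surj[OF cA])
  obtain b' where b': "b = cov B b'" using b by (rule rcover_surj[OF cB])
  obtain d' where d': "d = cov B d'" using d by (rule rcover_surj[OF cB])
  have "b' * d' - phi a' \<in> K" "a' \<notin> KA" using a a' b' d' 0 by (simp_all add: diffB KA_def rcover_mult[OF cB] phi(2))
  hence "\<exists>r b1. b1 \<notin> q \<and> b' - phi r * b1 \<in> K" by (rule smooth_local.divisor_of_scalar[OF sl])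
  then obtain r b1 where "b1 \<notin> q" "b' - phi r * b1 \<in> K" by blast
  hence "cov B b1 \<in> Units B" "b = \<psi> (cov A r) \<otimes>\<^bsub>B\<^esub> cov B b1" by (simp_all add: nq diffB rcover_mult[OF cB] phi(2) b')
  thus "\<exists>r\<in>carrier A. \<exists>u\<in>Units B. b = \<psi> r \<otimes>\<^bsub>B\<^esub> u" using cc(3) by blast
 }
qed

section \<open>Stalks and localizations\<close>

text \<open>Evaluates the operations on classes, which are unions over representatives that all give
  the same set.\<close>

lemma UN_const: "x0 \<in> A ==> (\<And>x. x \<in> A ==> f x = c) ==> (\<Union>x\<in>A. f x) = c"
 by auto

abbreviation "opens Y \<equiv> openin (space_of Y)"
abbreviation "pts Y \<equiv> topspace (space_of Y)"
abbreviation "secs Y U \<equiv> carrier (sections Y U)"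

context
 fixes Y :: "('p, 'a) ringed_space" and x :: 'p
 assumes Y: "presheaf_of_rings Y"
begin

abbreviation (input) "nbhd U \<equiv> opens Y U \<and> x \<in> U"

lemma sections_cring: "opens Y U ==> cring (sections Y U)"
 and res_hom: "opens Y U ==> opens Y V ==> V \<subseteq> U ==> res Y U V \<in> Ring.ring_hom (sections Y U) (sections Y V)"
 and res_res: "opens Y U ==> opens Y V ==> opens Y W ==> V \<subseteq> U ==> W \<subseteq> V ==>
  s \<in> secs Y U ==> res Y V W (res Y U V s) = res Y U W s"
 using Y unfolding presheaf_of_rings_def by simp_all

lemma res_closed: "opens Y U ==> opens Y V ==> V \<subseteq> U ==> s \<in> secs Y U ==>
  res Y U V s \<in> secs Y V"
 by (rule ring_hom_closed[OF res_hom])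

lemma germ_eq_iff:
 assumes U: "nbhd U" and s: "s \<in> secs Y U" and V: "nbhd V" and t: "t \<in> secs Y V"
 shows "germ Y x U s = germ Y x V t \<longleftrightarrow> (\<exists>W. nbhd W \<and> W \<subseteq> U \<inter> V \<and> res Y U W s = res Y V W t)" (is "_ \<longleftrightarrow> ?R")
proof
 assume "germ Y x U s = germ Y x V t"
 moreover have "(V, t) \<in> germ Y x V t" unfolding germ_def using V t by auto
 ultimately have "(V, t) \<in> germ Y x U s" by simp
 thus ?R unfolding germ_def by blast
next
 have sub: "germ Y x U s \<subseteq> germ Y x V t"
  if U: "nbhd U" and s: "s \<in> secs Y U" and V: "nbhd V" and t: "t \<in> secs Y V"
   and W: "nbhd W" "W \<subseteq> U \<inter> V" "res Y U W s = res Y V W t" for U s V t W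
 proof
  fix z assume "z \<in> germ Y x U s"
  then obtain V' t' W' where z: "z = (V', t')" "nbhd V'" "t' \<in> carrier (sections Y V')" "nbhd W'" "W' \<subseteq> U \<inter> V'" "res Y U W' s = res Y V' W' t'"
   unfolding germ_def by blast
  have WW: "nbhd (W \<inter> W')" using W(1) z(4) by auto
  have "res Y V (W \<inter> W') t = res Y W (W \<inter> W') (res Y V W t)" using W V t WW by (subst res_res) auto
  also have "\<dots> = res Y W (W \<inter> W') (res Y U W s)" by (simp add: W(3))
  also have "\<dots> = res Y U (W \<inter> W') s" using W U s WW by (subst res_res) auto
  also have "\<dots> = res Y W' (W \<inter> W') (res Y U W' s)" using z U s WW by (subst res_res) auto
  also have "\<dots> = res Y W' (W \<inter> W') (res Y V' W' t')" by (simp add: z(6))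
  also have "\<dots> = res Y V' (W \<inter> W') t'" using z WW by (subst res_res) auto
  finally have "res Y V (W \<inter> W') t = res Y V' (W \<inter> W') t'" .
  thus "z \<in> germ Y x V t" unfolding germ_def using z W(2) WW by auto
 qed
 assume ?R
 then obtain W where W: "nbhd W" "W \<subseteq> U \<inter> V" "res Y U W s = res Y V W t" by blast
 have W': "W \<subseteq> V \<inter> U" using W(2) by blast
 show "germ Y x U s = germ Y x V t" using sub[OF U s V t W] sub[OF V t U s W(1) W' W(3)[symmetric]] by blast
qed

lemma germ_res:
 assumes U: "nbhd U" and s: "s \<in> secs Y U" and V: "nbhd V" "V \<subseteq> U"
 shows "germ Y x V (res Y U V s) = germ Y x U s"
proof -
 have "res Y V V (res Y U V s) = res Y U V s" using assms by (subst res_res) auto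
 moreover have "res Y U V s \<in> secs Y V" using res_closed assms by blast
 ultimately show ?thesis using assms by (subst germ_eq_iff) (auto)
qed

lemma germ_self: "nbhd U ==> s \<in> secs Y U ==> (U, s) \<in> germ Y x U s"
 unfolding germ_def by auto

lemma germ_memD:
 assumes U: "nbhd U" "s \<in> secs Y U" and z: "(V, t) \<in> germ Y x U s"
 shows "nbhd V" "t \<in> secs Y V" "germ Y x V t = germ Y x U s"
proof -
 obtain W where W: "nbhd V" "t \<in> secs Y V" "nbhd W" "W \<subseteq> U \<inter> V" "res Y U W s = res Y V W t"
  using z unfolding germ_def by blast
 thus "nbhd V" "t \<in> secs Y V" by blast+
 have "germ Y x U s = germ Y x V t" by (subst germ_eq_iff[OF U W(1,2)]) (use W(3,4,5) in blast)
 thus "germ Y x V t = germ Y x U s" ..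
qed

text \<open>Stated for any operation compatible with restriction, so that sums and products of germs
  are covered at once.\<close>

lemma germ_op:
 assumes ro: "\<And>V W s t. opens Y V ==> opens Y W ==> W \<subseteq> V ==> s \<in> secs Y V ==> t \<in> secs Y V ==>
   opr V s t \<in> secs Y V \<and> res Y V W (opr V s t) = opr W (res Y V W s) (res Y V W t)"
  and U: "nbhd U" and s: "s \<in> secs Y U" and t: "t \<in> secs Y U"
 shows "(\<Union>(V, s)\<in>germ Y x U s. \<Union>(W, t)\<in>germ Y x U t. germ Y x (V \<inter> W) (opr (V \<inter> W) (res Y V (V \<inter> W) s) (res Y W (V \<inter> W) t))) =
  germ Y x U (opr U s t)"
proof (rule UN_const[OF germ_self[OF U s]], clarify, rule UN_const[OF germ_self[OF U t]], clarify)
 fix V s' W t' assume "(V, s') \<in> germ Y x U s" "(W, t') \<in> germ Y x U t"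
 then obtain V' W' where V: "nbhd V" "s' \<in> secs Y V" "nbhd V'" "V' \<subseteq> U \<inter> V" "res Y U V' s = res Y V V' s'"
  and W: "nbhd W" "t' \<in> secs Y W" "nbhd W'" "W' \<subseteq> U \<inter> W" "res Y U W' t = res Y W W' t'"
  unfolding germ_def by blast
 have o: "opens Y (V \<inter> W)" "opens Y (V' \<inter> W')" using V W by auto
 have r: "res Y U (V' \<inter> W') s = res Y V (V' \<inter> W') s'" "res Y U (V' \<inter> W') t = res Y W (V' \<inter> W') t'"
  using res_res[of U V' "V' \<inter> W'" s] res_res res_res[of U W' "V' \<inter> W'" t] res_res
   U V W s t o by auto
 have le: "V' \<inter> W' \<subseteq> V \<inter> W" "V' \<inter> W' \<subseteq> U" using V W by auto
 have c: "res Y V (V \<inter> W) s' \<in> secs Y (V \<inter> W)" "res Y W (V \<inter> W) t' \<in> secs Y (V \<inter> W)" using V W o res_closed by auto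
 have "res Y (V \<inter> W) (V' \<inter> W') (opr (V \<inter> W) (res Y V (V \<inter> W) s') (res Y W (V \<inter> W) t')) = res Y U (V' \<inter> W') (opr U s t)"
  using ro[OF o le(1) c] ro[OF _ o(2) le(2) s t] U V W by (simp add: res_res[OF _ o _ le(1)] r)
 thus "germ Y x (V \<inter> W) (opr (V \<inter> W) (res Y V (V \<inter> W) s') (res Y W (V \<inter> W) t')) = germ Y x U (opr U s t)"
  using ro[OF o(1) o(1) _ c] ro[of U U s t] U V W o s t by (subst germ_eq_iff) (auto)
qed

lemma germ_in_stalk: "nbhd U ==> s \<in> secs Y U ==> germ Y x U s \<in> carrier (stalk Y x)"
 by (auto simp: stalk_def)

lemma stalk_carrierE:
 assumes "\<beta> \<in> carrier (stalk Y x)"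
 obtains U s where "opens Y U" "x \<in> U" "s \<in> secs Y U" "\<beta> = germ Y x U s"
 using assms by (auto simp: stalk_def)

lemma germ_hom:
 assumes U: "nbhd U" shows "germ Y x U \<in> Ring.ring_hom (sections Y U) (stalk Y x)"
proof (rule ring_hom_memI)
 have top: "nbhd (pts Y)" "U \<subseteq> pts Y" using U openin_subset by auto
 have 1: "\<one>\<^bsub>sections Y (pts Y)\<^esub> \<in> secs Y (pts Y)"
  by (rule cring.cring_simprules(6)[OF sections_cring]) simp
 show "germ Y x U \<one>\<^bsub>sections Y U\<^esub> = \<one>\<^bsub>stalk Y x\<^esub>" using germ_res[OF top(1) 1 U top(2)] ring_hom_one[OF res_hom] U top by (simp add: stalk_def)
 fix s t assume s: "s \<in> secs Y U" "t \<in> secs Y U"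
 thus "germ Y x U s \<in> carrier (stalk Y x)" using germ_in_stalk[OF U] by blast
 show "germ Y x U (s \<otimes>\<^bsub>sections Y U\<^esub> t) = germ Y x U s \<otimes>\<^bsub>stalk Y x\<^esub> germ Y x U t"
  unfolding stalk_def by (simp, rule germ_op[OF _ U s, symmetric])
   (simp add: cring.cring_simprules(5)[OF sections_cring] ring_hom_mult[OF res_hom])
 show "germ Y x U (s \<oplus>\<^bsub>sections Y U\<^esub> t) = germ Y x U s \<oplus>\<^bsub>stalk Y x\<^esub> germ Y x U t"
  unfolding stalk_def by (simp, rule germ_op[OF _ U s, symmetric])
   (simp add: cring.cring_simprules(1)[OF sections_cring] ring_hom_add[OF res_hom])
qed

end

subsection \<open>Fractions\<close>

definition mult_set :: "'a ring => 'a set => bool" where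
 "mult_set R S \<longleftrightarrow> S \<subseteq> carrier R \<and> \<one>\<^bsub>R\<^esub> \<in> S \<and> (\<forall>a\<in>S. \<forall>b\<in>S. a \<otimes>\<^bsub>R\<^esub> b \<in> S)"

context
 fixes R :: "'a ring" (structure) and S :: "'a set"
 assumes R: "cring R" and S: "mult_set R S"
begin

interpretation cring R by (rule R)

lemma multS: "a \<in> S ==> a \<in> carrier R" "\<one> \<in> S" "a \<in> S ==> b \<in> S ==> a \<otimes> b \<in> S"
 using S by (auto simp: mult_set_def)

lemma fraction_self: "a \<in> carrier R ==> b \<in> S ==> (a, b) \<in> fraction R S a b"
  by (auto simp: fraction_def)

lemma fraction_eqD:
 assumes "(c, d) \<in> fraction R S a b" and ab: "a \<in> carrier R" "b \<in> S"
 shows "c \<in> carrier R" "d \<in> S" "fraction R S c d = fraction R S a b"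
proof -
 obtain u where u: "c \<in> carrier R" "d \<in> S" "u \<in> S" "u \<otimes> (a \<otimes> d) = u \<otimes> (c \<otimes> b)" using assms(1) by (auto simp: fraction_def)
 show "c \<in> carrier R" "d \<in> S" by fact+
 have sub: "fraction R S a b \<subseteq> fraction R S c d" if ab: "a \<in> carrier R" "b \<in> S" and cd: "c \<in> carrier R" "d \<in> S"
  and u: "u \<in> S" "u \<otimes> (a \<otimes> d) = u \<otimes> (c \<otimes> b)" for a b c d u
 proof
  fix z assume "z \<in> fraction R S a b"
  then obtain e f v where e: "z = (e, f)" "e \<in> carrier R" "f \<in> S" "v \<in> S" "v \<otimes> (a \<otimes> f) = v \<otimes> (e \<otimes> b)" by (auto simp: fraction_def)
  have cR: "a \<in> carrier R" "b \<in> carrier R" "c \<in> carrier R" "d \<in> carrier R" "e \<in> carrier R" "f \<in> carrier R" "u \<in> carrier R" "v \<in> carrier R"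
   using ab cd e u multS(1) by auto
  \<comment> \<open>The multiplier combines those of both equations; the factor \<open>b\<close> is
    the price of transitivity.\<close>
  have "(u \<otimes> v \<otimes> b) \<otimes> (c \<otimes> f) = v \<otimes> f \<otimes> (u \<otimes> (c \<otimes> b))" using cR by (simp add: m_ac)
  also have "\<dots> = v \<otimes> f \<otimes> (u \<otimes> (a \<otimes> d))" by (simp only: u(2))
  also have "\<dots> = u \<otimes> d \<otimes> (v \<otimes> (a \<otimes> f))" using cR by (simp add: m_ac)
  also have "\<dots> = u \<otimes> d \<otimes> (v \<otimes> (e \<otimes> b))" by (simp only: e(5))
  also have "\<dots> = (u \<otimes> v \<otimes> b) \<otimes> (e \<otimes> d)" using cR by (simp add: m_ac)
  finally show "z \<in> fraction R S c d" using e ab u multS(3) by (auto simp: fraction_def)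
 qed
 show "fraction R S c d = fraction R S a b" using sub[OF u(1,2) ab u(3) u(4)[symmetric]] sub[OF ab u(1,2) u(3,4)] by blast
qed

lemma fraction_eq_iff:
 assumes "a \<in> carrier R" "b \<in> S" "c \<in> carrier R" "d \<in> S"
 shows "fraction R S a b = fraction R S c d \<longleftrightarrow> (\<exists>u\<in>S. u \<otimes> (a \<otimes> d) = u \<otimes> (c \<otimes> b))"
proof
 assume "fraction R S a b = fraction R S c d"
 hence "(c, d) \<in> fraction R S a b" using fraction_self[OF assms(3,4)] by simp
 thus "\<exists>u\<in>S. u \<otimes> (a \<otimes> d) = u \<otimes> (c \<otimes> b)" by (auto simp: fraction_def)
next
 assume "\<exists>u\<in>S. u \<otimes> (a \<otimes> d) = u \<otimes> (c \<otimes> b)"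
 hence "(c, d) \<in> fraction R S a b" using assms by (auto simp: fraction_def)
 thus "fraction R S a b = fraction R S c d" using fraction_eqD assms by metis
qed

lemma fraction_mult:
 assumes ab: "a \<in> carrier R" "b \<in> S" and cd: "c \<in> carrier R" "d \<in> S"
 shows "fraction R S a b \<otimes>\<^bsub>localization R S\<^esub> fraction R S c d = fraction R S (a \<otimes> c) (b \<otimes> d)"
proof -
 have "(\<Union>(a', b')\<in>fraction R S a b. \<Union>(c', d')\<in>fraction R S c d. fraction R S (a' \<otimes> c') (b' \<otimes> d')) = fraction R S (a \<otimes> c) (b \<otimes> d)"
 proof (rule UN_const[OF fraction_self[OF ab]], clarify, rule UN_const[OF fraction_self[OF cd]], clarify)
  fix a' b' c' d' assume "(a', b') \<in> fraction R S a b" "(c', d') \<in> fraction R S c d"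
  then obtain u v where u: "a' \<in> carrier R" "b' \<in> S" "u \<in> S" "u \<otimes> (a \<otimes> b') = u \<otimes> (a' \<otimes> b)"
   and v: "c' \<in> carrier R" "d' \<in> S" "v \<in> S" "v \<otimes> (c \<otimes> d') = v \<otimes> (c' \<otimes> d)" by (auto simp: fraction_def)
  note cR = ab(1) multS(1)[OF ab(2)] cd(1) multS(1)[OF cd(2)] u(1) multS(1)[OF u(2)] multS(1)[OF u(3)] v(1) multS(1)[OF v(2)] multS(1)[OF v(3)]
  have "(u \<otimes> v) \<otimes> (a' \<otimes> c' \<otimes> (b \<otimes> d)) = (u \<otimes> (a' \<otimes> b)) \<otimes> (v \<otimes> (c' \<otimes> d))" using cR by (simp add: m_ac)
  also have "\<dots> = (u \<otimes> (a \<otimes> b')) \<otimes> (v \<otimes> (c \<otimes> d'))" by (simp add: u v)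
  also have "\<dots> = (u \<otimes> v) \<otimes> (a \<otimes> c \<otimes> (b' \<otimes> d'))" using cR by (simp add: m_ac)
  finally show "fraction R S (a' \<otimes> c') (b' \<otimes> d') = fraction R S (a \<otimes> c) (b \<otimes> d)"
   using u v ab cd multS by (subst fraction_eq_iff) auto
 qed
 thus ?thesis by (simp add: localization_def)
qed

lemma fraction_in: "a \<in> carrier R ==> b \<in> S ==> fraction R S a b \<in> carrier (localization R S)"
 by (auto simp: localization_def)

lemma localizationE:
 assumes "z \<in> carrier (localization R S)" obtains a b where "a \<in> carrier R" "b \<in> S" "z = fraction R S a b"
 using assms by (auto simp: localization_def)

lemma comm_monoid_localization: "comm_monoid (localization R S)"
proof (rule comm_monoidI)
 have one: "\<one>\<^bsub>localization R S\<^esub> = fraction R S \<one> \<one>" by (simp add: localization_def)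
 show "\<one>\<^bsub>localization R S\<^esub> \<in> carrier (localization R S)" unfolding one by (rule fraction_in) (simp_all add: multS)
 fix z w assume "z \<in> carrier (localization R S)" "w \<in> carrier (localization R S)"
 then obtain a b c d where z: "a \<in> carrier R" "b \<in> S" "z = fraction R S a b" and w: "c \<in> carrier R" "d \<in> S" "w = fraction R S c d"
  by (meson localizationE)
 show "z \<otimes>\<^bsub>localization R S\<^esub> w \<in> carrier (localization R S)" using z w multS by (simp add: fraction_mult fraction_in)
 show "z \<otimes>\<^bsub>localization R S\<^esub> w = w \<otimes>\<^bsub>localization R S\<^esub> z" using z w multS by (simp add: fraction_mult m_comm)
 show "\<one>\<^bsub>localization R S\<^esub> \<otimes>\<^bsub>localization R S\<^esub> z = z" unfolding one using z multS by (simp add: fraction_mult)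
 fix y assume "y \<in> carrier (localization R S)"
 then obtain e f where y: "e \<in> carrier R" "f \<in> S" "y = fraction R S e f" by (rule localizationE)
 show "z \<otimes>\<^bsub>localization R S\<^esub> w \<otimes>\<^bsub>localization R S\<^esub> y = z \<otimes>\<^bsub>localization R S\<^esub> (w \<otimes>\<^bsub>localization R S\<^esub> y)"
  using z w y multS by (simp add: fraction_mult m_assoc)
qed

end

subsection \<open>Affine open subschemes\<close>

context
 fixes R :: "'a ring" (structure)
 assumes R: "cring R"
begin

interpretation cring R by (rule R)

abbreviation (input) "spec \<equiv> {P. primeideal P R}"
abbreviation "spec_open \<equiv> openin (zariski_topology R)"
abbreviation "frc Q \<equiv> fraction R (carrier R - Q)"
abbreviation (input) "basic_open a \<equiv> {P. primeideal P R \<and> a \<notin> P}"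

lemma mult_set_prime: "primeideal P R ==> mult_set R (carrier R - P)"
proof -
 assume "primeideal P R"
 then interpret P: primeideal P R .
 show ?thesis using P.I_prime P.one_imp_carrier P.I_notcarr by (auto simp: mult_set_def)
qed

lemma openin_basic_open: "a \<in> carrier R ==> spec_open (basic_open a)"
 unfolding zariski_topology_def by (rule topology_generated_by_Basis) blast

lemma topspace_zariski: "topspace (zariski_topology R) = spec"
proof -
 have "\<one> \<notin> P" if "primeideal P R" for P using mult_set_prime[OF that] by (auto simp: mult_set_def)
 thus ?thesis by (auto simp: zariski_topology_def)
qed

lemma zariski_basis:
 assumes "spec_open V" "P \<in> V"
 shows "\<exists>a\<in>carrier R. P \<in> basic_open a \<and> basic_open a \<subseteq> V"
proof -
 have "generate_topology_on ((\<lambda>a. basic_open a) ` carrier R) V"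
  using assms(1) unfolding zariski_topology_def openin_topology_generated_by_iff .
 thus ?thesis using assms(2)
 proof induction
  case (Int a b)
  then obtain c d where c: "c \<in> carrier R" "P \<in> basic_open c" "basic_open c \<subseteq> a"
   and d: "d \<in> carrier R" "P \<in> basic_open d" "basic_open d \<subseteq> b" by blast
  have "Q \<in> basic_open (c \<otimes> d) \<longleftrightarrow> Q \<in> basic_open c \<inter> basic_open d" for Q
  proof (cases "primeideal Q R")
   case True
   then interpret Q: primeideal Q R .
   show ?thesis using c(1) d(1) Q.I_prime Q.I_l_closed Q.I_r_closed by auto
  qed auto
  thus ?case using c d by (intro bexI[of _ "c \<otimes> d"]) auto
 next
  case (UN K)
  then obtain k where "k \<in> K" "P \<in> k" by blast
  thus ?case using UN.IH by blast
 next
  case (Basis s)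
  thus ?case by auto
 qed simp
qed

text \<open>No prime contains all \<open>d P\<close>, so they generate the unit ideal, and 1 is a
  combination of finitely many of them.\<close>

lemma spec_quasi_compact:
 assumes d: "\<And>P. primeideal P R ==> d P \<in> carrier R \<and> d P \<notin> P"
 obtains T where "finite T" "T \<subseteq> spec" "\<forall>Q\<in>spec. \<exists>P\<in>T. d P \<notin> Q"
proof -
 note e = rcover_cov[OF R]
 define H where "H = {w. cov R w \<in> d ` spec}"
 have "d P \<in> cov R ` H" if P: "primeideal P R" for P
 proof -
  obtain w where "d P = cov R w" using d[OF P] rcover_image[OF e] by blast
  moreover have "d P \<in> d ` spec" using P by blast
  ultimately show ?thesis by (intro image_eqI) (simp_all add: H_def)
 qed
 hence H: "cov R ` H = d ` spec" by (auto simp: H_def)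
 have dc: "d ` spec \<subseteq> carrier R" using d by blast
 have "\<one> \<in> Idl (cov R ` H)"
 proof (rule ccontr)
  assume "\<one> \<notin> Idl (cov R ` H)"
  moreover have "ideal (Idl (cov R ` H)) R" unfolding H by (rule genideal_ideal[OF dc])
  ultimately obtain P where P: "primeideal P R" "Idl (cov R ` H) \<subseteq> P" using exists_primeideal_avoiding[OF R, of "Idl (cov R ` H)" "{\<one>}"] by auto
  thus False using genideal_self[OF dc] unfolding H using d by blast
 qed
 then obtain w where w: "w \<in> qspan UNIV H" "\<one> = cov R w" by (rule rcover_Idl[OF e subset_UNIV])
 let ?Q = "{w. \<exists>F. finite F \<and> F \<subseteq> H \<and> w \<in> qspan UNIV F}"
 have "qideal UNIV ?Q"
 proof (rule qidealI; (rule CollectI)?)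
  show "\<exists>F. finite F \<and> F \<subseteq> H \<and> 0 \<in> qspan UNIV F" by (intro exI[of _ "{}"]) auto
  fix u v assume "u \<in> ?Q" "v \<in> ?Q"
  then obtain F F' where F: "finite F" "F \<subseteq> H" "u \<in> qspan UNIV F" "finite F'" "F' \<subseteq> H" "v \<in> qspan UNIV F'" by blast
  have "u \<in> qspan UNIV (F \<union> F')" "v \<in> qspan UNIV (F \<union> F')"
   using subsetD[OF qspan_mono[of F "F \<union> F'" UNIV] F(3)] subsetD[OF qspan_mono[of F' "F \<union> F'" UNIV] F(6)] by auto
  hence "u + v \<in> qspan UNIV (F \<union> F')" by (rule qideal_add[OF qspan_qideal])
  thus "\<exists>F. finite F \<and> F \<subseteq> H \<and> u + v \<in> qspan UNIV F" using F by (intro exI[of _ "F \<union> F'"]) auto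
 next
  fix u v assume "v \<in> ?Q"
  then obtain F where F: "finite F" "F \<subseteq> H" "v \<in> qspan UNIV F" by blast
  thus "\<exists>F. finite F \<and> F \<subseteq> H \<and> u * v \<in> qspan UNIV F" using qideal_mult[OF qspan_qideal UNIV_I F(3), of u] by blast
 qed
 moreover have "H \<subseteq> ?Q"
 proof
  fix w assume w: "w \<in> H"
  have "w \<in> qspan UNIV {w}" by (rule qspan_basic) simp
  thus "w \<in> ?Q" using w by (intro CollectI exI[of _ "{w}"]) simp
 qed
 ultimately have "qspan UNIV H \<subseteq> ?Q" by (rule qspan_least)
 then obtain F where F: "finite F" "F \<subseteq> H" "w \<in> qspan UNIV F" using w(1) by blast
 have "\<forall>u\<in>F. \<exists>P. P \<in> spec \<and> cov R u = d P" using F(2) by (auto simp: H_def)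
 from bchoice[OF this] obtain pr where pr: "\<forall>u\<in>F. pr u \<in> spec \<and> cov R u = d (pr u)" ..
 have "\<exists>P\<in>pr ` F. d P \<notin> Q" if Q: "primeideal Q R" for Q
 proof (rule ccontr)
  interpret Q: primeideal Q R by (rule Q)
  assume "\<not> (\<exists>P\<in>pr ` F. d P \<notin> Q)"
  hence "F \<subseteq> {w. cov R w \<in> Q}" using pr by auto
  hence "qspan UNIV F \<subseteq> {w. cov R w \<in> Q}" by (rule qspan_least[OF rcover_ideal_vimage[OF e Q.is_ideal]])
  thus False using F(3) w(2) Q.one_imp_carrier Q.I_notcarr by auto
 qed
 thus thesis using that[of "pr ` F"] F(1) pr by blast
qed

text \<open>Otherwise the annihilator of \<open>a\<close> is disjoint from the powers of
  \<open>b\<close>, and a prime separating them contradicts the local vanishing.\<close>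

lemma locally_zero:
 assumes a: "a \<in> carrier R" and b: "b \<in> carrier R"
  and z: "\<And>Q. primeideal Q R ==> b \<notin> Q ==> \<exists>u\<in>carrier R - Q. u \<otimes> a = \<zero>"
 shows "\<exists>N::nat. b [^] N \<otimes> a = \<zero>"
proof (rule ccontr)
 assume n: "\<not> ?thesis"
 let ?I = "{r\<in>carrier R. r \<otimes> a = \<zero>}" and ?S = "range (\<lambda>N::nat. b [^] N)"
 have "ideal ?I R"
 proof (rule idealI[OF ring_axioms])
  show "subgroup ?I (add_monoid R)"
   by (rule add.subgroupI) (use a in \<open>auto simp: l_distr l_minus\<close>)
  fix u v assume u: "u \<in> ?I" and v: "v \<in> carrier R"
  have "v \<otimes> u \<otimes> a = v \<otimes> (u \<otimes> a)" using u v a by (simp add: m_assoc)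
  also have "\<dots> = \<zero>" using u v by simp
  finally show "v \<otimes> u \<in> ?I" using u v by simp
  thus "u \<otimes> v \<in> ?I" using u v by (simp add: m_comm)
 qed
 hence "\<exists>P. primeideal P R \<and> ?I \<subseteq> P \<and> P \<inter> ?S = {} \<and> (?S = {\<one>} \<longrightarrow> maximalideal P R)"
 proof (rule exists_primeideal_avoiding[OF R])
  show "\<one> \<in> ?S" by (rule range_eqI[of _ _ 0]) simp
  show "u \<otimes> v \<in> ?S" if "u \<in> ?S" "v \<in> ?S" for u v using that b by (auto simp: nat_pow_mult)
  show "?I \<inter> ?S = {}" using n by auto
 qed
 then obtain Q where Q: "primeideal Q R" "?I \<subseteq> Q" "Q \<inter> ?S = {}" by blast
 have "b [^] (1::nat) \<notin> Q" using Q(3) by blast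
 thus False using b z[OF Q(1)] Q(2) by auto
qed

definition frac_section :: "'a set set => 'a => 'a => 'a set => ('a \<times> 'a) set" where
 "frac_section V a b = (\<lambda>P\<in>V. frc P a b)"

lemma frac_section_in:
 assumes V: "spec_open V" and ab: "a \<in> carrier R" "b \<in> carrier R" "\<And>P. P \<in> V ==> b \<notin> P"
 shows "frac_section V a b \<in> carrier (spec_sections R V)"
proof -
 have "primeideal P R" if "P \<in> V" for P using openin_subset[OF V] that topspace_zariski by blast
 hence "frc P a b \<in> carrier (localization_at R P)" if "P \<in> V" for P
  using that ab by (auto simp: localization_def)
 hence "frac_section V a b \<in> (\<Pi>\<^sub>E P\<in>V. carrier (localization_at R P))" by (auto simp: frac_section_def)
 moreover have "\<forall>P\<in>V. \<exists>W a' b'. spec_open W \<and> P \<in> W \<and> W \<subseteq> V \<and>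
     a' \<in> carrier R \<and> b' \<in> carrier R \<and> (\<forall>Q\<in>W. b' \<notin> Q \<and> frac_section V a b Q = frc Q a' b')"
  using V ab by (intro ballI) (auto simp: frac_section_def)
 ultimately show ?thesis by (simp add: spec_sections_def)
qed

lemma frac_section_mult:
 assumes V: "spec_open V" and a: "a \<in> carrier R" "b \<in> carrier R" "\<And>P. P \<in> V ==> b \<notin> P"
  and c: "c \<in> carrier R" "d \<in> carrier R" "\<And>P. P \<in> V ==> d \<notin> P"
 shows "frac_section V a b \<otimes>\<^bsub>spec_sections R V\<^esub> frac_section V c d = frac_section V (a \<otimes> c) (b \<otimes> d)"
proof -
 have "primeideal P R" if "P \<in> V" for P using openin_subset[OF V] that topspace_zariski by blast
 thus ?thesis using a c
  by (auto simp: spec_sections_def frac_section_def fun_eq_iff fraction_mult[OF R mult_set_prime])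
qed

lemma restrict_frac_section: "W \<subseteq> V ==> restrict (frac_section V a b) W = frac_section W a b"
 by (auto simp: frac_section_def fun_eq_iff)

lemma frac_section_eqI:
 assumes V: "spec_open V" and a: "a \<in> carrier R" "b \<in> carrier R" "\<And>P. P \<in> V ==> b \<notin> P"
  and c: "c \<in> carrier R" "d \<in> carrier R" "\<And>P. P \<in> V ==> d \<notin> P" and eq: "a \<otimes> d = c \<otimes> b"
 shows "frac_section V a b = frac_section V c d"
proof -
 have p: "primeideal P R" if "P \<in> V" for P using openin_subset[OF V] that topspace_zariski by blast
 have "frc P a b = frc P c d" if P: "P \<in> V" for P
 proof -
  note m = mult_set_prime[OF p[OF P]]
  show ?thesis using a c eq P by (subst fraction_eq_iff[OF R m]) (auto)
 qed
 thus ?thesis by (auto simp: frac_section_def fun_eq_iff)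
qed

end

locale affine_chart =
 fixes Y :: "('p, 'a) ringed_space" and U :: "'p set" and x :: 'p and R :: "'b ring" (structure) and f h
 assumes Y: "presheaf_of_rings Y" and U: "opens Y U" and xU: "x \<in> U" and R: "cring R"
  and iso: "ringed_space_iso (open_subspace Y U) (Spec R) f h" and B: "cring (stalk Y x)"
begin

sublocale cring R by (rule R)

abbreviation "pre V \<equiv> preimage (open_subspace Y U) f V"
abbreviation "Sp \<equiv> {P. primeideal P R}"
abbreviation "zopen \<equiv> openin (zariski_topology R)"
abbreviation "zsecs V \<equiv> carrier (spec_sections R V)"
abbreviation "frac_at Q \<equiv> fraction R (carrier R - Q)"
abbreviation "fr \<equiv> frac_section R"

lemma iso_facts:
 shows cont: "continuous_map (subtopology (space_of Y) U) (zariski_topology R) f"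
  and hom: "zopen V ==> h V \<in> Ring.ring_hom (spec_sections R V) (sections Y (pre V))"
  and bij: "zopen V ==> bij_betw (h V) (zsecs V) (secs Y (pre V))"
  and nat: "zopen V ==> zopen W ==> W \<subseteq> V ==> s \<in> zsecs V ==> h W (restrict s W) = res Y (pre V) (pre W) (h V s)"
  and homeo: "homeomorphic_map (subtopology (space_of Y) U) (zariski_topology R) f"
 using iso unfolding ringed_space_iso_def ringed_space_morphism_def ring_iso_def by (simp_all add: open_subspace_def Spec_def)

lemma topY: "topspace (subtopology (space_of Y) U) = U"
 using openin_subset[OF U] by auto

lemma pre_eq: "pre V = {t\<in>U. f t \<in> V}"
 using topY by (auto simp: preimage_def open_subspace_def)

lemma pre_open: "zopen V ==> opens Y (pre V)"
proof -
 assume "zopen V"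
 from openin_continuous_map_preimage[OF cont this] show ?thesis
  unfolding topY pre_eq using U openin_trans_full by blast
qed

lemma zopen_Sp: "zopen Sp"
 using openin_topspace[of "zariski_topology R"] by (simp add: topspace_zariski[OF R])

lemma zopenD: "zopen V ==> P \<in> V ==> primeideal P R"
 using openin_subset[of "zariski_topology R" V] by (auto simp: topspace_zariski[OF R])

lemma fx: "t \<in> U ==> f t \<in> Sp"
 using continuous_map_image_subset_topspace[OF cont] topY topspace_zariski[OF R] by blast

lemma pre_Sp: "pre Sp = U"
 using fx by (auto simp: pre_eq)

lemma open_as_pre:
 assumes "opens Y W" "W \<subseteq> U" shows "zopen (f ` W)" "pre (f ` W) = W"
proof -
 show "zopen (f ` W)" using assms homeomorphic_imp_open_map[OF homeo] unfolding open_map_def by (simp add: openin_open_subtopology[OF U])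
 show "pre (f ` W) = W" using homeomorphic_imp_injective_map[OF homeo] topY assms(2) by (auto simp: pre_eq dest: inj_onD)
qed

lemma closed_h: "zopen V ==> s \<in> zsecs V ==> h V s \<in> secs Y (pre V)"
 by (rule ring_hom_closed[OF hom])

abbreviation "gm V s \<equiv> germ Y x (pre V) (h V s)"

lemma gm_restrict:
 assumes "zopen V" "zopen W" "W \<subseteq> V" "f x \<in> W" "s \<in> zsecs V"
 shows "gm W (restrict s W) = gm V s"
 unfolding nat[OF assms(1,2,3,5)]
 by (rule germ_res[OF Y]) (use assms xU pre_open closed_h in \<open>auto simp: pre_eq\<close>)

lemma gm_mult:
 assumes "zopen V" "f x \<in> V" "s \<in> zsecs V" "t \<in> zsecs V"
 shows "gm V s \<otimes>\<^bsub>stalk Y x\<^esub> gm V t = gm V (s \<otimes>\<^bsub>spec_sections R V\<^esub> t)"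
proof -
 have "gm V (s \<otimes>\<^bsub>spec_sections R V\<^esub> t) = germ Y x (pre V) (h V s \<otimes>\<^bsub>sections Y (pre V)\<^esub> h V t)"
  by (simp add: ring_hom_mult[OF hom[OF assms(1)] assms(3,4)])
 also have "\<dots> = gm V s \<otimes>\<^bsub>stalk Y x\<^esub> gm V t"
  by (rule ring_hom_mult[OF germ_hom[OF Y]]) (use assms xU pre_open closed_h in \<open>auto simp: pre_eq\<close>)
 finally show ?thesis ..
qed

lemma not_in_prime_one: "zopen V ==> P \<in> V ==> \<one> \<notin> P"
 using mult_set_prime[OF R zopenD] by (auto simp: mult_set_def)

lemma fr1_in: "zopen V ==> a \<in> carrier R ==> fr V a \<one> \<in> zsecs V"
 by (rule frac_section_in[OF R]) (auto dest: not_in_prime_one)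

text \<open>The ring axioms for \<open>spec_sections\<close> are not established, so zero is reached
  through products: a preimage t of zero satisfies 0 t = 0, whence h(0) = h(0) h(t) = 0.\<close>

lemma h_zero: assumes V: "zopen V" shows "h V (fr V \<zero> \<one>) = \<zero>\<^bsub>sections Y (pre V)\<^esub>"
proof -
 interpret C: cring "sections Y (pre V)" by (rule sections_cring[OF Y pre_open[OF V]])
 have z: "fr V \<zero> \<one> \<in> zsecs V" by (rule fr1_in[OF V]) simp
 have "\<zero>\<^bsub>sections Y (pre V)\<^esub> \<in> h V ` zsecs V" using bij[OF V] C.zero_closed unfolding bij_betw_def by blast
 then obtain t where t: "t \<in> zsecs V" "\<zero>\<^bsub>sections Y (pre V)\<^esub> = h V t" by blast
 have "frac_at P \<zero> \<one> \<otimes>\<^bsub>localization_at R P\<^esub> t P = frac_at P \<zero> \<one>" if P: "P \<in> V" for P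
 proof -
  note m = mult_set_prime[OF R zopenD[OF V P]]
  have "t P \<in> carrier (localization_at R P)" using t(1) P by (auto simp: spec_sections_def)
  then obtain a b where "a \<in> carrier R" "b \<in> carrier R - P" "t P = frac_at P a b" by (rule localizationE[OF R m])
  thus ?thesis using fraction_mult[OF R m, of \<zero> \<one> a b] not_in_prime_one[OF V P] by (simp add: fraction_eq_iff[OF R m]) blast
 qed
 hence "fr V \<zero> \<one> \<otimes>\<^bsub>spec_sections R V\<^esub> t = fr V \<zero> \<one>" by (simp add: spec_sections_def frac_section_def[OF R] fun_eq_iff)
 thus ?thesis using ring_hom_mult[OF hom[OF V] z t(1)] closed_h[OF V z] by (simp add: t(2)[symmetric])
qed

lemma germ_global_unit:
 assumes b: "b \<in> carrier R" "b \<notin> f x"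
 shows "germ Y x U (h Sp (fr Sp b \<one>)) \<in> Units (stalk Y x)"
proof -
 interpret B: cring "stalk Y x" by (rule B)
 let ?D = "{P. primeideal P R \<and> b \<notin> P}"
 have D: "zopen ?D" by (rule openin_basic_open[OF R b(1)])
 have xD: "f x \<in> ?D" using fx[OF xU] b by auto
 have c1: "fr ?D b \<one> \<in> zsecs ?D" by (rule fr1_in[OF D b(1)])
 have c2: "fr ?D \<one> b \<in> zsecs ?D" by (rule frac_section_in[OF R D]) (use b in auto)
 have "restrict (fr Sp b \<one>) ?D = fr ?D b \<one>" by (rule restrict_frac_section[OF R]) auto
 hence e: "germ Y x U (h Sp (fr Sp b \<one>)) = gm ?D (fr ?D b \<one>)"
  using gm_restrict[OF zopen_Sp D _ xD fr1_in[OF zopen_Sp b(1)]] by (simp add: pre_Sp) blast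
 have "gm ?D (fr ?D b \<one>) \<otimes>\<^bsub>stalk Y x\<^esub> gm ?D (fr ?D \<one> b) = gm ?D (fr ?D (b \<otimes> \<one>) (\<one> \<otimes> b))"
  unfolding gm_mult[OF D xD c1 c2] by (subst frac_section_mult[OF R D]) (use b not_in_prime_one[OF D] in auto)
 also have "fr ?D (b \<otimes> \<one>) (\<one> \<otimes> b) = fr ?D \<one> \<one>"
  by (rule frac_section_eqI[OF R D]) (use b not_in_prime_one[OF D] in auto)
 also have "fr ?D \<one> \<one> = \<one>\<^bsub>spec_sections R ?D\<^esub>" by (auto simp: spec_sections_def frac_section_def[OF R] localization_def)
 also have "gm ?D \<one>\<^bsub>spec_sections R ?D\<^esub> = \<one>\<^bsub>stalk Y x\<^esub>"
  using ring_hom_one[OF hom[OF D]] ring_hom_one[OF germ_hom[OF Y, of "pre ?D" x]] pre_open[OF D] xD xU by (simp add: pre_eq)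
 finally have i: "gm ?D (fr ?D b \<one>) \<otimes>\<^bsub>stalk Y x\<^esub> gm ?D (fr ?D \<one> b) = \<one>\<^bsub>stalk Y x\<^esub>" .
 have n: "opens Y (pre ?D) \<and> x \<in> pre ?D" using pre_open[OF D] xU xD by (auto simp: pre_eq)
 have c: "gm ?D (fr ?D b \<one>) \<in> carrier (stalk Y x)" "gm ?D (fr ?D \<one> b) \<in> carrier (stalk Y x)"
  using germ_in_stalk[OF Y n closed_h[OF D c1]] germ_in_stalk[OF Y n closed_h[OF D c2]] by auto
 thus ?thesis unfolding e Units_def using i B.m_comm[OF c] by auto
qed

lemma stalk_fraction:
 assumes "\<beta> \<in> carrier (stalk Y x)"
 shows "\<exists>r\<in>secs Y U. \<exists>s\<in>secs Y U. germ Y x U s \<in> Units (stalk Y x) \<and> \<beta> \<otimes>\<^bsub>stalk Y x\<^esub> germ Y x U s = germ Y x U r"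
proof -
 obtain W0 s0 where s0: "opens Y W0" "x \<in> W0" "s0 \<in> secs Y W0" "\<beta> = germ Y x W0 s0"
  using assms by (rule stalk_carrierE[OF Y])
 define W where "W = W0 \<inter> U"
 have W: "opens Y W" "x \<in> W" "W \<subseteq> W0" "W \<subseteq> U" using s0 U xU by (auto simp: W_def)
 let ?s = "res Y W0 W s0"
 have s: "?s \<in> secs Y W" using res_closed[OF Y s0(1) W(1,3) s0(3)] .
 have \<beta>: "\<beta> = germ Y x W ?s" using germ_res[OF Y, of W0 x s0 W] s0 W by simp
 let ?V = "f ` W"
 note V = open_as_pre[OF W(1,4)]
 obtain \<sigma> where \<sigma>: "\<sigma> \<in> zsecs ?V" "?s = h ?V \<sigma>" using bij[OF V(1)] s V(2) by (auto simp: bij_betw_def)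
 obtain V' a b where V': "zopen V'" "f x \<in> V'" "V' \<subseteq> ?V" and ab: "a \<in> carrier R" "b \<in> carrier R"
  and loc: "\<forall>Q\<in>V'. b \<notin> Q \<and> \<sigma> Q = frac_at Q a b" using W(2) \<sigma>(1) unfolding spec_sections_def by auto
 have bn: "\<And>P. P \<in> V' ==> b \<notin> P" using loc by blast
 have "restrict \<sigma> V' = fr V' a b" using loc by (auto simp: frac_section_def[OF R] fun_eq_iff)
 hence \<beta>': "\<beta> = gm V' (fr V' a b)" using gm_restrict[OF V(1) V'(1,3,2) \<sigma>(1)] \<beta> V(2) \<sigma>(2) by simp
 have VS: "V' \<subseteq> Sp" using zopenD[OF V'(1)] by blast
 have gl: "germ Y x U (h Sp (fr Sp c \<one>)) = gm V' (fr V' c \<one>)" if "c \<in> carrier R" for c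
  using gm_restrict[OF zopen_Sp V'(1) VS V'(2) fr1_in[OF zopen_Sp that]] restrict_frac_section[OF R VS] by (simp add: pre_Sp)
 have "\<beta> \<otimes>\<^bsub>stalk Y x\<^esub> gm V' (fr V' b \<one>) = gm V' (fr V' a b \<otimes>\<^bsub>spec_sections R V'\<^esub> fr V' b \<one>)"
  unfolding \<beta>' by (rule gm_mult[OF V'(1,2) frac_section_in[OF R V'(1) ab] fr1_in[OF V'(1) ab(2)]]) (rule bn)
 also have "fr V' a b \<otimes>\<^bsub>spec_sections R V'\<^esub> fr V' b \<one> = fr V' (a \<otimes> b) (b \<otimes> \<one>)"
  by (rule frac_section_mult[OF R V'(1)]) (use ab bn not_in_prime_one[OF V'(1)] in auto)
 also have "fr V' (a \<otimes> b) (b \<otimes> \<one>) = fr V' a \<one>"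
  by (rule frac_section_eqI[OF R V'(1)]) (use ab bn not_in_prime_one[OF V'(1)] in auto)
 finally have "\<beta> \<otimes>\<^bsub>stalk Y x\<^esub> germ Y x U (h Sp (fr Sp b \<one>)) = germ Y x U (h Sp (fr Sp a \<one>))" by (simp add: gl ab)
 moreover have "h Sp (fr Sp c \<one>) \<in> secs Y U" if "c \<in> carrier R" for c
  using closed_h[OF zopen_Sp fr1_in[OF zopen_Sp that]] by (simp add: pre_Sp)
 moreover have "germ Y x U (h Sp (fr Sp b \<one>)) \<in> Units (stalk Y x)"
  by (rule germ_global_unit[OF ab(2)]) (use bn V'(2) in blast)
 ultimately show ?thesis using ab by blast
qed

text \<open>A section with zero germ vanishes on a basic open set D(b). On each of finitely many
  basic open sets D(d) covering the spectrum it is a fraction whose numerator is killed by a power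
  of b d, so one power of b kills the section globally; and b is a unit in the stalk.\<close>

lemma stalk_kernel:
 assumes r: "r \<in> secs Y U" and z: "germ Y x U r = \<zero>\<^bsub>stalk Y x\<^esub>"
 shows "\<exists>s\<in>secs Y U. germ Y x U s \<in> Units (stalk Y x) \<and> s \<otimes>\<^bsub>sections Y U\<^esub> r = \<zero>\<^bsub>sections Y U\<^esub>"
proof -
 interpret C: cring "sections Y U" by (rule sections_cring[OF Y U])
 have nU: "opens Y U \<and> x \<in> U" using U xU by simp
 obtain \<sigma> where \<sigma>: "\<sigma> \<in> zsecs Sp" "r = h Sp \<sigma>" using bij[OF zopen_Sp] r by (auto simp: bij_betw_def pre_Sp)
 obtain W where W: "opens Y W" "x \<in> W" "W \<subseteq> U" "res Y U W r = res Y U W \<zero>\<^bsub>sections Y U\<^esub>" using z ring_hom_zero[OF germ_hom[OF Y nU] C.ring_axioms cring.axioms(1)[OF B]] germ_eq_iff[OF Y nU r nU C.zero_closed] by auto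
 note V = open_as_pre[OF W(1,3)]
 let ?V = "f ` W"
 have VS: "?V \<subseteq> Sp" using zopenD[OF V(1)] by blast
 have z1: "fr Sp \<zero> \<one> \<in> zsecs Sp" "fr ?V \<zero> \<one> \<in> zsecs ?V"
  using fr1_in[OF zopen_Sp] fr1_in[OF V(1)] by simp_all
 have "h ?V (restrict \<sigma> ?V) = h ?V (fr ?V \<zero> \<one>)"
  using nat[OF zopen_Sp V(1) VS \<sigma>(1)] nat[OF zopen_Sp V(1) VS z1(1)] W(4) h_zero[OF zopen_Sp] restrict_frac_section[OF R VS]
  by (simp add: pre_Sp V(2) \<sigma>(2))
 moreover have locrep: "\<forall>P\<in>Sp. \<exists>V a b. zopen V \<and> P \<in> V \<and> V \<subseteq> Sp \<and> a \<in> carrier R \<and> b \<in> carrier R \<and>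
   (\<forall>Q\<in>V. b \<notin> Q \<and> \<sigma> Q = frac_at Q a b)"
  using \<sigma>(1) by (simp add: spec_sections_def)
 moreover have "restrict \<sigma> ?V \<in> zsecs ?V"
 proof -
  have "\<sigma> P \<in> carrier (localization_at R P)" if "P \<in> ?V" for P using \<sigma>(1) that VS by (auto simp: spec_sections_def)
  moreover have "\<exists>V' a b. zopen V' \<and> P \<in> V' \<and> V' \<subseteq> ?V \<and> a \<in> carrier R \<and> b \<in> carrier R \<and>
   (\<forall>Q\<in>V'. b \<notin> Q \<and> restrict \<sigma> ?V Q = frac_at Q a b)" if P: "P \<in> ?V" for P
  proof -
   have "P \<in> Sp" using P VS by blast
   from bspec[OF locrep this] obtain V' a b where "zopen V'" "P \<in> V'" "a \<in> carrier R" "b \<in> carrier R" "\<forall>Q\<in>V'. b \<notin> Q \<and> \<sigma> Q = frac_at Q a b"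
    by blast
   thus ?thesis using P V(1)
    by - (rule exI[of _ "V' \<inter> ?V"], rule exI[of _ a], rule exI[of _ b], simp add: openin_Int)
  qed
  ultimately show ?thesis by (auto simp: spec_sections_def)
 qed
 ultimately have eq: "restrict \<sigma> ?V = fr ?V \<zero> \<one>" using bij[OF V(1)] z1(2) unfolding bij_betw_def inj_on_def by blast
 have \<sigma>0: "\<sigma> Q = frac_at Q \<zero> \<one>" if "Q \<in> ?V" for Q
  using fun_cong[OF eq, of Q] that by (simp add: frac_section_def[OF R])
 have "f x \<in> ?V" using W(2) by blast
 from zariski_basis[OF R V(1) this] obtain b where b: "b \<in> carrier R" "b \<notin> f x" "{P. primeideal P R \<and> b \<notin> P} \<subseteq> ?V" by blast
 \<comment> \<open>On D(d) the section is the fraction a / e, and \<open>N\<close> is an exponent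
   for which the power of b d kills a; it exists because the section vanishes on D(b d).\<close>
 define chart where "chart P d a e N \<longleftrightarrow> d \<in> carrier R \<and> d \<notin> P \<and> a \<in> carrier R \<and> e \<in> carrier R \<and> (b \<otimes> d) [^] (N::nat) \<otimes> a = \<zero> \<and>
   (\<forall>Q. primeideal Q R \<longrightarrow> d \<notin> Q \<longrightarrow> e \<notin> Q \<and> \<sigma> Q = frac_at Q a e)" for P d a e N
 have ex: "\<exists>d a e N. chart P d a e N" if P: "primeideal P R" for P
 proof -
  from P have "P \<in> Sp" by simp
  from bspec[OF locrep this] obtain V' a e where V': "zopen V'" "P \<in> V'" "a \<in> carrier R" "e \<in> carrier R" "\<forall>Q\<in>V'. e \<notin> Q \<and> \<sigma> Q = frac_at Q a e"
   by blast
  obtain d where d: "d \<in> carrier R" "d \<notin> P" "{P. primeideal P R \<and> d \<notin> P} \<subseteq> V'" using zariski_basis[OF R V'(1,2)] by blast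
  have "\<exists>N::nat. (b \<otimes> d) [^] N \<otimes> a = \<zero>"
  proof (rule locally_zero[OF R V'(3)])
   show "b \<otimes> d \<in> carrier R" using b d by simp
   fix Q assume Q: "primeideal Q R" "b \<otimes> d \<notin> Q"
   interpret Q: primeideal Q R by (rule Q(1))
   have "b \<notin> Q" "d \<notin> Q" using Q(2) Q.I_l_closed Q.I_r_closed b(1) d(1) by auto
   hence "Q \<in> ?V" "Q \<in> V'" using b(3) d(3) Q(1) by auto
   hence "frac_at Q a e = frac_at Q \<zero> \<one>" "e \<notin> Q" using \<sigma>0 V'(5) by auto
   moreover have "\<one> \<notin> Q" using mult_set_prime[OF R Q(1)] by (auto simp: mult_set_def)
   ultimately obtain u where "u \<in> carrier R - Q" "u \<otimes> (a \<otimes> \<one>) = u \<otimes> (\<zero> \<otimes> e)"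
    using fraction_eq_iff[OF R mult_set_prime[OF R Q(1)], of a e \<zero> \<one>] V' by auto
   thus "\<exists>u\<in>carrier R - Q. u \<otimes> a = \<zero>" using V' by auto
  qed
  thus ?thesis using d V' unfolding chart_def by blast
 qed
 obtain d a e N where ch: "\<And>P. primeideal P R ==> chart P (d P) (a P) (e P) (N P)" using ex by metis
 from ch have dP: "\<And>P. primeideal P R ==> d P \<in> carrier R \<and> d P \<notin> P"
  and ae: "\<And>P. primeideal P R ==> a P \<in> carrier R \<and> e P \<in> carrier R" and N: "\<And>P. primeideal P R ==> (b \<otimes> d P) [^] N P \<otimes> a P = \<zero>"
  and loc: "\<And>P Q. primeideal P R ==> primeideal Q R ==> d P \<notin> Q ==> e P \<notin> Q \<and> \<sigma> Q = frac_at Q (a P) (e P)"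
  by (simp_all add: chart_def)
 obtain T where T: "finite T" "T \<subseteq> Sp" "\<forall>Q\<in>Sp. \<exists>P\<in>T. d P \<notin> Q" by (rule spec_quasi_compact[OF R dP])
 \<comment> \<open>The sum bounds every exponent \<open>N P\<close> with \<open>P\<close> in
   \<open>T\<close>.\<close>
 define M where "M = sum N T"
 have bM: "b [^] M \<in> carrier R" using b(1) by simp
 have "fr Sp (b [^] M) \<one> \<otimes>\<^bsub>spec_sections R Sp\<^esub> \<sigma> = fr Sp \<zero> \<one>"
 proof -
  have "frac_at Q (b [^] M) \<one> \<otimes>\<^bsub>localization_at R Q\<^esub> \<sigma> Q = frac_at Q \<zero> \<one>" if Q: "primeideal Q R" for Q
  proof -
   interpret Q: primeideal Q R by (rule Q)
   note m = mult_set_prime[OF R Q]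
   obtain P where P: "P \<in> T" "d P \<notin> Q" using T(3) Q by blast
   hence Pp: "primeideal P R" using T(2) by blast
   have oQ: "\<one> \<notin> Q" using m by (auto simp: mult_set_def)
   have dQ: "d P [^] k \<in> carrier R - Q" for k :: nat
    by (induction k) (use m P(2) dP[OF Pp] in \<open>auto simp: mult_set_def\<close>)
   have "b [^] M = b [^] (M - N P) \<otimes> b [^] N P" unfolding M_def using T(1) P(1) b(1) by (simp add: member_le_sum nat_pow_mult)
   moreover have "(b \<otimes> d P) [^] N P = b [^] N P \<otimes> d P [^] N P" using b(1) dP[OF Pp] by (simp add: nat_pow_distrib)
   ultimately have "d P [^] N P \<otimes> (b [^] M \<otimes> a P) = b [^] (M - N P) \<otimes> ((b \<otimes> d P) [^] N P \<otimes> a P)"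
    using b(1) dP[OF Pp] ae[OF Pp] by (simp add: m_ac)
   hence 0: "d P [^] N P \<otimes> (b [^] M \<otimes> a P) = \<zero>" using N[OF Pp] b(1) by simp
   have eQ: "e P \<notin> Q" "\<sigma> Q = frac_at Q (a P) (e P)" using loc[OF Pp Q P(2)] by auto
   have eS: "e P \<in> carrier R - Q" "\<one> \<in> carrier R - Q" using eQ(1) oQ ae[OF Pp] by auto
   have "frac_at Q (b [^] M) \<one> \<otimes>\<^bsub>localization_at R Q\<^esub> \<sigma> Q = frac_at Q (b [^] M \<otimes> a P) (\<one> \<otimes> e P)"
    unfolding eQ(2) by (rule fraction_mult[OF R m bM eS(2) _ eS(1)]) (use ae[OF Pp] in simp)
   also have "\<dots> = frac_at Q \<zero> \<one>"
    using bM ae[OF Pp] eS 0 dQ by (subst fraction_eq_iff[OF R m]) (auto)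
   finally show ?thesis .
  qed
  thus ?thesis by (auto simp: spec_sections_def frac_section_def[OF R] fun_eq_iff)
 qed
 moreover have bMc: "fr Sp (b [^] M) \<one> \<in> zsecs Sp" by (rule fr1_in[OF zopen_Sp bM])
 ultimately have "h Sp (fr Sp (b [^] M) \<one>) \<otimes>\<^bsub>sections Y U\<^esub> r = \<zero>\<^bsub>sections Y U\<^esub>"
  using ring_hom_mult[OF hom[OF zopen_Sp] bMc \<sigma>(1)] h_zero[OF zopen_Sp] by (simp add: pre_Sp \<sigma>(2))
 moreover have "b [^] M \<notin> f x"
 proof -
  have m: "mult_set R (carrier R - f x)" using mult_set_prime[OF R] fx[OF xU] by blast
  have "b [^] k \<in> carrier R - f x" for k :: nat by (induction k) (use m b in \<open>auto simp: mult_set_def\<close>)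
  thus ?thesis by blast
 qed
 hence "germ Y x U (h Sp (fr Sp (b [^] M) \<one>)) \<in> Units (stalk Y x)" by (rule germ_global_unit[OF bM])
 moreover have "h Sp (fr Sp (b [^] M) \<one>) \<in> secs Y U" using closed_h[OF zopen_Sp bMc] by (simp add: pre_Sp)
 ultimately show ?thesis by blast
qed

end

lemma affine_openE:
 fixes Y :: "('p, 'a) ringed_space"
 assumes "affine_open Y U" "presheaf_of_rings Y" "x \<in> U" "cring (stalk Y x)"
 obtains R :: "'a ring" and f h where "affine_chart Y U x R f h"
 using assms unfolding affine_open_def affine_chart_def by blast

section \<open>Flatness of torsion-free modules\<close>

lemma (in abelian_group) add_minus_cancel:
 assumes "p \<in> carrier G" "q \<in> carrier G" shows "p \<oplus> q \<ominus> p \<ominus> q = \<zero>"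
proof -
 show ?thesis  using assms by (simp add: a_minus_def a_comm[of p q] a_assoc r_neg)
qed

locale torsion_free_module = Module.module A N for A :: "'r ring" (structure) and N :: "('r, 'n) Module.module" +
 assumes dom: "domain A"
  and total: "a \<in> carrier A ==> b \<in> carrier A ==> a divides b \<or> b divides a"
  and torsion_free: "a \<in> carrier A ==> y \<in> carrier N ==> a \<odot>\<^bsub>N\<^esub> y = \<zero>\<^bsub>N\<^esub> ==> a = \<zero> \<or> y = \<zero>\<^bsub>N\<^esub>"
begin

abbreviation "cfs E \<equiv> E \<rightarrow> carrier A"
definition lin :: "('n => 'r) => 'n set => 'n" where "lin a E = (\<Oplus>\<^bsub>N\<^esub>e\<in>E. a e \<odot>\<^bsub>N\<^esub> e)"
definition lspan :: "'n set => 'n set" where "lspan E = {lin a E | a. a \<in> cfs E}"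
definition indep :: "'n set => bool" where
 "indep E \<longleftrightarrow> finite E \<and> E \<subseteq> carrier N \<and> (\<forall>a\<in>cfs E. lin a E = \<zero>\<^bsub>N\<^esub> \<longrightarrow> (\<forall>e\<in>E. a e = \<zero>))"

lemma smult_in: "E \<subseteq> carrier N ==> a \<in> cfs E ==> (\<lambda>e. a e \<odot>\<^bsub>N\<^esub> e) \<in> E \<rightarrow> carrier N"
 by auto

lemma lin_closed: "E \<subseteq> carrier N ==> a \<in> cfs E ==> lin a E \<in> carrier N"
 unfolding lin_def by (rule M.finsum_closed[OF smult_in])

lemma lin_add:
 assumes E: "E \<subseteq> carrier N" and a: "a \<in> cfs E" and b: "b \<in> cfs E"
 shows "lin (\<lambda>e. a e \<oplus> b e) E = lin a E \<oplus>\<^bsub>N\<^esub> lin b E"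
proof -
 have "(\<Oplus>\<^bsub>N\<^esub>e\<in>E. (a e \<oplus> b e) \<odot>\<^bsub>N\<^esub> e) = (\<Oplus>\<^bsub>N\<^esub>e\<in>E. a e \<odot>\<^bsub>N\<^esub> e \<oplus>\<^bsub>N\<^esub> b e \<odot>\<^bsub>N\<^esub> e)"
  by (rule M.finsum_cong') (use assms in \<open>auto simp: Pi_iff smult_l_distr subset_eq\<close>)
 thus ?thesis unfolding lin_def by (simp add: smult_in assms)
qed

lemma lin_smult:
 assumes "finite E" and E: "E \<subseteq> carrier N" and a: "a \<in> cfs E" and r: "r \<in> carrier A"
 shows "lin (\<lambda>e. r \<otimes> a e) E = r \<odot>\<^bsub>N\<^esub> lin a E"
proof -
 have "(\<Oplus>\<^bsub>N\<^esub>e\<in>E. (r \<otimes> a e) \<odot>\<^bsub>N\<^esub> e) = (\<Oplus>\<^bsub>N\<^esub>e\<in>E. r \<odot>\<^bsub>N\<^esub> (a e \<odot>\<^bsub>N\<^esub> e))"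
  by (rule M.finsum_cong') (use assms in \<open>auto simp: Pi_iff smult_assoc1 subset_eq\<close>)
 thus ?thesis unfolding lin_def using assms by (simp add: finsum_smult_ldistr smult_in)
qed

lemma lin_uminus:
 assumes "finite E" "E \<subseteq> carrier N" "a \<in> cfs E"
 shows "lin (\<lambda>e. \<ominus> a e) E = \<ominus>\<^bsub>N\<^esub> lin a E"
proof -
 have "lin (\<lambda>e. a e \<oplus> \<ominus> a e) E = lin a E \<oplus>\<^bsub>N\<^esub> lin (\<lambda>e. \<ominus> a e) E"
  by (rule lin_add) (use assms in auto)
 moreover have "lin (\<lambda>e. a e \<oplus> \<ominus> a e) E = (\<Oplus>\<^bsub>N\<^esub>e\<in>E. \<zero>\<^bsub>N\<^esub>)"
  unfolding lin_def by (rule M.finsum_cong') (use assms in \<open>auto simp: Pi_iff R.r_neg subset_eq\<close>)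
 moreover have "lin a E \<in> carrier N" "lin (\<lambda>e. \<ominus> a e) E \<in> carrier N" using assms by (auto intro!: lin_closed)
 ultimately have "lin (\<lambda>e. \<ominus> a e) E \<oplus>\<^bsub>N\<^esub> lin a E = \<zero>\<^bsub>N\<^esub>" "lin a E \<in> carrier N" "lin (\<lambda>e. \<ominus> a e) E \<in> carrier N"
  by (simp_all add: M.a_comm)
 from M.minus_equality[OF this] show ?thesis ..
qed

lemma divides_all:
 assumes "finite E" "E \<noteq> {}" "a \<in> cfs E" shows "\<exists>j\<in>E. \<forall>l\<in>E. a j divides a l"
 using assms
proof (induction E rule: finite_ne_induct)
 case (insert e E)
 then obtain j where j: "j \<in> E" "\<forall>l\<in>E. a j divides a l" by auto
 have c: "a e \<in> carrier A" "a j \<in> carrier A" "\<forall>l\<in>E. a l \<in> carrier A" using insert.prems j(1) by auto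
 show ?case
 proof (cases "a e divides a j")
  case True
  thus ?thesis using j(2) c divides_trans by blast
 next
  case False
  thus ?thesis using total c j by blast
 qed
qed auto

text \<open>The coefficient dividing all others is cancelled from the relation by torsion-freeness,
  so that \<open>j\<close> becomes a combination of the other generators. Iterated in
  \<open>exists_indep\<close>, this replaces finitely many generators by independent ones.\<close>

lemma lspan_remove:
 assumes E: "finite E" "E \<subseteq> carrier N" and j: "j \<in> E" and a: "a \<in> cfs E" "lin a E = \<zero>\<^bsub>N\<^esub>"
  and aj: "a j \<noteq> \<zero>" "\<forall>l\<in>E. a j divides a l"
 shows "lspan E \<subseteq> lspan (E - {j})"
proof
 fix y assume "y \<in> lspan E"
 then obtain c where c: "c \<in> cfs E" "y = lin c E" by (auto simp: lspan_def)
 have "\<forall>l\<in>E. \<exists>b. b \<in> carrier A \<and> a l = a j \<otimes> b" using aj(2) by auto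
 from bchoice[OF this] obtain b0 where b0: "\<forall>l\<in>E. b0 l \<in> carrier A \<and> a l = a j \<otimes> b0 l" ..
 define b where "b = b0(j := \<one>)"
 have ajc: "a j \<in> carrier A" using a(1) j by auto
 have b: "b \<in> cfs E" "\<And>l. l \<in> E ==> a l = a j \<otimes> b l" using b0 ajc by (auto simp: b_def)
 have "a j \<odot>\<^bsub>N\<^esub> lin b E = lin (\<lambda>l. a j \<otimes> b l) E" by (rule lin_smult[OF E b(1) ajc, symmetric])
 also have "\<dots> = lin a E" unfolding lin_def by (rule M.finsum_cong') (use b E a(1) in \<open>auto simp: Pi_iff subset_eq\<close>)
 finally have lb: "lin b E = \<zero>\<^bsub>N\<^esub>" using torsion_free[OF ajc lin_closed[OF E(2) b(1)]] aj(1) a(2) by simp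
 let ?k = "\<ominus> c j"
 have k: "?k \<in> carrier A" using c(1) j by auto
 define d where "d l = c l \<oplus> ?k \<otimes> b l" for l
 have d: "d \<in> cfs E" using b(1) c(1) k by (auto simp: d_def Pi_iff)
 have "lin d E = lin c E \<oplus>\<^bsub>N\<^esub> lin (\<lambda>l. ?k \<otimes> b l) E" unfolding d_def by (rule lin_add[OF E(2) c(1)]) (use b(1) k in auto)
 also have "lin (\<lambda>l. ?k \<otimes> b l) E = \<zero>\<^bsub>N\<^esub>" using lin_smult[OF E b(1) k] lb k by simp
 finally have y: "y = lin d E" using c lin_closed[OF E(2) c(1)] by simp
 have dj: "d j = \<zero>" using c(1) j by (auto simp: d_def b_def R.r_neg Pi_iff)
 have "lin d E = d j \<odot>\<^bsub>N\<^esub> j \<oplus>\<^bsub>N\<^esub> lin d (E - {j})"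
 proof -
  have "lin d (insert j (E - {j})) = d j \<odot>\<^bsub>N\<^esub> j \<oplus>\<^bsub>N\<^esub> lin d (E - {j})"
   unfolding lin_def by (rule M.finsum_insert) (use E d j in \<open>auto simp: Pi_iff subset_eq\<close>)
  thus ?thesis using j by (simp add: insert_absorb)
 qed
 moreover have "lin d (E - {j}) \<in> carrier N" by (rule lin_closed) (use E d in auto)
 moreover have "j \<in> carrier N" using E j by auto
 ultimately show "y \<in> lspan (E - {j})" using y dj d by (auto simp: lspan_def)
qed

lemma exists_indep: "finite E ==> E \<subseteq> carrier N ==> \<exists>E'. indep E' \<and> lspan E \<subseteq> lspan E'"
proof (induction "card E" arbitrary: E)
 case 0
 thus ?case by (auto simp: indep_def)
next
 case (Suc k)
 show ?case
 proof (cases "indep E")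
  case False
  then obtain a e where a: "a \<in> cfs E" "lin a E = \<zero>\<^bsub>N\<^esub>" "e \<in> E" "a e \<noteq> \<zero>" using Suc.prems by (auto simp: indep_def)
  obtain j where j: "j \<in> E" "\<forall>l\<in>E. a j divides a l" using divides_all[OF Suc.prems(1) _ a(1)] a(3) by blast
  have "a j \<noteq> \<zero>"
  proof
   assume "a j = \<zero>"
   hence "\<zero> divides a e" using j(2) a(3) by auto
   thus False using a(4) by auto
  qed
  hence "lspan E \<subseteq> lspan (E - {j})" using lspan_remove[OF Suc.prems j(1) a(1,2) _ j(2)] by blast
  moreover have "\<exists>E'. indep E' \<and> lspan (E - {j}) \<subseteq> lspan E'"
   by (rule Suc.hyps(1)) (use Suc.hyps(2) Suc.prems j(1) in auto)
  ultimately show ?thesis by blast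
 qed blast
qed

lemma mem_lspan: assumes E: "finite E" "E \<subseteq> carrier N" and y: "y \<in> E" shows "y \<in> lspan E"
proof -
 let ?a = "\<lambda>e. if e = y then \<one> else \<zero>"
 have "lin ?a E = (\<Oplus>\<^bsub>N\<^esub>e\<in>E. if y = e then e else \<zero>\<^bsub>N\<^esub>)"
  unfolding lin_def by (rule M.finsum_cong') (use E in auto)
 also have "\<dots> = y" using M.finsum_singleton[OF y E(1), of "\<lambda>e. e"] E(2) by auto
 finally show ?thesis unfolding lspan_def by (intro CollectI exI[of _ ?a]) auto
qed

text \<open>A choice of coefficients, forced by \<open>coord_eqI\<close> when \<open>E\<close> is
  independent and meaningful only on \<open>lspan E\<close>.\<close>

definition coord :: "'n set => 'n => 'n => 'r" where
 "coord E y = (SOME a. a \<in> cfs E \<and> y = lin a E)"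

lemma coord: assumes "y \<in> lspan E" shows "coord E y \<in> cfs E" "lin (coord E y) E = y"
proof -
 have "\<exists>a. a \<in> cfs E \<and> y = lin a E" using assms by (auto simp: lspan_def)
 from someI_ex[OF this] show "coord E y \<in> cfs E" "lin (coord E y) E = y" unfolding coord_def by auto
qed

lemma coord_eqI:
 assumes E: "indep E" and a: "a \<in> cfs E" and e: "e \<in> E" shows "coord E (lin a E) e = a e"
proof -
 have Ef: "finite E" "E \<subseteq> carrier N" using E by (auto simp: indep_def)
 let ?c = "coord E (lin a E)"
 have y: "lin a E \<in> lspan E" using a by (auto simp: lspan_def)
 note c = coord[OF y]
 have "lin (\<lambda>e. a e \<oplus> \<ominus> ?c e) E = lin a E \<oplus>\<^bsub>N\<^esub> lin (\<lambda>e. \<ominus> ?c e) E" by (rule lin_add[OF Ef(2) a]) (use c(1) in auto)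
 also have "\<dots> = \<zero>\<^bsub>N\<^esub>" unfolding lin_uminus[OF Ef c(1)] c(2) using lin_closed[OF Ef(2) a] by (simp add: M.r_neg)
 finally have "a e \<oplus> \<ominus> ?c e = \<zero>" using E e a c(1) unfolding indep_def by (auto simp: Pi_iff)
 moreover have "a e \<in> carrier A" "?c e \<in> carrier A" using a c(1) e by auto
 ultimately show ?thesis by (metis a_minus_def R.r_right_minus_eq)
qed

lemma lspan_add:
 assumes E: "indep E" and y: "y \<in> lspan E" "y' \<in> lspan E"
 shows "y \<oplus>\<^bsub>N\<^esub> y' \<in> lspan E" "e \<in> E ==> coord E (y \<oplus>\<^bsub>N\<^esub> y') e = coord E y e \<oplus> coord E y' e"
proof -
 have EN: "E \<subseteq> carrier N" using E by (simp add: indep_def)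
 have s: "(\<lambda>e. coord E y e \<oplus> coord E y' e) \<in> cfs E" using coord(1)[OF y(1)] coord(1)[OF y(2)] by auto
 have eq: "y \<oplus>\<^bsub>N\<^esub> y' = lin (\<lambda>e. coord E y e \<oplus> coord E y' e) E"
  using lin_add[OF EN coord(1)[OF y(1)] coord(1)[OF y(2)]] by (simp add: coord(2) y)
 show "y \<oplus>\<^bsub>N\<^esub> y' \<in> lspan E" unfolding lspan_def eq using s by blast
 show "coord E (y \<oplus>\<^bsub>N\<^esub> y') e = coord E y e \<oplus> coord E y' e" if "e \<in> E" unfolding eq by (rule coord_eqI[OF E s that])
qed

lemma lspan_smult:
 assumes E: "indep E" and y: "y \<in> lspan E" and r: "r \<in> carrier A"
 shows "r \<odot>\<^bsub>N\<^esub> y \<in> lspan E" "e \<in> E ==> coord E (r \<odot>\<^bsub>N\<^esub> y) e = r \<otimes> coord E y e"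
proof -
 have EN: "finite E" "E \<subseteq> carrier N" using E by (simp_all add: indep_def)
 have s: "(\<lambda>e. r \<otimes> coord E y e) \<in> cfs E" using coord(1)[OF y] r by auto
 have eq: "r \<odot>\<^bsub>N\<^esub> y = lin (\<lambda>e. r \<otimes> coord E y e) E" using lin_smult[OF EN coord(1)[OF y] r] by (simp add: coord(2) y)
 show "r \<odot>\<^bsub>N\<^esub> y \<in> lspan E" unfolding lspan_def eq using s by blast
 show "coord E (r \<odot>\<^bsub>N\<^esub> y) e = r \<otimes> coord E y e" if "e \<in> E" unfolding eq by (rule coord_eqI[OF E s that])
qed

text \<open>The map \<open>M \<otimes> N \<rightarrow> M\<close> given by the \<open>e\<close>-th coordinate, on the free abelian group of symbols; symbols with
 second component outside of the span of \<open>E\<close> are sent to \<open>0\<close>.\<close>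

definition coord_hom :: "('r, 'm) Module.module => 'n set => 'n => ('m \<times> 'n \<Rightarrow>\<^sub>0 int) => 'm" where
 "coord_hom M E e = (SOME h. h \<in> hom (tensor_free M N) (add_monoid M) \<and>
   (\<forall>x\<in>carrier M. \<forall>y\<in>carrier N. h (frag_of (x, y)) = (if y \<in> lspan E then coord E y e \<odot>\<^bsub>M\<^esub> x else \<zero>\<^bsub>M\<^esub>)))"

lemma coord_hom:
 assumes M: "Module.module A M" and e: "e \<in> E"
 shows "coord_hom M E e \<in> hom (tensor_free M N) (add_monoid M)"
  and "x \<in> carrier M ==> y \<in> carrier N ==> coord_hom M E e (frag_of (x, y)) = (if y \<in> lspan E then coord E y e \<odot>\<^bsub>M\<^esub> x else \<zero>\<^bsub>M\<^esub>)"
proof -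
 interpret m: Module.module A M by (rule M)
 let ?f = "\<lambda>(x, y). if y \<in> lspan E then coord E y e \<odot>\<^bsub>M\<^esub> x else \<zero>\<^bsub>M\<^esub>"
 have "?f z \<in> carrier (add_monoid M)" if zc: "z \<in> carrier M \<times> carrier N" for z
 proof -
  obtain x y where z: "z = (x, y)" "x \<in> carrier M" using zc by auto
  thus ?thesis using funcset_mem[OF coord(1) e] by auto
 qed
 hence "?f ` (carrier M \<times> carrier N) \<subseteq> carrier (add_monoid M)" by blast
 then obtain h where "h \<in> hom (tensor_free M N) (add_monoid M)" "\<And>z. z \<in> carrier M \<times> carrier N ==> h (frag_of z) = ?f z"
  unfolding tensor_free_def using comm_group.free_Abelian_group_universal[OF m.M.a_comm_group] by blast
 hence "\<exists>h. h \<in> hom (tensor_free M N) (add_monoid M) \<and>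
   (\<forall>x\<in>carrier M. \<forall>y\<in>carrier N. h (frag_of (x, y)) = (if y \<in> lspan E then coord E y e \<odot>\<^bsub>M\<^esub> x else \<zero>\<^bsub>M\<^esub>))"
  by auto
 from someI_ex[OF this] show "coord_hom M E e \<in> hom (tensor_free M N) (add_monoid M)"
  "x \<in> carrier M ==> y \<in> carrier N ==> coord_hom M E e (frag_of (x, y)) = (if y \<in> lspan E then coord E y e \<odot>\<^bsub>M\<^esub> x else \<zero>\<^bsub>M\<^esub>)"
  unfolding coord_hom_def by auto
qed

abbreviation "symbols M \<equiv> {c. Poly_Mapping.keys c \<subseteq> carrier M \<times> carrier N}"

lemma coord_hom_add:
 assumes M: "Module.module A M" and e: "e \<in> E" and c: "c \<in> symbols M" "d \<in> symbols M"
 shows "coord_hom M E e (c + d) = coord_hom M E e c \<oplus>\<^bsub>M\<^esub> coord_hom M E e d"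
  and "coord_hom M E e c \<in> carrier M"
 using coord_hom(1)[OF M e] c by (auto simp: hom_def tensor_free_def)

lemma symbols_closed: "c \<in> symbols M ==> d \<in> symbols M ==> c + d \<in> symbols M" "c \<in> symbols M ==> - c \<in> symbols M"
  "c \<in> symbols M ==> d \<in> symbols M ==> c - d \<in> symbols M" "0 \<in> symbols M"
  "x \<in> carrier M ==> y \<in> carrier N ==> frag_of (x, y) \<in> symbols M"
 using Poly_Mapping.keys_add[of c d] keys_diff[of c d] by auto

lemma coord_hom_diff:
 assumes M: "Module.module A M" and e: "e \<in> E" and c: "c \<in> symbols M" "d \<in> symbols M"
 shows "coord_hom M E e (c - d) = coord_hom M E e c \<ominus>\<^bsub>M\<^esub> coord_hom M E e d" and "coord_hom M E e 0 = \<zero>\<^bsub>M\<^esub>"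
proof -
 interpret m: Module.module A M by (rule M)
 show "coord_hom M E e (c - d) = coord_hom M E e c \<ominus>\<^bsub>M\<^esub> coord_hom M E e d" using coord_hom_add(1)[OF M e symbols_closed(3)[OF c] c(2)] coord_hom_add(2)[OF M e symbols_closed(3)[OF c] c(2)] coord_hom_add(2)[OF M e c(2) c(2)] by (simp add: a_minus_def m.M.a_assoc m.M.r_neg)
 show "coord_hom M E e 0 = \<zero>\<^bsub>M\<^esub>"
  using coord_hom_add[OF M e symbols_closed(4) symbols_closed(4)] by (metis m.M.add.r_cancel_one add_0)
qed

lemma coord_hom_diff2:
 assumes M: "Module.module A M" and e: "e \<in> E" and c: "c \<in> symbols M" "d \<in> symbols M" "d' \<in> symbols M"
 shows "coord_hom M E e (c - d - d') = coord_hom M E e c \<ominus>\<^bsub>M\<^esub> coord_hom M E e d \<ominus>\<^bsub>M\<^esub> coord_hom M E e d'"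
 by (simp only: coord_hom_diff(1)[OF M e symbols_closed(3)[OF c(1,2)] c(3)] coord_hom_diff(1)[OF M e c(1,2)])

abbreviation "relgens M \<equiv> {frag_of (x \<oplus>\<^bsub>M\<^esub> x', y) - frag_of (x, y) - frag_of (x', y) | x x' y.
     x \<in> carrier M \<and> x' \<in> carrier M \<and> y \<in> carrier N} \<union>
   {frag_of (x, y \<oplus>\<^bsub>N\<^esub> y') - frag_of (x, y) - frag_of (x, y') | x y y'.
     x \<in> carrier M \<and> y \<in> carrier N \<and> y' \<in> carrier N} \<union>
   {frag_of (r \<odot>\<^bsub>M\<^esub> x, y) - frag_of (x, r \<odot>\<^bsub>N\<^esub> y) | r x y.
     r \<in> carrier A \<and> x \<in> carrier M \<and> y \<in> carrier N}"

lemma relgens_symbols: assumes M: "Module.module A M" shows "relgens M \<subseteq> symbols M"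
proof -
 interpret m: Module.module A M by (rule M)
 have a: "frag_of (x \<oplus>\<^bsub>M\<^esub> x', y) - frag_of (x, y) - frag_of (x', y) \<in> symbols M" if "x \<in> carrier M" "x' \<in> carrier M" "y \<in> carrier N" for x x' y
  by (intro symbols_closed(3)) (use that in auto)
 have b: "frag_of (x, y \<oplus>\<^bsub>N\<^esub> y') - frag_of (x, y) - frag_of (x, y') \<in> symbols M" if "x \<in> carrier M" "y \<in> carrier N" "y' \<in> carrier N" for x y y'
  by (intro symbols_closed(3)) (use that in auto)
 have c: "frag_of (r \<odot>\<^bsub>M\<^esub> x, y) - frag_of (x, r \<odot>\<^bsub>N\<^esub> y) \<in> symbols M" if "r \<in> carrier A" "x \<in> carrier M" "y \<in> carrier N" for r x y
  by (intro symbols_closed(3)) (use that in \<open>auto intro: smult_closed m.smult_closed\<close>)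
 show ?thesis
 proof
  fix z assume "z \<in> relgens M"
  thus "z \<in> symbols M" by (elim UnE CollectE exE) (simp_all only: a b c)
 qed
qed

abbreviation "rels M \<equiv> tensor_relations A M N"

text \<open>Coordinates are additive only inside \<open>lspan E\<close>, so a relation is killed
  once the span contains the finitely many second components \<open>W\<close> used in deriving it.
  \<open>W\<close> depends on the derivation and not only on \<open>c\<close>, as symbols may
  cancel.\<close>

lemma coord_hom_relation:
 assumes M: "Module.module A M" and c: "c \<in> rels M"
 shows "c \<in> symbols M \<and> (\<exists>W. finite W \<and> W \<subseteq> carrier N \<and> (\<forall>E. indep E \<longrightarrow> W \<subseteq> lspan E \<longrightarrow> (\<forall>e\<in>E. coord_hom M E e c = \<zero>\<^bsub>M\<^esub>)))"
proof -
 interpret m: Module.module A M by (rule M)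
 define V where "V c W \<longleftrightarrow> finite W \<and> W \<subseteq> carrier N \<and> (\<forall>E. indep E \<longrightarrow> W \<subseteq> lspan E \<longrightarrow> (\<forall>e\<in>E. coord_hom M E e c = \<zero>\<^bsub>M\<^esub>))" for c W
 have VI: "V c W" if "finite W" "W \<subseteq> carrier N" "\<And>E e. indep E ==> W \<subseteq> lspan E ==> e \<in> E ==> coord_hom M E e c = \<zero>\<^bsub>M\<^esub>" for c W
  using that by (auto simp: V_def)
 have VD: "finite W" "W \<subseteq> carrier N" "indep E ==> W \<subseteq> lspan E ==> e \<in> E ==> coord_hom M E e c = \<zero>\<^bsub>M\<^esub>" if "V c W" for c W E e
  using that by (auto simp: V_def)
 have ch: "coord_hom M E e (frag_of (x, y)) = coord E y e \<odot>\<^bsub>M\<^esub> x" "coord E y e \<in> carrier A"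
  if "indep E" "e \<in> E" "x \<in> carrier M" "y \<in> carrier N" "y \<in> lspan E" for E e x y
  using coord_hom(2)[OF M that(2,3,4)] coord(1) that by auto
 have gen: "\<exists>W. V c W" if "c \<in> relgens M" for c
  using that
 proof (elim UnE CollectE exE conjE)
  fix x x' y assume c: "c = frag_of (x \<oplus>\<^bsub>M\<^esub> x', y) - frag_of (x, y) - frag_of (x', y)" and xy: "x \<in> carrier M" "x' \<in> carrier M" "y \<in> carrier N"
  show ?thesis
  proof (rule exI[of _ "{y}"], rule VI)
   fix E e assume E: "indep E" "{y} \<subseteq> lspan E" "e \<in> E"
   have "coord_hom M E e c = coord_hom M E e (frag_of (x \<oplus>\<^bsub>M\<^esub> x', y)) \<ominus>\<^bsub>M\<^esub> coord_hom M E e (frag_of (x, y)) \<ominus>\<^bsub>M\<^esub> coord_hom M E e (frag_of (x', y))"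
    unfolding c by (rule coord_hom_diff2[OF M E(3)]; rule) (use xy in auto)
   thus "coord_hom M E e c = \<zero>\<^bsub>M\<^esub>" using xy E ch
    by (simp add: m.smult_r_distr m.M.add_minus_cancel)
  qed (use xy in auto)
 next
  fix x y y' assume c: "c = frag_of (x, y \<oplus>\<^bsub>N\<^esub> y') - frag_of (x, y) - frag_of (x, y')" and xy: "x \<in> carrier M" "y \<in> carrier N" "y' \<in> carrier N"
  show ?thesis
  proof (rule exI[of _ "{y, y'}"], rule VI)
   fix E e assume E: "indep E" "{y, y'} \<subseteq> lspan E" "e \<in> E"
   hence E2: "y \<in> lspan E" "y' \<in> lspan E" by auto
   have "coord_hom M E e c = coord_hom M E e (frag_of (x, y \<oplus>\<^bsub>N\<^esub> y')) \<ominus>\<^bsub>M\<^esub> coord_hom M E e (frag_of (x, y)) \<ominus>\<^bsub>M\<^esub> coord_hom M E e (frag_of (x, y'))"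
    unfolding c by (rule coord_hom_diff2[OF M E(3)]; rule) (use xy in auto)
   thus "coord_hom M E e c = \<zero>\<^bsub>M\<^esub>" using xy E2 ch[OF E(1,3)] lspan_add[OF E(1) E2] E(3)
    by (simp add: m.smult_l_distr m.M.add_minus_cancel)
  qed (use xy in auto)
 next
  fix r x y assume c: "c = frag_of (r \<odot>\<^bsub>M\<^esub> x, y) - frag_of (x, r \<odot>\<^bsub>N\<^esub> y)" and xy: "r \<in> carrier A" "x \<in> carrier M" "y \<in> carrier N"
  show ?thesis
  proof (rule exI[of _ "{y}"], rule VI)
   fix E e assume E: "indep E" "{y} \<subseteq> lspan E" "e \<in> E"
   hence E2: "y \<in> lspan E" by auto
   have cc: "coord E y e \<in> carrier A" "r \<odot>\<^bsub>M\<^esub> x \<in> carrier M" "r \<odot>\<^bsub>N\<^esub> y \<in> carrier N" using coord(1)[OF E2] E(3) xy by auto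
   have "coord_hom M E e c = coord_hom M E e (frag_of (r \<odot>\<^bsub>M\<^esub> x, y)) \<ominus>\<^bsub>M\<^esub> coord_hom M E e (frag_of (x, r \<odot>\<^bsub>N\<^esub> y))"
    unfolding c by (rule coord_hom_diff(1)[OF M E(3)]) (use xy in auto)
   also have "\<dots> = coord E y e \<odot>\<^bsub>M\<^esub> (r \<odot>\<^bsub>M\<^esub> x) \<ominus>\<^bsub>M\<^esub> (r \<otimes> coord E y e) \<odot>\<^bsub>M\<^esub> x"
    using coord_hom(2)[OF M E(3) cc(2) xy(3)] coord_hom(2)[OF M E(3) xy(2) cc(3)] lspan_smult[OF E(1) E2 xy(1)] E2 E(3) by simp
   also have "\<dots> = \<zero>\<^bsub>M\<^esub>" using xy cc by (simp add: R.m_comm[of r] m.smult_assoc1 m.M.r_neg a_minus_def)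
   finally show "coord_hom M E e c = \<zero>\<^bsub>M\<^esub>" .
  qed (use xy in auto)
 qed
 have rs: "h \<in> symbols M" if "h \<in> relgens M" for h using relgens_symbols[OF M] that by blast
 have "c \<in> generate (tensor_free M N) (relgens M)" using c by (simp add: tensor_relations_def)
 hence "c \<in> symbols M \<and> (\<exists>W. V c W)"
 proof (induction c rule: generate.induct)
  case one
  have "V 0 {}" by (rule VI) (simp_all add: coord_hom_diff(2)[OF M _ symbols_closed(4) symbols_closed(4)])
  thus ?case by (auto simp: tensor_free_def)
 next
  case (incl h)
  show ?case by (rule conjI[OF rs[OF incl] gen[OF incl]])
 next
  case (inv h)
  have hs: "h \<in> symbols M" by (rule rs[OF inv])
  have i: "inv\<^bsub>tensor_free M N\<^esub> h = 0 - h" using hs by (simp add: tensor_free_def)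
  from gen[OF inv] obtain W where W: "V h W" ..
  have "V (0 - h) W"
  proof (rule VI[OF VD(1,2)[OF W]])
   fix E e assume E: "indep E" "W \<subseteq> lspan E" "e \<in> E"
   show "coord_hom M E e (0 - h) = \<zero>\<^bsub>M\<^esub>"
    unfolding coord_hom_diff(1)[OF M E(3) symbols_closed(4) hs] coord_hom_diff(2)[OF M E(3) hs hs] VD(3)[OF W E]
    by (simp add: a_minus_def)
  qed
  thus ?case unfolding i using symbols_closed(3)[OF symbols_closed(4) hs] by auto
 next
  case (eng h1 h2)
  from eng.IH obtain W1 W2 where W1: "V h1 W1" and W2: "V h2 W2" and hs: "h1 \<in> symbols M" "h2 \<in> symbols M" by auto
  have "V (h1 + h2) (W1 \<union> W2)"
  proof (rule VI)
   show "finite (W1 \<union> W2)" "W1 \<union> W2 \<subseteq> carrier N" using VD(1,2)[OF W1] VD(1,2)[OF W2] by auto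
   fix E e assume E: "indep E" "W1 \<union> W2 \<subseteq> lspan E" "e \<in> E"
   have W: "W1 \<subseteq> lspan E" "W2 \<subseteq> lspan E" using E(2) by auto
   show "coord_hom M E e (h1 + h2) = \<zero>\<^bsub>M\<^esub>"
    unfolding coord_hom_add(1)[OF M E(3) hs] VD(3)[OF W1 E(1) W(1) E(3)] VD(3)[OF W2 E(1) W(2) E(3)] by simp
  qed
  thus ?case using symbols_closed(1)[OF hs] by (auto simp: tensor_free_def)
 qed
 thus ?thesis unfolding V_def .
qed

lemma relation_diff:
 assumes M: "Module.module A M" shows "c \<in> rels M ==> d \<in> rels M ==> c - d \<in> rels M"
  and "0 \<in> rels M" "relgens M \<subseteq> rels M"
proof -
 have s: "subgroup (rels M) (tensor_free M N)" unfolding tensor_relations_def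
  by (rule group.generate_is_subgroup) (use relgens_symbols[OF M] in \<open>simp_all add: tensor_free_def carrier_free_Abelian_group_iff[symmetric] subset_eq\<close>)
 have rs: "d \<in> symbols M" if "d \<in> rels M" for d using coord_hom_relation[OF M that] by blast
 show "c - d \<in> rels M" if "c \<in> rels M" "d \<in> rels M"
  using subgroup.m_closed[OF s that(1) subgroup.m_inv_closed[OF s that(2)]] rs[OF that(2)] by (simp add: tensor_free_def)
 show "0 \<in> rels M" using subgroup.one_closed[OF s] by (simp add: tensor_free_def)
 show "relgens M \<subseteq> rels M" unfolding tensor_relations_def by (rule, rule)
qed

lemma relation_add:
 assumes M: "Module.module A M" and c: "c \<in> rels M" and d: "d \<in> rels M"
 shows "c + d \<in> rels M"
proof -
 have "0 - d \<in> rels M" by (rule relation_diff(1)[OF M relation_diff(2)[OF M] d])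
 from relation_diff(1)[OF M c this] show ?thesis by simp
qed

text \<open>For a free module on \<open>E\<close> the tensor product is a sum of copies of
  \<open>M\<close>; at the level of symbols, bilinearity moves every second component to the
  basis.\<close>

lemma symbol_expansion:
 assumes M: "Module.module A M" and E: "indep E" and c: "c \<in> symbols M" "Poly_Mapping.keys c \<subseteq> carrier M \<times> lspan E"
 shows "c - (\<Sum>e\<in>E. frag_of (coord_hom M E e c, e)) \<in> rels M"
proof -
 interpret m: Module.module A M by (rule M)
 let ?T = "rels M"
 note rd = relation_diff(1)[OF M] and ra = relation_add[OF M]
 have EN: "finite E" "E \<subseteq> carrier N" using E by (simp_all add: indep_def)
 have r1: "frag_of (x \<oplus>\<^bsub>M\<^esub> x', y) - frag_of (x, y) - frag_of (x', y) \<in> ?T" if "x \<in> carrier M" "x' \<in> carrier M" "y \<in> carrier N" for x x' y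
  by (rule subsetD[OF relation_diff(3)[OF M]]) (use that in blast)
 have r2: "frag_of (x, y \<oplus>\<^bsub>N\<^esub> y') - frag_of (x, y) - frag_of (x, y') \<in> ?T" if "x \<in> carrier M" "y \<in> carrier N" "y' \<in> carrier N" for x y y'
  by (rule subsetD[OF relation_diff(3)[OF M]]) (use that in blast)
 have r3: "frag_of (r \<odot>\<^bsub>M\<^esub> x, y) - frag_of (x, r \<odot>\<^bsub>N\<^esub> y) \<in> ?T" if "r \<in> carrier A" "x \<in> carrier M" "y \<in> carrier N" for r x y
  by (rule subsetD[OF relation_diff(3)[OF M]]) (use that in blast)
 have z1: "frag_of (\<zero>\<^bsub>M\<^esub>, y) \<in> ?T" if "y \<in> carrier N" for y
  using rd[OF relation_diff(2)[OF M] r1[OF m.M.zero_closed m.M.zero_closed that]] by simp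
 have z2: "frag_of (x, \<zero>\<^bsub>N\<^esub>) \<in> ?T" if "x \<in> carrier M" for x
  using rd[OF relation_diff(2)[OF M] r2[OF that M.zero_closed M.zero_closed]] by simp
 have lin_sym: "frag_of (x, lin a F) - (\<Sum>e\<in>F. frag_of (a e \<odot>\<^bsub>M\<^esub> x, e)) \<in> ?T"
  if "finite F" "F \<subseteq> carrier N" "a \<in> cfs F" "x \<in> carrier M" for x a F
  using that
 proof (induction F)
  case empty
  thus ?case using z2 by (simp add: lin_def)
 next
  case (insert e F)
  have c: "e \<in> carrier N" "F \<subseteq> carrier N" "a \<in> cfs F" "a e \<in> carrier A" "a e \<odot>\<^bsub>N\<^esub> e \<in> carrier N" "lin a F \<in> carrier N"
   using insert.prems lin_closed by auto
  have l: "lin a (insert e F) = a e \<odot>\<^bsub>N\<^esub> e \<oplus>\<^bsub>N\<^esub> lin a F" unfolding lin_def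
   by (rule M.finsum_insert[OF insert.hyps]) (use c in auto)
  have "(frag_of (x, a e \<odot>\<^bsub>N\<^esub> e \<oplus>\<^bsub>N\<^esub> lin a F) - frag_of (x, a e \<odot>\<^bsub>N\<^esub> e) - frag_of (x, lin a F)) +
   (frag_of (x, lin a F) - (\<Sum>e\<in>F. frag_of (a e \<odot>\<^bsub>M\<^esub> x, e))) - (frag_of (a e \<odot>\<^bsub>M\<^esub> x, e) - frag_of (x, a e \<odot>\<^bsub>N\<^esub> e)) \<in> ?T"
   by (rule rd[OF ra[OF r2[OF insert.prems(3) c(5,6)] insert.IH[OF c(2,3) insert.prems(3)]] r3[OF c(4) insert.prems(3) c(1)]])
  thus ?case unfolding l using insert.hyps by (simp add: algebra_simps)
 qed
 have sumT: "sum g F \<in> ?T" if "\<And>i. i \<in> F ==> g i \<in> ?T" for g :: "'n => _" and F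
  using that by (induction F rule: infinite_finite_induct) (auto simp: relation_diff(2)[OF M] ra)
 have LN: "lspan E \<subseteq> carrier N" using lin_closed[OF EN(2)] by (auto simp: lspan_def)
 have "c \<in> symbols M \<and> c - (\<Sum>e\<in>E. frag_of (coord_hom M E e c, e)) \<in> ?T"
  using c(2)
 proof (induction c rule: frag_induction)
  case zero
  have "(\<Sum>e\<in>E. frag_of (coord_hom M E e 0, e)) = (\<Sum>e\<in>E. frag_of (\<zero>\<^bsub>M\<^esub>, e))"
   by (rule sum.cong) (simp_all add: coord_hom_diff(2)[OF M _ symbols_closed(4) symbols_closed(4)])
  also have "\<dots> \<in> ?T" by (rule sumT) (use z1 EN in auto)
  finally show ?case using rd[OF relation_diff(2)[OF M]] symbols_closed(4) by blast
 next
  case (one z)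
  then obtain x y where z: "z = (x, y)" "x \<in> carrier M" "y \<in> lspan E" by auto
  have yN: "y \<in> carrier N" using z LN by blast
  have "(\<Sum>e\<in>E. frag_of (coord_hom M E e (frag_of z), e)) = (\<Sum>e\<in>E. frag_of (coord E y e \<odot>\<^bsub>M\<^esub> x, e))"
   by (rule sum.cong) (use z coord_hom(2)[OF M _ z(2) yN] in auto)
  thus ?case using lin_sym[OF EN coord(1)[OF z(3)] z(2)] symbols_closed(5)[OF z(2) yN] by (simp add: coord(2)[OF z(3)] z(1))
 next
  case (diff a b)
  have ab: "a \<in> symbols M" "b \<in> symbols M" using diff by blast+
  have t: "frag_of (coord_hom M E e (a - b), e) - frag_of (coord_hom M E e a, e) + frag_of (coord_hom M E e b, e) \<in> ?T" if "e \<in> E" for e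
  proof -
   note hc = coord_hom_add(2)[OF M that]
   have "frag_of (coord_hom M E e a, e) - frag_of (coord_hom M E e (a - b), e) - frag_of (coord_hom M E e b, e) \<in> ?T" using coord_hom_add(1)[OF M that symbols_closed(3)[OF ab] ab(2)] r1[OF hc[OF symbols_closed(3)[OF ab] ab(1)] hc[OF ab(2) ab(1)], of e] EN that by auto
   from rd[OF relation_diff(2)[OF M] this] show ?thesis by (simp add: algebra_simps)
  qed
  have "(a - (\<Sum>e\<in>E. frag_of (coord_hom M E e a, e))) - (b - (\<Sum>e\<in>E. frag_of (coord_hom M E e b, e))) -
   (\<Sum>e\<in>E. frag_of (coord_hom M E e (a - b), e) - frag_of (coord_hom M E e a, e) + frag_of (coord_hom M E e b, e)) \<in> ?T"
   by (rule rd[OF rd[OF conjunct2[OF diff(1)] conjunct2[OF diff(2)]]], rule sumT, rule t)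
  thus ?case using symbols_closed(3)[OF ab] by (simp add: sum.distrib sum_subtractf)
 qed
 thus ?thesis by blast
qed

lemma coord_hom_natural:
 assumes M: "Module.module A M" and M': "Module.module A M'" and u: "u \<in> linear_maps A M M'" and E: "indep E" and e: "e \<in> E"
  and c: "c \<in> symbols M"
 shows "coord_hom M' E e (frag_extend (\<lambda>(x, y). frag_of (u x, y)) c) = u (coord_hom M E e c)"
proof -
 interpret m: Module.module A M by (rule M)
 interpret m': Module.module A M' by (rule M')
 let ?U = "frag_extend (\<lambda>(x, y). frag_of (u x, y) :: 'b \<times> 'n \<Rightarrow>\<^sub>0 int)"
 have uh: "u \<in> hom (add_monoid M) (add_monoid M')" and us: "\<And>r x. r \<in> carrier A ==> x \<in> carrier M ==> u (r \<odot>\<^bsub>M\<^esub> x) = r \<odot>\<^bsub>M'\<^esub> u x"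
  using u by (auto simp: linear_maps_def)
 have uc: "u x \<in> carrier M'" if "x \<in> carrier M" for x using uh that by (auto simp: hom_def)
 have ua: "u (x \<oplus>\<^bsub>M\<^esub> x') = u x \<oplus>\<^bsub>M'\<^esub> u x'" if "x \<in> carrier M" "x' \<in> carrier M" for x x' using uh that by (auto simp: hom_def)
 have u0: "u \<zero>\<^bsub>M\<^esub> = \<zero>\<^bsub>M'\<^esub>" using ua[of "\<zero>\<^bsub>M\<^esub>" "\<zero>\<^bsub>M\<^esub>"] uc[of "\<zero>\<^bsub>M\<^esub>"] by (metis m'.M.add.r_cancel_one m.M.zero_closed m.M.r_zero)
 have ud: "u (x \<ominus>\<^bsub>M\<^esub> x') = u x \<ominus>\<^bsub>M'\<^esub> u x'" if "x \<in> carrier M" "x' \<in> carrier M" for x x'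
 proof -
  show ?thesis using ua[of "x \<ominus>\<^bsub>M\<^esub> x'" x'] that uc by (simp add: a_minus_def m.M.a_assoc m.M.l_neg m'.M.a_assoc m'.M.r_neg)
 qed
 have "c \<in> symbols M \<and> ?U c \<in> symbols M' \<and> coord_hom M' E e (?U c) = u (coord_hom M E e c)"
  using c[simplified]
 proof (induction c rule: frag_induction)
  case zero
  show ?case using coord_hom_diff(2)[OF M' e symbols_closed(4) symbols_closed(4)] coord_hom_diff(2)[OF M e symbols_closed(4) symbols_closed(4)] u0 by simp
 next
  case (one z)
  then obtain x y where z: "z = (x, y)" "x \<in> carrier M" "y \<in> carrier N" by auto
  show ?case using coord_hom(2)[OF M e z(2,3)] coord_hom(2)[OF M' e uc[OF z(2)] z(3)] us[OF funcset_mem[OF coord(1)[of y E] e] z(2)] u0 z uc by simp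
 next
  case (diff a b)
  have ab: "a \<in> symbols M" "b \<in> symbols M" "?U a \<in> symbols M'" "?U b \<in> symbols M'"
   "coord_hom M' E e (?U a) = u (coord_hom M E e a)" "coord_hom M' E e (?U b) = u (coord_hom M E e b)" using diff by blast+
  have "coord_hom M' E e (?U a - ?U b) = u (coord_hom M E e (a - b))"
   unfolding coord_hom_diff(1)[OF M' e ab(3,4)] coord_hom_diff(1)[OF M e ab(1,2)]
   using ud coord_hom_add(2)[OF M e ab(1,1)] coord_hom_add(2)[OF M e ab(2,2)] ab(5,6) by simp
  thus ?case using symbols_closed(3)[OF ab(1,2)] symbols_closed(3)[OF ab(3,4)] by (simp add: frag_extend_diff)
 qed
 thus ?thesis by blast
qed

text \<open>\<open>N\<close> itself need not be free. The basis \<open>E\<close> is chosen for the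
  second components of \<open>c\<close> together with those in a derivation that the image of
  \<open>c\<close> is zero. Over this \<open>E\<close> the coordinates of \<open>c\<close> are sent
  to zero by the injective \<open>u\<close>, so they vanish.\<close>

lemma tensor_injective:
 assumes M: "Module.module A M" and M': "Module.module A M'" and u: "u \<in> linear_maps A M M'" and inj: "inj_on u (carrier M)"
  and c: "c \<in> symbols M" and z: "frag_extend (\<lambda>(x, y). frag_of (u x, y)) c \<in> rels M'"
 shows "c \<in> rels M"
proof -
 interpret m: Module.module A M by (rule M)
 interpret m': Module.module A M' by (rule M')
 let ?c' = "frag_extend (\<lambda>(x, y). frag_of (u x, y) :: 'b \<times> 'n \<Rightarrow>\<^sub>0 int) c"
 obtain W where W: "finite W" "W \<subseteq> carrier N" "\<forall>E. indep E \<longrightarrow> W \<subseteq> lspan E \<longrightarrow> (\<forall>e\<in>E. coord_hom M' E e ?c' = \<zero>\<^bsub>M'\<^esub>)"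
  using coord_hom_relation[OF M' z] by blast
 let ?W = "W \<union> snd ` Poly_Mapping.keys c"
 have fW: "finite ?W" "?W \<subseteq> carrier N" using W c by auto
 obtain E where E: "indep E" "lspan ?W \<subseteq> lspan E" using exists_indep[OF fW] by blast
 have WE: "?W \<subseteq> lspan E" using mem_lspan[OF fW] E(2) by blast
 have "coord_hom M E e c = \<zero>\<^bsub>M\<^esub>" if e: "e \<in> E" for e
 proof -
  have uh: "u \<in> hom (add_monoid M) (add_monoid M')" using u by (auto simp: linear_maps_def)
  have "u (\<zero>\<^bsub>M\<^esub> \<oplus>\<^bsub>M\<^esub> \<zero>\<^bsub>M\<^esub>) = u \<zero>\<^bsub>M\<^esub> \<oplus>\<^bsub>M'\<^esub> u \<zero>\<^bsub>M\<^esub>" "u \<zero>\<^bsub>M\<^esub> \<in> carrier M'"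
   using hom_mult[OF uh, of "\<zero>\<^bsub>M\<^esub>" "\<zero>\<^bsub>M\<^esub>"] hom_in_carrier[OF uh, of "\<zero>\<^bsub>M\<^esub>"] by simp_all
  hence u0: "u \<zero>\<^bsub>M\<^esub> = \<zero>\<^bsub>M'\<^esub>" by simp
  show ?thesis using coord_hom_natural[OF M M' u E(1) e c] W(3) E(1) WE e u0 inj_onD[OF inj] coord_hom_add(2)[OF M e c c] by simp
 qed
 hence "(\<Sum>e\<in>E. frag_of (coord_hom M E e c, e)) = (\<Sum>e\<in>E. frag_of (\<zero>\<^bsub>M\<^esub>, e))" by simp
 also have "\<dots> = (\<Sum>e\<in>E. frag_of (coord_hom M E e 0, e))"
  by (rule sum.cong) (simp_all add: coord_hom_diff(2)[OF M _ symbols_closed(4) symbols_closed(4)])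
 finally have s: "(\<Sum>e\<in>E. frag_of (coord_hom M E e c, e)) = (\<Sum>e\<in>E. frag_of (coord_hom M E e 0, e))" .
 have "Poly_Mapping.keys c \<subseteq> carrier M \<times> lspan E" using c WE by (force simp: subset_iff)
 hence 1: "c - (\<Sum>e\<in>E. frag_of (coord_hom M E e c, e)) \<in> rels M" by (rule symbol_expansion[OF M E(1) c])
 \<comment> \<open>Symbols with first component zero are not zero in the free abelian group;
   subtracting the expansion of 0 removes them.\<close>
 have 2: "0 - (\<Sum>e\<in>E. frag_of (coord_hom M E e 0, e)) \<in> rels M" by (rule symbol_expansion[OF M E(1) symbols_closed(4)]) simp
 from relation_diff(1)[OF M 1 2] show ?thesis by (simp add: s)
qed

theorem flat: "flat_module TYPE('m) A N"
 unfolding flat_module_def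
proof (intro conjI allI impI)
 show "Module.module A N" by (rule module_axioms)
 fix M M' :: "('r, 'm) Module.module" and u
 assume M: "Module.module A M" and M': "Module.module A M'" and u: "u \<in> linear_maps A M M'" and inj: "inj_on u (carrier M)"
 interpret m: Module.module A M by (rule M)
 interpret m': Module.module A M' by (rule M')
 let ?U = "frag_extend (\<lambda>(x, y). frag_of (u x, y) :: 'm \<times> 'n \<Rightarrow>\<^sub>0 int)"
 let ?T = "rels M" and ?F = "tensor_free M N" and ?T' = "rels M'" and ?F' = "tensor_free M' N"
 have coset: "?T #>\<^bsub>?F\<^esub> c = {r + c | r. r \<in> ?T}" for c by (auto simp: r_coset_def tensor_free_def)
 have coset': "?T' #>\<^bsub>?F'\<^esub> c = {r + c | r. r \<in> ?T'}" for c by (auto simp: r_coset_def tensor_free_def)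
 have Ts: "c \<in> symbols M" if "c \<in> ?T" for c using coord_hom_relation[OF M that] by blast
 have carr: "Y \<in> carrier (tensor_product A M N) \<longleftrightarrow> (\<exists>c\<in>symbols M. Y = {r + c | r. r \<in> ?T})" for Y
  unfolding tensor_product_def FactGroup_def RCOSETS_def coset by (auto simp: tensor_free_def free_Abelian_group_def)
 show "inj_on (tensor_map A M' N u) (carrier (tensor_product A M N))"
 proof (rule inj_onI)
  fix Y1 Y2 assume Y: "Y1 \<in> carrier (tensor_product A M N)" "Y2 \<in> carrier (tensor_product A M N)" "tensor_map A M' N u Y1 = tensor_map A M' N u Y2"
  obtain c1 where c1: "c1 \<in> symbols M" "Y1 = {r + c1 | r. r \<in> ?T}" using Y(1) carr by blast
  obtain c2 where c2: "c2 \<in> symbols M" "Y2 = {r + c2 | r. r \<in> ?T}" using Y(2) carr by blast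
  have "0 + c1 \<in> Y1" unfolding c1(2) using relation_diff(2)[OF M] by blast
  moreover have "0 + ?U c1 \<in> {r + ?U c1 | r. r \<in> ?T'}" using relation_diff(2)[OF M'] by blast
  ultimately have "?U c1 \<in> tensor_map A M' N u Y1" unfolding tensor_map_def coset' by (intro UN_I[of c1]) simp_all
  then obtain d r where d: "d \<in> Y2" "r \<in> ?T'" "?U c1 = r + ?U d" using Y(3) unfolding tensor_map_def coset' by auto
  obtain s where s: "s \<in> ?T" "d = s + c2" using d(1) c2(2) by blast
  have ds: "d \<in> symbols M" unfolding s(2) by (rule symbols_closed(1)[OF Ts[OF s(1)] c2(1)])
  have "?U (c1 - d) \<in> ?T'" using d(2,3) by (simp add: frag_extend_diff)
  hence 1: "c1 - d \<in> ?T" by (rule tensor_injective[OF M M' u inj symbols_closed(3)[OF c1(1) ds]])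
  have 2: "c1 - c2 \<in> ?T" using relation_add[OF M 1 s(1)] by (simp add: s(2))
  have "r + c1 \<in> Y2" if "r \<in> ?T" for r
  proof -
   have "r + c1 = (r + (c1 - c2)) + c2" by simp
   thus ?thesis unfolding c2(2) using relation_add[OF M that 2] by blast
  qed
  moreover have "r + c2 \<in> Y1" if "r \<in> ?T" for r
  proof -
   have "r + c2 = (r - (c1 - c2)) + c1" by simp
   thus ?thesis unfolding c1(2) using relation_diff(1)[OF M that 2] by blast
  qed
  ultimately show "Y1 = Y2" unfolding c1(2) c2(2) by blast
 qed
qed

end

section \<open>Groups of divisors\<close>

text \<open>\<open>Rg\<close> stands for \<open>regular_stalk\<close>, which can be smaller than the
  set of nonzerodivisors. Closure under divisors makes the units of the localization exactly the
  fractions with numerator and denominator in \<open>Rg\<close>.\<close>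

locale divisor_group =
 fixes B :: "'a ring" (structure) and Rg :: "'a set"
 assumes B: "cring B" and Rg: "mult_set B Rg"
  and divisor_closed: "a \<in> carrier B ==> b \<in> carrier B ==> a \<otimes> b \<in> Rg ==> a \<in> Rg"
  and regular: "r \<in> Rg ==> a \<in> carrier B ==> r \<otimes> a = \<zero> ==> a = \<zero>"
begin

sublocale cring B by (rule B)

abbreviation "fr \<equiv> fraction B Rg"
definition G where "G = units_of (localization B Rg)"
definition U where "U = (\<lambda>v. fr v \<one>) ` Units B"
definition cls where "cls b c = U #>\<^bsub>G\<^esub> fr b c"

lemma Rg_in: "a \<in> Rg ==> a \<in> carrier B" "\<one> \<in> Rg" "a \<in> Rg ==> b \<in> Rg ==> a \<otimes> b \<in> Rg"
 using multS[OF B Rg] by blast+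

lemma cancel: "r \<in> Rg ==> a \<in> carrier B ==> b \<in> carrier B ==> r \<otimes> a = r \<otimes> b ==> a = b"
 using regular[of r "a \<ominus> b"] Rg_in(1)[of r] by (simp add: a_minus_def r_distr r_minus r_neg) (metis a_minus_def r_right_minus_eq)

lemma Units_Rg: "v \<in> Units B ==> v \<in> Rg"
 using divisor_closed[of v "inv v"] Rg_in(2) by (simp add: Units_closed)

lemma fr_eq_iff: "a \<in> carrier B ==> b \<in> Rg ==> c \<in> carrier B ==> d \<in> Rg ==> fr a b = fr c d \<longleftrightarrow> a \<otimes> d = c \<otimes> b"
proof -
 assume a: "a \<in> carrier B" "b \<in> Rg" "c \<in> carrier B" "d \<in> Rg"
 have "u \<otimes> (a \<otimes> d) = u \<otimes> (c \<otimes> b) \<longleftrightarrow> a \<otimes> d = c \<otimes> b" if "u \<in> Rg" for u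
  using cancel[OF that, of "a \<otimes> d" "c \<otimes> b"] a Rg_in(1) by auto
 thus ?thesis using fraction_eq_iff[OF B Rg a] Rg_in(2) by auto
qed

lemma Units_of_mult_one: "a \<otimes> b = \<one> ==> a \<in> carrier B ==> b \<in> carrier B ==> a \<in> Units B"
 using m_comm[of a b] by (auto simp: Units_def)

lemmas fr_mult = fraction_mult[OF B Rg]

lemma one_loc: "\<one>\<^bsub>localization B Rg\<^esub> = fr \<one> \<one>"
 by (simp add: localization_def)

lemma fr_unit_iff:
 assumes "a \<in> carrier B" "b \<in> Rg" shows "fr a b \<in> Units (localization B Rg) \<longleftrightarrow> a \<in> Rg"
proof
 assume "fr a b \<in> Units (localization B Rg)"
 then obtain z where z: "z \<in> carrier (localization B Rg)" "fr a b \<otimes>\<^bsub>localization B Rg\<^esub> z = fr \<one> \<one>"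
  unfolding Units_def one_loc by blast
 obtain c d where c: "c \<in> carrier B" "d \<in> Rg" "z = fr c d" using z(1) by (rule localizationE[OF B Rg])
 have "a \<otimes> c \<in> Rg" using z(2) assms c Rg_in by (simp add: fr_mult fr_eq_iff)
 thus "a \<in> Rg" by (rule divisor_closed[OF assms(1) c(1)])
next
 assume a: "a \<in> Rg"
 have "fr a b \<otimes>\<^bsub>localization B Rg\<^esub> fr b a = fr \<one> \<one>" "fr b a \<otimes>\<^bsub>localization B Rg\<^esub> fr a b = fr \<one> \<one>"
  using a assms Rg_in by (simp_all add: fr_mult fr_eq_iff m_comm)
 thus "fr a b \<in> Units (localization B Rg)" unfolding Units_def one_loc
  using fraction_in[OF B Rg] assms a Rg_in(1) by blast
qed

lemma G_group: "comm_group G"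
 unfolding G_def by (rule comm_monoid.units_comm_group[OF comm_monoid_localization[OF B Rg]])

lemma G_carrier: "carrier G = {fr a b | a b. a \<in> Rg \<and> b \<in> Rg}"
proof -
 have "z \<in> Units (localization B Rg) \<longleftrightarrow> (\<exists>a b. z = fr a b \<and> a \<in> Rg \<and> b \<in> Rg)" for z
 proof
  assume z: "z \<in> Units (localization B Rg)"
  hence "z \<in> carrier (localization B Rg)" by (simp add: Units_def)
  then obtain a b where "a \<in> carrier B" "b \<in> Rg" "z = fr a b" by (rule localizationE[OF B Rg])
  thus "\<exists>a b. z = fr a b \<and> a \<in> Rg \<and> b \<in> Rg" using z fr_unit_iff by blast
 next
  assume "\<exists>a b. z = fr a b \<and> a \<in> Rg \<and> b \<in> Rg"
  thus "z \<in> Units (localization B Rg)" using fr_unit_iff Rg_in(1) by blast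
 qed
 thus ?thesis by (auto simp: G_def units_of_carrier)
qed

lemma G_mult: "a \<in> Rg ==> b \<in> Rg ==> c \<in> Rg ==> d \<in> Rg ==> fr a b \<otimes>\<^bsub>G\<^esub> fr c d = fr (a \<otimes> c) (b \<otimes> d)"
 by (simp add: G_def units_of_mult fr_mult Rg_in(1))

lemma G_one: "\<one>\<^bsub>G\<^esub> = fr \<one> \<one>"
 by (simp add: G_def units_of_one one_loc)

lemma U_subgroup: "subgroup U G"
proof -
 interpret G: comm_group G by (rule G_group)
 show ?thesis
 proof (rule G.subgroupI)
  show "U \<subseteq> carrier G" using Units_Rg by (auto simp: U_def G_carrier)
  show "U \<noteq> {}" by (auto simp: U_def)
  fix z assume "z \<in> U"
  then obtain v where v: "v \<in> Units B" "z = fr v \<one>" by (auto simp: U_def)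
  have i: "inv v \<in> Units B" using v(1) by simp
  have "fr (inv v) \<one> \<otimes>\<^bsub>G\<^esub> z = \<one>\<^bsub>G\<^esub>"
   using v Units_Rg by (simp add: G_mult G_one)
  hence "inv\<^bsub>G\<^esub> z = fr (inv v) \<one>"
   by (rule G.inv_equality) (use v Units_Rg[OF i] Units_Rg[OF v(1)] Rg_in(2) in \<open>auto simp: G_carrier\<close>)
  thus "inv\<^bsub>G\<^esub> z \<in> U" using i by (auto simp: U_def)
  fix w assume "w \<in> U"
  then obtain y where y: "y \<in> Units B" "w = fr y \<one>" by (auto simp: U_def)
  thus "z \<otimes>\<^bsub>G\<^esub> w \<in> U" using v Units_Rg by (auto simp: G_mult U_def)
 qed
qed

lemma cls_eq_iff:
 assumes b: "b \<in> Rg" "c \<in> Rg" and d: "b' \<in> Rg" "c' \<in> Rg"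
 shows "cls b c = cls b' c' \<longleftrightarrow> (\<exists>v\<in>Units B. b \<otimes> c' = v \<otimes> (b' \<otimes> c))"
proof -
 interpret G: comm_group G by (rule G_group)
 have c: "fr b c \<in> carrier G" "fr b' c' \<in> carrier G" using assms by (auto simp: G_carrier)
 have "cls b c = cls b' c' \<longleftrightarrow> fr b c \<in> cls b' c'"
  unfolding cls_def using G.repr_independence[OF _ c(2) U_subgroup, of "fr b c"] G.rcos_self[OF c(1) U_subgroup] by blast
 also have "\<dots> \<longleftrightarrow> (\<exists>v\<in>Units B. fr b c = fr v \<one> \<otimes>\<^bsub>G\<^esub> fr b' c')" by (auto simp: cls_def r_coset_def U_def)
 also have "\<dots> \<longleftrightarrow> (\<exists>v\<in>Units B. b \<otimes> c' = v \<otimes> (b' \<otimes> c))"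
 proof (rule bex_cong[OF refl])
  fix v assume "v \<in> Units B"
  hence "v \<in> Rg" by (rule Units_Rg)
  thus "fr b c = fr v \<one> \<otimes>\<^bsub>G\<^esub> fr b' c' \<longleftrightarrow> b \<otimes> c' = v \<otimes> (b' \<otimes> c)"
   using assms Rg_in by (simp add: G_mult fr_eq_iff m_assoc)
 qed
 finally show ?thesis .
qed

definition D where "D = G Mod U"

lemma U_normal: "U \<lhd> G"
 by (rule comm_group.subgroup_imp_normal[OF G_group U_subgroup])

lemma D_group: "group D"
 unfolding D_def by (rule normal.factorgroup_is_group[OF U_normal])

lemma D_carrier: "carrier D = {cls b c | b c. b \<in> Rg \<and> c \<in> Rg}"
 by (auto simp: D_def FactGroup_def RCOSETS_def G_carrier cls_def)

lemma cls_mult: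
 assumes "b \<in> Rg" "c \<in> Rg" "b' \<in> Rg" "c' \<in> Rg"
 shows "cls b c \<otimes>\<^bsub>D\<^esub> cls b' c' = cls (b \<otimes> b') (c \<otimes> c')"
proof -
 have "fr b c \<in> carrier G" "fr b' c' \<in> carrier G" using assms by (auto simp: G_carrier)
 thus ?thesis using normal.rcos_sum[OF U_normal] assms by (simp add: D_def cls_def G_mult)
qed

lemma cls_one: "\<one>\<^bsub>D\<^esub> = cls \<one> \<one>"
proof -
 interpret D: group D by (rule D_group)
 have "cls \<one> \<one> \<otimes>\<^bsub>D\<^esub> cls \<one> \<one> = cls \<one> \<one>" using Rg_in(2) by (simp add: cls_mult)
 moreover have "cls \<one> \<one> \<in> carrier D" using Rg_in(2) by (auto simp: D_carrier)
 ultimately show ?thesis by simp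
qed

lemma cls_inv: assumes "b \<in> Rg" "c \<in> Rg" shows "inv\<^bsub>D\<^esub> (cls b c) = cls c b"
proof (rule group.inv_equality[OF D_group])
 have "cls (c \<otimes> b) (b \<otimes> c) = cls \<one> \<one>"
  using assms Rg_in by (subst cls_eq_iff) (auto simp: m_comm bexI[of _ \<one>])
 thus "cls c b \<otimes>\<^bsub>D\<^esub> cls b c = \<one>\<^bsub>D\<^esub>" using assms by (simp add: cls_mult cls_one)
qed (use assms in \<open>auto simp: D_carrier\<close>)

end

locale divisor_group_map = A: divisor_group A RS + divisor_group B RT
 for A :: "'b ring" and RS and B :: "'a ring" (structure) and RT +
 fixes \<psi> assumes hom: "\<psi> \<in> Ring.ring_hom A B" and pr: "a \<in> RS ==> \<psi> a \<in> RT"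
  and total: "a \<in> carrier A ==> b \<in> carrier A ==> a divides\<^bsub>A\<^esub> b \<or> b divides\<^bsub>A\<^esub> a"
  and divisor: "d \<in> RS ==> x \<in> carrier B ==> y \<in> carrier B ==> x \<otimes> y = \<psi> d ==> \<exists>r\<in>carrier A. \<exists>u\<in>Units B. x = \<psi> r \<otimes> u"
begin

lemmas pc = ring_hom_closed[OF hom] and pm = ring_hom_mult[OF hom] and p1 = ring_hom_one[OF hom]

definition H where "H = {cls (\<psi> a) (\<psi> c) | a c. a \<in> RS \<and> c \<in> RS}"

lemma localization_map_fr:
 assumes ac: "a \<in> carrier A" "c \<in> RS"
 shows "localization_map B RT \<psi> (A.fr a c) = fr (\<psi> a) (\<psi> c)"
 unfolding localization_map_def
proof (rule UN_const[OF fraction_self[OF A.B A.Rg ac]])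
 fix z assume z: "z \<in> A.fr a c"
 obtain a' c' where z': "z = (a', c')" by (cases z)
 note e = fraction_eqD[OF A.B A.Rg z[unfolded z'] ac]
 show "(case z of (a, b) => fr (\<psi> a) (\<psi> b)) = fr (\<psi> a) (\<psi> c)" using e A.fr_eq_iff[OF e(1,2) ac] pm[OF e(1) A.Rg_in(1)[OF ac(2)]] pm[OF ac(1) A.Rg_in(1)[OF e(2)]] fr_eq_iff[OF pc[OF e(1)] pr[OF e(2)] pc[OF ac(1)] pr[OF ac(2)]] by (simp add: z')
qed

lemma class_map:
 assumes ac: "a \<in> RS" "c \<in> RS"
 shows "(\<Union>m\<in>A.cls a c. U #>\<^bsub>G\<^esub> localization_map B RT \<psi> m) = cls (\<psi> a) (\<psi> c)"
proof (rule UN_const)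
 interpret G: comm_group A.G by (rule A.G_group)
 show "A.fr a c \<in> A.cls a c" unfolding A.cls_def by (rule G.rcos_self[OF _ A.U_subgroup]) (use ac in \<open>auto simp: A.G_carrier\<close>)
 fix m assume "m \<in> A.cls a c"
 then obtain v where v: "v \<in> Units A" "m = A.fr v \<one>\<^bsub>A\<^esub> \<otimes>\<^bsub>A.G\<^esub> A.fr a c" by (auto simp: A.cls_def A.U_def r_coset_def)
 have vR: "v \<in> RS" by (rule A.Units_Rg[OF v(1)])
 have va: "v \<otimes>\<^bsub>A\<^esub> a \<in> RS" by (rule A.Rg_in(3)[OF vR ac(1)])
 have "\<psi> v \<otimes> \<psi> (inv\<^bsub>A\<^esub> v) = \<one>" using pm[of v "inv\<^bsub>A\<^esub> v"] v(1) p1 by (simp add: A.Units_closed)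
 hence u: "\<psi> v \<in> Units B" by (rule Units_of_mult_one) (use v(1) in \<open>simp_all add: pc A.Units_closed\<close>)
 have "U #>\<^bsub>G\<^esub> localization_map B RT \<psi> m = cls (\<psi> (v \<otimes>\<^bsub>A\<^esub> a)) (\<psi> c)" using v(2) A.G_mult[OF vR A.Rg_in(2) ac] A.Rg_in(1)[OF ac(2)] localization_map_fr[OF A.Rg_in(1)[OF va] ac(2)] by (simp add: cls_def)
 also have "\<dots> = cls (\<psi> a) (\<psi> c)"
 proof (subst cls_eq_iff[OF pr[OF va] pr[OF ac(2)] pr[OF ac(1)] pr[OF ac(2)]], rule bexI[OF _ u])
  show "\<psi> (v \<otimes>\<^bsub>A\<^esub> a) \<otimes> \<psi> c = \<psi> v \<otimes> (\<psi> a \<otimes> \<psi> c)" using pm pc A.Rg_in(1) vR ac by (simp add: m_assoc)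
 qed
 finally show "U #>\<^bsub>G\<^esub> localization_map B RT \<psi> m = cls (\<psi> a) (\<psi> c)" .
qed

lemma H_subgroup: "subgroup H D"
proof (rule group.subgroupI[OF D_group])
 show "H \<subseteq> carrier D" unfolding H_def D_carrier using pr by blast
 show "H \<noteq> {}" unfolding H_def using A.Rg_in(2) by blast
 fix x assume "x \<in> H"
 then obtain a c where ac: "x = cls (\<psi> a) (\<psi> c)" "a \<in> RS" "c \<in> RS" unfolding H_def by blast
 have "inv\<^bsub>D\<^esub> x = cls (\<psi> c) (\<psi> a)" unfolding ac(1) by (rule cls_inv[OF pr[OF ac(2)] pr[OF ac(3)]])
 thus "inv\<^bsub>D\<^esub> x \<in> H" unfolding H_def using ac by blast
 fix y assume "y \<in> H"
 then obtain a' c' where ac': "y = cls (\<psi> a') (\<psi> c')" "a' \<in> RS" "c' \<in> RS" unfolding H_def by blast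
 have "x \<otimes>\<^bsub>D\<^esub> y = cls (\<psi> (a \<otimes>\<^bsub>A\<^esub> a')) (\<psi> (c \<otimes>\<^bsub>A\<^esub> c'))" using ac ac' A.Rg_in(1) by (simp add: pm cls_mult pr)
 thus "x \<otimes>\<^bsub>D\<^esub> y \<in> H" unfolding H_def using ac ac' A.Rg_in(3) by blast
qed

lemma cls_leD:
 assumes "group_le D {cls x \<one> | x. x \<in> RT} (cls a a') (cls b b')" and g: "a \<in> RT" "a' \<in> RT" "b \<in> RT" "b' \<in> RT"
 shows "\<exists>x\<in>RT. b \<otimes> a' = x \<otimes> (a \<otimes> b')"
proof -
 obtain x where x: "x \<in> RT" "cls b b' \<otimes>\<^bsub>D\<^esub> cls a' a = cls x \<one>"
  using assms(1) unfolding group_le_def cls_inv[OF g(1,2)] by blast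
 have c: "a \<in> carrier B" "a' \<in> carrier B" "b \<in> carrier B" "b' \<in> carrier B" "x \<in> carrier B" using g x(1) Rg_in(1) by auto
 obtain v where v: "v \<in> Units B" "(b \<otimes> a') \<otimes> \<one> = v \<otimes> (x \<otimes> (b' \<otimes> a))" using x(2) cls_mult[OF g(3,4,2,1)] cls_eq_iff[OF Rg_in(3)[OF g(3,2)] Rg_in(3)[OF g(4,1)] x(1) Rg_in(2)] by blast
 have "b \<otimes> a' = (v \<otimes> x) \<otimes> (a \<otimes> b')" using v c Units_closed by (simp add: m_assoc m_comm[of b' a])
 thus ?thesis using Rg_in(3)[OF Units_Rg[OF v(1)] x(1)] by blast
qed

text \<open>The scalar given by \<open>divisor\<close> need not be in \<open>RS\<close> a priori. If
  it divides \<open>d\<close>, it is in \<open>RS\<close> as a divisor; otherwise it is a multiple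
  of \<open>d\<close>, which makes \<open>y\<close> a unit and lets \<open>d\<close> replace
  it.\<close>

lemma regular_divisor:
 assumes x: "x \<in> RT" and y: "y \<in> RT" and d: "d \<in> RS" and xy: "x \<otimes> y = \<psi> d"
 shows "\<exists>r\<in>RS. \<exists>u\<in>Units B. x = \<psi> r \<otimes> u"
proof -
 have c: "x \<in> carrier B" "y \<in> carrier B" "d \<in> carrier A" using x y d Rg_in(1) A.Rg_in(1) by auto
 obtain r u where r: "r \<in> carrier A" "u \<in> Units B" "x = \<psi> r \<otimes> u" using divisor[OF d c(1,2) xy] by blast
 show ?thesis using total[OF r(1) c(3)]
 proof
  assume "r divides\<^bsub>A\<^esub> d"
  then obtain e where "e \<in> carrier A" "d = r \<otimes>\<^bsub>A\<^esub> e" by auto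
  thus ?thesis using A.divisor_closed[OF r(1)] d r(2,3) by blast
 next
  assume "d divides\<^bsub>A\<^esub> r"
  then obtain e where e: "e \<in> carrier A" "r = d \<otimes>\<^bsub>A\<^esub> e" by auto
  have uc: "u \<in> carrier B" "\<psi> e \<in> carrier B" "\<psi> d \<in> carrier B" using r(2) pc e(1) c(3) by (simp_all add: Units_closed)
  have "\<psi> d \<otimes> (y \<otimes> (\<psi> e \<otimes> u)) = \<psi> d \<otimes> \<one>"
   using xy c uc unfolding r(3) e(2) pm[OF c(3) e(1)] by (simp add: m_ac)
  hence 1: "y \<otimes> (\<psi> e \<otimes> u) = \<one>" by (rule cancel[OF pr[OF d], rotated 2]) (use uc c in auto)
  hence "y \<in> Units B" using Units_of_mult_one uc c by simp
  moreover have "x = \<psi> d \<otimes> inv y" using \<open>y \<in> Units B\<close> c xy[symmetric] by (simp add: m_assoc)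
  ultimately show ?thesis using d by blast
 qed
qed

text \<open>Let x and y represent the effective differences \<beta> - \<alpha> and \<gamma> -
  \<beta>. Then x y is a quotient of two scalars. If it is integral, x divides a scalar; if its
  inverse is integral, x is a unit. In both cases the class of x comes from A, hence so does
  \<beta>.\<close>

theorem H_convex: "convex_subgroup D {cls x \<one> | x. x \<in> RT} H"
proof -
 have "\<beta> \<in> H" if ab: "\<alpha> \<in> H" "\<gamma> \<in> H" and \<beta>: "\<beta> \<in> carrier D"
  and l: "group_le D {cls x \<one> | x. x \<in> RT} \<alpha> \<beta>" "group_le D {cls x \<one> | x. x \<in> RT} \<beta> \<gamma>" for \<alpha> \<beta> \<gamma>
 proof -
  obtain a1 a2 where a: "\<alpha> = cls (\<psi> a1) (\<psi> a2)" "a1 \<in> RS" "a2 \<in> RS" using ab(1) unfolding H_def by blast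
  obtain c1 c2 where c: "\<gamma> = cls (\<psi> c1) (\<psi> c2)" "c1 \<in> RS" "c2 \<in> RS" using ab(2) unfolding H_def by blast
  obtain b1 b2 where b: "\<beta> = cls b1 b2" "b1 \<in> RT" "b2 \<in> RT" using \<beta> unfolding D_carrier by blast
  obtain x where x: "x \<in> RT" "b1 \<otimes> \<psi> a2 = x \<otimes> (\<psi> a1 \<otimes> b2)"
   using cls_leD[OF l(1)[unfolded a(1) b(1)] pr[OF a(2)] pr[OF a(3)] b(2,3)] by blast
  obtain y where y: "y \<in> RT" "\<psi> c1 \<otimes> b2 = y \<otimes> (b1 \<otimes> \<psi> c2)"
   using cls_leD[OF l(2)[unfolded c(1) b(1)] b(2,3) pr[OF c(2)] pr[OF c(3)]] by blast
  note cR = A.Rg_in(1)[OF a(2)] A.Rg_in(1)[OF a(3)] A.Rg_in(1)[OF c(2)] A.Rg_in(1)[OF c(3)]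
  note cB = pc[OF cR(1)] pc[OF cR(2)] pc[OF cR(3)] pc[OF cR(4)] Rg_in(1)[OF b(2)] Rg_in(1)[OF b(3)] Rg_in(1)[OF x(1)] Rg_in(1)[OF y(1)]
  let ?p = "a2 \<otimes>\<^bsub>A\<^esub> c1" and ?q = "a1 \<otimes>\<^bsub>A\<^esub> c2"
  have pq: "?p \<in> RS" "?q \<in> RS" using A.Rg_in(3) a c by auto
  have "(b1 \<otimes> b2) \<otimes> (\<psi> a2 \<otimes> \<psi> c1) = (b1 \<otimes> \<psi> a2) \<otimes> (\<psi> c1 \<otimes> b2)" using cB by (simp add: m_ac)
  also have "\<dots> = (b1 \<otimes> b2) \<otimes> ((\<psi> a1 \<otimes> \<psi> c2) \<otimes> (x \<otimes> y))" unfolding x(2) y(2) using cB by (simp add: m_ac)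
  finally have "\<psi> a2 \<otimes> \<psi> c1 = (\<psi> a1 \<otimes> \<psi> c2) \<otimes> (x \<otimes> y)"
   by (rule cancel[OF Rg_in(3)[OF b(2,3)], rotated 2]) (use cB in auto)
  hence key: "\<psi> ?p = \<psi> ?q \<otimes> (x \<otimes> y)" using cR by (simp add: pm)
  have "\<exists>r\<in>RS. \<exists>u\<in>Units B. x = \<psi> r \<otimes> u" using total[OF A.Rg_in(1)[OF pq(1)] A.Rg_in(1)[OF pq(2)]]
  proof
   assume "?q divides\<^bsub>A\<^esub> ?p"
   then obtain d where d: "d \<in> carrier A" "?p = ?q \<otimes>\<^bsub>A\<^esub> d" by auto
   have dR: "d \<in> RS" using d pq A.divisor_closed[OF d(1)] A.Rg_in(1)[OF pq(2)] by (simp add: A.m_comm)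
   have "\<psi> ?q \<otimes> (x \<otimes> y) = \<psi> ?q \<otimes> \<psi> d" using key pm[OF A.Rg_in(1)[OF pq(2)] d(1)] d(2) by simp
   hence "x \<otimes> y = \<psi> d" by (rule cancel[OF pr[OF pq(2)], rotated 2]) (use cB pc[OF d(1)] in auto)
   thus ?thesis by (rule regular_divisor[OF x(1) y(1) dR])
  next
   assume "?p divides\<^bsub>A\<^esub> ?q"
   then obtain d where d: "d \<in> carrier A" "?q = ?p \<otimes>\<^bsub>A\<^esub> d" by auto
   have pc': "\<psi> ?p \<in> carrier B" "\<psi> d \<in> carrier B" using pc A.Rg_in(1)[OF pq(1)] d(1) by auto
   have "\<psi> ?p \<otimes> (x \<otimes> (\<psi> d \<otimes> y)) = \<psi> ?p \<otimes> \<one>"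
    using key pm[OF A.Rg_in(1)[OF pq(1)] d(1)] d(2) pc' cB by (simp add: m_assoc m_lcomm)
   hence "x \<otimes> (\<psi> d \<otimes> y) = \<one>" by (rule cancel[OF pr[OF pq(1)], rotated 2]) (use cB pc' in auto)
   hence "x \<in> Units B" by (rule Units_of_mult_one) (use cB pc' in auto)
   thus ?thesis using A.Rg_in(2) p1 cB(7) by (metis l_one)
  qed
  then obtain r u where r: "r \<in> RS" "u \<in> Units B" "x = \<psi> r \<otimes> u" by blast
  have ra: "r \<otimes>\<^bsub>A\<^esub> a1 \<in> RS" by (rule A.Rg_in(3)[OF r(1) a(2)])
  have rc: "r \<in> carrier A" "\<psi> r \<in> carrier B" "u \<in> carrier B" using A.Rg_in(1)[OF r(1)] pc r(2) by (simp_all add: Units_closed)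
  have "\<beta> = cls (\<psi> (r \<otimes>\<^bsub>A\<^esub> a1)) (\<psi> a2)" unfolding b(1)
  proof (subst cls_eq_iff[OF b(2,3) pr[OF ra] pr[OF a(3)]], rule bexI[OF _ r(2)])
   show "b1 \<otimes> \<psi> a2 = u \<otimes> (\<psi> (r \<otimes>\<^bsub>A\<^esub> a1) \<otimes> b2)" unfolding x(2) r(3) pm[OF rc(1) cR(1)] using rc cB by (simp add: m_ac)
  qed
  thus "\<beta> \<in> H" unfolding H_def using ra a(3) by blast
 qed
 thus ?thesis unfolding convex_subgroup_def using H_subgroup by blast
qed

end

section \<open>Regular germs\<close>

lemma nonzerodivisor_mult_iff:
 assumes R: "cring R" and a: "a \<in> carrier R" and b: "b \<in> carrier R"
 shows "nonzerodivisor R (a \<otimes>\<^bsub>R\<^esub> b) \<longleftrightarrow> nonzerodivisor R a \<and> nonzerodivisor R b"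
proof -
 interpret cring R by (rule R)
 have 1: "nonzerodivisor R a" if "nonzerodivisor R (a \<otimes>\<^bsub>R\<^esub> b)" "a \<in> carrier R" "b \<in> carrier R" for a b
  unfolding nonzerodivisor_def
 proof (intro conjI ballI impI that(2))
  fix y assume y: "y \<in> carrier R" "a \<otimes>\<^bsub>R\<^esub> y = \<zero>\<^bsub>R\<^esub>"
  have "(a \<otimes>\<^bsub>R\<^esub> b) \<otimes>\<^bsub>R\<^esub> y = b \<otimes>\<^bsub>R\<^esub> (a \<otimes>\<^bsub>R\<^esub> y)" using y(1) that(2,3) by (simp add: m_ac)
  also have "\<dots> = \<zero>\<^bsub>R\<^esub>" using y(2) that(3) by simp
  finally show "y = \<zero>\<^bsub>R\<^esub>" using that(1) y(1) by (auto simp: nonzerodivisor_def)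
 qed
 have 2: "nonzerodivisor R b" if "nonzerodivisor R (a \<otimes>\<^bsub>R\<^esub> b)" by (rule 1[of b a, OF _ b a]) (use that m_comm[OF a b] in simp)
 have 3: "nonzerodivisor R (a \<otimes>\<^bsub>R\<^esub> b)" if n: "nonzerodivisor R a" "nonzerodivisor R b"
  unfolding nonzerodivisor_def
 proof (intro conjI ballI impI m_closed a b)
  fix y assume y: "y \<in> carrier R" "(a \<otimes>\<^bsub>R\<^esub> b) \<otimes>\<^bsub>R\<^esub> y = \<zero>\<^bsub>R\<^esub>"
  have "a \<otimes>\<^bsub>R\<^esub> (b \<otimes>\<^bsub>R\<^esub> y) = \<zero>\<^bsub>R\<^esub>" using y(2) unfolding m_assoc[OF a b y(1)] .
  hence "b \<otimes>\<^bsub>R\<^esub> y = \<zero>\<^bsub>R\<^esub>" using n(1) m_closed[OF b y(1)] by (simp add: nonzerodivisor_def)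
  thus "y = \<zero>\<^bsub>R\<^esub>" using n(2) y(1) by (simp add: nonzerodivisor_def)
 qed
 show ?thesis using 1[OF _ a b] 2 3 by (intro iffI) simp_all
qed

context
 fixes Y :: "('p, 'a) ringed_space"
 assumes Y: "presheaf_of_rings Y" and "\<forall>y\<in>pts Y. cring (stalk Y y)"
begin

lemma stalk_cring: "y \<in> pts Y ==> cring (stalk Y y)"
 using \<open>\<forall>y\<in>pts Y. cring (stalk Y y)\<close> by blast

lemma in_topspace: "opens Y V ==> y \<in> V ==> y \<in> pts Y"
 using openin_subset by blast

text \<open>Regularity has to hold on a neighbourhood and not only at \<open>x\<close>. Phrased with
  interiors, the case of products in \<open>regular_stalk_mult_iff\<close> reduces to
  \<open>interior_of_Int\<close>.\<close>

lemma regular_stalk_germ_iff: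
 assumes W: "opens Y W \<and> x \<in> W" and s: "s \<in> secs Y W"
 shows "germ Y x W s \<in> regular_stalk Y x \<longleftrightarrow> x \<in> space_of Y interior_of {y \<in> W. nonzerodivisor (stalk Y y) (germ Y y W s)}"
proof
 assume "germ Y x W s \<in> regular_stalk Y x"
 then obtain V t where V: "opens Y V \<and> x \<in> V" "t \<in> secs Y V" "\<forall>y\<in>V. nonzerodivisor (stalk Y y) (germ Y y V t)" "germ Y x W s = germ Y x V t"
  by (auto simp: regular_stalk_def regular_sections_def)
 then obtain N where N: "opens Y N" "x \<in> N" "N \<subseteq> W \<inter> V" "res Y W N s = res Y V N t"
  using germ_eq_iff[OF Y W s V(1,2)] by blast
 have "germ Y y W s = germ Y y V t" if "y \<in> N" for y
  using germ_res[OF Y, of W y s N] germ_res[OF Y, of V y t N] W V N s that by (simp add: subset_iff)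
 thus "x \<in> space_of Y interior_of {y \<in> W. nonzerodivisor (stalk Y y) (germ Y y W s)}"
  unfolding interior_of_def using N V(3) by (auto intro!: exI)
next
 assume "x \<in> space_of Y interior_of {y \<in> W. nonzerodivisor (stalk Y y) (germ Y y W s)}"
 then obtain N where N: "opens Y N" "x \<in> N" "N \<subseteq> W" "\<forall>y\<in>N. nonzerodivisor (stalk Y y) (germ Y y W s)"
  unfolding interior_of_def by blast
 have g: "germ Y y N (res Y W N s) = germ Y y W s" if "y \<in> N" for y using germ_res[OF Y, of W y s N] W N s that by auto
 have "res Y W N s \<in> regular_sections Y N" using res_closed[OF Y, of W N s] W N s g by (simp add: regular_sections_def)
 thus "germ Y x W s \<in> regular_stalk Y x" unfolding g[OF N(2), symmetric] using N by (auto simp: regular_stalk_def)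
qed

lemma regular_stalk_mult_iff:
 assumes a: "a \<in> carrier (stalk Y x)" and b: "b \<in> carrier (stalk Y x)"
 shows "a \<otimes>\<^bsub>stalk Y x\<^esub> b \<in> regular_stalk Y x \<longleftrightarrow> a \<in> regular_stalk Y x \<and> b \<in> regular_stalk Y x"
proof -
 obtain V s where V: "opens Y V" "x \<in> V" "s \<in> secs Y V" "a = germ Y x V s" using a by (rule stalk_carrierE[OF Y])
 obtain W t where W: "opens Y W" "x \<in> W" "t \<in> secs Y W" "b = germ Y x W t" using b by (rule stalk_carrierE[OF Y])
 let ?U = "V \<inter> W" let ?s = "res Y V ?U s" and ?t = "res Y W ?U t"
 have U: "opens Y ?U \<and> y \<in> ?U" if "y \<in> ?U" for y using V W that by auto
 have st: "?s \<in> secs Y ?U" "?t \<in> secs Y ?U" using V W by (auto intro!: res_closed[OF Y])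
 have x: "x \<in> ?U" using V W by blast
 have ab: "a = germ Y x ?U ?s" "b = germ Y x ?U ?t" using germ_res[OF Y, of V x s ?U] germ_res[OF Y, of W x t ?U] V W by auto
 interpret cring "sections Y ?U" using U[OF x] by (intro sections_cring[OF Y]) simp
 let ?n = "\<lambda>s. {y \<in> ?U. nonzerodivisor (stalk Y y) (germ Y y ?U s)}"
 have m: "germ Y y ?U (?s \<otimes>\<^bsub>sections Y ?U\<^esub> ?t) = germ Y y ?U ?s \<otimes>\<^bsub>stalk Y y\<^esub> germ Y y ?U ?t" if "y \<in> ?U" for y
  by (rule ring_hom_mult[OF germ_hom[OF Y U[OF that]] st])
 have "?n (?s \<otimes>\<^bsub>sections Y ?U\<^esub> ?t) = ?n ?s \<inter> ?n ?t"
 proof -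
  have "nonzerodivisor (stalk Y y) (germ Y y ?U ?s \<otimes>\<^bsub>stalk Y y\<^esub> germ Y y ?U ?t) \<longleftrightarrow>
    nonzerodivisor (stalk Y y) (germ Y y ?U ?s) \<and> nonzerodivisor (stalk Y y) (germ Y y ?U ?t)" if y: "y \<in> ?U" for y
   using U[OF y] by (intro nonzerodivisor_mult_iff stalk_cring in_topspace germ_in_stalk[OF Y _ st(1)] germ_in_stalk[OF Y _ st(2)]) auto
  thus ?thesis using m by auto
 qed
 thus ?thesis using st unfolding ab m[OF x, symmetric] by (simp add: regular_stalk_germ_iff[OF U[OF x]] interior_of_Int)
qed

lemma divisor_group_stalk: assumes x: "x \<in> pts Y" shows "divisor_group (stalk Y x) (regular_stalk Y x)"
proof -
 interpret cring "stalk Y x" by (rule stalk_cring[OF x])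
 have nz: "nonzerodivisor (stalk Y x) a" if a: "a \<in> regular_stalk Y x" for a
  using a by (auto simp: regular_stalk_def regular_sections_def)
 hence sub: "regular_stalk Y x \<subseteq> carrier (stalk Y x)" by (auto simp: nonzerodivisor_def)
 let ?X = "pts Y"
 have o: "opens Y ?X \<and> y \<in> ?X" if "y \<in> ?X" for y using that by simp
 interpret C: cring "sections Y ?X" by (rule sections_cring[OF Y]) simp
 have g1: "germ Y y ?X \<one>\<^bsub>sections Y ?X\<^esub> = \<one>\<^bsub>stalk Y y\<^esub>" if "y \<in> ?X" for y by (rule ring_hom_one[OF germ_hom[OF Y o[OF that]]])
 have "{y \<in> ?X. nonzerodivisor (stalk Y y) (germ Y y ?X \<one>\<^bsub>sections Y ?X\<^esub>)} = ?X"
  using g1 cring.cring_simprules(6,12)[OF stalk_cring] by (auto simp: nonzerodivisor_def)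
 hence one: "\<one>\<^bsub>stalk Y x\<^esub> \<in> regular_stalk Y x"
  using regular_stalk_germ_iff[OF o[OF x] C.one_closed] x g1 by simp
 show ?thesis
 proof (rule divisor_group.intro)
  show "cring (stalk Y x)" by (rule is_cring)
  show "mult_set (stalk Y x) (regular_stalk Y x)" unfolding mult_set_def
  proof (intro conjI ballI sub one)
   fix a b assume ab: "a \<in> regular_stalk Y x" "b \<in> regular_stalk Y x"
   thus "a \<otimes>\<^bsub>stalk Y x\<^esub> b \<in> regular_stalk Y x" using regular_stalk_mult_iff sub by blast
  qed
  show "a \<in> regular_stalk Y x" if "a \<in> carrier (stalk Y x)" "b \<in> carrier (stalk Y x)" "a \<otimes>\<^bsub>stalk Y x\<^esub> b \<in> regular_stalk Y x" for a b
   using regular_stalk_mult_iff[OF that(1,2)] that(3) by blast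
  show "a = \<zero>\<^bsub>stalk Y x\<^esub>" if "r \<in> regular_stalk Y x" "a \<in> carrier (stalk Y x)" "r \<otimes>\<^bsub>stalk Y x\<^esub> a = \<zero>\<^bsub>stalk Y x\<^esub>" for r a
   using nz[OF that(1)] that(2,3) by (simp add: nonzerodivisor_def)
 qed
qed

end

section \<open>Smooth morphisms over Pruefer schemes\<close>

locale smooth_over_prufer =
 fixes S :: "('p, 'a) ringed_space" and T :: "('q, 'b) ringed_space" and f h
 assumes S: "prufer_scheme S" and sm: "smooth_morphism T S f h"
begin

lemma scheme_facts:
 shows mor: "scheme_morphism T S f h" and psS: "presheaf_of_rings S" and psT: "presheaf_of_rings T"
  and locS: "y \<in> pts S ==> local_ring (stalk S y)" and locT: "t \<in> pts T ==> local_ring (stalk T t)"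
  and val: "y \<in> pts S ==> valuation_domain (stalk S y)"
  and rsm: "ringed_space_morphism T S f h"
  and lhom: "t \<in> pts T ==> local_ring_hom (stalk S (f t)) (stalk T t) (stalk_map T f h t)"
 using S sm unfolding prufer_scheme_def smooth_morphism_def scheme_morphism_def locally_ringed_space_morphism_def locally_ringed_space_def ringed_space_def by simp_all

lemma cringS: "y \<in> pts S ==> cring (stalk S y)" and cringT: "t \<in> pts T ==> cring (stalk T t)"
 using locS locT by (simp_all add: local_ring_def)

lemma stalks_cring: "\<forall>y\<in>pts S. cring (stalk S y)" "\<forall>t\<in>pts T. cring (stalk T t)"
 using cringS cringT by auto

lemma cont: "continuous_map (space_of T) (space_of S) f"
 and hhom: "opens S V ==> h V \<in> Ring.ring_hom (sections S V) (sections T (preimage T f V))"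
 and hres: "opens S V ==> opens S W ==> W \<subseteq> V ==> s \<in> secs S V ==>
    h W (res S V W s) = res T (preimage T f V) (preimage T f W) (h V s)"
 using rsm unfolding ringed_space_morphism_def by simp_all

lemma f_top: "t \<in> pts T ==> f t \<in> pts S"
 using cont continuous_map_image_subset_topspace by blast

lemma pre_open: "opens S V ==> opens T (preimage T f V)"
 using openin_continuous_map_preimage[OF cont] by (simp add: preimage_def)

lemma stalk_map_germ:
 assumes t: "t \<in> pts T" and V: "opens S V" "f t \<in> V" and s: "s \<in> secs S V"
 shows "stalk_map T f h t (germ S (f t) V s) = germ T t (preimage T f V) (h V s)"
 unfolding stalk_map_def
proof (rule UN_const)
 show "(V, s) \<in> germ S (f t) V s" by (rule germ_self[OF psS]) (use V s in auto)
 fix z assume z: "z \<in> germ S (f t) V s"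
 obtain V' s' where z': "z = (V', s')" by (cases z)
 have nV: "opens S V \<and> f t \<in> V" using V by simp
 note m = germ_memD[OF psS nV s z[unfolded z']]
 obtain W where W: "opens S W" "f t \<in> W" "W \<subseteq> V' \<inter> V" "res S V' W s' = res S V W s"
  using m(3) germ_eq_iff[OF psS m(1,2) nV s] by blast
 have g: "germ T t (preimage T f W) (h W (res S V W s)) = germ T t (preimage T f V) (h V s)"
  if "opens S V" "f t \<in> V" "W \<subseteq> V" "s \<in> secs S V" for V s
  unfolding hres[OF that(1) W(1) that(3,4)]
  by (rule germ_res[OF psT _ ring_hom_closed[OF hhom[OF that(1)] that(4)]])
   (use that W t pre_open in \<open>auto simp: preimage_def\<close>)
 have "W \<subseteq> V'" "W \<subseteq> V" using W(3) by auto
 thus "(case z of (V, s) => germ T t (preimage T f V) (h V s)) = germ T t (preimage T f V) (h V s)" using g[of V' s'] g V s m(1,2) W(4) by (simp add: z')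
qed

text \<open>Affine charts around \<open>t\<close> and \<open>f t\<close> provide the fractions and
  kernels that \<open>smooth_over_valuation_ring\<close> asks for. The first claim is used for
  flatness and for regularity of images, the second for convexity.\<close>

lemma stalk_map_smooth:
 assumes t: "t \<in> pts T"
 defines "A \<equiv> stalk S (f t)" and "B \<equiv> stalk T t" and "\<psi> \<equiv> stalk_map T f h t"
 shows stalk_map_torsion_free: "\<And>a b. a \<in> carrier A ==> b \<in> carrier B ==> a \<noteq> \<zero>\<^bsub>A\<^esub> ==> \<psi> a \<otimes>\<^bsub>B\<^esub> b = \<zero>\<^bsub>B\<^esub> ==> b = \<zero>\<^bsub>B\<^esub>"
  and stalk_map_divisor: "\<And>a b c. a \<in> carrier A ==> b \<in> carrier B ==> c \<in> carrier B ==> a \<noteq> \<zero>\<^bsub>A\<^esub> ==> b \<otimes>\<^bsub>B\<^esub> c = \<psi> a ==>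
   \<exists>r\<in>carrier A. \<exists>u\<in>Units B. b = \<psi> r \<otimes>\<^bsub>B\<^esub> u"
proof -
 obtain U V where UV: "affine_open T U" "t \<in> U" "affine_open S V" "f ` U \<subseteq> V"
  "standard_smooth (sections S V) (sections T U) (\<lambda>s. res T (preimage T f V) U (h V s))"
  using sm t unfolding smooth_morphism_def by blast
 have ftV: "f t \<in> V" using UV by blast
 have oU: "opens T U" and oV: "opens S V" using UV by (simp_all add: affine_open_def)
 have UpV: "U \<subseteq> preimage T f V" using UV(4) openin_subset[OF oU] by (auto simp: preimage_def)
 note cA = cringS[OF f_top[OF t]] and cB = cringT[OF t]
 obtain R1 f1 h1 where ch1: "affine_chart T U t (R1 :: 'b ring) f1 h1" by (rule affine_openE[OF UV(1) psT UV(2) cB])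
 obtain R2 f2 h2 where ch2: "affine_chart S V (f t) (R2 :: 'a ring) f2 h2" by (rule affine_openE[OF UV(3) psS ftV cA])
 have gA: "germ S (f t) V \<in> Ring.ring_hom (sections S V) A" unfolding A_def by (rule germ_hom[OF psS]) (use oV ftV in simp)
 have gB: "germ T t U \<in> Ring.ring_hom (sections T U) B" unfolding B_def by (rule germ_hom[OF psT]) (use oU UV(2) in simp)
 have comm: "germ T t U (res T (preimage T f V) U (h V r)) = \<psi> (germ S (f t) V r)" if r: "r \<in> secs S V" for r
  unfolding \<psi>_def stalk_map_germ[OF t oV ftV r]
  by (rule germ_res[OF psT _ ring_hom_closed[OF hhom[OF oV] r]]) (use pre_open[OF oV] UpV UV(2) oU in auto)
 note core = sections_cring[OF psS oV] sections_cring[OF psT oU] UV(5) val[OF f_top[OF t], folded A_def] locS[OF f_top[OF t], folded A_def]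
  locT[OF t, folded B_def] lhom[OF t, folded A_def B_def \<psi>_def] gA gB
 note fA = affine_chart.stalk_fraction[OF ch2, folded A_def] and fB = affine_chart.stalk_fraction[OF ch1, folded B_def]
  and kB = affine_chart.stalk_kernel[OF ch1, folded B_def]
 show "b = \<zero>\<^bsub>B\<^esub>" if "a \<in> carrier A" "b \<in> carrier B" "a \<noteq> \<zero>\<^bsub>A\<^esub>" "\<psi> a \<otimes>\<^bsub>B\<^esub> b = \<zero>\<^bsub>B\<^esub>" for a b
  by (rule smooth_torsion_free[OF core comm fA fB kB that])
 show "\<exists>r\<in>carrier A. \<exists>u\<in>Units B. b = \<psi> r \<otimes>\<^bsub>B\<^esub> u"
  if "a \<in> carrier A" "b \<in> carrier B" "c \<in> carrier B" "a \<noteq> \<zero>\<^bsub>A\<^esub>" "b \<otimes>\<^bsub>B\<^esub> c = \<psi> a" for a b c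
  by (rule smooth_divisor_of_scalar[OF core comm fA fB kB that])
qed

lemma flat_stalk: assumes t: "t \<in> pts T" shows "flat_ring_hom TYPE('m) (stalk S (f t)) (stalk T t) (stalk_map T f h t)"
proof -
 let ?A = "stalk S (f t)" and ?B = "stalk T t" and ?\<psi> = "stalk_map T f h t"
 interpret A: domain ?A using val[OF f_top[OF t]] by (simp add: valuation_domain_def)
 interpret B: cring ?B by (rule cringT[OF t])
 have \<psi>: "?\<psi> \<in> Ring.ring_hom ?A ?B" using lhom[OF t] by (simp add: local_ring_hom_def)
 note pc = ring_hom_closed[OF \<psi>]
 have simps: "carrier (restrict_scalars ?\<psi> ?B) = carrier ?B" "ring.add (restrict_scalars ?\<psi> ?B) = ring.add ?B" "ring.zero (restrict_scalars ?\<psi> ?B) = ring.zero ?B"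
  "\<And>a b. a \<odot>\<^bsub>restrict_scalars ?\<psi> ?B\<^esub> b = ?\<psi> a \<otimes>\<^bsub>?B\<^esub> b"
  by (simp_all add: restrict_scalars_def ring.defs)
 have "Module.module ?A (restrict_scalars ?\<psi> ?B)"
 proof (rule moduleI)
  show "cring ?A" by (rule A.is_cring)
  show "abelian_group (restrict_scalars ?\<psi> ?B)"
   by (rule abelian_groupI) (auto simp: simps B.a_ac)
 qed (simp_all add: simps pc ring_hom_add[OF \<psi>] ring_hom_mult[OF \<psi>] ring_hom_one[OF \<psi>] B.l_distr B.r_distr B.m_assoc)
 hence "torsion_free_module ?A (restrict_scalars ?\<psi> ?B)"
 proof (rule torsion_free_module.intro, unfold_locales)
  fix a b assume "a \<in> carrier ?A" "b \<in> carrier ?A"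
  thus "a divides\<^bsub>?A\<^esub> b \<or> b divides\<^bsub>?A\<^esub> a" using val[OF f_top[OF t]] by (simp add: valuation_domain_def)
 next
  fix a y assume "a \<in> carrier ?A" "y \<in> carrier (restrict_scalars ?\<psi> ?B)" "a \<odot>\<^bsub>restrict_scalars ?\<psi> ?B\<^esub> y = \<zero>\<^bsub>restrict_scalars ?\<psi> ?B\<^esub>"
  thus "a = \<zero>\<^bsub>?A\<^esub> \<or> y = \<zero>\<^bsub>restrict_scalars ?\<psi> ?B\<^esub>" using stalk_map_torsion_free[OF t, of a y] by (auto simp: simps)
 qed
 thus ?thesis unfolding flat_ring_hom_def using torsion_free_module.flat \<psi> by blast
qed

text \<open>All stalks of \<open>S\<close> are domains, so a regular section is nonzero at every
  point of \<open>V\<close>. Torsion-freeness applies at each point of the preimage, which gives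
  regularity on a whole neighbourhood of \<open>t\<close>.\<close>

lemma stalk_map_regular:
 assumes t: "t \<in> pts T" and a: "a \<in> regular_stalk S (f t)"
 shows "stalk_map T f h t a \<in> regular_stalk T t"
proof -
 obtain V s where s: "opens S V" "f t \<in> V" "s \<in> secs S V" "\<forall>y\<in>V. nonzerodivisor (stalk S y) (germ S y V s)" "a = germ S (f t) V s"
  using a by (auto simp: regular_stalk_def regular_sections_def)
 let ?P = "preimage T f V"
 have P: "opens T ?P" "t \<in> ?P" "h V s \<in> secs T ?P" using pre_open[OF s(1)] t s(2) ring_hom_closed[OF hhom[OF s(1)] s(3)] by (auto simp: preimage_def)
 have "nonzerodivisor (stalk T y) (germ T y ?P (h V s))" if y: "y \<in> ?P" for y
 proof -
  have yt: "y \<in> pts T" "f y \<in> V" using y by (auto simp: preimage_def)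
  interpret A: domain "stalk S (f y)" using val[OF f_top[OF yt(1)]] by (simp add: valuation_domain_def)
  have nz: "nonzerodivisor (stalk S (f y)) (germ S (f y) V s)" using s(4) yt(2) by blast
  hence gc: "germ S (f y) V s \<in> carrier (stalk S (f y))" by (simp add: nonzerodivisor_def)
  show ?thesis using nz A.one_closed A.one_not_zero unfolding nonzerodivisor_def using stalk_map_torsion_free[OF yt(1) gc] stalk_map_germ[OF yt(1) s(1) yt(2) s(3)] germ_in_stalk[OF psT _ P(3)] P(1) y by (metis A.l_null)
 qed
 thus ?thesis  using stalk_map_germ[OF t s(1,2,3)] s(5) P by (auto simp: regular_sections_def regular_stalk_def)
qed

lemma convex_stalk:
 assumes t: "t \<in> pts T"
 shows "convex_subgroup (cartier_stalk T t) (cartier_nonneg T t) (cartier_map T f h t ` carrier (cartier_stalk S (f t)))"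
proof -
 let ?A = "stalk S (f t)" and ?B = "stalk T t" and ?\<psi> = "stalk_map T f h t"
 interpret A: divisor_group ?A "regular_stalk S (f t)" by (rule divisor_group_stalk[OF psS stalks_cring(1) f_top[OF t]])
 interpret B: divisor_group ?B "regular_stalk T t" by (rule divisor_group_stalk[OF psT stalks_cring(2) t])
 interpret d: domain ?A using val[OF f_top[OF t]] by (simp add: valuation_domain_def)
 interpret M: divisor_group_map ?A "regular_stalk S (f t)" ?B "regular_stalk T t" ?\<psi>
 proof
  show "?\<psi> \<in> Ring.ring_hom ?A ?B" using lhom[OF t] by (simp add: local_ring_hom_def)
  show "a divides\<^bsub>?A\<^esub> b \<or> b divides\<^bsub>?A\<^esub> a" if "a \<in> carrier ?A" "b \<in> carrier ?A" for a b
   using val[OF f_top[OF t]] that by (simp add: valuation_domain_def)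
  fix d x y assume d: "d \<in> regular_stalk S (f t)" "x \<in> carrier ?B" "y \<in> carrier ?B" "x \<otimes>\<^bsub>?B\<^esub> y = ?\<psi> d"
  have "d \<noteq> \<zero>\<^bsub>?A\<^esub>" using A.regular[OF d(1) A.one_closed] by auto
  thus "\<exists>r\<in>carrier ?A. \<exists>u\<in>Units ?B. x = ?\<psi> r \<otimes>\<^bsub>?B\<^esub> u" using stalk_map_divisor[OF t A.Rg_in(1)[OF d(1)] d(2,3) _ d(4)] by blast
 qed (rule stalk_map_regular[OF t])
 note defs = cartier_stalk_def B.D_def A.D_def B.G_def A.G_def B.U_def A.U_def mero_stalk_def unit_divisors_def to_mero_def
 have D: "cartier_stalk T t = B.D" "cartier_stalk S (f t) = A.D" by (simp_all add: defs)
 have dc: "divisor_class T t m = B.U #>\<^bsub>B.G\<^esub> m" for m by (simp add: divisor_class_def defs)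
 have "cartier_nonneg T t = {B.cls x \<one>\<^bsub>?B\<^esub> | x. x \<in> regular_stalk T t}"
  by (auto simp: cartier_nonneg_def to_mero_def dc B.cls_def)
 moreover have "cartier_map T f h t ` carrier A.D = M.H" unfolding A.D_carrier M.H_def
 proof -
  have "cartier_map T f h t (A.cls a c) = B.cls (?\<psi> a) (?\<psi> c)" if "a \<in> regular_stalk S (f t)" "c \<in> regular_stalk S (f t)" for a c
   unfolding cartier_map_def dc by (rule M.class_map[OF that])
  thus "cartier_map T f h t ` {A.cls a c | a c. a \<in> regular_stalk S (f t) \<and> c \<in> regular_stalk S (f t)} =
    {B.cls (?\<psi> a) (?\<psi> c) | a c. a \<in> regular_stalk S (f t) \<and> c \<in> regular_stalk S (f t)}" by blast
 qed
 ultimately show ?thesis using M.H_convex D by simp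
qed

end

theorem corollary20:
  fixes S :: "('p, 'a) ringed_space" and T :: "('q, 'b) ringed_space"
    and f :: "'q \<Rightarrow> 'p" and h :: "'p set \<Rightarrow> 'a \<Rightarrow> 'b"
  assumes "prufer_scheme S"
    and "smooth_morphism T S f h"
  shows "convex_morphism TYPE('m) T S f h"
proof -
  interpret smooth_over_prufer S T f h using assms by unfold_locales
  show ?thesis unfolding convex_morphism_def flat_morphism_def using mor flat_stalk convex_stalk by blast
qed

end
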